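(* Let $A$ be a finite-dimensional $\mathbb{C}$-algebra of finite global dimension and $\mathbf d\in K_0(\mathcal D^b(A))$. Then $$\mathcal{QP}^b(A,\mathbf d)=\mathcal Q_1\mathcal P^b(A,\mathbf d)=\varinjlim_{\underline{\mathbf d}(\underline{\mathbf e})\in\underline\dim^{-1}(\mathbf d)}\mathcal{QP}^b(A,\underline{\mathbf e}),$$ i.e. the quotient of $\mathcal P^b(A,\mathbf d)$ by quasi-isomorphism coincides with the orbit space of $\mathcal P^b(A,\mathbf d)$ under $G_{\mathbf d}$ and with the direct limit of the orbit spaces of $\mathcal P^b(A,\underline{\mathbf e})$ under $G_{\underline{\mathbf d}(\underline{\mathbf e})}$.
   Context: Write $A=\mathbb{C}Q/J$ ($Q$ a finite quiver, $J$ an admissible ideal generated by relations $R$), and let $P_1,\dots,P_l$ be the indecomposable projective $A$-modules up to isomorphism. A projective dimension sequence is $\underline{\mathbf e}=(\underline e_i)_{i\in\mathbb{Z}}$, $\underline e_i=(e^i_1,\dots,e^i_l)\in\mathbb{N}^l$, with finitely many non-zero entries; $\underline d_i$ is the dimension vector of $\bigoplus_je^i_jP_j$ and $\underline{\mathbf d}(\underline{\mathbf e})=(\underline d_i)_i$. $\mathcal P^b(A,\underline{\mathbf e})$ is the variety of $(x_i,\partial_i)_i$ where $x_i$ is a representation of $(Q,R)$ on $\mathbb{C}^{\underline d_i}$ isomorphic to $\bigoplus_je^i_jP_j$, and the $\partial_i$ are $A$-module maps from the $i$-th to the $(i+1)$-st module with $\partial_{i+1}\partial_i=0$. The group $G_{\underline{\mathbf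 d}(\underline{\mathbf e})}=\prod_iG_{\underline d_i}$ ($G_{\underline d}=\prod_{v\in Q_0}GL_{d_v}(\mathbb{C})$) acts by conjugation; the orbit space is $\mathcal{QP}^b(A,\underline{\mathbf e})$. The canonical map $\underline\dim$ sends a dimension vector sequence to the class in $K_0(\mathcal D^b(A))$ of complexes having it. For projective dimension sequences with $\underline{\mathbf d}(\underline{\mathbf e})\in\underline\dim^{-1}(\mathbf d)$, write $\underline{\mathbf e}_1\le\underline{\mathbf e}_2$ if there is a contractible (acyclic) projective complex $P^\bullet(\underline{\mathbf e}_1,\underline{\mathbf e}_2)\in\mathcal P^b(A,\underline{\mathbf e}_2-\underline{\mathbf e}_1)$; fix such complexes with $P^\bullet(\underline{\mathbf e}_1,\underline{\mathbf e}_2)\oplus P^\bullet(\underline{\mathbf e}_2,\underline{\mathbf e}_3)=P^\bullet(\underline{\mathbf e}_1,\underline{\mathbf e}_3)$. Put $\mathcal P^b(A,\mathbf d)=\varinjlim\mathcal P^b(A,\underline{\mathbf e})$ with transition maps $X^\bullet\mapsto X^\bullet\oplus P^\bullet(\underline{\mathbf e}_1,\underline{\mathbf e}_2)$, and $G_{\mathbf d}=\varinjlim G_{\underline{\mathbf d}(\underline{\mathbf e})}$ with transition maps $g\mapsto\begin{pmatrix}g&0\\0&1\end{pmatrix}$; $G_{\mathbf d}$ acts on $\mathcal P^b(A,\mathbf d)$ by acting at a common large enough level, and $\mathcal Q_1\mathcal P^b(A,\mathbf d)$ is the orbit space. $\mathcal{QP}^b(A,\mathbf d)=\mathcal P^b(A,\mathbf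 d)/\sim$ where $x\sim y$ iff the corresponding projective complexes are quasi-isomorphic, with the quotient topology. *)

theory Defs
  imports
    "Graph_Theory.Arc_Walk"
    "Jordan_Normal_Form.Matrix"
    "HOL-Analysis.Sum_Topology"
    "HOL-Algebra.Free_Abelian_Groups"
begin

section \<open>Quotients and direct limits\<close>

definition quotient_topology :: "'a topology \<Rightarrow> ('a \<times> 'a) set \<Rightarrow> 'a set topology" where
  "quotient_topology X r = topology (\<lambda>U. U \<subseteq> topspace X // r \<and>
     openin X {x \<in> topspace X. r `` {x} \<in> U})"

lemma openin_quotient_topology:
  "openin (quotient_topology X r) U \<longleftrightarrow>
     U \<subseteq> topspace X // r \<and> openin X {x \<in> topspace X. r `` {x} \<in> U}"
proof -
  have "{x \<in> topspace X. r `` {x} \<in> S \<inter> T} =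
      {x \<in> topspace X. r `` {x} \<in> S} \<inter> {x \<in> topspace X. r `` {x} \<in> T}" for S T
    by auto
  moreover have "{x \<in> topspace X. r `` {x} \<in> \<Union>\<K>} =
      (\<Union>S\<in>\<K>. {x \<in> topspace X. r `` {x} \<in> S})" for \<K>
    by auto
  ultimately have "istopology (\<lambda>U. U \<subseteq> topspace X // r \<and>
      openin X {x \<in> topspace X. r `` {x} \<in> U})"
    unfolding istopology_def by (auto simp del: Union_iff Int_iff intro!: openin_Int openin_Union)
  then show ?thesis
    by (simp add: quotient_topology_def)
qed

lemma topspace_quotient_topology [simp]: "topspace (quotient_topology X r) = topspace X // r"
proof -
  have "{x \<in> topspace X. r `` {x} \<in> topspace X // r} = topspace X"
    by (auto intro: quotientI)
  then have "openin (quotient_topology X r) (topspace X // r)"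
    by (simp add: openin_quotient_topology)
  then show ?thesis
    by (meson openin_quotient_topology openin_subset openin_topspace subset_antisym)
qed

lemma quotient_map_quotient_topology:
  "quotient_map X (quotient_topology X r) (\<lambda>x. r `` {x})"
  by (auto simp: quotient_map_def openin_quotient_topology quotient_def)

text \<open>The direct limit of sets \<open>D i\<close>, for \<open>i\<close> in \<open>I\<close> ordered by \<open>leq\<close>, along maps \<open>t i j\<close>,
  is \<open>Sigma I D // dlim_rel I leq D t\<close>.\<close>

definition dlim_rel ::
  "'i set \<Rightarrow> ('i \<Rightarrow> 'i \<Rightarrow> bool) \<Rightarrow> ('i \<Rightarrow> 'x set) \<Rightarrow> ('i \<Rightarrow> 'i \<Rightarrow> 'x \<Rightarrow> 'x) \<Rightarrow> (('i \<times> 'x) \<times> ('i \<times> 'x)) set"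
where
  "dlim_rel I leq D t = {((i, x), (j, y)). i \<in> I \<and> x \<in> D i \<and> j \<in> I \<and> y \<in> D j \<and>
     (\<exists>k\<in>I. leq i k \<and> leq j k \<and> t i k x = t j k y)}"

definition dlim_topology ::
  "'i set \<Rightarrow> ('i \<Rightarrow> 'i \<Rightarrow> bool) \<Rightarrow> ('i \<Rightarrow> 'x topology) \<Rightarrow> ('i \<Rightarrow> 'i \<Rightarrow> 'x \<Rightarrow> 'x) \<Rightarrow> ('i \<times> 'x) set topology"
where
  "dlim_topology I leq X t =
     quotient_topology (sum_topology X I) (dlim_rel I leq (\<lambda>i. topspace (X i)) t)"


section \<open>Bound quivers and their representations\<close>

text \<open>A finite quiver is a finite multi-digraph. A path is a pair of its starting vertex and its
  list of arrows in the order in which they are traversed, so that \<open>(v, [])\<close> is the trivial path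
  at \<open>v\<close>. Elements of the path algebra are finitely supported functions on paths.\<close>

type_synonym ('v, 'a) path = "'v \<times> 'a list"

definition paths :: "('v, 'a) pre_digraph \<Rightarrow> ('v, 'a) path set" where
  "paths Q = {(u, p). \<exists>v. pre_digraph.awalk Q u p v}"

definition path_mult ::
  "('v, 'a) pre_digraph \<Rightarrow> (('v, 'a) path \<Rightarrow>\<^sub>0 complex) \<Rightarrow> (('v, 'a) path \<Rightarrow>\<^sub>0 complex) \<Rightarrow>
     (('v, 'a) path \<Rightarrow>\<^sub>0 complex)"
where
  "path_mult Q f g = (\<Sum>p\<in>Poly_Mapping.keys f. \<Sum>q\<in>Poly_Mapping.keys g.
     if pre_digraph.awlast Q (fst p) (snd p) = fst q
     then Poly_Mapping.single (fst p, snd p @ snd q) (Poly_Mapping.lookup f p * Poly_Mapping.lookup g q)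
     else 0)"

text \<open>The two-sided ideal generated by \<open>R\<close>. Scalar multiples are products with
  multiples of the identity, the sum of the trivial paths.\<close>

inductive_set relation_ideal ::
  "('v, 'a) pre_digraph \<Rightarrow> (('v, 'a) path \<Rightarrow>\<^sub>0 complex) set \<Rightarrow> (('v, 'a) path \<Rightarrow>\<^sub>0 complex) set"
  for Q :: "('v, 'a) pre_digraph" and R :: "(('v, 'a) path \<Rightarrow>\<^sub>0 complex) set"
where
  "0 \<in> relation_ideal Q R"
| "\<rho> \<in> R \<Longrightarrow> \<rho> \<in> relation_ideal Q R"
| "f \<in> relation_ideal Q R \<Longrightarrow> g \<in> relation_ideal Q R \<Longrightarrow> f + g \<in> relation_ideal Q R"
| "f \<in> relation_ideal Q R \<Longrightarrow> Poly_Mapping.keys c \<subseteq> paths Q \<Longrightarrow> path_mult Q c f \<in> relation_ideal Q R"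
| "f \<in> relation_ideal Q R \<Longrightarrow> Poly_Mapping.keys c \<subseteq> paths Q \<Longrightarrow> path_mult Q f c \<in> relation_ideal Q R"

text \<open>\<open>Q\<close> is a finite quiver and \<open>R\<close> a set of relations generating an admissible ideal.\<close>

definition bound_quiver :: "('v, 'a) pre_digraph \<Rightarrow> (('v, 'a) path \<Rightarrow>\<^sub>0 complex) set \<Rightarrow> bool" where
  "bound_quiver Q R \<longleftrightarrow> fin_digraph Q \<and>
     (\<forall>\<rho>\<in>R. \<exists>u v. \<forall>(w, p) \<in> Poly_Mapping.keys \<rho>.
        w = u \<and> pre_digraph.awalk Q u p v \<and> 2 \<le> length p) \<and>
     (\<exists>N. \<forall>(u, p) \<in> paths Q. N \<le> length p \<longrightarrow> Poly_Mapping.single (u, p) 1 \<in> relation_ideal Q R)"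

text \<open>The underlying space of a representation at the vertex \<open>v\<close> is \<open>\<complex>\<close> to the power \<open>rdim M v\<close>.
  Dimensions off the vertex set are \<open>0\<close>; families of matrices indexed by vertices or arrows are
  \<open>undefined\<close> off the quiver, so that equality of data is equality of the matrices.\<close>

record ('v, 'a) rep =
  rdim :: "'v \<Rightarrow> nat"
  rmap :: "'a \<Rightarrow> complex mat"

primrec path_map :: "('v, 'a) pre_digraph \<Rightarrow> ('v, 'a) rep \<Rightarrow> 'v \<Rightarrow> 'a list \<Rightarrow> complex mat" where
  "path_map Q M u [] = 1\<^sub>m (rdim M u)"
| "path_map Q M u (a # p) = path_map Q M (head Q a) p * rmap M a"

definition satisfies_relation ::
  "('v, 'a) pre_digraph \<Rightarrow> ('v, 'a) rep \<Rightarrow> (('v, 'a) path \<Rightarrow>\<^sub>0 complex) \<Rightarrow> bool"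
where
  "satisfies_relation Q M \<rho> \<longleftrightarrow> (\<forall>u\<in>verts Q. \<forall>v\<in>verts Q. \<forall>r < rdim M v. \<forall>c < rdim M u.
     (\<Sum>p | p \<in> Poly_Mapping.keys \<rho> \<and> fst p = u \<and> pre_digraph.awlast Q u (snd p) = v.
        Poly_Mapping.lookup \<rho> p * path_map Q M u (snd p) $$ (r, c)) = 0)"

definition reps ::
  "('v, 'a) pre_digraph \<Rightarrow> (('v, 'a) path \<Rightarrow>\<^sub>0 complex) set \<Rightarrow> ('v, 'a) rep set"
where
  "reps Q R = {M. (\<forall>v. v \<notin> verts Q \<longrightarrow> rdim M v = 0) \<and>
     rmap M \<in> (\<Pi>\<^sub>E a\<in>arcs Q. carrier_mat (rdim M (head Q a)) (rdim M (tail Q a))) \<and>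
     (\<forall>\<rho>\<in>R. satisfies_relation Q M \<rho>)}"

definition rep_hom ::
  "('v, 'a) pre_digraph \<Rightarrow> ('v, 'a) rep \<Rightarrow> ('v, 'a) rep \<Rightarrow> ('v \<Rightarrow> complex mat) set"
where
  "rep_hom Q M N = {f \<in> (\<Pi>\<^sub>E v\<in>verts Q. carrier_mat (rdim N v) (rdim M v)).
     \<forall>a\<in>arcs Q. f (head Q a) * rmap M a = rmap N a * f (tail Q a)}"

definition rep_iso :: "('v, 'a) pre_digraph \<Rightarrow> ('v, 'a) rep \<Rightarrow> ('v, 'a) rep \<Rightarrow> bool" where
  "rep_iso Q M N \<longleftrightarrow> (\<exists>f\<in>rep_hom Q M N. \<exists>g\<in>rep_hom Q N M. \<forall>v\<in>verts Q.
     g v * f v = 1\<^sub>m (rdim M v) \<and> f v * g v = 1\<^sub>m (rdim N v))"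

definition zero_rep :: "('v, 'a) pre_digraph \<Rightarrow> ('v, 'a) rep" where
  "zero_rep Q = \<lparr>rdim = (\<lambda>_. 0), rmap = (\<lambda>a\<in>arcs Q. 0\<^sub>m 0 0)\<rparr>"

definition block_diag :: "complex mat \<Rightarrow> complex mat \<Rightarrow> complex mat" where
  "block_diag A B =
     four_block_mat A (0\<^sub>m (dim_row A) (dim_col B)) (0\<^sub>m (dim_row B) (dim_col A)) B"

definition rep_sum ::
  "('v, 'a) pre_digraph \<Rightarrow> ('v, 'a) rep \<Rightarrow> ('v, 'a) rep \<Rightarrow> ('v, 'a) rep"
where
  "rep_sum Q M N =
     \<lparr>rdim = (\<lambda>v. rdim M v + rdim N v), rmap = (\<lambda>a\<in>arcs Q. block_diag (rmap M a) (rmap N a))\<rparr>"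

definition projective_rep ::
  "('v, 'a) pre_digraph \<Rightarrow> (('v, 'a) path \<Rightarrow>\<^sub>0 complex) set \<Rightarrow> ('v, 'a) rep \<Rightarrow> bool"
where
  "projective_rep Q R M \<longleftrightarrow> M \<in> reps Q R \<and>
     (\<forall>X\<in>reps Q R. \<forall>Y\<in>reps Q R. \<forall>p\<in>rep_hom Q X Y. \<forall>f\<in>rep_hom Q M Y.
        (\<forall>v\<in>verts Q. (\<lambda>x. p v *\<^sub>v x) ` carrier_vec (rdim X v) = carrier_vec (rdim Y v)) \<longrightarrow>
        (\<exists>g\<in>rep_hom Q M X. \<forall>v\<in>verts Q. p v * g v = f v))"

definition indecomposable_rep ::
  "('v, 'a) pre_digraph \<Rightarrow> (('v, 'a) path \<Rightarrow>\<^sub>0 complex) set \<Rightarrow> ('v, 'a) rep \<Rightarrow> bool"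
where
  "indecomposable_rep Q R M \<longleftrightarrow> M \<in> reps Q R \<and> \<not> rep_iso Q M (zero_rep Q) \<and>
     (\<forall>X\<in>reps Q R. \<forall>Y\<in>reps Q R. rep_iso Q M (rep_sum Q X Y) \<longrightarrow>
        rep_iso Q X (zero_rep Q) \<or> rep_iso Q Y (zero_rep Q))"

text \<open>\<open>P\<close> lists the indecomposable projectives up to isomorphism, without repetition.\<close>

definition indecomposable_projectives ::
  "('v, 'a) pre_digraph \<Rightarrow> (('v, 'a) path \<Rightarrow>\<^sub>0 complex) set \<Rightarrow> ('v, 'a) rep list \<Rightarrow> bool"
where
  "indecomposable_projectives Q R P \<longleftrightarrow>
     (\<forall>M\<in>set P. projective_rep Q R M \<and> indecomposable_rep Q R M) \<and>
     (\<forall>i<length P. \<forall>j<length P. i \<noteq> j \<longrightarrow> \<not> rep_iso Q (P ! i) (P ! j)) \<and>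
     (\<forall>M. projective_rep Q R M \<and> indecomposable_rep Q R M \<longrightarrow> (\<exists>N\<in>set P. rep_iso Q M N))"


section \<open>Bounded complexes and quasi-isomorphism\<close>

text \<open>Complexes are cohomological: \<open>diff X i\<close> maps \<open>obj X i\<close> to \<open>obj X (i + 1)\<close>.\<close>

record ('v, 'a) cpx =
  obj :: "int \<Rightarrow> ('v, 'a) rep"
  diff :: "int \<Rightarrow> 'v \<Rightarrow> complex mat"

abbreviation cdim :: "('v, 'a) cpx \<Rightarrow> int \<Rightarrow> 'v \<Rightarrow> nat" where
  "cdim X \<equiv> \<lambda>i. rdim (obj X i)"

definition bounded_cpxs ::
  "('v, 'a) pre_digraph \<Rightarrow> (('v, 'a) path \<Rightarrow>\<^sub>0 complex) set \<Rightarrow> ('v, 'a) cpx set"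
where
  "bounded_cpxs Q R = {X. (\<forall>i. obj X i \<in> reps Q R) \<and>
     (\<forall>i. diff X i \<in> rep_hom Q (obj X i) (obj X (i + 1))) \<and>
     (\<forall>i. \<forall>v\<in>verts Q. diff X (i + 1) v * diff X i v = 0\<^sub>m (cdim X (i + 2) v) (cdim X i v)) \<and>
     finite {i. \<exists>v. cdim X i v \<noteq> 0}}"

definition cpx_sum ::
  "('v, 'a) pre_digraph \<Rightarrow> ('v, 'a) cpx \<Rightarrow> ('v, 'a) cpx \<Rightarrow> ('v, 'a) cpx"
where
  "cpx_sum Q X Y = \<lparr>obj = (\<lambda>i. rep_sum Q (obj X i) (obj Y i)),
     diff = (\<lambda>i. \<lambda>v\<in>verts Q. block_diag (diff X i v) (diff Y i v))\<rparr>"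

definition chain_maps ::
  "('v, 'a) pre_digraph \<Rightarrow> ('v, 'a) cpx \<Rightarrow> ('v, 'a) cpx \<Rightarrow> (int \<Rightarrow> 'v \<Rightarrow> complex mat) set"
where
  "chain_maps Q X Y = {f. (\<forall>i. f i \<in> rep_hom Q (obj X i) (obj Y i)) \<and>
     (\<forall>i. \<forall>v\<in>verts Q. f (i + 1) v * diff X i v = diff Y i v * f i v)}"

definition contractible :: "('v, 'a) pre_digraph \<Rightarrow> ('v, 'a) cpx \<Rightarrow> bool" where
  "contractible Q X \<longleftrightarrow> (\<exists>h. (\<forall>i. h i \<in> rep_hom Q (obj X i) (obj X (i - 1))) \<and>
     (\<forall>i. \<forall>v\<in>verts Q. diff X (i - 1) v * h i v + h (i + 1) v * diff X i v = 1\<^sub>m (cdim X i v)))"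

definition cocycles :: "('v, 'a) cpx \<Rightarrow> int \<Rightarrow> 'v \<Rightarrow> complex vec set" where
  "cocycles X i v = {z \<in> carrier_vec (cdim X i v). diff X i v *\<^sub>v z = 0\<^sub>v (cdim X (i + 1) v)}"

definition coboundaries :: "('v, 'a) cpx \<Rightarrow> int \<Rightarrow> 'v \<Rightarrow> complex vec set" where
  "coboundaries X i v = (\<lambda>y. diff X (i - 1) v *\<^sub>v y) ` carrier_vec (cdim X (i - 1) v)"

definition cohomologous :: "('v, 'a) cpx \<Rightarrow> int \<Rightarrow> 'v \<Rightarrow> (complex vec \<times> complex vec) set" where
  "cohomologous X i v =
     {(z, z'). z \<in> cocycles X i v \<and> z' \<in> cocycles X i v \<and> z - z' \<in> coboundaries X i v}"

definition cohomology :: "('v, 'a) cpx \<Rightarrow> int \<Rightarrow> 'v \<Rightarrow> complex vec set set" where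
  "cohomology X i v = cocycles X i v // cohomologous X i v"

definition quasi_isos ::
  "('v, 'a) pre_digraph \<Rightarrow> ('v, 'a) cpx \<Rightarrow> ('v, 'a) cpx \<Rightarrow> (int \<Rightarrow> 'v \<Rightarrow> complex mat) set"
where
  "quasi_isos Q X Y = {f \<in> chain_maps Q X Y. \<forall>i. \<forall>v\<in>verts Q.
     bij_betw (\<lambda>C. cohomologous Y i v `` ((\<lambda>z. f i v *\<^sub>v z) ` C)) (cohomology X i v) (cohomology Y i v)}"

text \<open>Quasi-isomorphic complexes are those isomorphic in the bounded derived category, i.e. linked
  by a zigzag of quasi-isomorphisms.\<close>

definition quasi_isomorphic ::
  "('v, 'a) pre_digraph \<Rightarrow> (('v, 'a) path \<Rightarrow>\<^sub>0 complex) set \<Rightarrow> ('v, 'a) cpx \<Rightarrow> ('v, 'a) cpx \<Rightarrow> bool"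
where
  "quasi_isomorphic Q R =
     equivclp (\<lambda>X Y. X \<in> bounded_cpxs Q R \<and> Y \<in> bounded_cpxs Q R \<and> quasi_isos Q X Y \<noteq> {})"

definition stalk_cpx :: "('v, 'a) pre_digraph \<Rightarrow> ('v, 'a) rep \<Rightarrow> ('v, 'a) cpx" where
  "stalk_cpx Q M = (let X = (\<lambda>i::int. if i = 0 then M else zero_rep Q) in
     \<lparr>obj = X, diff = (\<lambda>i. \<lambda>v\<in>verts Q. 0\<^sub>m (rdim (X (i + 1)) v) (rdim (X i) v))\<rparr>)"

text \<open>Every finite-dimensional module has a projective resolution, given here as a complex \<open>X\<close> in
  degrees \<open>-n, ..., 0\<close> together with a quasi-isomorphism to the module, of length at most a
  common bound \<open>n\<close>.\<close>

definition finite_global_dimension ::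
  "('v, 'a) pre_digraph \<Rightarrow> (('v, 'a) path \<Rightarrow>\<^sub>0 complex) set \<Rightarrow> bool"
where
  "finite_global_dimension Q R \<longleftrightarrow> (\<exists>n::nat. \<forall>M\<in>reps Q R. \<exists>X\<in>bounded_cpxs Q R.
     (\<forall>i. projective_rep Q R (obj X i)) \<and>
     (\<forall>i v. i < - int n \<or> 0 < i \<longrightarrow> cdim X i v = 0) \<and>
     quasi_isos Q X (stalk_cpx Q M) \<noteq> {})"


section \<open>The Grothendieck group of the bounded derived category\<close>

definition cone ::
  "('v, 'a) pre_digraph \<Rightarrow> ('v, 'a) cpx \<Rightarrow> ('v, 'a) cpx \<Rightarrow> (int \<Rightarrow> 'v \<Rightarrow> complex mat) \<Rightarrow> ('v, 'a) cpx"
where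
  "cone Q X Y f = \<lparr>obj = (\<lambda>i. rep_sum Q (obj X (i + 1)) (obj Y i)),
     diff = (\<lambda>i. \<lambda>v\<in>verts Q. four_block_mat
       (- diff X (i + 1) v) (0\<^sub>m (cdim X (i + 2) v) (cdim Y i v))
       (f (i + 1) v)        (diff Y i v))\<rparr>"

text \<open>The distinguished triangles of the derived category are those isomorphic there to
  \<open>X \<rightarrow> Y \<rightarrow> cone f \<rightarrow> X[1]\<close> for a chain map \<open>f\<close>, so the triangle relations are
  generated by the following ones.\<close>

definition K0_relations ::
  "('v, 'a) pre_digraph \<Rightarrow> (('v, 'a) path \<Rightarrow>\<^sub>0 complex) set \<Rightarrow> (('v, 'a) cpx \<Rightarrow>\<^sub>0 int) set"
where
  "K0_relations Q R = generate (free_Abelian_group (bounded_cpxs Q R))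
     ({frag_of X - frag_of Y | X Y.
         X \<in> bounded_cpxs Q R \<and> Y \<in> bounded_cpxs Q R \<and> quasi_isomorphic Q R X Y} \<union>
      {frag_of Y - frag_of X - frag_of (cone Q X Y f) | X Y f.
         X \<in> bounded_cpxs Q R \<and> Y \<in> bounded_cpxs Q R \<and> f \<in> chain_maps Q X Y})"

definition K0 ::
  "('v, 'a) pre_digraph \<Rightarrow> (('v, 'a) path \<Rightarrow>\<^sub>0 complex) set \<Rightarrow> (('v, 'a) cpx \<Rightarrow>\<^sub>0 int) set monoid"
where
  "K0 Q R = free_Abelian_group (bounded_cpxs Q R) Mod K0_relations Q R"

definition K0_class ::
  "('v, 'a) pre_digraph \<Rightarrow> (('v, 'a) path \<Rightarrow>\<^sub>0 complex) set \<Rightarrow> ('v, 'a) cpx \<Rightarrow> (('v, 'a) cpx \<Rightarrow>\<^sub>0 int) set"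
where
  "K0_class Q R X = K0_relations Q R #>\<^bsub>free_Abelian_group (bounded_cpxs Q R)\<^esub> frag_of X"

text \<open>The fibre over \<open>d\<close> of the map sending a dimension vector sequence to the class of the
  complexes having it. All such complexes have the same class, since a module over a bound quiver
  algebra has a composition series whose factors are determined by its dimension vector.\<close>

definition dim_fibre ::
  "('v, 'a) pre_digraph \<Rightarrow> (('v, 'a) path \<Rightarrow>\<^sub>0 complex) set \<Rightarrow> (('v, 'a) cpx \<Rightarrow>\<^sub>0 int) set \<Rightarrow>
     (int \<Rightarrow> 'v \<Rightarrow> nat) set"
where
  "dim_fibre Q R d = {ds. \<exists>X\<in>bounded_cpxs Q R. cdim X = ds \<and> K0_class Q R X = d}"


section \<open>Varieties of projective complexes of fixed projective dimension sequence\<close>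

type_synonym pdseq = "int \<Rightarrow> nat \<Rightarrow> nat"

text \<open>The multiplicity of \<open>P ! j\<close> in degree \<open>i\<close> is \<open>e i j\<close>.\<close>

definition proj_dim_seq :: "('v, 'a) rep list \<Rightarrow> pdseq \<Rightarrow> bool" where
  "proj_dim_seq P e \<longleftrightarrow> (\<forall>i j. length P \<le> j \<longrightarrow> e i j = 0) \<and> finite {i. \<exists>j. e i j \<noteq> 0}"

definition proj_sum ::
  "('v, 'a) pre_digraph \<Rightarrow> ('v, 'a) rep list \<Rightarrow> (nat \<Rightarrow> nat) \<Rightarrow> ('v, 'a) rep"
where
  "proj_sum Q P m =
     foldr (rep_sum Q) (concat (map (\<lambda>j. replicate (m j) (P ! j)) [0..<length P])) (zero_rep Q)"

definition dim_seq ::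
  "('v, 'a) pre_digraph \<Rightarrow> ('v, 'a) rep list \<Rightarrow> pdseq \<Rightarrow> int \<Rightarrow> 'v \<Rightarrow> nat"
where
  "dim_seq Q P e i = rdim (proj_sum Q P (e i))"

definition proj_cpxs ::
  "('v, 'a) pre_digraph \<Rightarrow> (('v, 'a) path \<Rightarrow>\<^sub>0 complex) set \<Rightarrow> ('v, 'a) rep list \<Rightarrow> pdseq \<Rightarrow>
     ('v, 'a) cpx set"
where
  "proj_cpxs Q R P e = {X \<in> bounded_cpxs Q R. cdim X = dim_seq Q P e \<and>
     (\<forall>i. rep_iso Q (obj X i) (proj_sum Q P (e i)))}"

text \<open>The Zariski topology on the affine space of all matrix data with a given dimension vector
  sequence; the sets where a polynomial in the matrix entries does not vanish form a basis.\<close>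

definition cpx_space :: "('v, 'a) pre_digraph \<Rightarrow> (int \<Rightarrow> 'v \<Rightarrow> nat) \<Rightarrow> ('v, 'a) cpx set" where
  "cpx_space Q ds = {X. cdim X = ds \<and>
     (\<forall>i. rmap (obj X i) \<in> (\<Pi>\<^sub>E a\<in>arcs Q. carrier_mat (ds i (head Q a)) (ds i (tail Q a)))) \<and>
     (\<forall>i. diff X i \<in> (\<Pi>\<^sub>E v\<in>verts Q. carrier_mat (ds (i + 1) v) (ds i v)))}"

inductive_set polynomials ::
  "('v, 'a) pre_digraph \<Rightarrow> (int \<Rightarrow> 'v \<Rightarrow> nat) \<Rightarrow> (('v, 'a) cpx \<Rightarrow> complex) set"
  for Q :: "('v, 'a) pre_digraph" and ds :: "int \<Rightarrow> 'v \<Rightarrow> nat"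
where
  "(\<lambda>_. k) \<in> polynomials Q ds"
| "a \<in> arcs Q \<Longrightarrow> r < ds i (head Q a) \<Longrightarrow> c < ds i (tail Q a) \<Longrightarrow>
     (\<lambda>X. rmap (obj X i) a $$ (r, c)) \<in> polynomials Q ds"
| "v \<in> verts Q \<Longrightarrow> r < ds (i + 1) v \<Longrightarrow> c < ds i v \<Longrightarrow>
     (\<lambda>X. diff X i v $$ (r, c)) \<in> polynomials Q ds"
| "p \<in> polynomials Q ds \<Longrightarrow> q \<in> polynomials Q ds \<Longrightarrow> (\<lambda>X. p X + q X) \<in> polynomials Q ds"
| "p \<in> polynomials Q ds \<Longrightarrow> q \<in> polynomials Q ds \<Longrightarrow> (\<lambda>X. p X * q X) \<in> polynomials Q ds"

definition zariski :: "('v, 'a) pre_digraph \<Rightarrow> (int \<Rightarrow> 'v \<Rightarrow> nat) \<Rightarrow> ('v, 'a) cpx topology" where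
  "zariski Q ds =
     topology_generated_by {{X \<in> cpx_space Q ds. p X \<noteq> 0} | p. p \<in> polynomials Q ds}"

definition proj_variety ::
  "('v, 'a) pre_digraph \<Rightarrow> (('v, 'a) path \<Rightarrow>\<^sub>0 complex) set \<Rightarrow> ('v, 'a) rep list \<Rightarrow> pdseq \<Rightarrow>
     ('v, 'a) cpx topology"
where
  "proj_variety Q R P e = subtopology (zariski Q (dim_seq Q P e)) (proj_cpxs Q R P e)"

definition GL_seq ::
  "('v, 'a) pre_digraph \<Rightarrow> (int \<Rightarrow> 'v \<Rightarrow> nat) \<Rightarrow> (int \<Rightarrow> 'v \<Rightarrow> complex mat) set"
where
  "GL_seq Q ds = {g. \<forall>i. g i \<in> (\<Pi>\<^sub>E v\<in>verts Q. Units (ring_mat TYPE(complex) (ds i v) ()))}"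

definition inverse_mat :: "complex mat \<Rightarrow> complex mat" where
  "inverse_mat A = inv\<^bsub>ring_mat TYPE(complex) (dim_row A) ()\<^esub> A"

definition conj_act ::
  "('v, 'a) pre_digraph \<Rightarrow> (int \<Rightarrow> 'v \<Rightarrow> complex mat) \<Rightarrow> ('v, 'a) cpx \<Rightarrow> ('v, 'a) cpx"
where
  "conj_act Q g X =
     \<lparr>obj = (\<lambda>i. \<lparr>rdim = cdim X i,
        rmap = (\<lambda>a\<in>arcs Q. g i (head Q a) * rmap (obj X i) a * inverse_mat (g i (tail Q a)))\<rparr>),
      diff = (\<lambda>i. \<lambda>v\<in>verts Q. g (i + 1) v * diff X i v * inverse_mat (g i v))\<rparr>"

definition orbit_rel ::
  "('v, 'a) pre_digraph \<Rightarrow> (('v, 'a) path \<Rightarrow>\<^sub>0 complex) set \<Rightarrow> ('v, 'a) rep list \<Rightarrow> pdseq \<Rightarrow>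
     (('v, 'a) cpx \<times> ('v, 'a) cpx) set"
where
  "orbit_rel Q R P e =
     {(X, conj_act Q g X) | X g. X \<in> proj_cpxs Q R P e \<and> g \<in> GL_seq Q (dim_seq Q P e)}"

definition QP_level ::
  "('v, 'a) pre_digraph \<Rightarrow> (('v, 'a) path \<Rightarrow>\<^sub>0 complex) set \<Rightarrow> ('v, 'a) rep list \<Rightarrow> pdseq \<Rightarrow>
     ('v, 'a) cpx set topology"
where
  "QP_level Q R P e = quotient_topology (proj_variety Q R P e) (orbit_rel Q R P e)"


section \<open>The direct system\<close>

definition levels ::
  "('v, 'a) pre_digraph \<Rightarrow> (('v, 'a) path \<Rightarrow>\<^sub>0 complex) set \<Rightarrow> ('v, 'a) rep list \<Rightarrow>
     (('v, 'a) cpx \<Rightarrow>\<^sub>0 int) set \<Rightarrow> pdseq set"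
where
  "levels Q R P d = {e. proj_dim_seq P e \<and> dim_seq Q P e \<in> dim_fibre Q R d}"

definition seq_diff :: "pdseq \<Rightarrow> pdseq \<Rightarrow> pdseq" where
  "seq_diff e\<^sub>2 e\<^sub>1 = (\<lambda>i j. e\<^sub>2 i j - e\<^sub>1 i j)"

definition level_le ::
  "('v, 'a) pre_digraph \<Rightarrow> (('v, 'a) path \<Rightarrow>\<^sub>0 complex) set \<Rightarrow> ('v, 'a) rep list \<Rightarrow> pdseq \<Rightarrow> pdseq \<Rightarrow> bool"
where
  "level_le Q R P e\<^sub>1 e\<^sub>2 \<longleftrightarrow> (\<forall>i j. e\<^sub>1 i j \<le> e\<^sub>2 i j) \<and>
     (\<exists>X\<in>proj_cpxs Q R P (seq_diff e\<^sub>2 e\<^sub>1). contractible Q X)"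

text \<open>The fixed contractible complexes \<open>C e\<^sub>1 e\<^sub>2\<close>. Forming \<open>X \<oplus> C e\<^sub>1 e\<^sub>2\<close> as a point of the variety
  at level \<open>e\<^sub>2\<close> involves identifications, of the sum of the spaces with dimension sequences
  \<open>dim_seq Q P e\<^sub>1\<close> and \<open>dim_seq Q P (seq_diff e\<^sub>2 e\<^sub>1)\<close> with the space with dimension sequence
  \<open>dim_seq Q P e\<^sub>2\<close>, and the equation
  \<open>C e\<^sub>1 e\<^sub>2 \<oplus> C e\<^sub>2 e\<^sub>3 = C e\<^sub>1 e\<^sub>3\<close> is meant up to a compatible identification \<open>\<tau>\<close>.
  The matrices \<open>\<iota> e\<^sub>1 e\<^sub>2\<close> record the former. They cannot all be taken to be
  identity matrices in general: sums of block matrices in different orders are different matrices,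
  while a level \<open>e\<^sub>3\<close> may be reached from \<open>e\<^sub>1\<close> by adding the same contractible summands in
  different orders. Identity matrices \<open>\<iota>\<close> and \<open>\<tau>\<close> give the equation of block matrices on the nose.
  Compatible families exist: indexing the copies of \<open>P ! j\<close> in degree \<open>i\<close> by an interval of
  integers, add sources of contractible summands \<open>P ! j = P ! j\<close> at its upper end and
  targets at its lower end.\<close>

definition compatible_family ::
  "('v, 'a) pre_digraph \<Rightarrow> (('v, 'a) path \<Rightarrow>\<^sub>0 complex) set \<Rightarrow> ('v, 'a) rep list \<Rightarrow>
     (('v, 'a) cpx \<Rightarrow>\<^sub>0 int) set \<Rightarrow> (pdseq \<Rightarrow> pdseq \<Rightarrow> ('v, 'a) cpx) \<Rightarrow>
     (pdseq \<Rightarrow> pdseq \<Rightarrow> int \<Rightarrow> 'v \<Rightarrow> complex mat) \<Rightarrow> bool"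
where
  "compatible_family Q R P d C \<iota> \<longleftrightarrow>
     (\<forall>e\<^sub>1\<in>levels Q R P d. \<forall>e\<^sub>2\<in>levels Q R P d. level_le Q R P e\<^sub>1 e\<^sub>2 \<longrightarrow>
        C e\<^sub>1 e\<^sub>2 \<in> proj_cpxs Q R P (seq_diff e\<^sub>2 e\<^sub>1) \<and> contractible Q (C e\<^sub>1 e\<^sub>2) \<and>
        \<iota> e\<^sub>1 e\<^sub>2 \<in> GL_seq Q (dim_seq Q P e\<^sub>2)) \<and>
     (\<forall>e\<^sub>1\<in>levels Q R P d. \<forall>e\<^sub>2\<in>levels Q R P d. \<forall>e\<^sub>3\<in>levels Q R P d.
        level_le Q R P e\<^sub>1 e\<^sub>2 \<longrightarrow> level_le Q R P e\<^sub>2 e\<^sub>3 \<longrightarrow>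
        (\<exists>\<tau>\<in>GL_seq Q (dim_seq Q P (seq_diff e\<^sub>3 e\<^sub>1)).
           conj_act Q \<tau> (cpx_sum Q (C e\<^sub>1 e\<^sub>2) (C e\<^sub>2 e\<^sub>3)) = C e\<^sub>1 e\<^sub>3 \<and>
           (\<forall>i. \<forall>v\<in>verts Q.
              \<iota> e\<^sub>1 e\<^sub>3 i v * block_diag (1\<^sub>m (dim_seq Q P e\<^sub>1 i v)) (\<tau> i v) =
              \<iota> e\<^sub>2 e\<^sub>3 i v *
                block_diag (\<iota> e\<^sub>1 e\<^sub>2 i v) (1\<^sub>m (dim_seq Q P (seq_diff e\<^sub>3 e\<^sub>2) i v)))))"

definition transition ::
  "('v, 'a) pre_digraph \<Rightarrow> (pdseq \<Rightarrow> pdseq \<Rightarrow> ('v, 'a) cpx) \<Rightarrow>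
     (pdseq \<Rightarrow> pdseq \<Rightarrow> int \<Rightarrow> 'v \<Rightarrow> complex mat) \<Rightarrow> pdseq \<Rightarrow> pdseq \<Rightarrow> ('v, 'a) cpx \<Rightarrow> ('v, 'a) cpx"
where
  "transition Q C \<iota> e\<^sub>1 e\<^sub>2 X = conj_act Q (\<iota> e\<^sub>1 e\<^sub>2) (cpx_sum Q X (C e\<^sub>1 e\<^sub>2))"

definition GL_transition ::
  "('v, 'a) pre_digraph \<Rightarrow> ('v, 'a) rep list \<Rightarrow> (pdseq \<Rightarrow> pdseq \<Rightarrow> int \<Rightarrow> 'v \<Rightarrow> complex mat) \<Rightarrow>
     pdseq \<Rightarrow> pdseq \<Rightarrow> (int \<Rightarrow> 'v \<Rightarrow> complex mat) \<Rightarrow> (int \<Rightarrow> 'v \<Rightarrow> complex mat)"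
where
  "GL_transition Q P \<iota> e\<^sub>1 e\<^sub>2 g = (\<lambda>i. \<lambda>v\<in>verts Q. \<iota> e\<^sub>1 e\<^sub>2 i v *
     block_diag (g i v) (1\<^sub>m (dim_seq Q P (seq_diff e\<^sub>2 e\<^sub>1) i v)) * inverse_mat (\<iota> e\<^sub>1 e\<^sub>2 i v))"

definition orbit_transition ::
  "('v, 'a) pre_digraph \<Rightarrow> (('v, 'a) path \<Rightarrow>\<^sub>0 complex) set \<Rightarrow> ('v, 'a) rep list \<Rightarrow>
     (pdseq \<Rightarrow> pdseq \<Rightarrow> ('v, 'a) cpx) \<Rightarrow> (pdseq \<Rightarrow> pdseq \<Rightarrow> int \<Rightarrow> 'v \<Rightarrow> complex mat) \<Rightarrow>
     pdseq \<Rightarrow> pdseq \<Rightarrow> ('v, 'a) cpx set \<Rightarrow> ('v, 'a) cpx set"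
where
  "orbit_transition Q R P C \<iota> e\<^sub>1 e\<^sub>2 \<O> = orbit_rel Q R P e\<^sub>2 `` (transition Q C \<iota> e\<^sub>1 e\<^sub>2 ` \<O>)"


section \<open>The limit variety and its quotients\<close>

text \<open>Points of the limit variety are the sets \<open>cpx_class Q R P d C \<iota> e X\<close> for \<open>X\<close> at level \<open>e\<close>,
  elements of the limit group the sets \<open>GL_class Q R P d \<iota> e g\<close>.\<close>

definition Pb_limit ::
  "('v, 'a) pre_digraph \<Rightarrow> (('v, 'a) path \<Rightarrow>\<^sub>0 complex) set \<Rightarrow> ('v, 'a) rep list \<Rightarrow>
     (('v, 'a) cpx \<Rightarrow>\<^sub>0 int) set \<Rightarrow> (pdseq \<Rightarrow> pdseq \<Rightarrow> ('v, 'a) cpx) \<Rightarrow>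
     (pdseq \<Rightarrow> pdseq \<Rightarrow> int \<Rightarrow> 'v \<Rightarrow> complex mat) \<Rightarrow> (pdseq \<times> ('v, 'a) cpx) set topology"
where
  "Pb_limit Q R P d C \<iota> =
     dlim_topology (levels Q R P d) (level_le Q R P) (proj_variety Q R P) (transition Q C \<iota>)"

definition cpx_class ::
  "('v, 'a) pre_digraph \<Rightarrow> (('v, 'a) path \<Rightarrow>\<^sub>0 complex) set \<Rightarrow> ('v, 'a) rep list \<Rightarrow>
     (('v, 'a) cpx \<Rightarrow>\<^sub>0 int) set \<Rightarrow> (pdseq \<Rightarrow> pdseq \<Rightarrow> ('v, 'a) cpx) \<Rightarrow>
     (pdseq \<Rightarrow> pdseq \<Rightarrow> int \<Rightarrow> 'v \<Rightarrow> complex mat) \<Rightarrow> pdseq \<Rightarrow> ('v, 'a) cpx \<Rightarrow>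
     (pdseq \<times> ('v, 'a) cpx) set"
where
  "cpx_class Q R P d C \<iota> e X =
     dlim_rel (levels Q R P d) (level_le Q R P) (\<lambda>e. topspace (proj_variety Q R P e))
       (transition Q C \<iota>) `` {(e, X)}"

definition GL_limit_rel ::
  "('v, 'a) pre_digraph \<Rightarrow> (('v, 'a) path \<Rightarrow>\<^sub>0 complex) set \<Rightarrow> ('v, 'a) rep list \<Rightarrow>
     (('v, 'a) cpx \<Rightarrow>\<^sub>0 int) set \<Rightarrow> (pdseq \<Rightarrow> pdseq \<Rightarrow> int \<Rightarrow> 'v \<Rightarrow> complex mat) \<Rightarrow>
     ((pdseq \<times> (int \<Rightarrow> 'v \<Rightarrow> complex mat)) \<times> (pdseq \<times> (int \<Rightarrow> 'v \<Rightarrow> complex mat))) set"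
where
  "GL_limit_rel Q R P d \<iota> =
     dlim_rel (levels Q R P d) (level_le Q R P) (\<lambda>e. GL_seq Q (dim_seq Q P e)) (GL_transition Q P \<iota>)"

definition GL_limit ::
  "('v, 'a) pre_digraph \<Rightarrow> (('v, 'a) path \<Rightarrow>\<^sub>0 complex) set \<Rightarrow> ('v, 'a) rep list \<Rightarrow>
     (('v, 'a) cpx \<Rightarrow>\<^sub>0 int) set \<Rightarrow> (pdseq \<Rightarrow> pdseq \<Rightarrow> int \<Rightarrow> 'v \<Rightarrow> complex mat) \<Rightarrow>
     (pdseq \<times> (int \<Rightarrow> 'v \<Rightarrow> complex mat)) set set"
where
  "GL_limit Q R P d \<iota> =
     (SIGMA e:levels Q R P d. GL_seq Q (dim_seq Q P e)) // GL_limit_rel Q R P d \<iota>"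

definition GL_class ::
  "('v, 'a) pre_digraph \<Rightarrow> (('v, 'a) path \<Rightarrow>\<^sub>0 complex) set \<Rightarrow> ('v, 'a) rep list \<Rightarrow>
     (('v, 'a) cpx \<Rightarrow>\<^sub>0 int) set \<Rightarrow> (pdseq \<Rightarrow> pdseq \<Rightarrow> int \<Rightarrow> 'v \<Rightarrow> complex mat) \<Rightarrow>
     pdseq \<Rightarrow> (int \<Rightarrow> 'v \<Rightarrow> complex mat) \<Rightarrow> (pdseq \<times> (int \<Rightarrow> 'v \<Rightarrow> complex mat)) set"
where
  "GL_class Q R P d \<iota> e g = GL_limit_rel Q R P d \<iota> `` {(e, g)}"

text \<open>\<open>limit_acts Q R P d C \<iota> \<gamma> x y\<close> says that \<open>\<gamma>\<close> takes \<open>x\<close> to \<open>y\<close>, computed at a level at which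
  both \<open>\<gamma>\<close> and \<open>x\<close> are represented.\<close>

definition limit_acts ::
  "('v, 'a) pre_digraph \<Rightarrow> (('v, 'a) path \<Rightarrow>\<^sub>0 complex) set \<Rightarrow> ('v, 'a) rep list \<Rightarrow>
     (('v, 'a) cpx \<Rightarrow>\<^sub>0 int) set \<Rightarrow> (pdseq \<Rightarrow> pdseq \<Rightarrow> ('v, 'a) cpx) \<Rightarrow>
     (pdseq \<Rightarrow> pdseq \<Rightarrow> int \<Rightarrow> 'v \<Rightarrow> complex mat) \<Rightarrow>
     (pdseq \<times> (int \<Rightarrow> 'v \<Rightarrow> complex mat)) set \<Rightarrow>
     (pdseq \<times> ('v, 'a) cpx) set \<Rightarrow> (pdseq \<times> ('v, 'a) cpx) set \<Rightarrow> bool"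
where
  "limit_acts Q R P d C \<iota> \<gamma> x y \<longleftrightarrow>
     (\<exists>e\<in>levels Q R P d. \<exists>g\<in>GL_seq Q (dim_seq Q P e). \<exists>X\<in>proj_cpxs Q R P e.
        \<gamma> = GL_class Q R P d \<iota> e g \<and> x = cpx_class Q R P d C \<iota> e X \<and>
        y = cpx_class Q R P d C \<iota> e (conj_act Q g X))"

definition limit_orbit_rel ::
  "('v, 'a) pre_digraph \<Rightarrow> (('v, 'a) path \<Rightarrow>\<^sub>0 complex) set \<Rightarrow> ('v, 'a) rep list \<Rightarrow>
     (('v, 'a) cpx \<Rightarrow>\<^sub>0 int) set \<Rightarrow> (pdseq \<Rightarrow> pdseq \<Rightarrow> ('v, 'a) cpx) \<Rightarrow>
     (pdseq \<Rightarrow> pdseq \<Rightarrow> int \<Rightarrow> 'v \<Rightarrow> complex mat) \<Rightarrow>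
     ((pdseq \<times> ('v, 'a) cpx) set \<times> (pdseq \<times> ('v, 'a) cpx) set) set"
where
  "limit_orbit_rel Q R P d C \<iota> = {(x, y). \<exists>\<gamma>\<in>GL_limit Q R P d \<iota>. limit_acts Q R P d C \<iota> \<gamma> x y}"

definition Q1P ::
  "('v, 'a) pre_digraph \<Rightarrow> (('v, 'a) path \<Rightarrow>\<^sub>0 complex) set \<Rightarrow> ('v, 'a) rep list \<Rightarrow>
     (('v, 'a) cpx \<Rightarrow>\<^sub>0 int) set \<Rightarrow> (pdseq \<Rightarrow> pdseq \<Rightarrow> ('v, 'a) cpx) \<Rightarrow>
     (pdseq \<Rightarrow> pdseq \<Rightarrow> int \<Rightarrow> 'v \<Rightarrow> complex mat) \<Rightarrow> (pdseq \<times> ('v, 'a) cpx) set set topology"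
where
  "Q1P Q R P d C \<iota> = quotient_topology (Pb_limit Q R P d C \<iota>) (limit_orbit_rel Q R P d C \<iota>)"

definition quasi_iso_rel ::
  "('v, 'a) pre_digraph \<Rightarrow> (('v, 'a) path \<Rightarrow>\<^sub>0 complex) set \<Rightarrow> ('v, 'a) rep list \<Rightarrow>
     (('v, 'a) cpx \<Rightarrow>\<^sub>0 int) set \<Rightarrow> (pdseq \<Rightarrow> pdseq \<Rightarrow> ('v, 'a) cpx) \<Rightarrow>
     (pdseq \<Rightarrow> pdseq \<Rightarrow> int \<Rightarrow> 'v \<Rightarrow> complex mat) \<Rightarrow>
     ((pdseq \<times> ('v, 'a) cpx) set \<times> (pdseq \<times> ('v, 'a) cpx) set) set"
where
  "quasi_iso_rel Q R P d C \<iota> =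
     {(x, y). x \<in> topspace (Pb_limit Q R P d C \<iota>) \<and> y \<in> topspace (Pb_limit Q R P d C \<iota>) \<and>
        (\<exists>(e\<^sub>1, X) \<in> x. \<exists>(e\<^sub>2, Y) \<in> y. quasi_isomorphic Q R X Y)}"

definition QP ::
  "('v, 'a) pre_digraph \<Rightarrow> (('v, 'a) path \<Rightarrow>\<^sub>0 complex) set \<Rightarrow> ('v, 'a) rep list \<Rightarrow>
     (('v, 'a) cpx \<Rightarrow>\<^sub>0 int) set \<Rightarrow> (pdseq \<Rightarrow> pdseq \<Rightarrow> ('v, 'a) cpx) \<Rightarrow>
     (pdseq \<Rightarrow> pdseq \<Rightarrow> int \<Rightarrow> 'v \<Rightarrow> complex mat) \<Rightarrow> (pdseq \<times> ('v, 'a) cpx) set set topology"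
where
  "QP Q R P d C \<iota> = quotient_topology (Pb_limit Q R P d C \<iota>) (quasi_iso_rel Q R P d C \<iota>)"

definition QP_levels_limit ::
  "('v, 'a) pre_digraph \<Rightarrow> (('v, 'a) path \<Rightarrow>\<^sub>0 complex) set \<Rightarrow> ('v, 'a) rep list \<Rightarrow>
     (('v, 'a) cpx \<Rightarrow>\<^sub>0 int) set \<Rightarrow> (pdseq \<Rightarrow> pdseq \<Rightarrow> ('v, 'a) cpx) \<Rightarrow>
     (pdseq \<Rightarrow> pdseq \<Rightarrow> int \<Rightarrow> 'v \<Rightarrow> complex mat) \<Rightarrow> (pdseq \<times> ('v, 'a) cpx set) set topology"
where
  "QP_levels_limit Q R P d C \<iota> = dlim_topology (levels Q R P d) (level_le Q R P)
     (QP_level Q R P) (orbit_transition Q R P C \<iota>)"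

definition orbit_class ::
  "('v, 'a) pre_digraph \<Rightarrow> (('v, 'a) path \<Rightarrow>\<^sub>0 complex) set \<Rightarrow> ('v, 'a) rep list \<Rightarrow>
     (('v, 'a) cpx \<Rightarrow>\<^sub>0 int) set \<Rightarrow> (pdseq \<Rightarrow> pdseq \<Rightarrow> ('v, 'a) cpx) \<Rightarrow>
     (pdseq \<Rightarrow> pdseq \<Rightarrow> int \<Rightarrow> 'v \<Rightarrow> complex mat) \<Rightarrow> pdseq \<Rightarrow> ('v, 'a) cpx set \<Rightarrow>
     (pdseq \<times> ('v, 'a) cpx set) set"
where
  "orbit_class Q R P d C \<iota> e \<O> =
     dlim_rel (levels Q R P d) (level_le Q R P) (\<lambda>e. topspace (QP_level Q R P e))
       (orbit_transition Q R P C \<iota>) `` {(e, \<O>)}"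

end

(* Bounded complexes X, Y of projectives are quasi-isomorphic iff they are homotopy equivalent, and
   for a homotopy equivalence f from X to Y the mapping cylinder gives an isomorphism
   X + cone f ~ Y + cone 1_X with contractible second summands. A contractible complex of
   projectives is determined up to isomorphism by its terms, because tops are additive and determine
   projectives. Hence X and Y are quasi-isomorphic iff their images at some common level lie in one
   orbit, and all three spaces are the quotient of the disjoint union of the varieties by this
   relation. *)

theory Submission
  imports Defs "HOL-Library.Function_Algebras" "Jordan_Normal_Form.Determinant"
begin

section \<open>Finitely supported matrices\<close>

text \<open>The obstacle is bookkeeping: every identity lives between spaces of varying dimension.
  All matrices are therefore extended by zeros to elements of one ring without unit, and families
  over the vertices form a product of copies of it. The identity of an object becomes an idempotent,
  a map becomes an element fixed by two idempotents, and identities between maps of complexes become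
  ring equations. A zigzag of quasi-isomorphisms out of a bounded complex of projectives collapses
  to one map, since such complexes lift against acyclic cones. Cancellation of projective summands,
  needed to compare contractible complexes, rests on tops: their dimensions are traces, hence
  additive, and a map inducing the identity on the top is inverted by a finite geometric series,
  because long paths act as zero. The common level of complexes at levels \<open>e\<close> and
  \<open>e'\<close> is \<open>e + e' + e[1]\<close>: it arises from \<open>e\<close> by adding the
  terms of the cone of the map, and from \<open>e'\<close> by adding those of the cone of the
  identity.\<close>

typedef fmat = "{f :: nat \<Rightarrow> nat \<Rightarrow> complex. \<exists>N. \<forall>i j. N \<le> i \<or> N \<le> j \<longrightarrow> f i j = 0}"
  morphisms entry Abs_fmat
  by (rule exI[of _ "\<lambda>_ _. 0"]) simp

lemma fmat_eqI: "(\<And>i j. entry A i j = entry B i j) \<Longrightarrow> A = B"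
  by (metis entry_inject ext)

lemma entry_bound: obtains N where "\<And>i j. N \<le> i \<or> N \<le> j \<Longrightarrow> entry A i j = 0"
  using entry[of A] by auto

lemma entry_Abs_fmat:
  assumes "\<And>i j. N \<le> i \<or> N \<le> j \<Longrightarrow> f i j = 0"
  shows "entry (Abs_fmat f) = f"
  using assms by (intro Abs_fmat_inverse) blast

lemma entry_bound2:
  obtains N where "\<And>i j. N \<le> i \<or> N \<le> j \<Longrightarrow> entry A i j = 0"
    and "\<And>i j. N \<le> i \<or> N \<le> j \<Longrightarrow> entry B i j = 0"
proof -
  obtain N where N: "\<And>i j. N \<le> i \<or> N \<le> j \<Longrightarrow> entry A i j = 0" using entry_bound by blast
  obtain M where M: "\<And>i j. M \<le> i \<or> M \<le> j \<Longrightarrow> entry B i j = 0" using entry_bound by blast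
  show ?thesis by (rule that[of "max M N"]) (use M N in auto)
qed

section \<open>The ring of finitely supported matrices, which has no unit\<close>

instantiation fmat :: ring
begin

definition "0 = Abs_fmat (\<lambda>i j. 0)"
definition "A + B = Abs_fmat (\<lambda>i j. entry A i j + entry B i j)"
definition "A - B = Abs_fmat (\<lambda>i j. entry A i j - entry B i j)"
definition "- A = Abs_fmat (\<lambda>i j. - entry A i j)"
text \<open>Summing over the support of a row keeps the sum finite without naming a bound, so
  products need no size conditions.\<close>

definition "A * B = Abs_fmat (\<lambda>i k. \<Sum>j | entry A i j \<noteq> 0. entry A i j * entry B j k)"

lemma entry_zero [simp]: "entry 0 i j = 0"
  by (simp add: zero_fmat_def entry_Abs_fmat)

lemma entry_plus [simp]: "entry (A + B) i j = entry A i j + entry B i j"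
proof -
  obtain N where "\<And>i j. N \<le> i \<or> N \<le> j \<Longrightarrow> entry A i j = 0"
    "\<And>i j. N \<le> i \<or> N \<le> j \<Longrightarrow> entry B i j = 0" using entry_bound2 by blast
  then show ?thesis by (subst plus_fmat_def, subst entry_Abs_fmat[of N]) auto
qed

lemma entry_minus [simp]: "entry (A - B) i j = entry A i j - entry B i j"
proof -
  obtain N where "\<And>i j. N \<le> i \<or> N \<le> j \<Longrightarrow> entry A i j = 0"
    "\<And>i j. N \<le> i \<or> N \<le> j \<Longrightarrow> entry B i j = 0" using entry_bound2 by blast
  then show ?thesis by (subst minus_fmat_def, subst entry_Abs_fmat[of N]) auto
qed

lemma entry_uminus [simp]: "entry (- A) i j = - entry A i j"
proof -
  obtain N where "\<And>i j. N \<le> i \<or> N \<le> j \<Longrightarrow> entry A i j = 0" using entry_bound by blast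
  then show ?thesis by (subst uminus_fmat_def, subst entry_Abs_fmat[of N]) auto
qed

lemma entry_times_raw: "entry (A * B) i k = (\<Sum>j | entry A i j \<noteq> 0. entry A i j * entry B j k)"
proof -
  obtain N where N: "\<And>i j. N \<le> i \<or> N \<le> j \<Longrightarrow> entry A i j = 0"
    "\<And>i j. N \<le> i \<or> N \<le> j \<Longrightarrow> entry B i j = 0" using entry_bound2 by blast
  then have "(\<Sum>j | entry A i j \<noteq> 0. entry A i j * entry B j k) = 0" if "N \<le> i \<or> N \<le> k" for i k
    using that by (intro sum.neutral) auto
  then have "entry (A * B) = (\<lambda>i k. \<Sum>j | entry A i j \<noteq> 0. entry A i j * entry B j k)"
    unfolding times_fmat_def by (rule entry_Abs_fmat)
  then show ?thesis by simp
qed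

text \<open>Any bound beyond the support of row \<open>i\<close> may be the range of summation. A
  common range for several products is what lets their sums be added and exchanged.\<close>

lemma entry_times:
  assumes "\<And>j. N \<le> j \<Longrightarrow> entry A i j = 0"
  shows "entry (A * B) i k = (\<Sum>j<N. entry A i j * entry B j k)"
  unfolding entry_times_raw
  by (rule sum.mono_neutral_left) (use assms in \<open>auto simp: not_le[symmetric]\<close>)

instance
proof
  fix A B C :: fmat
  show "A * B * C = A * (B * C)"
  proof (rule fmat_eqI)
    fix i k
    obtain N where N: "\<And>i j. N \<le> i \<or> N \<le> j \<Longrightarrow> entry A i j = 0"
      "\<And>i j. N \<le> i \<or> N \<le> j \<Longrightarrow> entry B i j = 0" using entry_bound2 by blast
    have AB: "entry (A * B) i j = (\<Sum>l<N. entry A i l * entry B l j)" for i j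
      by (rule entry_times) (use N in auto)
    have BC: "entry (B * C) i j = (\<Sum>l<N. entry B i l * entry C l j)" for i j
      by (rule entry_times) (use N in auto)
    have 1: "entry (A * B * C) i k = (\<Sum>j<N. entry (A * B) i j * entry C j k)"
      by (rule entry_times) (use N in \<open>auto simp: AB\<close>)
    have 2: "entry (A * (B * C)) i k = (\<Sum>j<N. entry A i j * entry (B * C) j k)"
      by (rule entry_times) (use N in auto)
    show "entry (A * B * C) i k = entry (A * (B * C)) i k"
      unfolding 1 2 AB BC sum_distrib_left sum_distrib_right
      by (subst sum.swap) (simp add: mult.assoc)
  qed
  show "(A + B) * C = A * C + B * C"
  proof (rule fmat_eqI)
    fix i k
    obtain N where N: "\<And>i j. N \<le> i \<or> N \<le> j \<Longrightarrow> entry A i j = 0"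
      "\<And>i j. N \<le> i \<or> N \<le> j \<Longrightarrow> entry B i j = 0" using entry_bound2 by blast
    then show "entry ((A + B) * C) i k = entry (A * C + B * C) i k"
      by (simp add: entry_times[of N] distrib_right sum.distrib)
  qed
  show "A * (B + C) = A * B + A * C"
  proof (rule fmat_eqI)
    fix i k
    obtain N where N: "\<And>i j. N \<le> i \<or> N \<le> j \<Longrightarrow> entry A i j = 0" using entry_bound by blast
    then show "entry (A * (B + C)) i k = entry (A * B + A * C) i k"
      by (simp add: entry_times[of N] distrib_left sum.distrib)
  qed
qed (auto intro!: fmat_eqI)

end

text \<open>A rewriting device: in a product associated to the right, \<open>a * b\<close> is no
  subterm, so an equation for it must be offered in this form too. It is mostly used through
  \<open>THEN\<close>.\<close>

lemma mult_assoc_eq: "a * b = c \<Longrightarrow> a * (b * x) = c * (x :: 'a::semigroup_mult)"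
  by (metis mult.assoc)

section \<open>Transpose, trace and scalar multiples\<close>

definition mtransp :: "fmat \<Rightarrow> fmat" where
  "mtransp A = Abs_fmat (\<lambda>i j. entry A j i)"

lemma entry_mtransp [simp]: "entry (mtransp A) i j = entry A j i"
proof -
  obtain N where "\<And>i j. N \<le> i \<or> N \<le> j \<Longrightarrow> entry A i j = 0" using entry_bound by blast
  then show ?thesis by (subst mtransp_def, subst entry_Abs_fmat[of N]) auto
qed

lemma mtransp_mtransp [simp]: "mtransp (mtransp A) = A"
  by (rule fmat_eqI) simp

lemma mtransp_zero [simp]: "mtransp 0 = 0"
  by (rule fmat_eqI) simp

lemma mtransp_mult: "mtransp (A * B) = mtransp B * mtransp A"
proof (rule fmat_eqI)
  fix i k
  obtain N where "\<And>i j. N \<le> i \<or> N \<le> j \<Longrightarrow> entry A i j = 0"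
    "\<And>i j. N \<le> i \<or> N \<le> j \<Longrightarrow> entry B i j = 0" using entry_bound2 by blast
  then show "entry (mtransp (A * B)) i k = entry (mtransp B * mtransp A) i k"
    by (simp add: entry_times[of N] mult.commute)
qed

definition mtrace :: "fmat \<Rightarrow> complex" where
  "mtrace A = (\<Sum>i | entry A i i \<noteq> 0. entry A i i)"

lemma mtrace_eq: "(\<And>i. N \<le> i \<Longrightarrow> entry A i i = 0) \<Longrightarrow> mtrace A = (\<Sum>i<N. entry A i i)"
  unfolding mtrace_def
  by (rule sum.mono_neutral_left) (auto simp: not_le[symmetric])

lemma mtrace_plus: "mtrace (A + B) = mtrace A + mtrace B"
proof -
  obtain N where "\<And>i j. N \<le> i \<or> N \<le> j \<Longrightarrow> entry A i j = 0"
    "\<And>i j. N \<le> i \<or> N \<le> j \<Longrightarrow> entry B i j = 0" using entry_bound2 by blast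
  then show ?thesis by (simp add: mtrace_eq[of N] sum.distrib)
qed

lemma mtrace_commute: "mtrace (A * B) = mtrace (B * A)"
proof -
  obtain N where N: "\<And>i j. N \<le> i \<or> N \<le> j \<Longrightarrow> entry A i j = 0"
    "\<And>i j. N \<le> i \<or> N \<le> j \<Longrightarrow> entry B i j = 0" using entry_bound2 by blast
  have "mtrace (A * B) = (\<Sum>i<N. \<Sum>j<N. entry A i j * entry B j i)"
    using N by (subst mtrace_eq[of N]) (auto simp: entry_times[of N])
  also have "\<dots> = (\<Sum>i<N. \<Sum>j<N. entry B i j * entry A j i)"
    by (subst sum.swap) (simp add: mult.commute)
  also have "\<dots> = mtrace (B * A)"
    using N by (subst mtrace_eq[of N]) (auto simp: entry_times[of N])
  finally show ?thesis .
qed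

definition smult_fmat :: "complex \<Rightarrow> fmat \<Rightarrow> fmat" (infixr \<open>*\<^sub>f\<close> 75) where
  "k *\<^sub>f A = Abs_fmat (\<lambda>i j. k * entry A i j)"

lemma entry_smult_fmat [simp]: "entry (k *\<^sub>f A) i j = k * entry A i j"
proof -
  obtain N where "\<And>i j. N \<le> i \<or> N \<le> j \<Longrightarrow> entry A i j = 0" using entry_bound by blast
  then show ?thesis by (subst smult_fmat_def, subst entry_Abs_fmat[of N]) auto
qed

lemma smult_fmat_zero [simp]: "k *\<^sub>f 0 = 0" "0 *\<^sub>f A = 0"
  by (auto intro: fmat_eqI)

lemma smult_fmat_one [simp]: "1 *\<^sub>f A = A"
  by (auto intro: fmat_eqI)

lemma smult_fmat_plus: "k *\<^sub>f (A + B) = k *\<^sub>f A + k *\<^sub>f B"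
  "(k + l) *\<^sub>f A = k *\<^sub>f A + l *\<^sub>f A"
  by (auto intro: fmat_eqI simp: algebra_simps)

lemma smult_fmat_smult: "k *\<^sub>f (l *\<^sub>f A) = (k * l) *\<^sub>f A"
  by (auto intro: fmat_eqI simp: algebra_simps)

lemma smult_fmat_times:
  "(k *\<^sub>f A) * B = k *\<^sub>f (A * B)" "A * (k *\<^sub>f B) = k *\<^sub>f (A * B)"
proof -
  obtain N where "\<And>i j. N \<le> i \<or> N \<le> j \<Longrightarrow> entry A i j = 0"
    "\<And>i j. N \<le> i \<or> N \<le> j \<Longrightarrow> entry B i j = 0" using entry_bound2 by blast
  then show "(k *\<^sub>f A) * B = k *\<^sub>f (A * B)" "A * (k *\<^sub>f B) = k *\<^sub>f (A * B)"
    by (auto intro!: fmat_eqI sum.cong simp: entry_times[of N] sum_distrib_left)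
qed

lemma entry_sum: "entry (sum F I) i j = (\<Sum>x\<in>I. entry (F x) i j)"
  by (induction I rule: infinite_finite_induct) auto

section \<open>Identity blocks as local units, coordinate inclusions and projections\<close>

definition idm :: "nat \<Rightarrow> fmat" where
  "idm n = Abs_fmat (\<lambda>i j. if i = j \<and> i < n then 1 else 0)"

text \<open>The inclusion of \<open>\<complex>\<close> to the power \<open>n\<close> as the last coordinates of \<open>\<complex>\<close> to the power
  \<open>m + n\<close>, and the corresponding projection.\<close>

definition sh_in :: "nat \<Rightarrow> nat \<Rightarrow> fmat" where
  "sh_in m n = Abs_fmat (\<lambda>i j. if i = m + j \<and> j < n then 1 else 0)"

definition sh_out :: "nat \<Rightarrow> nat \<Rightarrow> fmat" where
  "sh_out m n = Abs_fmat (\<lambda>i j. if j = m + i \<and> i < n then 1 else 0)"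

lemma entry_idm [simp]: "entry (idm n) i j = (if i = j \<and> i < n then 1 else 0)"
  by (subst idm_def, subst entry_Abs_fmat[of n]) auto

lemma entry_sh_in [simp]: "entry (sh_in m n) i j = (if i = m + j \<and> j < n then 1 else 0)"
  by (subst sh_in_def, subst entry_Abs_fmat[of "m + n"]) auto

lemma entry_sh_out [simp]: "entry (sh_out m n) i j = (if j = m + i \<and> i < n then 1 else 0)"
  by (subst sh_out_def, subst entry_Abs_fmat[of "m + n"]) auto

lemma mtransp_idm [simp]: "mtransp (idm n) = idm n"
  by (auto intro: fmat_eqI)

lemma mtransp_sh [simp]: "mtransp (sh_in m n) = sh_out m n" "mtransp (sh_out m n) = sh_in m n"
  by (auto intro!: fmat_eqI)

lemma idm_0 [simp]: "idm 0 = 0"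
  by (auto intro: fmat_eqI)

lemma sh_0 [simp]: "sh_in m 0 = 0" "sh_out m 0 = 0"
  by (auto intro: fmat_eqI)

lemma entry_idm_times [simp]: "entry (idm n * A) i j = (if i < n then entry A i j else 0)"
  by (subst entry_times[of n]) (auto simp: if_distrib[where f="\<lambda>x. x * _"] sum.delta' cong: if_cong)

text \<open>Transposition turns the rule for multiplication from the left into this one; the shift
  matrices are treated in the same way.\<close>

lemma entry_times_idm [simp]: "entry (A * idm n) i j = (if j < n then entry A i j else 0)"
  using entry_idm_times[of n "mtransp A" j i] mtransp_mult[of A "idm n"]
  by (metis entry_mtransp mtransp_idm)

lemma entry_sh_in_times [simp]:
  "entry (sh_in m n * A) i j = (if m \<le> i \<and> i < m + n then entry A (i - m) j else 0)"
proof -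
  have "entry (sh_in m n * A) i j = (\<Sum>k<n. (if i = m + k \<and> k < n then 1 else 0) * entry A k j)"
    by (subst entry_times[of n]) auto
  also have "\<dots> = (\<Sum>k<n. if k = i - m then (if m \<le> i then entry A k j else 0) else 0)"
    by (rule sum.cong) auto
  also have "\<dots> = (if m \<le> i \<and> i < m + n then entry A (i - m) j else 0)"
    by (auto simp: sum.delta)
  finally show ?thesis .
qed

lemma entry_sh_out_times [simp]:
  "entry (sh_out m n * A) i j = (if i < n then entry A (m + i) j else 0)"
proof -
  have "entry (sh_out m n * A) i j = (\<Sum>k<m + n. (if k = m + i \<and> i < n then 1 else 0) * entry A k j)"
    by (subst entry_times[of "m + n"]) auto
  also have "\<dots> = (\<Sum>k<m + n. if k = m + i then (if i < n then entry A k j else 0) else 0)"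
    by (rule sum.cong) auto
  also have "\<dots> = (if i < n then entry A (m + i) j else 0)"
    by (auto simp: sum.delta)
  finally show ?thesis .
qed

lemma entry_times_sh_in [simp]:
  "entry (A * sh_in m n) i j = (if j < n then entry A i (m + j) else 0)"
  using entry_sh_out_times[of m n "mtransp A" j i] mtransp_mult[of A "sh_in m n"]
  by (metis entry_mtransp mtransp_sh(1))

lemma entry_times_sh_out [simp]:
  "entry (A * sh_out m n) i j = (if m \<le> j \<and> j < m + n then entry A i (j - m) else 0)"
  using entry_sh_in_times[of m n "mtransp A" j i] mtransp_mult[of A "sh_out m n"]
  by (metis entry_mtransp mtransp_sh(2))

lemma idm_idm: "idm m * idm n = idm (min m n)"
  by (auto intro!: fmat_eqI)

lemma idm_idem [simp]: "idm n * idm n = idm n"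
  by (simp add: idm_idm)

lemma idm_add [simp]:
  "idm m * idm (m + n) = idm m" "idm (m + n) * idm m = idm m"
  by (simp_all add: idm_idm)

lemma sh_simps [simp]:
  "idm m * sh_in m n = 0" "sh_out m n * idm m = 0"
  "sh_out m n * sh_in m n = idm n"
  "idm (m + n) * sh_in m n = sh_in m n" "sh_in m n * idm n = sh_in m n"
  "sh_out m n * idm (m + n) = sh_out m n" "idm n * sh_out m n = sh_out m n"
  by (auto intro!: fmat_eqI)

lemma idm_plus: "idm m + sh_in m n * sh_out m n = idm (m + n)"
  by (auto intro!: fmat_eqI)

lemma idm_inject [simp]: "idm m = idm n \<longleftrightarrow> m = n"
proof
  assume "idm m = idm n"
  then have "entry (idm m) i i = entry (idm n) i i" for i by simp
  then have "i < m \<longleftrightarrow> i < n" for i by (metis entry_idm zero_neq_one)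
  then show "m = n" by (meson linorder_neqE_nat less_irrefl)
qed simp

lemma mtrace_idm [simp]: "mtrace (idm n) = of_nat n"
  by (subst mtrace_eq[of n]) auto

text \<open>Being fixed by the local units on both sides, rather than a condition on entries, makes
  sizes available to equational rewriting.\<close>

definition sized :: "nat \<Rightarrow> nat \<Rightarrow> fmat \<Rightarrow> bool" where
  "sized m n A \<longleftrightarrow> idm m * A = A \<and> A * idm n = A"

lemma sized_iff: "sized m n A \<longleftrightarrow> (\<forall>i j. m \<le> i \<or> n \<le> j \<longrightarrow> entry A i j = 0)"
proof
  assume A: "sized m n A"
  then have "entry A i j = entry (idm m * A) i j" "entry A i j = entry (A * idm n) i j" for i j
    by (simp_all add: sized_def)
  then show "\<forall>i j. m \<le> i \<or> n \<le> j \<longrightarrow> entry A i j = 0"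
    by (metis entry_idm_times entry_times_idm not_less)
qed (auto simp: sized_def not_le[symmetric] intro!: fmat_eqI)

lemma sized_mult: "sized m n A \<Longrightarrow> sized n k B \<Longrightarrow> sized m k (A * B)"
  unfolding sized_def by (metis mult.assoc)

section \<open>Translation of matrices and vectors with dimensions\<close>

definition of_mat :: "complex mat \<Rightarrow> fmat" where
  "of_mat A = Abs_fmat (\<lambda>i j. if i < dim_row A \<and> j < dim_col A then A $$ (i, j) else 0)"

lemma entry_of_mat [simp]:
  "entry (of_mat A) i j = (if i < dim_row A \<and> j < dim_col A then A $$ (i, j) else 0)"
  by (subst of_mat_def, subst entry_Abs_fmat[of "max (dim_row A) (dim_col A)"]) auto

lemma sized_of_mat: "A \<in> carrier_mat m n \<Longrightarrow> sized m n (of_mat A)"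
  by (auto simp: sized_iff)

text \<open>Extension by zeros forgets the dimensions, so these have to be compared separately; all
  zero matrices, for instance, have the same image.\<close>

lemma of_mat_eqD:
  assumes "of_mat A = of_mat B" "dim_row A = dim_row B" "dim_col A = dim_col B"
  shows "A = B"
proof (rule eq_matI)
  fix i j assume "i < dim_row B" "j < dim_col B"
  then show "A $$ (i, j) = B $$ (i, j)"
    using arg_cong[OF assms(1), of "\<lambda>X. entry X i j"] assms(2,3) by simp
qed (use assms in auto)

lemma of_mat_inject:
  "A \<in> carrier_mat m n \<Longrightarrow> B \<in> carrier_mat m n \<Longrightarrow> of_mat A = of_mat B \<longleftrightarrow> A = B"
  using of_mat_eqD[of A B] by auto

lemma of_mat_mult: "dim_col A = dim_row B \<Longrightarrow> of_mat (A * B) = of_mat A * of_mat B"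
  by (rule fmat_eqI)
    (auto simp: entry_times[where N="dim_col A"] scalar_prod_def atLeast0LessThan intro!: sum.cong)

lemma of_mat_add:
  "dim_row A = dim_row B \<Longrightarrow> dim_col A = dim_col B \<Longrightarrow> of_mat (A + B) = of_mat A + of_mat B"
  by (rule fmat_eqI) auto

lemma of_mat_uminus: "of_mat (- A) = - of_mat A"
  by (rule fmat_eqI) auto

lemma of_mat_zero [simp]: "of_mat (0\<^sub>m m n) = 0"
  by (rule fmat_eqI) auto

lemma of_mat_one [simp]: "of_mat (1\<^sub>m n) = idm n"
  by (rule fmat_eqI) auto

definition to_mat :: "nat \<Rightarrow> nat \<Rightarrow> fmat \<Rightarrow> complex mat" where
  "to_mat m n A = mat m n (\<lambda>(i, j). entry A i j)"

lemma to_mat_carrier [simp]: "to_mat m n A \<in> carrier_mat m n"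
  by (simp add: to_mat_def)

lemma dim_to_mat [simp]: "dim_row (to_mat m n A) = m" "dim_col (to_mat m n A) = n"
  by (simp_all add: to_mat_def)

lemma of_mat_to_mat: "sized m n A \<Longrightarrow> of_mat (to_mat m n A) = A"
  by (rule fmat_eqI) (auto simp: sized_iff to_mat_def not_le[symmetric])

lemma of_mat_four_block:
  assumes "dim_col A = dim_col C" "dim_row A = dim_row B" "dim_row C = dim_row D" "dim_col B = dim_col D"
  shows "of_mat (four_block_mat A B C D) = of_mat A + of_mat B * sh_out (dim_col A) (dim_col D)
     + sh_in (dim_row A) (dim_row D) * of_mat C
     + sh_in (dim_row A) (dim_row D) * of_mat D * sh_out (dim_col A) (dim_col D)"
  by (rule fmat_eqI) (use assms in auto)

lemma of_mat_block_diag: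
  "of_mat (block_diag A B) = of_mat A + sh_in (dim_row A) (dim_row B) * of_mat B * sh_out (dim_col A) (dim_col B)"
  unfolding block_diag_def by (subst of_mat_four_block) auto

lemma dim_block_diag [simp]:
  "dim_row (block_diag A B) = dim_row A + dim_row B"
  "dim_col (block_diag A B) = dim_col A + dim_col B"
  by (simp_all add: block_diag_def)

text \<open>This is an equality, not an isomorphism. It makes direct sums of representations and of
  complexes strictly associative, on which the functoriality of the transition maps relies.\<close>

lemma block_diag_assoc: "block_diag A (block_diag B C) = block_diag (block_diag A B) C"
  unfolding block_diag_def by (rule assoc_four_block_mat)

text \<open>Columns, i.e. matrices with one column, represent vectors.\<close>

definition of_vec :: "complex vec \<Rightarrow> fmat" where
  "of_vec x = Abs_fmat (\<lambda>i j. if i < dim_vec x \<and> j = 0 then x $ i else 0)"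

lemma entry_of_vec [simp]: "entry (of_vec x) i j = (if i < dim_vec x \<and> j = 0 then x $ i else 0)"
  by (subst of_vec_def, subst entry_Abs_fmat[of "Suc (dim_vec x)"]) auto

lemma sized_of_vec: "x \<in> carrier_vec n \<Longrightarrow> sized n 1 (of_vec x)"
  by (auto simp: sized_iff)

lemma of_vec_eqD:
  assumes "of_vec x = of_vec y" "dim_vec x = dim_vec y"
  shows "x = y"
proof (rule eq_vecI)
  fix i assume "i < dim_vec y"
  then show "x $ i = y $ i"
    using arg_cong[OF assms(1), of "\<lambda>X. entry X i 0"] assms(2) by simp
qed (use assms in simp)

lemma of_vec_mult: "dim_col A = dim_vec x \<Longrightarrow> of_vec (A *\<^sub>v x) = of_mat A * of_vec x"
  by (rule fmat_eqI)
    (auto simp: entry_times[where N="dim_col A"] scalar_prod_def atLeast0LessThan intro!: sum.cong)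

lemma of_vec_minus: "dim_vec x = dim_vec y \<Longrightarrow> of_vec (x - y) = of_vec x - of_vec y"
  by (rule fmat_eqI) auto

lemma of_vec_zero [simp]: "of_vec (0\<^sub>v n) = 0"
  by (rule fmat_eqI) auto

lemma of_vec_surj:
  assumes "sized n 1 A" obtains x where "x \<in> carrier_vec n" "of_vec x = A"
proof
  show "vec n (\<lambda>i. entry A i 0) \<in> carrier_vec n" by simp
  show "of_vec (vec n (\<lambda>i. entry A i 0)) = A"
    using assms by (intro fmat_eqI) (auto simp: sized_iff)
qed

text \<open>A pair \<open>B\<close>, \<open>L\<close> with \<open>L * B = 1\<close> whose idempotent \<open>B * L\<close> projects onto the common
  kernel of the matrices in \<open>\<A>\<close> is obtained by taking it of maximal rank.\<close>

lemma left_inverse_bound: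
  assumes "sized n k B" "sized k n L" "L * B = idm k"
  shows "k \<le> n"
proof (rule ccontr)
  assume "\<not> k \<le> n"
  then have nk: "n < k" by simp
  \<comment> \<open>If \<open>n < k\<close>, both matrices can be padded to size \<open>k\<close> by
    \<open>k\<close>, where a left inverse is two-sided. Then \<open>B * L\<close> would be the
    identity of size \<open>k\<close>, although it is fixed by the smaller
    \<open>idm n\<close>.\<close>
  have sz: "sized k k B" "sized k k L" using assms nk by (auto simp: sized_iff)
  have "to_mat k k L * to_mat k k B = 1\<^sub>m k"
    by (rule of_mat_eqD) (use assms sz in \<open>simp_all add: of_mat_mult of_mat_to_mat\<close>)
  then have "to_mat k k B * to_mat k k L = 1\<^sub>m k"
    using mat_mult_left_right_inverse by (metis to_mat_carrier)
  then have "of_mat (to_mat k k B * to_mat k k L) = idm k" by simp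
  then have "B * L = idm k" using sz by (simp add: of_mat_mult of_mat_to_mat)
  moreover have "idm n * (B * L) = B * L" using assms(1) by (metis mult.assoc sized_def)
  ultimately show False using nk by (simp add: idm_idm)
qed

lemma kernel_split:
  obtains k B L where "sized n k B" "sized k n L" "L * B = idm k" "\<And>A. A \<in> \<A> \<Longrightarrow> A * B = 0"
    "\<And>x. idm n * x = x \<Longrightarrow> (\<And>A. A \<in> \<A> \<Longrightarrow> A * x = 0) \<Longrightarrow> B * (L * x) = x"
proof -
  define good where "good k B L \<longleftrightarrow> sized n k B \<and> sized k n L \<and> L * B = idm k \<and> (\<forall>A\<in>\<A>. A * B = 0)" for k B L
  have "good 0 0 0" by (simp add: good_def sized_def)
  then have ex: "\<exists>k. \<exists>B L. good k B L" by blast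
  have bound: "\<forall>k. (\<exists>B L. good k B L) \<longrightarrow> k \<le> n"
    using left_inverse_bound by (auto simp: good_def)
  define k where "k = (GREATEST k. \<exists>B L. good k B L)"
  have k: "\<exists>B L. good k B L"
    unfolding k_def by (rule GreatestI_ex_nat[OF ex, of n]) (use bound in blast)
  have max: "k' \<le> k" if "\<exists>B L. good k' B L" for k'
    unfolding k_def by (rule Greatest_le_nat[of _ _ n]) (use that bound in blast)+
  obtain B L where BL: "good k B L" using k by blast
  then have b: "sized n k B" "sized k n L" "L * B = idm k" "\<And>A. A \<in> \<A> \<Longrightarrow> A * B = 0"
    by (auto simp: good_def)
  have "B * (L * x) = x" if x: "idm n * x = x" and Ax: "\<And>A. A \<in> \<A> \<Longrightarrow> A * x = 0" for x
  proof (rule ccontr)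
    assume "B * (L * x) \<noteq> x"
    \<comment> \<open>The part of \<open>x\<close> missed by \<open>B * L\<close>. It is killed by
      \<open>L\<close> and by all of \<A>, and a non-zero entry of it yields one more column for
      \<open>B\<close>, against maximality.\<close>
    define y where "y = x - B * (L * x)"
    have "y \<noteq> 0" using \<open>B * (L * x) \<noteq> x\<close> by (simp add: y_def)
    then obtain c j where cj: "entry y c j \<noteq> 0" by (metis entry_zero fmat_eqI)
    have Ly: "L * y = 0"
      using b by (simp add: y_def algebra_simps sized_def mult_assoc_eq[of L B] mult_assoc_eq[of "idm k" L])
    have Ay: "A * y = 0" if "A \<in> \<A>" for A
      using that b(4) Ax by (simp add: y_def algebra_simps mult_assoc_eq[of A B])
    have ny: "idm n * y = y"
      using b x by (simp add: y_def algebra_simps sized_def mult_assoc_eq[of "idm n" B])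
    have c: "c < n" using arg_cong[OF ny, of "\<lambda>X. entry X c j"] cj by (auto split: if_splits)
    \<comment> \<open>A name for the number one, so that the rules for sizes of the form
      \<open>k + u\<close> apply.\<close>
    define u :: nat where "u = 1"
    define z where "z = y * sh_in j u"
    \<comment> \<open>Row \<open>c\<close> of the projector complementary to \<open>B * L\<close>,
      scaled to take the value one on the new column \<open>z\<close>; it vanishes on
      \<open>B\<close>.\<close>
    define e where "e = (inverse (entry y c j)) *\<^sub>f (sh_out c u * (idm n - B * L))"
    have U: "idm u * e = e"
      by (simp add: e_def smult_fmat_times mult_assoc_eq[of "idm u" "sh_out c u"])
    have "(sh_out c u * (idm n - B * L)) * z = sh_out c u * z"
      using ny Ly by (simp add: z_def algebra_simps mult_assoc_eq[of L y] mult_assoc_eq[of "idm n" y])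
    also have "\<dots> = entry y c j *\<^sub>f idm u"
      by (rule fmat_eqI) (auto simp: z_def u_def)
    finally have ez: "e * z = idm u"
      using cj by (simp add: e_def smult_fmat_times smult_fmat_smult)
    have eB: "e * B = 0"
      using b by (simp add: e_def smult_fmat_times algebra_simps sized_def)
    have en: "e * idm n = e"
      using b by (simp add: e_def smult_fmat_times algebra_simps sized_def)
    have zn: "idm n * z = z" "L * z = 0" "\<And>A. A \<in> \<A> \<Longrightarrow> A * z = 0"
      using ny Ly Ay by (simp_all add: z_def mult_assoc_eq)
    have bk: "B * idm (k + u) = B" "idm (k + u) * L = L"
      using b(1,2) by (auto simp: sized_iff not_le[symmetric] intro!: fmat_eqI)
    have bs: "B * sh_in k u = 0" "sh_out k u * L = 0"
      using b(1,2) by (auto simp: sized_iff intro!: fmat_eqI)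
    \<comment> \<open>\<open>z\<close> becomes the last column of \<open>B\<close> and
      \<open>e\<close> the last row of \<open>L\<close>.\<close>
    have "good (k + u) (B + z * sh_out k u) (L + sh_in k u * e)"
      unfolding good_def
    proof (intro conjI ballI)
      show "sized n (k + u) (B + z * sh_out k u)"
        using b(1) zn bk
        by (simp add: sized_def distrib_left distrib_right mult_assoc_eq[of "idm n" z] mult.assoc)
      show "sized (k + u) n (L + sh_in k u * e)"
        using b(2) en bk
        by (simp add: sized_def distrib_left distrib_right mult.assoc mult_assoc_eq[of "idm (k + u)" "sh_in k u"])
      show "(L + sh_in k u * e) * (B + z * sh_out k u) = idm (k + u)"
        using b(3) zn(2) eB ez idm_plus[of k u]
        by (simp add: distrib_left distrib_right mult.assoc mult_assoc_eq[of L z] mult_assoc_eq[of e z])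
      show "A * (B + z * sh_out k u) = 0" if "A \<in> \<A>" for A
        using that b(4) zn(3) by (simp add: distrib_left mult_assoc_eq)
    qed
    then have "k + u \<le> k" using max by blast
    then show False by (simp add: u_def)
  qed
  then show ?thesis using that b by blast
qed

text \<open>The transpose of \<open>kernel_split\<close>, with the transposes of \<open>B\<close>
  and \<open>L\<close> in the roles of \<open>q\<close> and \<open>s\<close>.\<close>

lemma cokernel_split:
  obtains t q s where "sized t n q" "sized n t s" "q * s = idm t" "\<And>A. A \<in> \<A> \<Longrightarrow> q * A = 0"
    "\<And>x. x * idm n = x \<Longrightarrow> (\<And>A. A \<in> \<A> \<Longrightarrow> x * A = 0) \<Longrightarrow> x * s * q = x"
proof -
  obtain k B L where b: "sized n k B" "sized k n L" "L * B = idm k" "\<And>A. A \<in> mtransp ` \<A> \<Longrightarrow> A * B = 0"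
    "\<And>x. idm n * x = x \<Longrightarrow> (\<And>A. A \<in> mtransp ` \<A> \<Longrightarrow> A * x = 0) \<Longrightarrow> B * (L * x) = x"
    using kernel_split[of n "mtransp ` \<A>"] by blast
  show ?thesis
  proof (rule that)
    show "sized k n (mtransp B)" "sized n k (mtransp L)" using b(1,2) by (auto simp: sized_iff)
    show "mtransp B * mtransp L = idm k" using b(3) by (metis mtransp_mult mtransp_idm)
    show "mtransp B * A = 0" if "A \<in> \<A>" for A
      using b(4)[of "mtransp A"] that mtransp_mult[of "mtransp A" B] by simp
    show "x * mtransp L * mtransp B = x" if "x * idm n = x" "\<And>A. A \<in> \<A> \<Longrightarrow> x * A = 0" for x
    proof -
      have "idm n * mtransp x = mtransp x" using that(1) mtransp_mult[of x "idm n"] by simp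
      moreover have "A * mtransp x = 0" if "A \<in> mtransp ` \<A>" for A
        using that \<open>\<And>A. A \<in> \<A> \<Longrightarrow> x * A = 0\<close> mtransp_mult[of x "mtransp A"] by auto
      ultimately have "B * (L * mtransp x) = mtransp x" by (rule b(5))
      then have "mtransp (B * (L * mtransp x)) = x" by simp
      then show ?thesis by (simp add: mtransp_mult mult.assoc)
    qed
  qed
qed

section \<open>Representations\<close>

locale bound_quiver_algebra =
  fixes Q :: "('v, 'a) pre_digraph" and R :: "(('v, 'a) path \<Rightarrow>\<^sub>0 complex) set"
  assumes bound_quiver: "bound_quiver Q R"
begin

lemma fin_digraph: "fin_digraph Q"
  using bound_quiver by (simp add: bound_quiver_def)

sublocale fin_digraph Q
  by (rule fin_digraph)

text \<open>Representations of the quiver without the relations. Homomorphisms, isomorphisms and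
  direct sums only see this part, and the relations can then be transported by
  \<open>reps_subrep\<close>.\<close>

definition rep_shape :: "('v, 'a) rep \<Rightarrow> bool" where
  "rep_shape M \<longleftrightarrow> (\<forall>v. v \<notin> verts Q \<longrightarrow> rdim M v = 0) \<and>
     rmap M \<in> (\<Pi>\<^sub>E a\<in>arcs Q. carrier_mat (rdim M (head Q a)) (rdim M (tail Q a)))"

lemma reps_shape: "M \<in> reps Q R \<Longrightarrow> rep_shape M"
  by (simp add: reps_def rep_shape_def)

text \<open>Families of matrices indexed by vertices form a ring. In it the identity of a representation
  is an idempotent, and homomorphisms are elements fixed by the idempotents at both ends.\<close>

definition Eo :: "('v, 'a) rep \<Rightarrow> 'v \<Rightarrow> fmat" where
  "Eo M = (\<lambda>v. idm (rdim M v))"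

definition act :: "('v, 'a) rep \<Rightarrow> 'a \<Rightarrow> fmat" where
  "act M a = of_mat (rmap M a)"

definition rhom :: "('v, 'a) rep \<Rightarrow> ('v, 'a) rep \<Rightarrow> ('v \<Rightarrow> fmat) \<Rightarrow> bool" where
  "rhom M N F \<longleftrightarrow> Eo N * F = F \<and> F * Eo M = F \<and>
     (\<forall>a\<in>arcs Q. F (head Q a) * act M a = act N a * F (tail Q a))"

lemma Eo_idem [simp]: "Eo M * Eo M = Eo M" "Eo M * (Eo M * F) = Eo M * F"
  by (simp_all add: Eo_def fun_eq_iff flip: mult.assoc)

lemma act_sized:
  assumes "rep_shape M" "a \<in> arcs Q"
  shows "idm (rdim M (head Q a)) * act M a = act M a" "act M a * idm (rdim M (tail Q a)) = act M a"
  using assms sized_of_mat[of "rmap M a"] unfolding rep_shape_def act_def sized_def by blast+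

lemma rhomD:
  assumes "rhom M N F"
  shows "Eo N * F = F" "F * Eo M = F" "Eo N * (F * X) = F * X" "F * (Eo M * X) = F * X"
  using assms by (simp_all add: rhom_def flip: mult.assoc)

lemma rhomD_at:
  assumes "rhom M N F"
  shows "idm (rdim N v) * F v = F v" "F v * idm (rdim M v) = F v"
    "idm (rdim N v) * (F v * x) = F v * x" "F v * (idm (rdim M v) * x) = F v * x"
  using fun_cong[OF rhomD(1)[OF assms], of v] fun_cong[OF rhomD(2)[OF assms], of v]
  by (simp_all add: Eo_def flip: mult.assoc)

lemma rhom_arc:
  "rhom M N F \<Longrightarrow> a \<in> arcs Q \<Longrightarrow> F (head Q a) * act M a = act N a * F (tail Q a)"
  by (simp add: rhom_def)

lemma rhom_sized: "rhom M N F \<Longrightarrow> sized (rdim N v) (rdim M v) (F v)"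
  by (simp add: sized_def rhomD_at)

lemma rhom_off: "rhom M N F \<Longrightarrow> rep_shape M \<Longrightarrow> v \<notin> verts Q \<Longrightarrow> F v = 0"
  using rhomD_at(2)[of M N F v] by (simp add: rep_shape_def)

lemma rhom_id: "rep_shape M \<Longrightarrow> rhom M M (Eo M)"
  using act_sized[of M] by (simp add: rhom_def Eo_def[abs_def] fun_eq_iff)

lemma rhom_zero: "rhom M N 0"
  by (simp add: rhom_def)

lemma rhom_mult: "rhom N K G \<Longrightarrow> rhom M N F \<Longrightarrow> rhom M K (G * F)"
  unfolding rhom_def
  by (auto simp: mult.assoc) (metis (no_types) mult.assoc)+

lemma rhom_add: "rhom M N F \<Longrightarrow> rhom M N G \<Longrightarrow> rhom M N (F + G)"
  by (simp add: rhom_def algebra_simps)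

lemma rhom_diff: "rhom M N F \<Longrightarrow> rhom M N G \<Longrightarrow> rhom M N (F - G)"
  by (simp add: rhom_def algebra_simps)

text \<open>Families of matrices are \<open>undefined\<close> off the vertex set. The value 0 put
  there instead makes identities of maps into equations between functions, valid at every
  argument.\<close>

definition fam :: "('v \<Rightarrow> complex mat) \<Rightarrow> 'v \<Rightarrow> fmat" where
  "fam f v = (if v \<in> verts Q then of_mat (f v) else 0)"

definition unfam :: "('v, 'a) rep \<Rightarrow> ('v, 'a) rep \<Rightarrow> ('v \<Rightarrow> fmat) \<Rightarrow> 'v \<Rightarrow> complex mat" where
  "unfam M N F = (\<lambda>v\<in>verts Q. to_mat (rdim N v) (rdim M v) (F v))"

lemma rhom_fam:
  assumes f: "f \<in> rep_hom Q M N" and M: "rep_shape M" and N: "rep_shape N"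
  shows "rhom M N (fam f)"
proof -
  have c: "f v \<in> carrier_mat (rdim N v) (rdim M v)" if "v \<in> verts Q" for v
    using f that by (auto simp: rep_hom_def)
  have "idm (rdim N v) * fam f v = fam f v" "fam f v * idm (rdim M v) = fam f v" for v
    using sized_of_mat[OF c] by (auto simp: fam_def sized_def)
  moreover have "fam f (head Q a) * act M a = act N a * fam f (tail Q a)" if a: "a \<in> arcs Q" for a
  proof -
    have m: "rmap M a \<in> carrier_mat (rdim M (head Q a)) (rdim M (tail Q a))"
      and n: "rmap N a \<in> carrier_mat (rdim N (head Q a)) (rdim N (tail Q a))"
      using M N a by (auto simp: rep_shape_def)
    have h: "head Q a \<in> verts Q" "tail Q a \<in> verts Q" using a by auto
    have "f (head Q a) * rmap M a = rmap N a * f (tail Q a)" using f a by (simp add: rep_hom_def)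
    then have "of_mat (f (head Q a) * rmap M a) = of_mat (rmap N a * f (tail Q a))" by simp
    then show ?thesis
      using m n c[OF h(1)] c[OF h(2)] h by (simp add: of_mat_mult fam_def act_def)
  qed
  ultimately show ?thesis by (simp add: rhom_def Eo_def fun_eq_iff)
qed

lemma fam_unfam: "rhom M N F \<Longrightarrow> rep_shape M \<Longrightarrow> fam (unfam M N F) = F"
  by (auto simp: fam_def unfam_def fun_eq_iff of_mat_to_mat rhom_sized rhom_off)

lemma unfam_rep_hom:
  assumes F: "rhom M N F" and M: "rep_shape M" and N: "rep_shape N"
  shows "unfam M N F \<in> rep_hom Q M N"
proof -
  have "unfam M N F (head Q a) * rmap M a = rmap N a * unfam M N F (tail Q a)" if a: "a \<in> arcs Q" for a
  proof (rule of_mat_eqD)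
    have m: "rmap M a \<in> carrier_mat (rdim M (head Q a)) (rdim M (tail Q a))"
      and n: "rmap N a \<in> carrier_mat (rdim N (head Q a)) (rdim N (tail Q a))"
      using M N a by (auto simp: rep_shape_def)
    have h: "head Q a \<in> verts Q" "tail Q a \<in> verts Q" using a by auto
    show "of_mat (unfam M N F (head Q a) * rmap M a) = of_mat (rmap N a * unfam M N F (tail Q a))"
      using rhom_arc[OF F a] m n h
      by (simp add: of_mat_mult unfam_def of_mat_to_mat rhom_sized[OF F] act_def)
  qed (use a M N in \<open>auto simp: unfam_def rep_shape_def PiE_iff\<close>)
  then show ?thesis by (auto simp: rep_hom_def unfam_def)
qed

lemma fam_inject:
  assumes "f \<in> (\<Pi>\<^sub>E v\<in>verts Q. carrier_mat (m v) (n v))" "g \<in> (\<Pi>\<^sub>E v\<in>verts Q. carrier_mat (m v) (n v))"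
    and "fam f = fam g"
  shows "f = g"
proof (rule PiE_ext[OF assms(1,2)])
  fix v assume v: "v \<in> verts Q"
  then have "of_mat (f v) = of_mat (g v)" using fun_cong[OF assms(3), of v] by (simp add: fam_def)
  moreover have "f v \<in> carrier_mat (m v) (n v)" "g v \<in> carrier_mat (m v) (n v)"
    using assms(1,2) v by auto
  ultimately show "f v = g v" by (simp add: of_mat_inject)
qed

lemma rep_hom_dims:
  assumes "f \<in> rep_hom Q M N" "v \<in> verts Q"
  shows "dim_row (f v) = rdim N v" "dim_col (f v) = rdim M v"
  using assms by (auto simp: rep_hom_def)

subsection \<open>Relations\<close>

definition pact :: "('v, 'a) rep \<Rightarrow> 'v \<Rightarrow> 'a list \<Rightarrow> fmat" where
  "pact M u p = of_mat (path_map Q M u p)"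

lemma path_map_carrier:
  assumes "rep_shape M" "awalk u p v"
  shows "path_map Q M u p \<in> carrier_mat (rdim M v) (rdim M u)"
  using assms(2)
proof (induction p arbitrary: u)
  case Nil
  then show ?case by (simp add: awalk_Nil_iff)
next
  case (Cons a p)
  then have a: "a \<in> arcs Q" "u = tail Q a" and p: "awalk (head Q a) p v"
    by (simp_all add: awalk_Cons_iff)
  have "rmap M a \<in> carrier_mat (rdim M (head Q a)) (rdim M (tail Q a))"
    using assms(1) a by (auto simp: rep_shape_def)
  then show ?case using Cons.IH[OF p] a by simp
qed

lemma pact_Nil [simp]: "pact M u [] = idm (rdim M u)"
  by (simp add: pact_def)

lemma pact_Cons:
  assumes "rep_shape M" "awalk u (a # p) v"
  shows "pact M u (a # p) = pact M (head Q a) p * act M a"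
proof -
  have a: "a \<in> arcs Q" "u = tail Q a" and p: "awalk (head Q a) p v"
    using assms(2) by (simp_all add: awalk_Cons_iff)
  have "rmap M a \<in> carrier_mat (rdim M (head Q a)) (rdim M (tail Q a))"
    using assms(1) a by (auto simp: rep_shape_def)
  then show ?thesis
    using path_map_carrier[OF assms(1) p] by (simp add: pact_def act_def of_mat_mult)
qed

lemma pact_sized: "rep_shape M \<Longrightarrow> awalk u p v \<Longrightarrow> sized (rdim M v) (rdim M u) (pact M u p)"
  unfolding pact_def by (intro sized_of_mat path_map_carrier)

lemma pact_append:
  assumes "rep_shape M" "awalk u p v" "awalk v q w"
  shows "pact M u (p @ q) = pact M v q * pact M u p"
  using assms(2)
proof (induction p arbitrary: u)
  case Nil
  then show ?case
    using pact_sized[OF assms(1,3)] by (simp add: awalk_Nil_iff sized_def)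
next
  case (Cons a p)
  then have a: "a \<in> arcs Q" "u = tail Q a" and p: "awalk (head Q a) p v"
    by (simp_all add: awalk_Cons_iff)
  have "awalk u (a # p @ q) w" using awalk_appendI[OF Cons.prems assms(3)] by (metis append_Cons)
  then show ?case
    using Cons.IH[OF p] pact_Cons[OF assms(1) Cons.prems] pact_Cons[OF assms(1), of u a "p @ q"]
    by (simp add: mult.assoc)
qed

lemma rhom_path:
  assumes F: "rhom M N F" and M: "rep_shape M" and N: "rep_shape N" and p: "awalk u p v"
  shows "F v * pact M u p = pact N u p * F u"
  using p
proof (induction p arbitrary: u)
  case Nil
  then show ?case by (simp add: awalk_Nil_iff rhomD_at[OF F])
next
  case (Cons a p)
  then have a: "a \<in> arcs Q" "u = tail Q a" and p: "awalk (head Q a) p v"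
    by (simp_all add: awalk_Cons_iff)
  have "F v * pact M u (a # p) = pact N (head Q a) p * (F (head Q a) * act M a)"
    by (simp add: pact_Cons[OF M Cons.prems] mult_assoc_eq[OF Cons.IH[OF p]] mult.assoc)
  also have "\<dots> = pact N u (a # p) * F u"
    by (simp only: pact_Cons[OF N Cons.prems[unfolded a(2)]] rhom_arc[OF F a(1)] a(2) mult.assoc)
  finally show ?case .
qed

definition rel_eval ::
  "('v, 'a) rep \<Rightarrow> (('v, 'a) path \<Rightarrow>\<^sub>0 complex) \<Rightarrow> 'v \<Rightarrow> 'v \<Rightarrow> fmat" where
  "rel_eval M \<rho> u v = (\<Sum>p | p \<in> Poly_Mapping.keys \<rho> \<and> fst p = u \<and> awlast u (snd p) = v.
     Poly_Mapping.lookup \<rho> p *\<^sub>f pact M u (snd p))"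

lemma path_awalk: "p \<in> paths Q \<Longrightarrow> fst p = u \<Longrightarrow> awlast u (snd p) = v \<Longrightarrow> awalk u (snd p) v"
  by (auto simp: paths_def awalk_def)

lemma satisfies_relation_iff:
  assumes M: "rep_shape M" and \<rho>: "Poly_Mapping.keys \<rho> \<subseteq> paths Q"
  shows "satisfies_relation Q M \<rho> \<longleftrightarrow> (\<forall>u\<in>verts Q. \<forall>v\<in>verts Q. rel_eval M \<rho> u v = 0)"
proof -
  have "(\<forall>r < rdim M v. \<forall>c < rdim M u.
     (\<Sum>p | p \<in> Poly_Mapping.keys \<rho> \<and> fst p = u \<and> awlast u (snd p) = v.
        Poly_Mapping.lookup \<rho> p * path_map Q M u (snd p) $$ (r, c)) = 0) \<longleftrightarrow> rel_eval M \<rho> u v = 0" for u v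
  proof -
    have c: "path_map Q M u (snd p) \<in> carrier_mat (rdim M v) (rdim M u)"
      if "p \<in> Poly_Mapping.keys \<rho> \<and> fst p = u \<and> awlast u (snd p) = v" for p
      by (intro path_map_carrier[OF M] path_awalk) (use that \<rho> in auto)
    have e: "entry (rel_eval M \<rho> u v) r c =
       (if r < rdim M v \<and> c < rdim M u then (\<Sum>p | p \<in> Poly_Mapping.keys \<rho> \<and> fst p = u \<and> awlast u (snd p) = v.
        Poly_Mapping.lookup \<rho> p * path_map Q M u (snd p) $$ (r, c)) else 0)" for r c
    proof -
      have "entry (Poly_Mapping.lookup \<rho> p *\<^sub>f pact M u (snd p)) r c =
          (if r < rdim M v \<and> c < rdim M u then Poly_Mapping.lookup \<rho> p * path_map Q M u (snd p) $$ (r, c) else 0)"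
        if "p \<in> {p \<in> Poly_Mapping.keys \<rho>. fst p = u \<and> awlast u (snd p) = v}" for p
        using c[of p] that by (auto simp: pact_def)
      then have "entry (rel_eval M \<rho> u v) r c =
          (\<Sum>p | p \<in> Poly_Mapping.keys \<rho> \<and> fst p = u \<and> awlast u (snd p) = v.
            if r < rdim M v \<and> c < rdim M u then Poly_Mapping.lookup \<rho> p * path_map Q M u (snd p) $$ (r, c) else 0)"
        unfolding rel_eval_def entry_sum by (rule sum.cong[OF refl])
      then show ?thesis by (cases "r < rdim M v"; cases "c < rdim M u") simp_all
    qed
    show ?thesis
    proof
      assume "rel_eval M \<rho> u v = 0"
      then show "\<forall>r < rdim M v. \<forall>c < rdim M u. (\<Sum>p | p \<in> Poly_Mapping.keys \<rho> \<and> fst p = u \<and> awlast u (snd p) = v.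
        Poly_Mapping.lookup \<rho> p * path_map Q M u (snd p) $$ (r, c)) = 0"
        using e by (metis (no_types, lifting) entry_zero)
    qed (auto intro!: fmat_eqI simp: e)
  qed
  then show ?thesis by (simp add: satisfies_relation_def)
qed

lemma relation_paths: "\<rho> \<in> R \<Longrightarrow> Poly_Mapping.keys \<rho> \<subseteq> paths Q"
  using bound_quiver unfolding bound_quiver_def paths_def by fastforce

lemma reps_iff:
  "M \<in> reps Q R \<longleftrightarrow> rep_shape M \<and> (\<forall>\<rho>\<in>R. \<forall>u\<in>verts Q. \<forall>v\<in>verts Q. rel_eval M \<rho> u v = 0)"
  using satisfies_relation_iff relation_paths
  by (auto simp: reps_def rep_shape_def)

text \<open>The pair \<open>p1\<close>, \<open>p2\<close> embeds \<open>S\<close> into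
  \<open>M\<close> and \<open>N\<close>, and relations holding there are inherited. The retraction
  \<alpha>1, \<alpha>2 is only linear at each vertex: evaluation of paths commutes with the
  homomorphisms \<open>p1\<close>, \<open>p2\<close>, and the retraction is applied last. Sums,
  kernels and conjugates all get their relations this way.\<close>

lemma reps_subrep:
  assumes M: "M \<in> reps Q R" and N: "N \<in> reps Q R" and S: "rep_shape S"
    and p1: "rhom S M p1" and p2: "rhom S N p2"
    and split: "\<And>v. v \<in> verts Q \<Longrightarrow> \<alpha>1 v * p1 v + \<alpha>2 v * p2 v = idm (rdim S v)"
  shows "S \<in> reps Q R"
proof -
  have "rel_eval S \<rho> u v = 0" if \<rho>: "\<rho> \<in> R" and u: "u \<in> verts Q" and v: "v \<in> verts Q" for \<rho> u v
  proof -
    have "pact S u (snd p) = \<alpha>1 v * pact M u (snd p) * p1 u + \<alpha>2 v * pact N u (snd p) * p2 u"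
      if "p \<in> Poly_Mapping.keys \<rho> \<and> fst p = u \<and> awlast u (snd p) = v" for p
    proof -
      have w: "awalk u (snd p) v" by (intro path_awalk) (use that relation_paths[OF \<rho>] in auto)
      have "pact S u (snd p) = (\<alpha>1 v * p1 v + \<alpha>2 v * p2 v) * pact S u (snd p)"
        using pact_sized[OF S w] split[OF v] by (simp add: sized_def)
      then show ?thesis
        using rhom_path[OF p1 S reps_shape[OF M] w] rhom_path[OF p2 S reps_shape[OF N] w]
        by (simp add: distrib_right mult.assoc)
    qed
    then have "rel_eval S \<rho> u v = \<alpha>1 v * rel_eval M \<rho> u v * p1 u + \<alpha>2 v * rel_eval N \<rho> u v * p2 u"
      unfolding rel_eval_def sum_distrib_left sum_distrib_right sum.distrib[symmetric]
      by (intro sum.cong) (auto simp: smult_fmat_times smult_fmat_plus)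
    then show ?thesis using M N \<rho> u v by (simp add: reps_iff)
  qed
  then show ?thesis using S by (simp add: reps_iff)
qed

lemma zero_rep_reps: "zero_rep Q \<in> reps Q R"
proof -
  have "rep_shape (zero_rep Q)" by (auto simp: rep_shape_def zero_rep_def)
  moreover have "rel_eval (zero_rep Q) \<rho> u v = 0" if "\<rho> \<in> R" for \<rho> u v
    unfolding rel_eval_def
  proof (rule sum.neutral, safe)
    fix w p assume "(w, p) \<in> Poly_Mapping.keys \<rho>" "u = fst (w, p)" "v = awlast (fst (w, p)) (snd (w, p))"
    then have "awalk u p v" using path_awalk[of "(w, p)" u v] relation_paths[OF that] by auto
    from pact_sized[OF \<open>rep_shape (zero_rep Q)\<close> this]
    have "pact (zero_rep Q) u p = 0" by (simp add: zero_rep_def sized_def)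
    then show "Poly_Mapping.lookup \<rho> (w, p) *\<^sub>f pact (zero_rep Q) (fst (w, p)) (snd (w, p)) = 0"
      using \<open>u = fst (w, p)\<close> by simp
  qed
  ultimately show ?thesis by (simp add: reps_iff)
qed

lemma Eo_zero_rep [simp]: "Eo (zero_rep Q) = 0"
  by (simp add: Eo_def zero_rep_def fun_eq_iff)

subsection \<open>Direct sums\<close>

text \<open>Only the second summand needs maps of its own: the first occupies the initial
  coordinates, so \<open>Eo M\<close> is at once its inclusion and its projection.\<close>

definition s_in :: "('v, 'a) rep \<Rightarrow> ('v, 'a) rep \<Rightarrow> 'v \<Rightarrow> fmat" where
  "s_in M N = (\<lambda>v. sh_in (rdim M v) (rdim N v))"

definition s_out :: "('v, 'a) rep \<Rightarrow> ('v, 'a) rep \<Rightarrow> 'v \<Rightarrow> fmat" where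
  "s_out M N = (\<lambda>v. sh_out (rdim M v) (rdim N v))"

lemma rdim_rep_sum [simp]: "rdim (rep_sum Q M N) v = rdim M v + rdim N v"
  by (simp add: rep_sum_def)

lemma rep_shape_sum: "rep_shape M \<Longrightarrow> rep_shape N \<Longrightarrow> rep_shape (rep_sum Q M N)"
  by (auto simp: rep_shape_def rep_sum_def PiE_iff) (metis carrier_matD(1) carrier_matD(2) carrier_matI dim_block_diag)

lemma act_rep_sum:
  assumes "rep_shape M" "rep_shape N" "a \<in> arcs Q"
  shows "act (rep_sum Q M N) a = act M a + s_in M N (head Q a) * act N a * s_out M N (tail Q a)"
proof -
  have "rmap M a \<in> carrier_mat (rdim M (head Q a)) (rdim M (tail Q a))"
    "rmap N a \<in> carrier_mat (rdim N (head Q a)) (rdim N (tail Q a))"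
    using assms by (auto simp: rep_shape_def)
  then show ?thesis
    using assms(3) by (simp add: act_def rep_sum_def of_mat_block_diag s_in_def s_out_def)
qed

lemma s_simps:
  "Eo M * s_in M N = 0" "s_out M N * Eo M = 0" "s_out M N * s_in M N = Eo N"
  "Eo (rep_sum Q M N) * s_in M N = s_in M N" "s_in M N * Eo N = s_in M N"
  "s_out M N * Eo (rep_sum Q M N) = s_out M N" "Eo N * s_out M N = s_out M N"
  "Eo (rep_sum Q M N) * Eo M = Eo M" "Eo M * Eo (rep_sum Q M N) = Eo M"
  by (simp_all add: Eo_def s_in_def s_out_def fun_eq_iff)

lemmas s_simps' = s_simps s_simps[THEN mult_assoc_eq]

lemma Eo_rep_sum: "Eo (rep_sum Q M N) = Eo M + s_in M N * s_out M N"
  by (simp add: Eo_def s_in_def s_out_def fun_eq_iff idm_plus)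

lemma rhom_sum_maps:
  assumes M: "rep_shape M" and N: "rep_shape N"
  shows "rhom M (rep_sum Q M N) (Eo M)" "rhom (rep_sum Q M N) M (Eo M)"
    "rhom N (rep_sum Q M N) (s_in M N)" "rhom (rep_sum Q M N) N (s_out M N)"
proof -
  have at: "Eo M v * s_in M N v = 0" "s_out M N v * Eo M v = 0" "s_out M N v * s_in M N v = Eo N v" for v
    using fun_cong[OF s_simps(1)] fun_cong[OF s_simps(2)] fun_cong[OF s_simps(3)] by auto
  note aat = at[THEN mult_assoc_eq]
  have "Eo M (head Q a) * act M a = act (rep_sum Q M N) a * Eo M (tail Q a)"
    "Eo M (head Q a) * act (rep_sum Q M N) a = act M a * Eo M (tail Q a)"
    "s_in M N (head Q a) * act N a = act (rep_sum Q M N) a * s_in M N (tail Q a)"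
    "s_out M N (head Q a) * act (rep_sum Q M N) a = act N a * s_out M N (tail Q a)" if a: "a \<in> arcs Q" for a
  proof -
    have s: "Eo M (head Q a) * act M a = act M a" "act M a * Eo M (tail Q a) = act M a"
      "Eo N (head Q a) * act N a = act N a" "act N a * Eo N (tail Q a) = act N a"
      using act_sized[OF M a] act_sized[OF N a] by (simp_all add: Eo_def)
    have z: "act M a * s_in M N (tail Q a) = 0" "s_out M N (head Q a) * act M a = 0"
      using s(1,2) at by (metis mult.assoc mult_zero_right, metis mult.assoc mult_zero_left)
    have s': "s_in M N (tail Q a) = s_in M N (tail Q a) * Eo N (tail Q a)"
      by (simp add: s_in_def Eo_def)
    show "Eo M (head Q a) * act M a = act (rep_sum Q M N) a * Eo M (tail Q a)"
      "Eo M (head Q a) * act (rep_sum Q M N) a = act M a * Eo M (tail Q a)"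
      "s_in M N (head Q a) * act N a = act (rep_sum Q M N) a * s_in M N (tail Q a)"
      "s_out M N (head Q a) * act (rep_sum Q M N) a = act N a * s_out M N (tail Q a)"
      by (simp_all add: act_rep_sum[OF M N a] distrib_left distrib_right mult.assoc at aat s z mult_assoc_eq[OF s(3)])
  qed
  then show "rhom M (rep_sum Q M N) (Eo M)" "rhom (rep_sum Q M N) M (Eo M)"
    "rhom N (rep_sum Q M N) (s_in M N)" "rhom (rep_sum Q M N) N (s_out M N)"
    by (auto simp: rhom_def s_simps)
qed

lemma rep_sum_reps:
  assumes M: "M \<in> reps Q R" and N: "N \<in> reps Q R"
  shows "rep_sum Q M N \<in> reps Q R"
  using M N rep_shape_sum[OF reps_shape[OF M] reps_shape[OF N]]
    rhom_sum_maps(2,4)[OF reps_shape[OF M] reps_shape[OF N]]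
proof (rule reps_subrep)
  show "Eo M v * Eo M v + s_in M N v * s_out M N v = idm (rdim (rep_sum Q M N) v)" for v
    using fun_cong[OF Eo_rep_sum[of M N], of v] by (simp add: Eo_def)
qed

subsection \<open>Kernels\<close>

text \<open>The kernel is split off at each vertex separately, and the arrows are restricted by
  \<open>L * act Y a * B\<close>. While \<open>B\<close> is a homomorphism, the retraction
  \<open>L\<close> is merely linear; but \<open>L * F\<close> is a homomorphism as soon as
  \<open>F\<close> lands in the kernel, which is the universal property.\<close>

lemma kernel_rep:
  assumes Y: "Y \<in> reps Q R" and D: "rhom Y Z D"
  obtains K B L where "K \<in> reps Q R" "rhom K Y B" "L * B = Eo K" "D * B = 0"
    "\<And>v x. idm (rdim Y v) * x = x \<Longrightarrow> D v * x = 0 \<Longrightarrow> B v * (L v * x) = x"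
    "\<And>F. Eo Y * F = F \<Longrightarrow> D * F = 0 \<Longrightarrow> B * (L * F) = F"
    "\<And>M F. rhom M Y F \<Longrightarrow> D * F = 0 \<Longrightarrow> rhom M K (L * F)"
proof -
  have "\<exists>k B L. sized (rdim Y v) k B \<and> sized k (rdim Y v) L \<and> L * B = idm k \<and> D v * B = 0 \<and>
     (\<forall>x. idm (rdim Y v) * x = x \<longrightarrow> D v * x = 0 \<longrightarrow> B * (L * x) = x)" for v
    using kernel_split[of "rdim Y v" "{D v}"] by (metis singletonI singletonD)
  then obtain k B L where kBL: "\<And>v. sized (rdim Y v) (k v) (B v)" "\<And>v. sized (k v) (rdim Y v) (L v)"
    "\<And>v. L v * B v = idm (k v)" "\<And>v. D v * B v = 0"
    "\<And>v x. idm (rdim Y v) * x = x \<Longrightarrow> D v * x = 0 \<Longrightarrow> B v * (L v * x) = x"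
    by metis
  note Ysh = reps_shape[OF Y]
  have k0: "k v = 0" if "v \<notin> verts Q" for v
    using left_inverse_bound[OF kBL(1-3)[of v]] Ysh that by (simp add: rep_shape_def)
  define A where "A a = L (head Q a) * act Y a * B (tail Q a)" for a
  define K where "K = \<lparr>rdim = k, rmap = (\<lambda>a\<in>arcs Q. to_mat (k (head Q a)) (k (tail Q a)) (A a))\<rparr>"
  have Ksh: "rep_shape K" using k0 by (auto simp: rep_shape_def K_def)
  have actK: "act K a = A a" if "a \<in> arcs Q" for a
  proof -
    have "sized (k (head Q a)) (k (tail Q a)) (A a)"
      unfolding A_def using kBL(1,2) act_sized[OF Ysh that] by (intro sized_mult) (auto simp: sized_def)
    then show ?thesis using that by (simp add: act_def K_def of_mat_to_mat)
  qed
  \<comment> \<open>Since \<open>D\<close> is a homomorphism, arrows preserve its kernel; hence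
    \<open>B * L\<close> fixes the image of each arrow on the kernel, and \<open>B\<close> commutes
    with the arrows.\<close>
  have DY: "D (head Q a) * act Y a * B (tail Q a) = 0" if "a \<in> arcs Q" for a
    using rhom_arc[OF D that] kBL(4) by (simp add: mult.assoc)
  have arc: "B (head Q a) * act K a = act Y a * B (tail Q a)" if "a \<in> arcs Q" for a
  proof -
    have "B (head Q a) * act K a = B (head Q a) * (L (head Q a) * (act Y a * B (tail Q a)))"
      using that by (simp add: actK A_def mult.assoc)
    also have "\<dots> = act Y a * B (tail Q a)"
      using act_sized[OF Ysh that] DY[OF that]
      by (intro kBL(5)) (simp_all add: mult_assoc_eq[OF act_sized(1)[OF Ysh that]] mult.assoc)
    finally show ?thesis .
  qed
  have BK: "rhom K Y B"
    using kBL(1) arc by (auto simp: rhom_def Eo_def fun_eq_iff sized_def K_def)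
  have LB: "L * B = Eo K" using kBL(3) by (simp add: fun_eq_iff Eo_def K_def)
  \<comment> \<open>The relations are inherited from \<open>Y\<close> alone, so the second embedding
    is a dummy with retraction 0.\<close>
  have K: "K \<in> reps Q R"
    by (rule reps_subrep[OF Y Y Ksh BK BK, of L 0])
      (use fun_cong[OF LB] in \<open>simp add: Eo_def\<close>)
  have L': "Eo K * L = L" using kBL(2) by (simp add: fun_eq_iff Eo_def K_def sized_def)
  have fix_F: "B * (L * F) = F" if "Eo Y * F = F" "D * F = 0" for F
    using that kBL(5) by (simp add: fun_eq_iff Eo_def)
  have LF: "rhom M K (L * F)" if F: "rhom M Y F" and DF: "D * F = 0" for M F
  proof -
    have "L (head Q a) * F (head Q a) * act M a = act K a * (L (tail Q a) * F (tail Q a))" if a: "a \<in> arcs Q" for a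
    proof -
      have "F (tail Q a) = B (tail Q a) * (L (tail Q a) * F (tail Q a))"
        using fun_cong[OF fix_F[OF rhomD(1)[OF F] DF], of "tail Q a"] by simp
      then have "L (head Q a) * F (head Q a) * act M a
          = L (head Q a) * (act Y a * (B (tail Q a) * (L (tail Q a) * F (tail Q a))))"
        using rhom_arc[OF F a] by (simp add: mult.assoc)
      also have "\<dots> = L (head Q a) * (B (head Q a) * (act K a * (L (tail Q a) * F (tail Q a))))"
        using mult_assoc_eq[OF arc[OF a, symmetric]] by (simp add: mult.assoc)
      also have "\<dots> = act K a * (L (tail Q a) * F (tail Q a))"
        using mult_assoc_eq[OF act_sized(1)[OF Ksh a]]
        by (simp add: mult_assoc_eq[OF kBL(3)] K_def)
      finally show ?thesis .
    qed
    then show ?thesis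
      using L' rhomD[OF F] by (auto simp: rhom_def mult.assoc) (metis mult.assoc)
  qed
  show ?thesis
    by (rule that[OF K BK LB _ kBL(5) fix_F LF]) (use kBL(4) in \<open>auto simp: fun_eq_iff\<close>)
qed

section \<open>Projective representations\<close>

definition surj_fam :: "('v, 'a) rep \<Rightarrow> ('v, 'a) rep \<Rightarrow> ('v \<Rightarrow> fmat) \<Rightarrow> bool" where
  "surj_fam X Y p \<longleftrightarrow> (\<forall>v\<in>verts Q. \<forall>y. sized (rdim Y v) 1 y \<longrightarrow> (\<exists>x. sized (rdim X v) 1 x \<and> p v * x = y))"

text \<open>Only the lifting property, in the language of ring elements and columns; whether
  \<open>M\<close> satisfies the relations is recorded separately.\<close>

definition prj :: "('v, 'a) rep \<Rightarrow> bool" where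
  "prj M \<longleftrightarrow> (\<forall>X\<in>reps Q R. \<forall>Y\<in>reps Q R. \<forall>p F. rhom X Y p \<longrightarrow> rhom M Y F \<longrightarrow> surj_fam X Y p \<longrightarrow>
     (\<exists>G. rhom M X G \<and> p * G = F))"

lemma prjD:
  assumes "prj M" "X \<in> reps Q R" "Y \<in> reps Q R" "rhom X Y p" "rhom M Y F" "surj_fam X Y p"
  obtains G where "rhom M X G" "p * G = F"
  using assms unfolding prj_def by blast

lemma fam_mult:
  assumes "\<And>v. v \<in> verts Q \<Longrightarrow> h v = f v * g v" "\<And>v. v \<in> verts Q \<Longrightarrow> dim_col (f v) = dim_row (g v)"
  shows "fam h = fam f * fam g"
  using assms by (auto simp: fam_def fun_eq_iff of_mat_mult)

lemma projective_prj:
  assumes P: "projective_rep Q R M"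
  shows "prj M"
  unfolding prj_def
proof (intro ballI allI impI)
  fix X Y p F
  assume X: "X \<in> reps Q R" and Y: "Y \<in> reps Q R" and p: "rhom X Y p" and F: "rhom M Y F" and s: "surj_fam X Y p"
  have M: "M \<in> reps Q R" using P by (simp add: projective_rep_def)
  note sh = reps_shape[OF M] reps_shape[OF X] reps_shape[OF Y]
  let ?p = "unfam X Y p" and ?F = "unfam M Y F"
  have p': "?p \<in> rep_hom Q X Y" and F': "?F \<in> rep_hom Q M Y"
    using p F sh by (auto intro: unfam_rep_hom)
  have "(\<lambda>x. ?p v *\<^sub>v x) ` carrier_vec (rdim X v) = carrier_vec (rdim Y v)" if v: "v \<in> verts Q" for v
  proof (intro equalityI subsetI)
    fix y :: "complex vec" assume "y \<in> (\<lambda>x. ?p v *\<^sub>v x) ` carrier_vec (rdim X v)"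
    then obtain x :: "complex vec" where "y = ?p v *\<^sub>v x" by blast
    then show "y \<in> carrier_vec (rdim Y v)" using rep_hom_dims(1)[OF p' v] by (simp add: carrier_vecI)
  next
    fix y :: "complex vec" assume y: "y \<in> carrier_vec (rdim Y v)"
    obtain z where z: "sized (rdim X v) 1 z" "p v * z = of_vec y"
      using s v sized_of_vec[OF y] unfolding surj_fam_def by blast
    obtain x where x: "x \<in> carrier_vec (rdim X v)" "of_vec x = z" using of_vec_surj[OF z(1)] .
    have "of_vec (?p v *\<^sub>v x) = of_vec y"
      using x z v by (simp add: unfam_def of_vec_mult of_mat_to_mat rhom_sized[OF p])
    then have "y = ?p v *\<^sub>v x" using y v by (intro of_vec_eqD) (auto simp: unfam_def)
    then show "y \<in> (\<lambda>x. ?p v *\<^sub>v x) ` carrier_vec (rdim X v)" using x by blast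
  qed
  then obtain g where g: "g \<in> rep_hom Q M X" "\<And>v. v \<in> verts Q \<Longrightarrow> ?p v * g v = ?F v"
    using P X Y p' F' unfolding projective_rep_def by metis
  have "fam ?F = fam ?p * fam g"
    using g rep_hom_dims[OF p'] rep_hom_dims[OF g(1)] by (intro fam_mult) auto
  then show "\<exists>G. rhom M X G \<and> p * G = F"
    using rhom_fam[OF g(1) sh(1,2)] fam_unfam[OF F sh(1)] fam_unfam[OF p sh(2)] by auto
qed

text \<open>A lift of \<open>F * p\<close> composed with \<open>i\<close> lifts \<open>F\<close>.
  Closure under isomorphism and projectivity of the cocycles of a contractible complex are both
  instances.\<close>

lemma prj_retract:
  assumes M: "prj M" and i: "rhom K M i" and p: "rhom M K p" and pi: "p * i = Eo K"
  shows "prj K"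
  unfolding prj_def
proof (intro ballI allI impI)
  fix X Y q F
  assume *: "X \<in> reps Q R" "Y \<in> reps Q R" "rhom X Y q" and F: "rhom K Y F" and s: "surj_fam X Y q"
  obtain G where G: "rhom M X G" "q * G = F * p"
    using prjD[OF M * rhom_mult[OF F p] s] by blast
  have "q * (G * i) = F * (p * i)" using G(2) by (simp flip: mult.assoc)
  then show "\<exists>G. rhom K X G \<and> q * G = F"
    using rhom_mult[OF G(1) i] pi rhomD(2)[OF F] by auto
qed

lemma prj_sum:
  assumes M: "prj M" and N: "prj N" and sh: "rep_shape M" "rep_shape N"
  shows "prj (rep_sum Q M N)"
  unfolding prj_def
proof (intro ballI allI impI)
  fix X Y q F
  assume *: "X \<in> reps Q R" "Y \<in> reps Q R" "rhom X Y q" and F: "rhom (rep_sum Q M N) Y F" and s: "surj_fam X Y q"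
  note maps = rhom_sum_maps[OF sh]
  obtain G where G: "rhom M X G" "q * G = F * Eo M"
    using prjD[OF M * rhom_mult[OF F maps(1)] s] by blast
  obtain H where H: "rhom N X H" "q * H = F * s_in M N"
    using prjD[OF N * rhom_mult[OF F maps(3)] s] by blast
  have "rhom (rep_sum Q M N) X (G * Eo M + H * s_out M N)"
    using G(1) H(1) maps by (intro rhom_add rhom_mult)
  moreover have "q * (G * Eo M + H * s_out M N) = F * (Eo M + s_in M N * s_out M N)"
    using G(2) H(2) rhomD(2)[OF G(1)] by (simp add: distrib_left mult_assoc_eq[OF H(2)] mult.assoc)
  ultimately show "\<exists>G. rhom (rep_sum Q M N) X G \<and> q * G = F"
    using rhomD(2)[OF F] by (auto simp: Eo_rep_sum)
qed

lemma rhom_from_zero: "Eo M = 0 \<Longrightarrow> rhom M N F \<Longrightarrow> F = 0"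
  using rhomD(2)[of M N F] by simp

lemma prj_zero: "Eo M = 0 \<Longrightarrow> prj M"
  unfolding prj_def
proof (intro ballI allI impI)
  fix X Y q F assume "Eo M = 0" "rhom M Y F"
  then have "F = 0" by (rule rhom_from_zero)
  then show "\<exists>G. rhom M X G \<and> q * G = F" using rhom_zero by (metis mult_zero_right)
qed

text \<open>Exactness at \<open>Y\<close> says that \<open>d1\<close> is surjective onto the kernel
  of \<open>d2\<close>, and \<open>F\<close> takes values in this kernel; the lift exists by
  projectivity after both have been corestricted to it.\<close>

lemma lift_exact:
  assumes M: "prj M" and X: "X \<in> reps Q R" and Y: "Y \<in> reps Q R"
    and d1: "rhom X Y d1" and d2: "rhom Y Z d2" and dd: "d2 * d1 = 0"
    and exact: "\<And>v y. v \<in> verts Q \<Longrightarrow> sized (rdim Y v) 1 y \<Longrightarrow> d2 v * y = 0 \<Longrightarrow>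
      \<exists>x. sized (rdim X v) 1 x \<and> d1 v * x = y"
    and F: "rhom M Y F" and dF: "d2 * F = 0"
  obtains G where "rhom M X G" "d1 * G = F"
proof -
  obtain K B L where K: "K \<in> reps Q R" "rhom K Y B" "L * B = Eo K" "d2 * B = 0"
    and fix_F: "\<And>F. Eo Y * F = F \<Longrightarrow> d2 * F = 0 \<Longrightarrow> B * (L * F) = F"
    and LF: "\<And>M F. rhom M Y F \<Longrightarrow> d2 * F = 0 \<Longrightarrow> rhom M K (L * F)"
    using kernel_rep[OF Y d2] by metis
  have "surj_fam X K (L * d1)"
    unfolding surj_fam_def
  proof (intro ballI allI impI)
    fix v y assume v: "v \<in> verts Q" and y: "sized (rdim K v) 1 y"
    have "sized (rdim Y v) 1 (B v * y)" using rhom_sized[OF K(2)] y by (rule sized_mult)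
    moreover have "d2 v * (B v * y) = 0" using mult_assoc_eq[OF fun_cong[OF K(4), unfolded times_fun_apply]] by simp
    ultimately obtain x where x: "sized (rdim X v) 1 x" "d1 v * x = B v * y" using exact v by blast
    have "(L * d1) v * x = L v * B v * y" using x(2) by (simp add: mult.assoc)
    also have "\<dots> = y" using fun_cong[OF K(3), of v] y by (simp add: Eo_def sized_def)
    finally show "\<exists>x. sized (rdim X v) 1 x \<and> (L * d1) v * x = y" using x(1) by blast
  qed
  then obtain G where G: "rhom M X G" "L * d1 * G = L * F"
    using prjD[OF M X K(1) LF[OF d1 dd] LF[OF F dF]] by blast
  \<comment> \<open>\<open>B\<close> undoes the corestriction on maps with values in the
    kernel.\<close>
  have "B * (L * d1) = d1" "B * (L * F) = F" using fix_F d1 d2 F dd dF rhomD(1) by auto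
  then have "d1 * G = F" using G(2) by (metis mult.assoc)
  with G(1) show ?thesis by (rule that)
qed

subsection \<open>Isomorphisms\<close>

definition riso :: "('v, 'a) rep \<Rightarrow> ('v, 'a) rep \<Rightarrow> bool" where
  "riso M N \<longleftrightarrow> (\<exists>F G. rhom M N F \<and> rhom N M G \<and> G * F = Eo M \<and> F * G = Eo N)"

lemma rep_iso_iff:
  assumes M: "rep_shape M" and N: "rep_shape N"
  shows "rep_iso Q M N \<longleftrightarrow> riso M N"
proof
  assume "rep_iso Q M N"
  then obtain f g where fg: "f \<in> rep_hom Q M N" "g \<in> rep_hom Q N M"
    "\<And>v. v \<in> verts Q \<Longrightarrow> g v * f v = 1\<^sub>m (rdim M v)" "\<And>v. v \<in> verts Q \<Longrightarrow> f v * g v = 1\<^sub>m (rdim N v)"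
    unfolding rep_iso_def by blast
  have "fam (\<lambda>v. 1\<^sub>m (rdim M v)) = fam g * fam f" "fam (\<lambda>v. 1\<^sub>m (rdim N v)) = fam f * fam g"
    using fg rep_hom_dims[OF fg(1)] rep_hom_dims[OF fg(2)] by (auto intro!: fam_mult)
  moreover have "fam (\<lambda>v. 1\<^sub>m (rdim M v)) = Eo M" "fam (\<lambda>v. 1\<^sub>m (rdim N v)) = Eo N"
    using M N by (auto simp: fam_def Eo_def fun_eq_iff rep_shape_def)
  ultimately show "riso M N" unfolding riso_def using rhom_fam[OF fg(1) M N] rhom_fam[OF fg(2) N M] by metis
next
  assume "riso M N"
  then obtain F G where FG: "rhom M N F" "rhom N M G" "G * F = Eo M" "F * G = Eo N"
    unfolding riso_def by blast
  show "rep_iso Q M N" unfolding rep_iso_def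
  proof (intro bexI ballI conjI)
    show "unfam M N F \<in> rep_hom Q M N" "unfam N M G \<in> rep_hom Q N M"
      using FG M N by (auto intro: unfam_rep_hom)
    fix v assume "v \<in> verts Q"
    then show "unfam N M G v * unfam M N F v = 1\<^sub>m (rdim M v)" "unfam M N F v * unfam N M G v = 1\<^sub>m (rdim N v)"
      using fun_cong[OF FG(3), of v] fun_cong[OF FG(4), of v]
      by (auto intro!: of_mat_eqD simp: of_mat_mult unfam_def of_mat_to_mat rhom_sized[OF FG(1)] rhom_sized[OF FG(2)] Eo_def)
  qed
qed

lemma riso_refl: "rep_shape M \<Longrightarrow> riso M M"
  unfolding riso_def using rhom_id Eo_idem by blast

lemma riso_sym: "riso M N \<Longrightarrow> riso N M"
  unfolding riso_def by blast

lemma riso_trans: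
  assumes "riso M N" "riso N K" shows "riso M K"
proof -
  obtain F G F' G' where 1: "rhom M N F" "rhom N M G" "G * F = Eo M" "F * G = Eo N"
    "rhom N K F'" "rhom K N G'" "G' * F' = Eo N" "F' * G' = Eo K"
    using assms unfolding riso_def by blast
  have "(G * G') * (F' * F) = Eo M" "(F' * F) * (G * G') = Eo K"
    using rhomD[OF 1(1)] rhomD[OF 1(2)] rhomD[OF 1(5)] rhomD[OF 1(6)] 1(3,8)
    by (simp_all add: mult.assoc mult_assoc_eq[OF 1(7)] mult_assoc_eq[OF 1(4)])
  then show ?thesis
    unfolding riso_def using rhom_mult[OF 1(5,1)] rhom_mult[OF 1(2,6)] by blast
qed

lemma riso_rdim: assumes "riso M N" shows "rdim M = rdim N"
proof
  fix v
  obtain F G where FG: "rhom M N F" "rhom N M G" "G * F = Eo M" "F * G = Eo N"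
    using assms unfolding riso_def by blast
  have "G v * F v = idm (rdim M v)" "F v * G v = idm (rdim N v)"
    using fun_cong[OF FG(3), of v] fun_cong[OF FG(4), of v] by (simp_all add: Eo_def)
  then show "rdim M v = rdim N v"
    using left_inverse_bound rhom_sized[OF FG(1)] rhom_sized[OF FG(2)] by (metis le_antisym)
qed

lemma riso_prj: "riso M N \<Longrightarrow> prj M \<Longrightarrow> prj N"
  unfolding riso_def using prj_retract by blast

text \<open>The injections of one biproduct are glued to the projections of the other; the
  orthogonality relations make the two resulting maps mutually inverse.\<close>

lemma biproduct_riso:
  assumes S: "rhom M S i1" "rhom N S i2" "rhom S M p1" "rhom S N p2"
    "i1 * p1 + i2 * p2 = Eo S" "p1 * i1 = Eo M" "p2 * i2 = Eo N" "p1 * i2 = 0" "p2 * i1 = 0"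
    and T: "rhom M T j1" "rhom N T j2" "rhom T M q1" "rhom T N q2"
    "j1 * q1 + j2 * q2 = Eo T" "q1 * j1 = Eo M" "q2 * j2 = Eo N" "q1 * j2 = 0" "q2 * j1 = 0"
  shows "riso S T"
  unfolding riso_def
proof (intro exI conjI)
  show "rhom S T (j1 * p1 + j2 * p2)" "rhom T S (i1 * q1 + i2 * q2)"
    using S T by (auto intro!: rhom_add rhom_mult)
  show "(i1 * q1 + i2 * q2) * (j1 * p1 + j2 * p2) = Eo S"
    "(j1 * p1 + j2 * p2) * (i1 * q1 + i2 * q2) = Eo T"
    using rhomD(1)[OF S(3)] rhomD(1)[OF S(4)] rhomD(1)[OF T(3)] rhomD(1)[OF T(4)] S(5) T(5)
    by (simp_all add: distrib_left distrib_right mult.assoc S(6-9)[THEN mult_assoc_eq] T(6-9)[THEN mult_assoc_eq])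
qed

lemma riso_sum_commute:
  assumes M: "rep_shape M" and N: "rep_shape N"
  shows "riso (rep_sum Q M N) (rep_sum Q N M)"
proof (rule biproduct_riso)
  show "rhom M (rep_sum Q M N) (Eo M)" "rhom N (rep_sum Q M N) (s_in M N)"
    "rhom (rep_sum Q M N) M (Eo M)" "rhom (rep_sum Q M N) N (s_out M N)" by (fact rhom_sum_maps[OF M N])+
  show "rhom M (rep_sum Q N M) (s_in N M)" "rhom N (rep_sum Q N M) (Eo N)"
    "rhom (rep_sum Q N M) M (s_out N M)" "rhom (rep_sum Q N M) N (Eo N)" by (fact rhom_sum_maps[OF N M])+
qed (simp_all add: s_simps Eo_rep_sum add.commute)

lemma riso_sum_cong:
  assumes M: "riso M M'" and N: "riso N N'" and sh: "rep_shape M" "rep_shape N" "rep_shape M'" "rep_shape N'"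
  shows "riso (rep_sum Q M N) (rep_sum Q M' N')"
proof -
  obtain F G where F: "rhom M M' F" "rhom M' M G" "G * F = Eo M" "F * G = Eo M'"
    using M unfolding riso_def by blast
  obtain F' G' where F': "rhom N N' F'" "rhom N' N G'" "G' * F' = Eo N" "F' * G' = Eo N'"
    using N unfolding riso_def by blast
  note m = rhom_sum_maps[OF sh(1,2)] and m' = rhom_sum_maps[OF sh(3,4)]
  note hs = rhomD[OF F(1)] rhomD[OF F(2)] rhomD[OF F'(1)] rhomD[OF F'(2)]
  have z: "G * s_in M' N' = 0" "s_out M' N' * F = 0"
    using mult_assoc_eq[OF s_simps(2), of M' N' F] mult.assoc[of G "Eo M'" "s_in M' N'"]
    by (simp_all add: hs s_simps)
  show ?thesis
  proof (rule biproduct_riso)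
    show "rhom M (rep_sum Q M N) (Eo M)" "rhom N (rep_sum Q M N) (s_in M N)"
      "rhom (rep_sum Q M N) M (Eo M)" "rhom (rep_sum Q M N) N (s_out M N)" by (fact m)+
    show "rhom M (rep_sum Q M' N') (Eo M' * F)" "rhom N (rep_sum Q M' N') (s_in M' N' * F')"
      "rhom (rep_sum Q M' N') M (G * Eo M')" "rhom (rep_sum Q M' N') N (G' * s_out M' N')"
      using m' F F' by (auto intro: rhom_mult)
    show "(Eo M' * F) * (G * Eo M') + (s_in M' N' * F') * (G' * s_out M' N') = Eo (rep_sum Q M' N')"
      using F(4) F'(4) by (simp add: Eo_rep_sum hs mult.assoc mult_assoc_eq[OF F'(4)] s_simps')
    show "(G * Eo M') * (Eo M' * F) = Eo M" "(G' * s_out M' N') * (s_in M' N' * F') = Eo N"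
      "(G * Eo M') * (s_in M' N' * F') = 0" "(G' * s_out M' N') * (Eo M' * F) = 0"
      using F(3) F'(3) z by (simp_all add: hs mult.assoc s_simps' z[THEN mult_assoc_eq])
  qed (simp_all add: s_simps Eo_rep_sum add.commute)
qed

lemma rep_sum_assoc: "rep_sum Q (rep_sum Q M N) K = rep_sum Q M (rep_sum Q N K)"
  by (auto simp: rep_sum_def block_diag_assoc fun_eq_iff)

lemma block_diag_zero: "block_diag (0\<^sub>m 0 0) A = A" "block_diag A (0\<^sub>m 0 0) = A"
  by (auto simp: block_diag_def)

lemma rep_sum_zero: "rep_shape M \<Longrightarrow> rep_sum Q (zero_rep Q) M = M"
  by (cases M) (auto simp: rep_sum_def zero_rep_def block_diag_zero rep_shape_def fun_eq_iff PiE_def extensional_def)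

section \<open>Iterated sums and multiplicities\<close>

definition rsum :: "('v, 'a) rep list \<Rightarrow> ('v, 'a) rep" where
  "rsum Ms = foldr (rep_sum Q) Ms (zero_rep Q)"

lemma rsum_simps [simp]: "rsum [] = zero_rep Q" "rsum (M # Ms) = rep_sum Q M (rsum Ms)"
  by (simp_all add: rsum_def)

lemma rsum_reps: "set Ms \<subseteq> reps Q R \<Longrightarrow> rsum Ms \<in> reps Q R"
  by (induction Ms) (auto intro: zero_rep_reps rep_sum_reps)

lemma rsum_prj: "set Ms \<subseteq> reps Q R \<Longrightarrow> (\<And>M. M \<in> set Ms \<Longrightarrow> prj M) \<Longrightarrow> prj (rsum Ms)"
  by (induction Ms) (auto intro: prj_zero prj_sum reps_shape rsum_reps)

lemma rsum_append: "set Ns \<subseteq> reps Q R \<Longrightarrow> rsum (Ms @ Ns) = rep_sum Q (rsum Ms) (rsum Ns)"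
  by (induction Ms) (simp_all add: rep_sum_zero rep_sum_assoc reps_shape rsum_reps)

lemma rsum_insert:
  assumes "set (Ms @ N # Ns) \<subseteq> reps Q R"
  shows "riso (rsum (Ms @ N # Ns)) (rep_sum Q N (rsum (Ms @ Ns)))"
proof -
  have r: "N \<in> reps Q R" "rsum Ms \<in> reps Q R" "rsum Ns \<in> reps Q R" using assms by (auto intro: rsum_reps)
  have "riso (rep_sum Q (rep_sum Q (rsum Ms) N) (rsum Ns)) (rep_sum Q (rep_sum Q N (rsum Ms)) (rsum Ns))"
    using r by (intro riso_sum_cong riso_sum_commute riso_refl reps_shape rep_sum_reps)
  then show ?thesis using assms by (simp add: rsum_append rep_sum_assoc)
qed

text \<open>The first summand is searched for in the other list and moved to the front there by
  commutativity; associativity holds on the nose.\<close>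

lemma rsum_mset:
  "mset Ms = mset Ns \<Longrightarrow> set Ms \<subseteq> reps Q R \<Longrightarrow> riso (rsum Ms) (rsum Ns)"
proof (induction Ms arbitrary: Ns)
  case Nil
  then show ?case by (simp add: riso_refl reps_shape zero_rep_reps)
next
  case (Cons M Ms)
  then have "M \<in> set Ns" by (metis list.set_intros(1) mset_eq_setD)
  then obtain Ns1 Ns2 where Ns: "Ns = Ns1 @ M # Ns2" by (meson split_list)
  have s: "set Ns \<subseteq> reps Q R" using Cons.prems by (metis mset_eq_setD)
  have "riso (rsum Ms) (rsum (Ns1 @ Ns2))" using Cons Ns by (intro Cons.IH) auto
  then have "riso (rep_sum Q M (rsum Ms)) (rep_sum Q M (rsum (Ns1 @ Ns2)))"
    using Cons.prems s Ns by (intro riso_sum_cong riso_refl reps_shape rsum_reps) auto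
  also have "riso \<dots> (rsum Ns)" using rsum_insert[of Ns1 M Ns2] s Ns riso_sym by blast
  finally (riso_trans) show ?case by simp
qed

definition proj_list :: "('v, 'a) rep list \<Rightarrow> (nat \<Rightarrow> nat) \<Rightarrow> ('v, 'a) rep list" where
  "proj_list P m = concat (map (\<lambda>j. replicate (m j) (P ! j)) [0..<length P])"

lemma proj_sum_rsum: "proj_sum Q P m = rsum (proj_list P m)"
  by (simp add: proj_sum_def rsum_def proj_list_def)

lemma set_proj_list: "set (proj_list P m) \<subseteq> set P"
  by (auto simp: proj_list_def)

lemma mset_proj_list: "mset (proj_list P (\<lambda>j. m j + n j)) = mset (proj_list P m @ proj_list P n)"
proof -
  have "mset (concat (map (\<lambda>j. replicate (m j + n j) (P ! j)) js)) =
    mset (concat (map (\<lambda>j. replicate (m j) (P ! j)) js)) + mset (concat (map (\<lambda>j. replicate (n j) (P ! j)) js))" for js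
    by (induction js) (auto simp: replicate_add)
  then show ?thesis by (simp add: proj_list_def)
qed

text \<open>Both sides have the same summands in different orders: on the left all copies of each
  projective are adjacent, on the right they lie in two blocks.\<close>

lemma proj_sum_add:
  assumes "set P \<subseteq> reps Q R"
  shows "riso (proj_sum Q P (\<lambda>j. m j + n j)) (rep_sum Q (proj_sum Q P m) (proj_sum Q P n))"
proof -
  have s: "set (proj_list P k) \<subseteq> reps Q R" for k using assms set_proj_list by blast
  have "riso (rsum (proj_list P (\<lambda>j. m j + n j))) (rsum (proj_list P m @ proj_list P n))"
    by (rule rsum_mset[OF mset_proj_list s])
  then show ?thesis using s by (simp add: proj_sum_rsum rsum_append)
qed

end

section \<open>Nilpotent perturbations of a local unit\<close>

primrec iter_mult :: "'r \<Rightarrow> 'r \<Rightarrow> nat \<Rightarrow> 'r::times" where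
  "iter_mult n e 0 = e"
| "iter_mult n e (Suc k) = n * iter_mult n e k"

text \<open>The partial geometric sum of \<open>k\<close> terms. As the ring has no unit, the
  idempotent \<open>e\<close> stands for the zeroth power of \<open>n\<close>.\<close>

primrec geometric :: "'r \<Rightarrow> 'r \<Rightarrow> nat \<Rightarrow> 'r::semiring_0" where
  "geometric n e 0 = 0"
| "geometric n e (Suc k) = e + n * geometric n e k"

text \<open>Telescoping. Once a power of \<open>n\<close> vanishes, the geometric sum is a two-sided
  inverse of \<open>e - n\<close> with respect to \<open>e\<close>.\<close>

lemma geometric_inverse:
  fixes n e :: "'r::ring"
  assumes "e * e = e" "e * n = n" "n * e = n"
  shows "(e - n) * geometric n e k = e - iter_mult n e k" "geometric n e k * (e - n) = e - iter_mult n e k"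
proof -
  have e: "e * geometric n e k = geometric n e k" for k
    using assms by (cases k) (simp_all add: distrib_left mult_assoc_eq)
  show "(e - n) * geometric n e k = e - iter_mult n e k"
  proof (induction k)
    case (Suc k)
    have "(e - n) * geometric n e (Suc k) = e - n + n * ((e - n) * geometric n e k)"
      using assms e by (simp add: algebra_simps mult_assoc_eq[OF assms(2)] mult_assoc_eq[OF assms(3)])
    then show ?case unfolding Suc.IH using assms by (simp add: right_diff_distrib)
  qed simp
  show "geometric n e k * (e - n) = e - iter_mult n e k"
  proof (induction k)
    case (Suc k)
    have "geometric n e (Suc k) * (e - n) = e - n + n * (geometric n e k * (e - n))"
      using assms by (simp add: algebra_simps)
    then show ?case unfolding Suc.IH using assms by (simp add: right_diff_distrib)
  qed simp
qed

context bound_quiver_algebra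
begin

section \<open>Long paths act as zero\<close>

text \<open>Linear extension of a matrix-valued weight from paths to the path algebra.\<close>

definition lin :: "(('v, 'a) path \<Rightarrow> fmat) \<Rightarrow> (('v, 'a) path \<Rightarrow>\<^sub>0 complex) \<Rightarrow> fmat" where
  "lin w f = (\<Sum>p\<in>Poly_Mapping.keys f. Poly_Mapping.lookup f p *\<^sub>f w p)"

lemma lin_superset:
  "finite S \<Longrightarrow> Poly_Mapping.keys f \<subseteq> S \<Longrightarrow> lin w f = (\<Sum>p\<in>S. Poly_Mapping.lookup f p *\<^sub>f w p)"
  unfolding lin_def by (rule sum.mono_neutral_left) (auto simp: in_keys_iff)

lemma lin_zero [simp]: "lin w 0 = 0"
  by (simp add: lin_def)

lemma lin_add: "lin w (f + g) = lin w f + lin w g"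
proof -
  let ?S = "Poly_Mapping.keys f \<union> Poly_Mapping.keys g"
  have "lin w h = (\<Sum>p\<in>?S. Poly_Mapping.lookup h p *\<^sub>f w p)" if "h \<in> {f, g, f + g}" for h
    using that Poly_Mapping.keys_add[of f g] by (intro lin_superset) auto
  then show ?thesis by (simp add: lookup_add smult_fmat_plus sum.distrib)
qed

lemma lin_sum: "lin w (\<Sum>i\<in>I. f i) = (\<Sum>i\<in>I. lin w (f i))"
  by (induction I rule: infinite_finite_induct) (simp_all add: lin_add)

lemma lin_single: "lin w (Poly_Mapping.single p k) = k *\<^sub>f w p"
  by (subst lin_superset[of "{p}"]) auto

lemma lin_path_mult:
  "lin w (path_mult Q f g) = (\<Sum>p\<in>Poly_Mapping.keys f. \<Sum>q\<in>Poly_Mapping.keys g.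
     if awlast (fst p) (snd p) = fst q
     then (Poly_Mapping.lookup f p * Poly_Mapping.lookup g q) *\<^sub>f w (fst p, snd p @ snd q) else 0)"
  unfolding path_mult_def lin_sum by (intro sum.cong) (auto simp: lin_single)

lemma keys_path_mult:
  assumes "Poly_Mapping.keys f \<subseteq> paths Q" "Poly_Mapping.keys g \<subseteq> paths Q"
  shows "Poly_Mapping.keys (path_mult Q f g) \<subseteq> paths Q"
proof -
  have sum: "Poly_Mapping.keys (\<Sum>i\<in>I. h i) \<subseteq> paths Q" if "\<And>i. i \<in> I \<Longrightarrow> Poly_Mapping.keys (h i) \<subseteq> paths Q"
    for I and h :: "('v, 'a) path \<Rightarrow> (('v, 'a) path \<Rightarrow>\<^sub>0 complex)"
    using that
  proof (induction I rule: infinite_finite_induct)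
    case (insert x F)
    then show ?case using Poly_Mapping.keys_add[of "h x" "\<Sum>i\<in>F. h i"] by fastforce
  qed auto
  show ?thesis
    unfolding path_mult_def
  proof (rule sum, rule sum)
    fix p q assume "p \<in> Poly_Mapping.keys f" "q \<in> Poly_Mapping.keys g"
    then have "p \<in> paths Q" "q \<in> paths Q" using assms by auto
    then obtain v w where "awalk (fst p) (snd p) v" "awalk (fst q) (snd q) w"
      using path_awalk by blast
    then have "(fst p, snd p @ snd q) \<in> paths Q" if "awlast (fst p) (snd p) = fst q"
      using that awalk_appendI[of "fst p" "snd p" v "snd q" w] by (auto simp: paths_def awalk_def awlast_if_cas)
    then show "Poly_Mapping.keys (if awlast (fst p) (snd p) = fst q then Poly_Mapping.single (fst p, snd p @ snd q)
       (Poly_Mapping.lookup f p * Poly_Mapping.lookup g q) else 0) \<subseteq> paths Q"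
      by (auto split: if_splits)
  qed
qed

text \<open>The value 0 on paths with other ends lets the linear extension single out the component
  of an element between two vertices.\<close>

definition path_weight :: "('v, 'a) rep \<Rightarrow> 'v \<Rightarrow> 'v \<Rightarrow> ('v, 'a) path \<Rightarrow> fmat" where
  "path_weight M u v p = (if fst p = u \<and> awlast u (snd p) = v then pact M u (snd p) else 0)"

lemma rel_eval_lin: "rel_eval M f u v = lin (path_weight M u v) f"
  unfolding rel_eval_def lin_def path_weight_def
  by (simp add: if_distrib[where f="\<lambda>x. _ *\<^sub>f x"] sum.inter_filter[symmetric] cong: if_cong)

lemma path_weight_append:
  assumes M: "rep_shape M" and p: "p \<in> paths Q" and q: "q \<in> paths Q" and pq: "awlast (fst p) (snd p) = fst q"
  shows "path_weight M u z (fst p, snd p @ snd q) = path_weight M (fst q) z q * path_weight M u (fst q) p"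
proof (cases "fst p = u")
  case True
  have "awalk u (snd p) (fst q)" using path_awalk[OF p True] pq True by simp
  moreover have "awalk (fst q) (snd q) (awlast (fst q) (snd q))" by (rule path_awalk[OF q refl refl])
  ultimately show ?thesis
    using True pq pact_append[OF M] by (auto simp: path_weight_def awlast_append)
qed (simp add: path_weight_def)

text \<open>Concatenation of paths becomes composition of maps, so the elements acting as zero are
  closed under the operations that generate the ideal. That only genuine paths occur is carried
  through the induction, because the product formula needs it.\<close>

lemma relation_ideal_eval:
  assumes M: "M \<in> reps Q R" and f: "f \<in> relation_ideal Q R"
  shows "Poly_Mapping.keys f \<subseteq> paths Q \<and> (\<forall>u\<in>verts Q. \<forall>v\<in>verts Q. rel_eval M f u v = 0)"
  using f
proof induction
  case 1
  then show ?case by (simp add: rel_eval_lin)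
next
  case (2 \<rho>)
  then show ?case using M relation_paths by (simp add: reps_iff)
next
  case (3 f g)
  then show ?case using Poly_Mapping.keys_add[of f g] by (auto simp: rel_eval_lin lin_add)
next
  case (4 g c)
  have "rel_eval M (path_mult Q c g) u z = 0" if u: "u \<in> verts Q" and z: "z \<in> verts Q" for u z
    unfolding rel_eval_lin lin_path_mult
  proof (rule sum.neutral, rule ballI)
    fix p assume p: "p \<in> Poly_Mapping.keys c"
    let ?v = "awlast (fst p) (snd p)"
    have "awalk (fst p) (snd p) ?v" using path_awalk p 4 by blast
    then have v: "?v \<in> verts Q" by auto
    \<comment> \<open>For a fixed left factor \<open>p\<close>, the inner sum is the evaluation of
      \<open>g\<close> from the end of \<open>p\<close>, composed with the weight of
      \<open>p\<close>.\<close>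
    have "(\<Sum>q\<in>Poly_Mapping.keys g. if ?v = fst q
       then (Poly_Mapping.lookup c p * Poly_Mapping.lookup g q) *\<^sub>f path_weight M u z (fst p, snd p @ snd q) else 0)
      = (\<Sum>q\<in>Poly_Mapping.keys g. Poly_Mapping.lookup c p *\<^sub>f
          ((Poly_Mapping.lookup g q *\<^sub>f path_weight M ?v z q) * path_weight M u ?v p))"
    proof (rule sum.cong[OF refl])
      fix q assume q: "q \<in> Poly_Mapping.keys g"
      then have "path_weight M u z (fst p, snd p @ snd q) = path_weight M (fst q) z q * path_weight M u (fst q) p"
        if "?v = fst q" using path_weight_append[OF reps_shape[OF M]] p that 4 by blast
      moreover have "path_weight M ?v z q = 0" if "?v \<noteq> fst q" using that by (auto simp: path_weight_def)
      ultimately show "(if ?v = fst q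
       then (Poly_Mapping.lookup c p * Poly_Mapping.lookup g q) *\<^sub>f path_weight M u z (fst p, snd p @ snd q) else 0)
        = Poly_Mapping.lookup c p *\<^sub>f ((Poly_Mapping.lookup g q *\<^sub>f path_weight M ?v z q) * path_weight M u ?v p)"
        by (simp add: smult_fmat_times smult_fmat_smult)
    qed
    also have "\<dots> = (\<Sum>q\<in>Poly_Mapping.keys g. Poly_Mapping.lookup g q *\<^sub>f path_weight M ?v z q) *
         (Poly_Mapping.lookup c p *\<^sub>f path_weight M u ?v p)"
      unfolding sum_distrib_right by (rule sum.cong) (simp_all add: smult_fmat_times)
    also have "\<dots> = 0" using 4 v z by (simp add: rel_eval_lin lin_def)
    finally show "(\<Sum>q\<in>Poly_Mapping.keys g. if ?v = fst q
       then (Poly_Mapping.lookup c p * Poly_Mapping.lookup g q) *\<^sub>f path_weight M u z (fst p, snd p @ snd q) else 0) = 0" .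
  qed
  then show ?case using 4 keys_path_mult by blast
next
  case (5 f c)
  have "rel_eval M (path_mult Q f c) u z = 0" if u: "u \<in> verts Q" and z: "z \<in> verts Q" for u z
    unfolding rel_eval_lin lin_path_mult
  \<comment> \<open>With the ideal element on the left, the outer sum has to run over the paths
    \<open>q\<close> of the right factor.\<close>
  proof (subst sum.swap, rule sum.neutral, rule ballI)
    fix q assume q: "q \<in> Poly_Mapping.keys c"
    have "awalk (fst q) (snd q) (awlast (fst q) (snd q))" using path_awalk q 5 by blast
    then have v: "fst q \<in> verts Q" by auto
    have "(\<Sum>p\<in>Poly_Mapping.keys f. if awlast (fst p) (snd p) = fst q
       then (Poly_Mapping.lookup f p * Poly_Mapping.lookup c q) *\<^sub>f path_weight M u z (fst p, snd p @ snd q) else 0)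
      = (\<Sum>p\<in>Poly_Mapping.keys f. (Poly_Mapping.lookup c q *\<^sub>f path_weight M (fst q) z q) *
           (Poly_Mapping.lookup f p *\<^sub>f path_weight M u (fst q) p))"
    proof (rule sum.cong[OF refl])
      fix p assume p: "p \<in> Poly_Mapping.keys f"
      then have "path_weight M u z (fst p, snd p @ snd q) = path_weight M (fst q) z q * path_weight M u (fst q) p"
        if "awlast (fst p) (snd p) = fst q" using path_weight_append[OF reps_shape[OF M]] q that 5 by blast
      moreover have "path_weight M u (fst q) p = 0" if "awlast (fst p) (snd p) \<noteq> fst q"
        using that by (auto simp: path_weight_def)
      ultimately show "(if awlast (fst p) (snd p) = fst q
       then (Poly_Mapping.lookup f p * Poly_Mapping.lookup c q) *\<^sub>f path_weight M u z (fst p, snd p @ snd q) else 0)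
        = (Poly_Mapping.lookup c q *\<^sub>f path_weight M (fst q) z q) *
           (Poly_Mapping.lookup f p *\<^sub>f path_weight M u (fst q) p)"
        by (simp add: smult_fmat_times smult_fmat_smult mult.commute)
    qed
    also have "\<dots> = (Poly_Mapping.lookup c q *\<^sub>f path_weight M (fst q) z q) * rel_eval M f u (fst q)"
      by (simp add: sum_distrib_left rel_eval_lin lin_def)
    also have "\<dots> = 0" using 5 v u by simp
    finally show "(\<Sum>p\<in>Poly_Mapping.keys f. if awlast (fst p) (snd p) = fst q
       then (Poly_Mapping.lookup f p * Poly_Mapping.lookup c q) *\<^sub>f path_weight M u z (fst p, snd p @ snd q) else 0) = 0" .
  qed
  then show ?case using 5 keys_path_mult by blast
qed

text \<open>Admissibility puts every path of length at least \<open>N\<close> into the ideal. The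
  bound does not depend on the representation.\<close>

lemma long_path_zero:
  obtains N where "\<And>M u p v. M \<in> reps Q R \<Longrightarrow> awalk u p v \<Longrightarrow> N \<le> length p \<Longrightarrow> pact M u p = 0"
proof -
  obtain N where N: "\<forall>(u, p) \<in> paths Q. N \<le> length p \<longrightarrow> Poly_Mapping.single (u, p) 1 \<in> relation_ideal Q R"
    using bound_quiver unfolding bound_quiver_def by blast
  have "pact M u p = 0" if M: "M \<in> reps Q R" and w: "awalk u p v" and l: "N \<le> length p" for M u p v
  proof -
    have "Poly_Mapping.single (u, p) 1 \<in> relation_ideal Q R"
      using N w l by (fastforce simp: paths_def)
    moreover have "u \<in> verts Q" "v \<in> verts Q" using w by auto
    ultimately have "rel_eval M (Poly_Mapping.single (u, p) 1) u v = 0"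
      using relation_ideal_eval[OF M] by blast
    moreover have "awlast u p = v" using w by (auto simp: awalk_def awlast_if_cas)
    ultimately show ?thesis by (simp add: rel_eval_lin lin_single path_weight_def)
  qed
  then show ?thesis by (rule that)
qed

section \<open>Tops of projective representations\<close>

text \<open>At each vertex, \<open>q\<close> is the projection of \<open>M\<close> onto its top, the cokernel of the
  arrows ending there, and \<open>s\<close> is a section of \<open>q\<close>.\<close>

definition is_top_at :: "('v, 'a) rep \<Rightarrow> 'v \<Rightarrow> nat \<Rightarrow> fmat \<Rightarrow> fmat \<Rightarrow> bool" where
  "is_top_at M v t q s \<longleftrightarrow> sized t (rdim M v) q \<and> sized (rdim M v) t s \<and> q * s = idm t \<and>
     (\<forall>a\<in>arcs Q. head Q a = v \<longrightarrow> q * act M a = 0) \<and>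
     (\<forall>x. x * idm (rdim M v) = x \<longrightarrow> (\<forall>a\<in>arcs Q. head Q a = v \<longrightarrow> x * act M a = 0) \<longrightarrow> x * (s * q) = x)"

definition is_top :: "('v, 'a) rep \<Rightarrow> ('v \<Rightarrow> nat) \<Rightarrow> ('v \<Rightarrow> fmat) \<Rightarrow> ('v \<Rightarrow> fmat) \<Rightarrow> bool" where
  "is_top M t q s \<longleftrightarrow> (\<forall>v. is_top_at M v (t v) (q v) (s v))"

lemma is_topD:
  assumes "is_top M t q s"
  shows "sized (t v) (rdim M v) (q v)" "sized (rdim M v) (t v) (s v)" "q v * s v = idm (t v)"
    "a \<in> arcs Q \<Longrightarrow> q (head Q a) * act M a = 0"
    "x * idm (rdim M v) = x \<Longrightarrow> (\<And>a. a \<in> arcs Q \<Longrightarrow> head Q a = v \<Longrightarrow> x * act M a = 0) \<Longrightarrow> x * (s v * q v) = x"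
  using assms unfolding is_top_def is_top_at_def by blast+

lemma ex_top: obtains t q s where "is_top M t q s"
proof -
  have "\<exists>t q s. is_top_at M v t q s" for v
  proof -
    obtain t q s where *: "sized t (rdim M v) q" "sized (rdim M v) t s" "q * s = idm t"
      and A: "\<And>A. A \<in> act M ` {a \<in> arcs Q. head Q a = v} \<Longrightarrow> q * A = 0"
      and x: "\<And>x. x * idm (rdim M v) = x \<Longrightarrow> (\<And>A. A \<in> act M ` {a \<in> arcs Q. head Q a = v} \<Longrightarrow> x * A = 0) \<Longrightarrow>
        x * s * q = x"
      by (rule cokernel_split[of "rdim M v" "act M ` {a \<in> arcs Q. head Q a = v}"]) (rule that; blast)
    have "x * (s * q) = x" if "x * idm (rdim M v) = x" "\<forall>a\<in>arcs Q. head Q a = v \<longrightarrow> x * act M a = 0" for x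
      using x[OF that(1)] that(2) by (auto simp: mult.assoc)
    then show ?thesis using * A unfolding is_top_at_def by blast
  qed
  then show ?thesis using that unfolding is_top_def by metis
qed

lemma top_le: assumes "is_top M t q s" shows "t v \<le> rdim M v"
  by (rule left_inverse_bound[OF is_topD(2)[OF assms] is_topD(1)[OF assms] is_topD(3)[OF assms]])

text \<open>The trace of the endomorphism that \<open>i * p\<close> induces on the top of
  \<open>S\<close>. By cyclicity it equals the trace of what \<open>p * i\<close>, the identity,
  induces on the top of \<open>M\<close>, which is the dimension.\<close>

lemma top_summand_trace:
  assumes M: "is_top M t q s" and S: "is_top S t' q' s'"
    and i: "rhom M S i" and p: "rhom S M p" and pi: "p * i = Eo M"
  shows "mtrace (q' v * (i v * (p v * s' v))) = of_nat (t v)"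
proof -
  \<comment> \<open>Homomorphisms map images of arrows to images of arrows, so
    \<open>q' v * i v\<close> kills the latter and factors through the top of
    \<open>M\<close>.\<close>
  have qi: "q' v * i v * (s v * q v) = q' v * i v"
  proof (rule is_topD(5)[OF M])
    show "q' v * i v * idm (rdim M v) = q' v * i v" by (simp add: mult.assoc rhomD_at[OF i])
    show "q' v * i v * act M a = 0" if a: "a \<in> arcs Q" "head Q a = v" for a
      using rhom_arc[OF i a(1)] mult_assoc_eq[OF is_topD(4)[OF S a(1)]] a(2) by (simp add: mult.assoc)
  qed
  have qp: "q v * p v * (s' v * q' v) = q v * p v"
  proof (rule is_topD(5)[OF S])
    show "q v * p v * idm (rdim S v) = q v * p v" by (simp add: mult.assoc rhomD_at[OF p])
    show "q v * p v * act S a = 0" if a: "a \<in> arcs Q" "head Q a = v" for a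
      using rhom_arc[OF p a(1)] mult_assoc_eq[OF is_topD(4)[OF M a(1)]] a(2) by (simp add: mult.assoc)
  qed
  have pi': "p v * i v = idm (rdim M v)" using fun_cong[OF pi, of v] by (simp add: Eo_def)
  have "mtrace (q' v * (i v * (p v * s' v))) = mtrace ((q' v * i v * (s v * q v)) * (p v * s' v))"
    unfolding qi by (simp add: mult.assoc)
  also have "\<dots> = mtrace ((q' v * i v * s v) * (q v * p v * s' v))" by (simp add: mult.assoc)
  also have "\<dots> = mtrace ((q v * p v * s' v) * (q' v * i v * s v))" by (rule mtrace_commute)
  also have "\<dots> = mtrace ((q v * p v * (s' v * q' v)) * (i v * s v))" by (simp add: mult.assoc)
  also have "\<dots> = mtrace (q v * (idm (rdim M v) * s v))"
    unfolding qp by (simp add: mult.assoc mult_assoc_eq[OF pi'])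
  also have "\<dots> = of_nat (t v)"
    using is_topD(2,3)[OF M, of v] by (simp add: sized_def)
  finally show ?thesis .
qed

text \<open>The two idempotents of the biproduct add up to the identity, and the traces they induce
  on the top are the dimensions of the two tops. Complex traces determine natural numbers, as the
  characteristic is zero.\<close>

lemma top_biproduct:
  assumes M: "is_top M t q s" and N: "is_top N t' q' s'" and S: "is_top S T q'' s''"
    and bi: "rhom M S i1" "rhom N S i2" "rhom S M p1" "rhom S N p2"
    "i1 * p1 + i2 * p2 = Eo S" "p1 * i1 = Eo M" "p2 * i2 = Eo N"
  shows "T v = t v + t' v"
proof -
  have "i1 v * p1 v + i2 v * p2 v = idm (rdim S v)" using fun_cong[OF bi(5), of v] by (simp add: Eo_def)
  then have "(i1 v * p1 v + i2 v * p2 v) * s'' v = s'' v" using is_topD(2)[OF S, of v] by (simp add: sized_def)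
  then have "q'' v * (i1 v * (p1 v * s'' v)) + q'' v * (i2 v * (p2 v * s'' v)) = idm (T v)"
    using is_topD(3)[OF S, of v] by (simp add: distrib_right distrib_left mult.assoc flip: distrib_left)
  then have "mtrace (q'' v * (i1 v * (p1 v * s'' v)) + q'' v * (i2 v * (p2 v * s'' v))) = of_nat (T v)"
    by simp
  then have "(of_nat (t v) + of_nat (t' v) :: complex) = of_nat (T v)"
    using top_summand_trace[OF M S bi(1,3,6), of v] top_summand_trace[OF N S bi(2,4,7), of v]
    by (simp add: mtrace_plus)
  then show ?thesis by (metis of_nat_add of_nat_eq_iff)
qed

text \<open>The trace formula for a summand with no complement: \<open>F * G\<close> is the
  identity, and its trace on the top of \<open>N\<close> is the dimension of that top.\<close>

lemma top_iso_unique: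
  assumes M: "is_top M t q s" and N: "is_top N t' q' s'" and MN: "riso M N"
  shows "t = t'"
proof
  fix v
  obtain F G where FG: "rhom M N F" "rhom N M G" "G * F = Eo M" "F * G = Eo N"
    using MN unfolding riso_def by blast
  have "F v * G v = idm (rdim N v)" using fun_cong[OF FG(4), of v] by (simp add: Eo_def)
  then have "F v * (G v * s' v) = s' v"
    using is_topD(2)[OF N, of v] by (simp add: sized_def mult_assoc_eq)
  then have "of_nat (t v) = mtrace (q' v * s' v)"
    using top_summand_trace[OF M N FG(1-3), of v] by simp
  then show "t v = t' v" using is_topD(3)[OF N, of v] by (metis mtrace_idm of_nat_eq_iff)
qed

text \<open>An endomorphism vanishing on the top has its image in the sum of the images of arrows.
  Each further power can be pushed along one more arrow, until the paths are so long that they act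
  as zero.\<close>

lemma radical_nilpotent:
  assumes M: "M \<in> reps Q R" and T: "is_top M t q s" and n: "rhom M M n" and qn: "q * n = 0"
  obtains k where "iter_mult n (Eo M) k = 0"
proof -
  let ?pow = "iter_mult n (Eo M)"
  note Msh = reps_shape[OF M]
  have pow_hom: "rhom M M (?pow k)" for k
    by (induction k) (simp_all only: iter_mult.simps rhom_id[OF Msh] rhom_mult[OF n])
  \<comment> \<open>The induction runs over matrices \<open>x\<close> that kill all paths of length
    \<open>k\<close> ending in \<open>v\<close>. If \<open>x\<close> does so for length
    \<open>k + 1\<close>, then after a path of length \<open>k\<close> it kills all incoming arrows,
    hence factors through the top, and there \<open>n\<close> vanishes. So \<open>x * n v\<close>
    qualifies for \<open>k\<close>.\<close>
  have pow: "x * ?pow k v = 0" if "x * idm (rdim M v) = x"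
    "\<And>u p. awalk u p v \<Longrightarrow> length p = k \<Longrightarrow> x * pact M u p = 0" "v \<in> verts Q" for x v k
    using that(1,2)
  proof (induction k arbitrary: x)
    case 0
    have "x * pact M v [] = 0" using 0 that(3) by (intro 0(2)) (auto simp: awalk_Nil_iff)
    then show ?case using 0(1) by (simp add: Eo_def)
  next
    case (Suc k)
    have "(x * n v) * ?pow k v = 0"
    proof (rule Suc.IH)
      show "x * n v * idm (rdim M v) = x * n v" by (simp add: mult.assoc rhomD_at[OF n])
      fix u p assume p: "awalk u p v" "length p = k"
      have xp: "(x * pact M u p) * (s u * q u) = x * pact M u p"
      proof (rule is_topD(5)[OF T])
        show "x * pact M u p * idm (rdim M u) = x * pact M u p"
          using pact_sized[OF Msh p(1)] by (simp add: sized_def mult.assoc)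
        fix a assume a: "a \<in> arcs Q" "head Q a = u"
        then have "awalk (tail Q a) (a # p) v" using p by (simp add: awalk_Cons_iff)
        then show "x * pact M u p * act M a = 0"
          using Suc.prems(2)[of "tail Q a" "a # p"] pact_Cons[OF Msh] a p by (simp add: mult.assoc)
      qed
      have "x * n v * pact M u p = x * pact M u p * n u"
        using rhom_path[OF n Msh Msh p(1)] by (simp add: mult.assoc)
      also have "\<dots> = x * pact M u p * (s u * (q u * n u))" by (metis xp mult.assoc)
      also have "\<dots> = 0" using fun_cong[OF qn, of u] by simp
      finally show "x * n v * pact M u p = 0" .
    qed
    then show ?case by (simp add: mult.assoc)
  qed
  obtain N where N: "\<And>M u p v. M \<in> reps Q R \<Longrightarrow> awalk u p v \<Longrightarrow> N \<le> length p \<Longrightarrow> pact M u p = 0"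
    using long_path_zero by blast
  have "?pow N v = 0" for v
  proof (cases "v \<in> verts Q")
    case True
    then have "idm (rdim M v) * ?pow N v = 0" by (intro pow) (auto simp: N[OF M])
    then show ?thesis by (simp add: rhomD_at[OF pow_hom])
  qed (rule rhom_off[OF pow_hom Msh])
  then have "?pow N = 0" by (simp add: fun_eq_iff)
  then show ?thesis by (rule that)
qed

lemma radical_invertible:
  assumes M: "M \<in> reps Q R" and T: "is_top M t q s" and n: "rhom M M n" and qn: "q * n = 0"
  obtains u where "rhom M M u" "(Eo M - n) * u = Eo M" "u * (Eo M - n) = Eo M"
proof -
  let ?pow = "iter_mult n (Eo M)"
  let ?geo = "geometric n (Eo M)"
  obtain k where k: "?pow k = 0" using radical_nilpotent[OF assms] .
  have hom: "rhom M M (?geo k)" for k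
    by (induction k) (simp_all only: geometric.simps rhom_zero rhom_add rhom_id[OF reps_shape[OF M]] rhom_mult[OF n])
  have E: "Eo M * n = n" "n * Eo M = n" using rhomD[OF n] by auto
  show ?thesis
    using that[OF hom[of k]] geometric_inverse[OF _ E, of k] k by simp
qed

text \<open>The semisimple representation with given dimensions. It is the common target over which
  two projectives with equal tops are lifted against each other.\<close>

definition top_rep :: "('v \<Rightarrow> nat) \<Rightarrow> ('v, 'a) rep" where
  "top_rep t = \<lparr>rdim = t, rmap = (\<lambda>a\<in>arcs Q. 0\<^sub>m (t (head Q a)) (t (tail Q a)))\<rparr>"

text \<open>Admissible relations involve only paths of length at least two, and every non-trivial
  path acts as zero.\<close>

lemma top_rep_reps:
  assumes "\<And>v. v \<notin> verts Q \<Longrightarrow> t v = 0"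
  shows "top_rep t \<in> reps Q R"
proof -
  have sh: "rep_shape (top_rep t)" using assms by (auto simp: rep_shape_def top_rep_def)
  have "rel_eval (top_rep t) \<rho> u v = 0" if \<rho>: "\<rho> \<in> R" for \<rho> u v
    unfolding rel_eval_def
  proof (rule sum.neutral, rule ballI)
    fix p assume p: "p \<in> {p \<in> Poly_Mapping.keys \<rho>. fst p = u \<and> awlast u (snd p) = v}"
    then have "2 \<le> length (snd p)" using bound_quiver \<rho> unfolding bound_quiver_def by fastforce
    then obtain a p' where ap: "snd p = a # p'" by (cases "snd p") auto
    have w: "awalk u (a # p') v" using path_awalk[of p u v] relation_paths[OF \<rho>] p ap by auto
    then have "act (top_rep t) a = 0" by (simp add: act_def top_rep_def awalk_Cons_iff)
    then show "Poly_Mapping.lookup \<rho> p *\<^sub>f pact (top_rep t) u (snd p) = 0"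
      using pact_Cons[OF sh w] ap by simp
  qed
  then show ?thesis using sh by (simp add: reps_iff)
qed

lemma top_proj:
  assumes M: "M \<in> reps Q R" and T: "is_top M t q s"
  shows "rhom M (top_rep t) q" "surj_fam M (top_rep t) q"
proof -
  show "rhom M (top_rep t) q"
    using is_topD[OF T] by (simp add: rhom_def Eo_def fun_eq_iff sized_def top_rep_def act_def)
  show "surj_fam M (top_rep t) q"
    unfolding surj_fam_def
  proof (intro ballI allI impI)
    fix v y assume "sized (rdim (top_rep t) v) 1 y"
    then have y: "sized (t v) 1 y" by (simp add: top_rep_def)
    have "q v * (s v * y) = y" using y by (simp add: mult_assoc_eq[OF is_topD(3)[OF T]] sized_def)
    then show "\<exists>x. sized (rdim M v) 1 x \<and> q v * x = y" using sized_mult[OF is_topD(2)[OF T] y] by blast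
  qed
qed

text \<open>Uniqueness of projective covers. The projections to the common top lift through each
  other, and both composites of the lifts are the identity modulo the radical, hence
  invertible.\<close>

lemma prj_top_riso:
  assumes M: "M \<in> reps Q R" "prj M" "is_top M t q s" and N: "N \<in> reps Q R" "prj N" "is_top N t q' s'"
  shows "riso M N"
proof -
  have T: "top_rep t \<in> reps Q R"
    using top_le[OF M(3)] reps_shape[OF M(1)] by (intro top_rep_reps) (metis le_zero_eq rep_shape_def)
  obtain f where f: "rhom M N f" "q' * f = q"
    using prjD[OF M(2) N(1) T top_proj(1)[OF N(1,3)] top_proj(1)[OF M(1,3)] top_proj(2)[OF N(1,3)]] .
  obtain g where g: "rhom N M g" "q * g = q'"
    using prjD[OF N(2) M(1) T top_proj(1)[OF M(1,3)] top_proj(1)[OF N(1,3)] top_proj(2)[OF M(1,3)]] .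
  have "q * Eo M = q" "q' * Eo N = q'"
    using rhomD(2)[OF top_proj(1)[OF M(1,3)]] rhomD(2)[OF top_proj(1)[OF N(1,3)]] .
  then have qz: "q * (Eo M - g * f) = 0" "q' * (Eo N - f * g) = 0"
    using f(2) g(2) by (simp_all add: right_diff_distrib mult_assoc_eq[OF f(2)] mult_assoc_eq[OF g(2)])
  have h: "rhom M M (Eo M - g * f)" "rhom N N (Eo N - f * g)"
    using f g M N by (auto intro!: rhom_diff rhom_id rhom_mult reps_shape)
  obtain u where u: "rhom M M u" "u * (g * f) = Eo M"
    using radical_invertible[OF M(1,3) h(1) qz(1)] by (metis diff_diff_eq2 add_diff_cancel_left')
  obtain w where w: "rhom N N w" "(f * g) * w = Eo N"
    using radical_invertible[OF N(1,3) h(2) qz(2)] by (metis diff_diff_eq2 add_diff_cancel_left')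
  \<comment> \<open>\<open>u * g\<close> is a left inverse and \<open>g * w\<close> a right inverse
    of \<open>f\<close>, so the two agree.\<close>
  have "u * g = u * g * (f * g * w)" using w(2) rhomD[OF g(1)] by (simp add: mult.assoc)
  also have "\<dots> = (u * (g * f)) * (g * w)" by (simp add: mult.assoc)
  also have "\<dots> = g * w" using u(2) rhomD[OF g(1)] by simp
  finally have "f * (u * g) = Eo N" using w(2) by (simp add: mult.assoc)
  moreover have "(u * g) * f = Eo M" using u(2) by (simp add: mult.assoc)
  ultimately show ?thesis unfolding riso_def using f(1) rhom_mult[OF u(1) g(1)] by blast
qed

end

section \<open>Complexes and quasi-isomorphisms\<close>

text \<open>Bijectivity of a map on cohomology is thereby expressed through representatives; nothing
  later handles sets of cocycles as elements.\<close>

lemma bij_betw_quotient_iff: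
  assumes r: "equiv A r" and s: "equiv B s" and f: "\<And>x. x \<in> A \<Longrightarrow> f x \<in> B"
    and rs: "\<And>x y. (x, y) \<in> r \<Longrightarrow> (f x, f y) \<in> s"
  shows "bij_betw (\<lambda>C. s `` (f ` C)) (A // r) (B // s) \<longleftrightarrow>
    (\<forall>x\<in>A. \<forall>y\<in>A. (f x, f y) \<in> s \<longrightarrow> (x, y) \<in> r) \<and> (\<forall>y\<in>B. \<exists>x\<in>A. (f x, y) \<in> s)"
proof -
  have im: "s `` (f ` (r `` {x})) = s `` {f x}" if x: "x \<in> A" for x
  proof -
    have "f x \<in> f ` (r `` {x})" using equiv_class_self[OF r x] by blast
    moreover have "s `` {z} = s `` {f x}" if "z \<in> f ` (r `` {x})" for z
      using that rs equiv_class_eq[OF s] by blast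
    ultimately show ?thesis by blast
  qed
  have inj: "inj_on (\<lambda>C. s `` (f ` C)) (A // r) \<longleftrightarrow> (\<forall>x\<in>A. \<forall>y\<in>A. (f x, f y) \<in> s \<longrightarrow> (x, y) \<in> r)"
  proof
    assume i: "inj_on (\<lambda>C. s `` (f ` C)) (A // r)"
    show "\<forall>x\<in>A. \<forall>y\<in>A. (f x, f y) \<in> s \<longrightarrow> (x, y) \<in> r"
    proof (intro ballI impI)
      fix x y assume xy: "x \<in> A" "y \<in> A" "(f x, f y) \<in> s"
      have "s `` (f ` (r `` {x})) = s `` (f ` (r `` {y}))"
        using im xy equiv_class_eq[OF s] by simp
      then have "r `` {x} = r `` {y}" by (rule inj_onD[OF i _ quotientI[OF xy(1)] quotientI[OF xy(2)]])
      then show "(x, y) \<in> r" using xy eq_equiv_class[OF _ r] by blast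
    qed
  next
    assume h: "\<forall>x\<in>A. \<forall>y\<in>A. (f x, f y) \<in> s \<longrightarrow> (x, y) \<in> r"
    show "inj_on (\<lambda>C. s `` (f ` C)) (A // r)"
    proof (rule inj_onI)
      fix C D assume CD: "C \<in> A // r" "D \<in> A // r" "s `` (f ` C) = s `` (f ` D)"
      then obtain x y where xy: "x \<in> A" "C = r `` {x}" "y \<in> A" "D = r `` {y}" by (auto elim!: quotientE)
      then have "s `` {f x} = s `` {f y}" using CD(3) im by simp
      then have "(f x, f y) \<in> s" using eq_equiv_class[OF _ s] f xy by blast
      then show "C = D" using h xy equiv_class_eq[OF r] by blast
    qed
  qed
  have surj: "(\<lambda>C. s `` (f ` C)) ` (A // r) = B // s \<longleftrightarrow> (\<forall>y\<in>B. \<exists>x\<in>A. (f x, y) \<in> s)"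
  proof
    assume e: "(\<lambda>C. s `` (f ` C)) ` (A // r) = B // s"
    show "\<forall>y\<in>B. \<exists>x\<in>A. (f x, y) \<in> s"
    proof
      fix y assume y: "y \<in> B"
      then have "s `` {y} \<in> (\<lambda>C. s `` (f ` C)) ` (A // r)" using e by (auto intro: quotientI)
      then obtain x where x: "x \<in> A" "s `` {y} = s `` {f x}" using im by (auto elim!: quotientE)
      then have "(f x, y) \<in> s" using eq_equiv_class[OF x(2)[symmetric] s y] by simp
      then show "\<exists>x\<in>A. (f x, y) \<in> s" using x(1) by blast
    qed
  next
    assume h: "\<forall>y\<in>B. \<exists>x\<in>A. (f x, y) \<in> s"
    show "(\<lambda>C. s `` (f ` C)) ` (A // r) = B // s"
    proof (intro equalityI subsetI)
      fix D assume "D \<in> (\<lambda>C. s `` (f ` C)) ` (A // r)"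
      then obtain x where "x \<in> A" "D = s `` {f x}" using im by (auto elim!: quotientE)
      then show "D \<in> B // s" using f by (auto intro: quotientI)
    next
      fix D assume "D \<in> B // s"
      then obtain y where y: "y \<in> B" "D = s `` {y}" by (auto elim!: quotientE)
      then obtain x where x: "x \<in> A" "(f x, y) \<in> s" using h by blast
      then have "D = s `` (f ` (r `` {x}))" using im y equiv_class_eq[OF s] by simp
      then show "D \<in> (\<lambda>C. s `` (f ` C)) ` (A // r)" using x(1) by (auto intro!: imageI quotientI)
    qed
  qed
  show ?thesis unfolding bij_betw_def inj surj ..
qed

context bound_quiver_algebra
begin

definition df :: "('v, 'a) cpx \<Rightarrow> int \<Rightarrow> 'v \<Rightarrow> fmat" where
  "df X i = fam (diff X i)"

abbreviation "cpxs \<equiv> bounded_cpxs Q R"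

lemma cpx_reps: "X \<in> cpxs \<Longrightarrow> obj X i \<in> reps Q R"
  by (simp add: bounded_cpxs_def)

lemma cpx_shape: "X \<in> cpxs \<Longrightarrow> rep_shape (obj X i)"
  by (simp add: cpx_reps reps_shape)

lemma df_hom: "X \<in> cpxs \<Longrightarrow> rhom (obj X i) (obj X (i + 1)) (df X i)"
  unfolding df_def by (rule rhom_fam) (auto simp: cpx_shape bounded_cpxs_def)

lemma df_hom': "X \<in> cpxs \<Longrightarrow> rhom (obj X (i - 1)) (obj X i) (df X (i - 1))"
  using df_hom[of X "i - 1"] by simp

lemma df_df: "X \<in> cpxs \<Longrightarrow> df X (i + 1) * df X i = 0"
proof -
  assume X: "X \<in> cpxs"
  have h: "diff X i \<in> rep_hom Q (obj X i) (obj X (i + 1))" for i using X by (simp add: bounded_cpxs_def)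
  have "fam (\<lambda>v. 0\<^sub>m (cdim X (i + 2) v) (cdim X i v)) = df X (i + 1) * df X i"
    unfolding df_def
    using X rep_hom_dims[OF h] by (intro fam_mult) (auto simp: bounded_cpxs_def)
  moreover have "fam (\<lambda>v. 0\<^sub>m (cdim X (i + 2) v) (cdim X i v)) = 0"
    by (rule ext) (simp add: fam_def)
  ultimately show ?thesis by simp
qed

lemma df_df': "X \<in> cpxs \<Longrightarrow> df X i * df X (i - 1) = 0"
  using df_df[of X "i - 1"] by simp

definition chain :: "('v, 'a) cpx \<Rightarrow> ('v, 'a) cpx \<Rightarrow> (int \<Rightarrow> 'v \<Rightarrow> fmat) \<Rightarrow> bool" where
  "chain X Y F \<longleftrightarrow> (\<forall>i. rhom (obj X i) (obj Y i) (F i) \<and> F (i + 1) * df X i = df Y i * F i)"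

lemma chainD:
  assumes "chain X Y F"
  shows "rhom (obj X i) (obj Y i) (F i)" "F (i + 1) * df X i = df Y i * F i"
    "F i * df X (i - 1) = df Y (i - 1) * F (i - 1)"
proof -
  show "rhom (obj X i) (obj Y i) (F i)" and *: "F (i + 1) * df X i = df Y i * F i" for i
    using assms unfolding chain_def by blast+
  show "F i * df X (i - 1) = df Y (i - 1) * F (i - 1)" using *[of "i - 1"] by simp
qed

lemma chain_fam:
  assumes X: "X \<in> cpxs" and Y: "Y \<in> cpxs" and f: "f \<in> chain_maps Q X Y"
  shows "chain X Y (\<lambda>i. fam (f i))"
proof -
  have hX: "diff X i \<in> rep_hom Q (obj X i) (obj X (i + 1))" for i using X by (simp add: bounded_cpxs_def)
  have hY: "diff Y i \<in> rep_hom Q (obj Y i) (obj Y (i + 1))" for i using Y by (simp add: bounded_cpxs_def)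
  have hf: "f i \<in> rep_hom Q (obj X i) (obj Y i)" for i using f by (simp add: chain_maps_def)
  have "fam (\<lambda>v. f (i + 1) v * diff X i v) = fam (f (i + 1)) * df X i"
    "fam (\<lambda>v. f (i + 1) v * diff X i v) = df Y i * fam (f i)" for i
    unfolding df_def using f rep_hom_dims[OF hX] rep_hom_dims[OF hY] rep_hom_dims[OF hf]
    by (auto intro!: fam_mult simp: chain_maps_def)
  then show ?thesis
    using rhom_fam[OF hf] X Y unfolding chain_def by (metis cpx_shape)
qed

lemma chain_unfam:
  assumes X: "X \<in> cpxs" and Y: "Y \<in> cpxs" and F: "chain X Y F"
  obtains f where "f \<in> chain_maps Q X Y" "\<And>i. fam (f i) = F i"
proof -
  define f where "f i = unfam (obj X i) (obj Y i) (F i)" for i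
  have hX: "diff X i \<in> rep_hom Q (obj X i) (obj X (i + 1))" for i using X by (simp add: bounded_cpxs_def)
  have hY: "diff Y i \<in> rep_hom Q (obj Y i) (obj Y (i + 1))" for i using Y by (simp add: bounded_cpxs_def)
  have hf: "f i \<in> rep_hom Q (obj X i) (obj Y i)" for i
    unfolding f_def using X Y chainD(1)[OF F] by (intro unfam_rep_hom cpx_shape)
  have fF: "fam (f i) = F i" for i
    unfolding f_def using X chainD(1)[OF F] by (intro fam_unfam cpx_shape)
  have "f (i + 1) v * diff X i v = diff Y i v * f i v" if v: "v \<in> verts Q" for i v
  proof (rule of_mat_eqD)
    show "of_mat (f (i + 1) v * diff X i v) = of_mat (diff Y i v * f i v)"
      using fun_cong[OF chainD(2)[OF F, of i], of v] v
        rep_hom_dims[OF hX v] rep_hom_dims[OF hY v] rep_hom_dims[OF hf v]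
      by (simp add: of_mat_mult df_def fam_def flip: fF)
  qed (use rep_hom_dims[OF hX v] rep_hom_dims[OF hY v] rep_hom_dims[OF hf v] in auto)
  then have "f \<in> chain_maps Q X Y" using hf by (simp add: chain_maps_def)
  then show ?thesis using fF by (rule that)
qed

lemma chain_id: "X \<in> cpxs \<Longrightarrow> chain X X (\<lambda>i. Eo (obj X i))"
  unfolding chain_def by (auto simp: rhom_id cpx_shape rhomD[OF df_hom])

lemma chain_comp: "chain X Y F \<Longrightarrow> chain Y Z G \<Longrightarrow> chain X Z (\<lambda>i. G i * F i)"
  unfolding chain_def by (metis mult.assoc rhom_mult)

section \<open>Cocycles, coboundaries and quasi-isomorphisms in terms of columns\<close>

definition cyc :: "('v, 'a) cpx \<Rightarrow> int \<Rightarrow> 'v \<Rightarrow> fmat \<Rightarrow> bool" where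
  "cyc X i v x \<longleftrightarrow> sized (cdim X i v) 1 x \<and> df X i v * x = 0"

definition bd :: "('v, 'a) cpx \<Rightarrow> int \<Rightarrow> 'v \<Rightarrow> fmat \<Rightarrow> bool" where
  "bd X i v x \<longleftrightarrow> (\<exists>y. sized (cdim X (i - 1) v) 1 y \<and> x = df X (i - 1) v * y)"

lemma sized_add: "sized m n x \<Longrightarrow> sized m n y \<Longrightarrow> sized m n (x + y)"
  by (simp add: sized_def distrib_left distrib_right)

lemma sized_diff: "sized m n x \<Longrightarrow> sized m n y \<Longrightarrow> sized m n (x - y)"
  by (simp add: sized_def left_diff_distrib right_diff_distrib)

lemma sized_uminus: "sized m n x \<Longrightarrow> sized m n (- x)"
  by (simp add: sized_def)

lemma sized_zero: "sized m n 0"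
  by (simp add: sized_def)

lemma bd_zero: "bd X i v 0"
  unfolding bd_def by (rule exI[of _ 0]) (simp add: sized_zero)

lemma bd_diff: "bd X i v x \<Longrightarrow> bd X i v y \<Longrightarrow> bd X i v (x - y)"
  unfolding bd_def using sized_diff right_diff_distrib by metis

lemma bd_add: "bd X i v x \<Longrightarrow> bd X i v y \<Longrightarrow> bd X i v (x + y)"
  unfolding bd_def using sized_add distrib_left by metis

lemma bd_uminus: "bd X i v x \<Longrightarrow> bd X i v (- x)"
  using bd_diff[OF bd_zero] by fastforce

lemma cyc_diff: "cyc X i v x \<Longrightarrow> cyc X i v y \<Longrightarrow> cyc X i v (x - y)"
  unfolding cyc_def by (auto intro: sized_diff simp: right_diff_distrib)

lemma chain_cyc:
  assumes F: "chain X Y F" and x: "cyc X i v x"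
  shows "cyc Y i v (F i v * x)"
proof -
  have "df Y i v * (F i v * x) = F (i + 1) v * (df X i v * x)"
    using fun_cong[OF chainD(2)[OF F, of i], of v] by (simp flip: mult.assoc)
  then show ?thesis
    using x sized_mult[OF rhom_sized[OF chainD(1)[OF F]]] by (simp add: cyc_def)
qed

lemma chain_bd:
  assumes F: "chain X Y F" and x: "bd X i v x"
  shows "bd Y i v (F i v * x)"
proof -
  obtain y where y: "sized (cdim X (i - 1) v) 1 y" "x = df X (i - 1) v * y" using x unfolding bd_def by blast
  have "F i v * x = df Y (i - 1) v * (F (i - 1) v * y)"
    using fun_cong[OF chainD(3)[OF F, of i], of v] y(2) by (simp flip: mult.assoc)
  then show ?thesis
    unfolding bd_def using sized_mult[OF rhom_sized[OF chainD(1)[OF F]] y(1)] by blast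
qed

text \<open>Injectivity and surjectivity on cohomology, stated for representatives. By linearity,
  injectivity is tested against zero only.\<close>

definition qis :: "('v, 'a) cpx \<Rightarrow> ('v, 'a) cpx \<Rightarrow> (int \<Rightarrow> 'v \<Rightarrow> fmat) \<Rightarrow> bool" where
  "qis X Y F \<longleftrightarrow> chain X Y F \<and> (\<forall>i. \<forall>v\<in>verts Q.
     (\<forall>x. cyc X i v x \<longrightarrow> bd Y i v (F i v * x) \<longrightarrow> bd X i v x) \<and>
     (\<forall>y. cyc Y i v y \<longrightarrow> (\<exists>x. cyc X i v x \<and> bd Y i v (y - F i v * x))))"

lemma qisD:
  assumes "qis X Y F"
  shows "chain X Y F"
    "v \<in> verts Q \<Longrightarrow> cyc X i v x \<Longrightarrow> bd Y i v (F i v * x) \<Longrightarrow> bd X i v x"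
    "v \<in> verts Q \<Longrightarrow> cyc Y i v y \<Longrightarrow> \<exists>x. cyc X i v x \<and> bd Y i v (y - F i v * x)"
  using assms unfolding qis_def by blast+

lemma cocycles_iff:
  assumes "X \<in> cpxs" "v \<in> verts Q"
  shows "z \<in> cocycles X i v \<longleftrightarrow> z \<in> carrier_vec (cdim X i v) \<and> cyc X i v (of_vec z)"
proof -
  have h: "diff X i \<in> rep_hom Q (obj X i) (obj X (i + 1))" using assms(1) by (simp add: bounded_cpxs_def)
  have "diff X i v *\<^sub>v z = 0\<^sub>v (cdim X (i + 1) v) \<longleftrightarrow> of_vec (diff X i v *\<^sub>v z) = 0"
    using rep_hom_dims[OF h assms(2)] of_vec_eqD[of "diff X i v *\<^sub>v z" "0\<^sub>v (cdim X (i + 1) v)"] by auto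
  moreover have "of_vec (diff X i v *\<^sub>v z) = df X i v * of_vec z" if "z \<in> carrier_vec (cdim X i v)"
    using that rep_hom_dims[OF h assms(2)] assms(2) by (simp add: of_vec_mult df_def fam_def)
  ultimately show ?thesis
    by (auto simp: cocycles_def cyc_def sized_of_vec simp del: One_nat_def)
qed

lemma coboundaries_iff:
  assumes "X \<in> cpxs" "v \<in> verts Q" and z: "z \<in> carrier_vec (cdim X i v)"
  shows "z \<in> coboundaries X i v \<longleftrightarrow> bd X i v (of_vec z)"
proof -
  have "diff X j \<in> rep_hom Q (obj X j) (obj X (j + 1))" for j using assms(1) by (simp add: bounded_cpxs_def)
  from this[of "i - 1"] have h: "diff X (i - 1) \<in> rep_hom Q (obj X (i - 1)) (obj X i)" by simp
  have m: "of_vec (diff X (i - 1) v *\<^sub>v y) = df X (i - 1) v * of_vec y" if "y \<in> carrier_vec (cdim X (i - 1) v)" for y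
    using that rep_hom_dims[OF h assms(2)] assms(2) by (simp add: of_vec_mult df_def fam_def)
  show ?thesis
  proof
    assume "z \<in> coboundaries X i v"
    then show "bd X i v (of_vec z)"
      unfolding coboundaries_def bd_def using m sized_of_vec by blast
  next
    assume "bd X i v (of_vec z)"
    then obtain y where y: "sized (cdim X (i - 1) v) 1 y" "of_vec z = df X (i - 1) v * y" unfolding bd_def by blast
    obtain w where w: "w \<in> carrier_vec (cdim X (i - 1) v)" "of_vec w = y" using of_vec_surj[OF y(1)] .
    have "z = diff X (i - 1) v *\<^sub>v w"
      using m[OF w(1)] w(2) y(2) z rep_hom_dims[OF h assms(2)] by (intro of_vec_eqD) auto
    then show "z \<in> coboundaries X i v" unfolding coboundaries_def using w(1) by blast
  qed
qed

lemma cohomologous_iff: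
  assumes "X \<in> cpxs" "v \<in> verts Q"
  shows "(z, z') \<in> cohomologous X i v \<longleftrightarrow> z \<in> cocycles X i v \<and> z' \<in> cocycles X i v \<and> bd X i v (of_vec z - of_vec z')"
proof -
  have "z - z' \<in> coboundaries X i v \<longleftrightarrow> bd X i v (of_vec z - of_vec z')"
    if "z \<in> carrier_vec (cdim X i v)" "z' \<in> carrier_vec (cdim X i v)"
    using coboundaries_iff[OF assms, of "z - z'" i] that by (simp add: of_vec_minus)
  then show ?thesis using cocycles_iff[OF assms] by (auto simp: cohomologous_def)
qed

lemma cohomologous_equiv:
  assumes "X \<in> cpxs" "v \<in> verts Q"
  shows "equiv (cocycles X i v) (cohomologous X i v)"
proof (rule equivI)
  show "cohomologous X i v \<subseteq> cocycles X i v \<times> cocycles X i v" by (auto simp: cohomologous_def)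
  show "refl_on (cocycles X i v) (cohomologous X i v)"
    using bd_zero by (auto simp: refl_on_def cohomologous_iff[OF assms])
  show "sym (cohomologous X i v)"
    using bd_uminus by (fastforce simp: sym_def cohomologous_iff[OF assms])
  show "trans (cohomologous X i v)"
    using bd_add by (fastforce simp: trans_def cohomologous_iff[OF assms])
qed

lemma quasi_isos_iff:
  assumes X: "X \<in> cpxs" and Y: "Y \<in> cpxs" and f: "f \<in> chain_maps Q X Y"
  shows "f \<in> quasi_isos Q X Y \<longleftrightarrow> qis X Y (\<lambda>i. fam (f i))"
proof -
  note ch = chain_fam[OF assms]
  have "bij_betw (\<lambda>C. cohomologous Y i v `` ((\<lambda>z. f i v *\<^sub>v z) ` C)) (cohomology X i v) (cohomology Y i v) \<longleftrightarrow>
     (\<forall>x. cyc X i v x \<longrightarrow> bd Y i v (fam (f i) v * x) \<longrightarrow> bd X i v x) \<and>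
     (\<forall>y. cyc Y i v y \<longrightarrow> (\<exists>x. cyc X i v x \<and> bd Y i v (y - fam (f i) v * x)))" if v: "v \<in> verts Q" for i v
  proof -
    have hf: "f i \<in> rep_hom Q (obj X i) (obj Y i)" for i using f by (simp add: chain_maps_def)
    note d = rep_hom_dims[OF hf v]
    have m: "of_vec (f i v *\<^sub>v z) = fam (f i) v * of_vec z" if "z \<in> cocycles X i v" for z
      using that d v by (auto simp: cocycles_def of_vec_mult fam_def)
    have c: "f i v *\<^sub>v z \<in> cocycles Y i v" if z: "z \<in> cocycles X i v" for z
    proof -
      have "f i v *\<^sub>v z \<in> carrier_vec (cdim Y i v)" using d by (simp add: carrier_vecI)
      then show ?thesis
        using chain_cyc[OF ch] z m[OF z] by (simp add: cocycles_iff[OF X v] cocycles_iff[OF Y v])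
    qed
    have lift: "\<exists>z\<in>cocycles X i v. of_vec z = x" if "cyc X i v x" for x
      using that of_vec_surj[of "cdim X i v" x] cocycles_iff[OF X v] unfolding cyc_def by metis
    have liftY: "\<exists>z\<in>cocycles Y i v. of_vec z = x" if "cyc Y i v x" for x
      using that of_vec_surj[of "cdim Y i v" x] cocycles_iff[OF Y v] unfolding cyc_def by metis
    have "bij_betw (\<lambda>C. cohomologous Y i v `` ((\<lambda>z. f i v *\<^sub>v z) ` C)) (cohomology X i v) (cohomology Y i v) \<longleftrightarrow>
      (\<forall>x\<in>cocycles X i v. \<forall>y\<in>cocycles X i v. (f i v *\<^sub>v x, f i v *\<^sub>v y) \<in> cohomologous Y i v \<longrightarrow> (x, y) \<in> cohomologous X i v) \<and>
      (\<forall>y\<in>cocycles Y i v. \<exists>x\<in>cocycles X i v. (f i v *\<^sub>v x, y) \<in> cohomologous Y i v)"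
      unfolding cohomology_def
    proof (rule bij_betw_quotient_iff[OF cohomologous_equiv[OF X v] cohomologous_equiv[OF Y v] c])
      fix x y assume xy: "(x, y) \<in> cohomologous X i v"
      then have "x \<in> cocycles X i v" "y \<in> cocycles X i v" by (auto simp: cohomologous_def)
      then show "(f i v *\<^sub>v x, f i v *\<^sub>v y) \<in> cohomologous Y i v"
        using xy chain_bd[OF ch, of i v "of_vec x - of_vec y"] c m
        by (simp add: cohomologous_iff[OF X v] cohomologous_iff[OF Y v] right_diff_distrib)
    qed
    also have "(\<forall>x\<in>cocycles X i v. \<forall>y\<in>cocycles X i v. (f i v *\<^sub>v x, f i v *\<^sub>v y) \<in> cohomologous Y i v \<longrightarrow> (x, y) \<in> cohomologous X i v)
       \<longleftrightarrow> (\<forall>x. cyc X i v x \<longrightarrow> bd Y i v (fam (f i) v * x) \<longrightarrow> bd X i v x)" (is "?A \<longleftrightarrow> ?B")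
    proof
      assume A: ?A
      show ?B
      proof (intro allI impI)
        fix x assume x: "cyc X i v x" "bd Y i v (fam (f i) v * x)"
        obtain z where z: "z \<in> cocycles X i v" "of_vec z = x" using lift[OF x(1)] by blast
        have 0: "0\<^sub>v (cdim X i v) \<in> cocycles X i v"
          by (simp add: cocycles_iff[OF X v] cyc_def sized_zero)
        have "(f i v *\<^sub>v z, f i v *\<^sub>v 0\<^sub>v (cdim X i v)) \<in> cohomologous Y i v"
          using c[OF z(1)] c[OF 0] m[OF z(1)] m[OF 0] z(2) x(2) by (simp add: cohomologous_iff[OF Y v])
        then have "(z, 0\<^sub>v (cdim X i v)) \<in> cohomologous X i v" using A z(1) 0 by blast
        then show "bd X i v x" using z(2) by (simp add: cohomologous_iff[OF X v])
      qed
    next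
      assume B: ?B
      show ?A
      proof (intro ballI impI)
        fix x y assume xy: "x \<in> cocycles X i v" "y \<in> cocycles X i v" "(f i v *\<^sub>v x, f i v *\<^sub>v y) \<in> cohomologous Y i v"
        then have "cyc X i v (of_vec x - of_vec y)" using cyc_diff by (simp add: cocycles_iff[OF X v])
        moreover have "bd Y i v (fam (f i) v * (of_vec x - of_vec y))"
          using xy m by (simp add: cohomologous_iff[OF Y v] right_diff_distrib)
        ultimately have "bd X i v (of_vec x - of_vec y)" using B by blast
        then show "(x, y) \<in> cohomologous X i v" using xy by (simp add: cohomologous_iff[OF X v])
      qed
    qed
    also have "(\<forall>y\<in>cocycles Y i v. \<exists>x\<in>cocycles X i v. (f i v *\<^sub>v x, y) \<in> cohomologous Y i v) \<longleftrightarrow>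
      (\<forall>y. cyc Y i v y \<longrightarrow> (\<exists>x. cyc X i v x \<and> bd Y i v (y - fam (f i) v * x)))" (is "?A \<longleftrightarrow> ?B")
    proof
      assume A: ?A
      show ?B
      proof (intro allI impI)
        fix y assume "cyc Y i v y"
        then obtain z where z: "z \<in> cocycles Y i v" "of_vec z = y" using liftY by blast
        obtain x where x: "x \<in> cocycles X i v" "(f i v *\<^sub>v x, z) \<in> cohomologous Y i v" using A z(1) by blast
        then have "bd Y i v (fam (f i) v * of_vec x - y)" using m z(2) by (simp add: cohomologous_iff[OF Y v])
        then have "bd Y i v (y - fam (f i) v * of_vec x)" using bd_uminus by fastforce
        then show "\<exists>x. cyc X i v x \<and> bd Y i v (y - fam (f i) v * x)"
          using x(1) by (auto simp: cocycles_iff[OF X v])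
      qed
    next
      assume B: ?B
      show ?A
      proof
        fix y assume y: "y \<in> cocycles Y i v"
        then obtain x where x: "cyc X i v x" "bd Y i v (of_vec y - fam (f i) v * x)"
          using B by (auto simp: cocycles_iff[OF Y v])
        obtain z where z: "z \<in> cocycles X i v" "of_vec z = x" using lift[OF x(1)] by blast
        have "bd Y i v (fam (f i) v * x - of_vec y)" using bd_uminus[OF x(2)] by simp
        then have "(f i v *\<^sub>v z, y) \<in> cohomologous Y i v"
          using c[OF z(1)] y m[OF z(1)] z(2) by (simp add: cohomologous_iff[OF Y v])
        then show "\<exists>x\<in>cocycles X i v. (f i v *\<^sub>v x, y) \<in> cohomologous Y i v" using z(1) by blast
      qed
    qed
    finally show ?thesis .
  qed
  then show ?thesis using f ch by (simp add: quasi_isos_def qis_def)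
qed

lemma quasi_isos_nonempty:
  assumes X: "X \<in> cpxs" and Y: "Y \<in> cpxs"
  shows "quasi_isos Q X Y \<noteq> {} \<longleftrightarrow> (\<exists>F. qis X Y F)"
proof
  assume "quasi_isos Q X Y \<noteq> {}"
  then obtain f where "f \<in> quasi_isos Q X Y" by blast
  then show "\<exists>F. qis X Y F" using quasi_isos_iff[OF X Y] by (auto simp: quasi_isos_def)
next
  assume "\<exists>F. qis X Y F"
  then obtain F where F: "qis X Y F" by blast
  obtain f where f: "f \<in> chain_maps Q X Y" "\<And>i. fam (f i) = F i"
    using chain_unfam[OF X Y qisD(1)[OF F]] by metis
  then have "(\<lambda>i. fam (f i)) = F" by auto
  then have "f \<in> quasi_isos Q X Y" using quasi_isos_iff[OF X Y f(1)] F by simp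
  then show "quasi_isos Q X Y \<noteq> {}" by blast
qed

lemma qis_comp:
  assumes F: "qis X Y F" and G: "qis Y Z G"
  shows "qis X Z (\<lambda>i. G i * F i)"
  unfolding qis_def
proof (intro conjI allI ballI impI)
  show "chain X Z (\<lambda>i. G i * F i)" using chain_comp qisD(1) F G by blast
  fix i v assume v: "v \<in> verts Q"
  show "bd X i v x" if "cyc X i v x" "bd Z i v ((G i * F i) v * x)" for x
  proof -
    have "bd Y i v (F i v * x)"
      using that chain_cyc[OF qisD(1)[OF F]] by (intro qisD(2)[OF G v]) (auto simp: mult.assoc)
    then show ?thesis using qisD(2)[OF F v that(1)] by blast
  qed
  show "\<exists>x. cyc X i v x \<and> bd Z i v (z - (G i * F i) v * x)" if z: "cyc Z i v z" for z
  proof -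
    obtain y where y: "cyc Y i v y" "bd Z i v (z - G i v * y)" using qisD(3)[OF G v z] by blast
    obtain x where x: "cyc X i v x" "bd Y i v (y - F i v * x)" using qisD(3)[OF F v y(1)] by blast
    have "bd Z i v ((z - G i v * y) + G i v * (y - F i v * x))"
      using y(2) chain_bd[OF qisD(1)[OF G] x(2)] by (rule bd_add)
    then have "bd Z i v (z - (G i * F i) v * x)" by (simp add: right_diff_distrib mult.assoc)
    then show ?thesis using x(1) by blast
  qed
qed

text \<open>By the homotopy \<open>K\<close>, the maps \<open>F\<close> and \<open>S * G\<close>
  agree on cohomology; since \<open>F\<close> and \<open>S\<close> are bijective there, so is
  \<open>G\<close>.\<close>

lemma qis_lift:
  assumes S: "qis X Y S" and F: "qis P Y F" and G: "chain P X G"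
    and K: "\<And>i. rhom (obj P i) (obj Y (i - 1)) (K i)"
    and h: "\<And>i. F i = S i * G i + df Y (i - 1) * K i + K (i + 1) * df P i"
  shows "qis P X G"
  unfolding qis_def
proof (intro conjI allI ballI impI)
  have hom: "bd Y i v (F i v * x - S i v * (G i v * x))" if x: "cyc P i v x" for i v x
  proof -
    have "sized (cdim Y (i - 1) v) 1 (K i v * x)"
      using rhom_sized[OF K] x unfolding cyc_def by (blast intro: sized_mult)
    moreover have "F i v * x - S i v * (G i v * x) = df Y (i - 1) v * (K i v * x)"
      using x fun_cong[OF h, of i v] by (simp add: cyc_def distrib_right mult.assoc)
    ultimately show ?thesis unfolding bd_def by blast
  qed
  fix i v assume v: "v \<in> verts Q"
  show "bd P i v x" if x: "cyc P i v x" "bd X i v (G i v * x)" for x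
  proof -
    have "bd Y i v ((F i v * x - S i v * (G i v * x)) + S i v * (G i v * x))"
      using hom[OF x(1)] chain_bd[OF qisD(1)[OF S] x(2)] by (rule bd_add)
    then show ?thesis using qisD(2)[OF F v x(1)] by simp
  qed
  show "\<exists>x. cyc P i v x \<and> bd X i v (y - G i v * x)" if y: "cyc X i v y" for y
  proof -
    obtain x where x: "cyc P i v x" "bd Y i v (S i v * y - F i v * x)"
      using qisD(3)[OF F v chain_cyc[OF qisD(1)[OF S] y]] by blast
    have "bd Y i v ((S i v * y - F i v * x) + (F i v * x - S i v * (G i v * x)))"
      using x(2) hom[OF x(1)] by (rule bd_add)
    then have "bd Y i v (S i v * (y - G i v * x))" by (simp add: right_diff_distrib)
    then have "bd X i v (y - G i v * x)"
      using qisD(2)[OF S v cyc_diff[OF y chain_cyc[OF G x(1)]]] by blast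
    then show ?thesis using x(1) by blast
  qed
qed (rule G)

lemma qis_id: "X \<in> cpxs \<Longrightarrow> qis X X (\<lambda>i. Eo (obj X i))"
  unfolding qis_def
proof (intro conjI allI ballI impI)
  assume X: "X \<in> cpxs"
  show "chain X X (\<lambda>i. Eo (obj X i))" by (rule chain_id[OF X])
  fix i v x
  have E: "Eo (obj X i) v * x = x" if "cyc X i v x" for x using that by (simp add: cyc_def Eo_def sized_def)
  show "bd X i v x" if "cyc X i v x" "bd X i v (Eo (obj X i) v * x)" using that E by simp
  show "\<exists>z. cyc X i v z \<and> bd X i v (x - Eo (obj X i) v * z)" if "cyc X i v x"
    using that E bd_zero by (intro exI[of _ x]) simp
qed

section \<open>Mapping cones\<close>

lemma fam_rep_hom:
  assumes f: "f \<in> (\<Pi>\<^sub>E v\<in>verts Q. carrier_mat (rdim N v) (rdim M v))"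
    and h: "rhom M N (fam f)" and M: "rep_shape M" and N: "rep_shape N"
  shows "f \<in> rep_hom Q M N"
proof -
  have "unfam M N (fam f) \<in> (\<Pi>\<^sub>E v\<in>verts Q. carrier_mat (rdim N v) (rdim M v))"
    by (auto simp: unfam_def)
  then have "unfam M N (fam f) = f" by (rule fam_inject[OF _ f fam_unfam[OF h M]])
  then show ?thesis using unfam_rep_hom[OF h M N] by simp
qed

lemma cpxI:
  assumes r: "\<And>i. obj X i \<in> reps Q R"
    and c: "\<And>i. diff X i \<in> (\<Pi>\<^sub>E v\<in>verts Q. carrier_mat (cdim X (i + 1) v) (cdim X i v))"
    and h: "\<And>i. rhom (obj X i) (obj X (i + 1)) (df X i)" and dd: "\<And>i. df X (i + 1) * df X i = 0"
    and fin: "finite {i. \<exists>v. cdim X i v \<noteq> 0}"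
  shows "X \<in> cpxs"
proof -
  have hom: "diff X i \<in> rep_hom Q (obj X i) (obj X (i + 1))" for i
    using c h r by (intro fam_rep_hom reps_shape) (simp_all add: df_def)
  have "diff X (i + 1) v * diff X i v = 0\<^sub>m (cdim X (i + 2) v) (cdim X i v)" if v: "v \<in> verts Q" for i v
  proof (rule of_mat_eqD)
    show "of_mat (diff X (i + 1) v * diff X i v) = of_mat (0\<^sub>m (cdim X (i + 2) v) (cdim X i v))"
      using fun_cong[OF dd, of i v] v rep_hom_dims[OF hom v] by (simp add: of_mat_mult df_def fam_def)
  qed (use rep_hom_dims[OF hom v, of "i + 1"] rep_hom_dims[OF hom v, of i] in \<open>simp_all add: add.commute\<close>)
  then show ?thesis using r hom fin by (simp add: bounded_cpxs_def)
qed

text \<open>Maps to or from \<open>M\<close> are supported on the initial coordinates, hence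
  orthogonal to the second summand. This removes most cross terms in computations with sums and
  cones.\<close>

lemma hom_s:
  "rhom M K G \<Longrightarrow> G * s_in M N = 0" "rhom K M F \<Longrightarrow> s_out M N * F = 0"
  using mult.assoc[of G "Eo M" "s_in M N"] mult_assoc_eq[OF s_simps(2), of M N F]
  by (simp_all add: rhomD s_simps)

lemma hom_s_at:
  "rhom M K G \<Longrightarrow> G v * (s_in M N v * x) = 0" "rhom K M F \<Longrightarrow> s_out M N v * (F v * x) = 0"
  using fun_cong[OF hom_s(1), of M K G N v] fun_cong[OF hom_s(2), of K M F N v]
  by (simp_all flip: mult.assoc)

lemma s_at:
  "idm (rdim M v) * (s_in M N v * x) = 0" "s_out M N v * (s_in M N v * x) = idm (rdim N v) * x"
  "s_out M N v * (idm (rdim M v) * x) = 0"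
  by (simp_all add: s_in_def s_out_def flip: mult.assoc)

lemma obj_cone [simp]: "obj (cone Q X Y f) i = rep_sum Q (obj X (i + 1)) (obj Y i)"
  by (simp add: cone_def)

lemma df_cone:
  assumes X: "X \<in> cpxs" and Y: "Y \<in> cpxs" and f: "f \<in> chain_maps Q X Y"
  shows "df (cone Q X Y f) i = - df X (i + 1) + s_in (obj X (i + 2)) (obj Y (i + 1)) * fam (f (i + 1)) +
    s_in (obj X (i + 2)) (obj Y (i + 1)) * (df Y i * s_out (obj X (i + 1)) (obj Y i))"
proof
  fix v
  have hX: "diff X i \<in> rep_hom Q (obj X i) (obj X (i + 1))" for i using X by (simp add: bounded_cpxs_def)
  have hY: "diff Y i \<in> rep_hom Q (obj Y i) (obj Y (i + 1))" for i using Y by (simp add: bounded_cpxs_def)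
  have hf: "f i \<in> rep_hom Q (obj X i) (obj Y i)" for i using f by (simp add: chain_maps_def)
  have off: "s_out (obj X (i + 1)) (obj Y i) v = 0" "s_in (obj X (i + 2)) (obj Y (i + 1)) v = 0" if "v \<notin> verts Q"
    using that cpx_shape[OF Y] by (auto simp: s_in_def s_out_def rep_shape_def)
  show "df (cone Q X Y f) i v = (- df X (i + 1) + s_in (obj X (i + 2)) (obj Y (i + 1)) * fam (f (i + 1)) +
    s_in (obj X (i + 2)) (obj Y (i + 1)) * (df Y i * s_out (obj X (i + 1)) (obj Y i))) v"
  proof (cases "v \<in> verts Q")
    case True
    note d = rep_hom_dims[OF hX True] rep_hom_dims[OF hY True] rep_hom_dims[OF hf True]
    have 2: "i + 1 + 1 = i + 2" by simp
    show ?thesis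
      using True d d(1)[of "i + 1", unfolded 2]
      by (simp add: df_def fam_def cone_def of_mat_four_block of_mat_uminus s_in_def s_out_def mult.assoc)
  next
    case False
    then show ?thesis using off by (simp add: df_def fam_def)
  qed
qed

lemma finite_cdim: "X \<in> cpxs \<Longrightarrow> finite {i. \<exists>v. cdim X i v \<noteq> 0}"
  by (simp add: bounded_cpxs_def)

lemma finite_cdim_shift: "X \<in> cpxs \<Longrightarrow> finite {i. \<exists>v. cdim X (i + 1) v \<noteq> 0}"
proof -
  assume "X \<in> cpxs"
  then have "finite ((\<lambda>i. i - 1) ` {i. \<exists>v. cdim X i v \<noteq> 0})" by (intro finite_imageI finite_cdim)
  moreover have "{i. \<exists>v. cdim X (i + 1) v \<noteq> 0} \<subseteq> (\<lambda>i. i - 1) ` {i. \<exists>v. cdim X i v \<noteq> 0}"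
    by (auto simp: image_iff) (metis add_diff_cancel_right')
  ultimately show ?thesis by (rule finite_subset[rotated])
qed

lemma cone_cpx:
  assumes X: "X \<in> cpxs" and Y: "Y \<in> cpxs" and f: "f \<in> chain_maps Q X Y"
  shows "cone Q X Y f \<in> cpxs"
proof (rule cpxI)
  let ?Z = "cone Q X Y f"
  have 2: "i + 1 + 1 = i + (2::int)" for i by simp
  note ch = chain_fam[OF assms]
  note sh = cpx_shape[OF X] cpx_shape[OF Y]
  note maps = rhom_sum_maps[OF sh]
  show "obj ?Z i \<in> reps Q R" for i using X Y by (simp add: rep_sum_reps cpx_reps)
  show "diff ?Z i \<in> (\<Pi>\<^sub>E v\<in>verts Q. carrier_mat (cdim ?Z (i + 1) v) (cdim ?Z i v))" for i
  proof -
    have hX: "diff X i \<in> rep_hom Q (obj X i) (obj X (i + 1))" for i using X by (simp add: bounded_cpxs_def)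
    have hY: "diff Y i \<in> rep_hom Q (obj Y i) (obj Y (i + 1))" for i using Y by (simp add: bounded_cpxs_def)
    have "dim_row (diff X (i + 1) v) = cdim X (i + 2) v" if "v \<in> verts Q" for v
      using rep_hom_dims(1)[OF hX that, of "i + 1", unfolded 2] .
    then show ?thesis
      using rep_hom_dims[OF hX] rep_hom_dims[OF hY] by (auto simp: cone_def intro!: carrier_matI)
  qed
  show "rhom (obj ?Z i) (obj ?Z (i + 1)) (df ?Z i)" for i
  proof -
    have h: "rhom (obj X (i + 1)) (obj X (i + 2)) (df X (i + 1))" using df_hom[OF X, of "i + 1"] by (simp add: 2)
    let ?S = "rep_sum Q (obj X (i + 1)) (obj Y i)" and ?T = "rep_sum Q (obj X (i + 2)) (obj Y (i + 1))"
    have "rhom ?S ?T (Eo (obj X (i + 2)) * (df X (i + 1) * Eo (obj X (i + 1))))"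
      "rhom ?S ?T (s_in (obj X (i + 2)) (obj Y (i + 1)) * (fam (f (i + 1)) * Eo (obj X (i + 1))))"
      "rhom ?S ?T (s_in (obj X (i + 2)) (obj Y (i + 1)) * (df Y i * s_out (obj X (i + 1)) (obj Y i)))"
      using maps h chainD(1)[OF ch] df_hom[OF Y] by (auto intro!: rhom_mult)
    then have "rhom ?S ?T (df ?Z i)"
      using rhomD[OF h] rhomD[OF chainD(1)[OF ch]]
      by (simp add: df_cone[OF assms] rhom_add rhom_diff)
    then show ?thesis by (simp add: 2)
  qed
  show "df ?Z (i + 1) * df ?Z i = 0" for i
  proof -
    let ?a = "df X (i + 1)" and ?a' = "df X (i + 2)" and ?b = "df Y i" and ?b' = "df Y (i + 1)"
      and ?f = "fam (f (i + 1))" and ?f' = "fam (f (i + 2))"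
      and ?j = "s_in (obj X (i + 2)) (obj Y (i + 1))" and ?j' = "s_in (obj X (i + 3)) (obj Y (i + 2))"
      and ?p = "s_out (obj X (i + 1)) (obj Y i)" and ?p' = "s_out (obj X (i + 2)) (obj Y (i + 1))"
    have n: "i + 1 + 1 = i + 2" "i + 2 + 1 = i + 3" "i + 1 + 2 = i + 3" by simp_all
    have e: "?a' * ?a = 0" "?b' * ?b = 0" "?f' * ?a = ?b' * ?f"
      using df_df[OF X, of "i + 1"] df_df[OF Y, of i] chainD(2)[OF ch, of "i + 1"] by (simp_all add: n)
    have z: "?a' * ?j = 0" "?f' * ?j = 0" "?p' * ?a = 0" "?p' * ?j = Eo (obj Y (i + 1))"
      using hom_s df_hom[OF X, of "i + 2"] chainD(1)[OF ch, of "i + 2"] df_hom[OF X, of "i + 1"]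
      by (simp_all add: n s_simps)
    have E: "Eo (obj Y (i + 1)) * ?f = ?f" "Eo (obj Y (i + 1)) * (?b * ?p) = ?b * ?p"
      using rhomD[OF chainD(1)[OF ch, of "i + 1"]] rhomD[OF df_hom[OF Y]] by simp_all
    have "df ?Z (i + 1) * df ?Z i = (- ?a' + ?j' * ?f' + ?j' * (?b' * ?p')) * (- ?a + ?j * ?f + ?j * (?b * ?p))"
      using df_cone[OF assms, of "i + 1"] df_cone[OF assms, of i] by (simp add: n)
    \<comment> \<open>Of the square of the block matrix only the lower left entry survives; it
      vanishes because \<open>f\<close> is a chain map.\<close>
    also have "\<dots> = ?j' * (?b' * ?f) - ?j' * (?f' * ?a)"
      by (simp add: distrib_left distrib_right left_diff_distrib right_diff_distrib mult.assoc e z z[THEN mult_assoc_eq] e[THEN mult_assoc_eq] E)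
    also have "\<dots> = 0" by (simp add: e)
    finally show ?thesis .
  qed
  have "{i. \<exists>v. cdim ?Z i v \<noteq> 0} \<subseteq> {i. \<exists>v. cdim X (i + 1) v \<noteq> 0} \<union> {i. \<exists>v. cdim Y i v \<noteq> 0}" by auto
  then show "finite {i. \<exists>v. cdim ?Z i v \<noteq> 0}"
    using finite_cdim_shift[OF X] finite_cdim[OF Y] finite_subset by blast
qed

definition acyclic_cpx :: "('v, 'a) cpx \<Rightarrow> bool" where
  "acyclic_cpx X \<longleftrightarrow> (\<forall>i. \<forall>v\<in>verts Q. \<forall>x. cyc X i v x \<longrightarrow> bd X i v x)"

text \<open>The diagram chase behind the long exact sequence: injectivity of the map on cohomology
  treats the first component of a cocycle of the cone, surjectivity then corrects the
  second.\<close>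

lemma cone_acyclic:
  assumes X: "X \<in> cpxs" and Y: "Y \<in> cpxs" and f: "f \<in> chain_maps Q X Y" and q: "qis X Y (\<lambda>i. fam (f i))"
  shows "acyclic_cpx (cone Q X Y f)"
  unfolding acyclic_cpx_def
proof (intro allI ballI impI)
  let ?Z = "cone Q X Y f"
  fix i v x assume v: "v \<in> verts Q" and x: "cyc ?Z i v x"
  note ch = chain_fam[OF X Y f]
  let ?F = "\<lambda>i. fam (f i)"
  let ?j = "s_in (obj X (i + 1)) (obj Y i) v"
  let ?j' = "s_in (obj X (i + 2)) (obj Y (i + 1)) v" and ?p' = "s_out (obj X (i + 2)) (obj Y (i + 1)) v"
  \<comment> \<open>The components of \<open>x\<close>. The cocycle condition says that
    \<open>x1\<close> is a cocycle and that its image under the map is the boundary of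
    \<open>- x2\<close>.\<close>
  define x1 where "x1 = idm (cdim X (i + 1) v) * x"
  define x2 where "x2 = s_out (obj X (i + 1)) (obj Y i) v * x"
  have sx: "sized (cdim X (i + 1) v + cdim Y i v) 1 x" using x by (simp add: cyc_def)
  have x1s: "sized (cdim X (i + 1) v) 1 x1" using sx by (auto simp: x1_def sized_def simp flip: mult.assoc) (simp add: mult.assoc)
  have x2s: "sized (cdim Y i v) 1 x2"
    using sx by (simp add: x2_def sized_def s_out_def mult.assoc mult_assoc_eq[OF sh_simps(7)])
  have split: "x = x1 + ?j * x2"
  proof -
    have "x = (idm (cdim X (i + 1) v) + ?j * s_out (obj X (i + 1)) (obj Y i) v) * x"
      using sx by (simp add: sized_def s_in_def s_out_def idm_plus)
    then show ?thesis by (simp add: x1_def x2_def distrib_right mult.assoc)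
  qed
  have 2: "i + 1 + 1 = i + 2" by simp
  have hX: "rhom (obj X (i + 1)) (obj X (i + 2)) (df X (i + 1))" using df_hom[OF X, of "i + 1"] by (simp add: 2)
  have p'j': "?p' * ?j' = idm (cdim Y (i + 1) v)" by (simp add: s_in_def s_out_def)
  have "df ?Z i v * x = 0" using x by (simp add: cyc_def)
  moreover have "df ?Z i v * x = - (df X (i + 1) v * x1) + ?j' * (?F (i + 1) v * x1 + df Y i v * x2)"
    using split rhomD_at(4)[OF hX] rhomD_at(4)[OF chainD(1)[OF ch, of "i + 1"]]
    by (simp add: df_cone[OF X Y f] distrib_right distrib_left left_diff_distrib mult.assoc x1_def x2_def)
  ultimately have eq: "- (df X (i + 1) v * x1) + ?j' * (?F (i + 1) v * x1 + df Y i v * x2) = 0" by simp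
  have "idm (cdim X (i + 2) v) * (- (df X (i + 1) v * x1) + ?j' * (?F (i + 1) v * x1 + df Y i v * x2)) = - (df X (i + 1) v * x1)"
    unfolding distrib_left[of "idm _"] s_at(1) by (simp add: rhomD_at[OF hX])
  then have ax1: "df X (i + 1) v * x1 = 0" unfolding eq by simp
  have "?p' * (?j' * (?F (i + 1) v * x1 + df Y i v * x2)) = ?F (i + 1) v * x1 + df Y i v * x2"
    by (simp add: mult_assoc_eq[OF p'j'] distrib_left rhomD_at[OF df_hom[OF Y]] rhomD_at[OF chainD(1)[OF ch, of "i + 1"]])
  then have fx: "?F (i + 1) v * x1 + df Y i v * x2 = 0" using eq ax1 by simp
  have c1: "cyc X (i + 1) v x1" using x1s ax1 by (simp add: cyc_def)
  have "?F (i + 1) v * x1 = df Y i v * (- x2)" using fx by (simp add: eq_neg_iff_add_eq_0)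
  then have "bd Y (i + 1) v (?F (i + 1) v * x1)"
    unfolding bd_def using sized_uminus[OF x2s] by (intro exI[of _ "- x2"]) simp
  then have "bd X (i + 1) v x1" by (rule qisD(2)[OF q v c1])
  then obtain w where w: "sized (cdim X i v) 1 w" "x1 = df X i v * w" unfolding bd_def by auto
  \<comment> \<open>Replacing \<open>x2\<close> by this sum compensates for the choice of
    \<open>w\<close> and gives a cocycle, to which surjectivity applies.\<close>
  define y where "y = x2 + ?F i v * w"
  have "df Y i v * (?F i v * w) = ?F (i + 1) v * (df X i v * w)"
    using fun_cong[OF chainD(2)[OF ch, of i], of v] by (simp flip: mult.assoc)
  then have "cyc Y i v y"
    using x2s sized_mult[OF rhom_sized[OF chainD(1)[OF ch]] w(1)] fx w(2)
    by (simp add: cyc_def y_def sized_add distrib_left add.commute)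
  then obtain u where u: "cyc X i v u" "bd Y i v (y - ?F i v * u)" using qisD(3)[OF q v] by blast
  then obtain z where z: "sized (cdim Y (i - 1) v) 1 z" "y - ?F i v * u = df Y (i - 1) v * z" unfolding bd_def by blast
  let ?k = "s_in (obj X i) (obj Y (i - 1)) v" and ?q = "s_out (obj X i) (obj Y (i - 1)) v"
  \<comment> \<open>The primitive of \<open>x\<close>, with components \<open>u - w\<close> and
    \<open>z\<close>: the sign in the cone differential turns \<open>u - w\<close> into
    \<open>x1\<close>, as \<open>u\<close> is a cocycle, and the second component becomes
    \<open>x2\<close> by the choice of \<open>z\<close>.\<close>
  define t where "t = u - w + ?k * z"
  have us: "sized (cdim X i v) 1 u" "df X i v * u = 0" using u(1) by (simp_all add: cyc_def)
  have ts: "sized (cdim ?Z (i - 1) v) 1 t"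
  proof -
    have "idm (cdim X i v + cdim Y (i - 1) v) * ?k = ?k" by (simp add: s_in_def)
    moreover have "idm (cdim X i v + cdim Y (i - 1) v) * (u - w) = u - w"
      using us(1) w(1) mult_assoc_eq[OF idm_add(2), of "cdim X i v" "cdim Y (i - 1) v" "u - w"]
      by (simp add: sized_def right_diff_distrib)
    ultimately show ?thesis
      using us(1) w(1) z(1) unfolding t_def sized_def
      by (simp add: distrib_left distrib_right left_diff_distrib mult.assoc mult_assoc_eq[of _ ?k ?k])
  qed
  have qk: "?q * ?k = idm (cdim Y (i - 1) v)" by (simp add: s_in_def s_out_def)
  have qw: "?q * (u - w) = 0"
    using us(1) w(1) s_at(3)[of "obj X i" "obj Y (i - 1)" v "u - w"] by (simp add: sized_def right_diff_distrib)
  have n: "i - 1 + 1 = i" "i - 1 + 2 = i + 1" by simp_all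
  have "df ?Z (i - 1) v = - df X i v + ?j * ?F i v + ?j * (df Y (i - 1) v * ?q)"
    using fun_cong[OF df_cone[OF X Y f, of "i - 1", unfolded n], of v] by simp
  then have "df ?Z (i - 1) v * t = - (df X i v * (u - w)) + ?j * (?F i v * (u - w)) + ?j * (df Y (i - 1) v * z)"
    using z(1) qw hom_s_at(1)[OF df_hom[OF X, of i]] hom_s_at(1)[OF chainD(1)[OF ch, of i]]
    by (simp add: t_def distrib_left distrib_right left_diff_distrib mult.assoc mult_assoc_eq[OF qk] sized_def)
  also have "\<dots> = x1 + ?j * x2"
    using us(2) w(2) by (simp add: right_diff_distrib flip: z(2)) (simp add: y_def distrib_left right_diff_distrib)
  finally have "df ?Z (i - 1) v * t = x" using split by simp
  then show "bd ?Z i v x" unfolding bd_def using ts by blast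
qed

section \<open>Lifting along quasi-isomorphisms\<close>

text \<open>The homotopy is built by descending induction on the degree, starting above the last
  non-zero term of \<open>P\<close>. In each step the part of \<open>F\<close> still to be explained
  is a cocycle and lifts by projectivity, because \<open>Z\<close> is exact.\<close>

lemma null_homotopic:
  assumes P: "P \<in> cpxs" and prj: "\<And>i. prj (obj P i)" and Z: "Z \<in> cpxs" and ac: "acyclic_cpx Z"
    and F: "chain P Z F"
  obtains h where "\<And>i. rhom (obj P i) (obj Z (i - 1)) (h i)"
    "\<And>i. F i = df Z (i - 1) * h i + h (i + 1) * df P i"
proof -
  have "finite {i. \<exists>v. cdim P i v \<noteq> 0}" using P by (rule finite_cdim)
  then obtain N where N: "\<And>i. i \<in> {i. \<exists>v. cdim P i v \<noteq> 0} \<Longrightarrow> i \<le> N"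
    by (meson bdd_above.E bdd_above_finite)
  have "cdim P i v = 0" if "N < i" for i v using N[of i] that by force
  then have E0: "Eo (obj P i) = 0" if "N < i" for i
    using that by (auto simp: Eo_def fun_eq_iff)
  \<comment> \<open>\<open>x\<close> is the homotopy in degree \<open>N + 1 - n\<close>. The second
    conjunct says that the remainder of \<open>F\<close> one degree lower is killed by the
    differential, which is what the next lift requires; \<open>rel\<close> is the homotopy equation
    itself.\<close>
  define good where "good n x \<longleftrightarrow> (let i = N + 1 - int n in rhom (obj P i) (obj Z (i - 1)) x \<and>
     df Z (i - 1) * (x * df P (i - 1)) = F i * df P (i - 1))" for n x
  define rel where "rel n x y \<longleftrightarrow> (let i = N - int n in df Z (i - 1) * y = F i - x * df P i)" for n x y
  have "\<exists>H. \<forall>n. good n (H n) \<and> rel n (H n) (H (Suc n))"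
  proof (rule dependent_nat_choice)
    have "F (N + 1) = 0" using rhom_from_zero[OF E0 chainD(1)[OF F]] by simp
    then show "\<exists>x. good 0 x" unfolding good_def by (intro exI[of _ 0]) (simp add: rhom_zero)
  next
    fix x n assume "good n x"
    define i where "i = N - int n"
    have i: "N + 1 - int n = i + 1" "N + 1 - int (Suc n) = i" by (simp_all add: i_def)
    have x: "rhom (obj P (i + 1)) (obj Z i) x" "df Z i * (x * df P i) = F (i + 1) * df P i"
      using \<open>good n x\<close> unfolding good_def i by (simp_all add: Let_def)
    have hom: "rhom (obj P i) (obj Z i) (F i - x * df P i)"
      using chainD(1)[OF F] x(1) df_hom[OF P] by (intro rhom_diff rhom_mult)
    have "df Z i * (F i - x * df P i) = 0"
      using chainD(2)[OF F, of i] x(2) by (simp add: right_diff_distrib)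
    moreover have "\<exists>x. sized (cdim Z (i - 1) v) 1 x \<and> df Z (i - 1) v * x = y"
      if "v \<in> verts Q" "sized (cdim Z i v) 1 y" "df Z i v * y = 0" for v y
      using ac that unfolding acyclic_cpx_def cyc_def bd_def by metis
    ultimately obtain y where y: "rhom (obj P i) (obj Z (i - 1)) y" "df Z (i - 1) * y = F i - x * df P i"
      using lift_exact[OF prj cpx_reps[OF Z] cpx_reps[OF Z] df_hom'[OF Z] df_hom[OF Z] df_df'[OF Z] _ hom] by metis
    have "df Z (i - 1) * (y * df P (i - 1)) = (F i - x * df P i) * df P (i - 1)"
      by (simp add: mult_assoc_eq[OF y(2)])
    also have "\<dots> = F i * df P (i - 1)"
      by (simp add: left_diff_distrib mult.assoc df_df'[OF P])
    finally have "good (Suc n) y" unfolding good_def i using y(1) by (simp add: Let_def)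
    moreover have "rel n x y" unfolding rel_def using y(2) by (simp add: i_def)
    ultimately show "\<exists>y. good (Suc n) y \<and> rel n x y" by blast
  qed
  then obtain H where H: "\<And>n. good n (H n)" "\<And>n. rel n (H n) (H (Suc n))" by blast
  \<comment> \<open>Above degree \<open>N + 1\<close> the terms of \<open>P\<close> vanish, and so
    must the homotopy.\<close>
  define h where "h i = (if i \<le> N + 1 then H (nat (N + 1 - i)) else 0)" for i
  have hom: "rhom (obj P i) (obj Z (i - 1)) (h i)" for i
    using H(1)[of "nat (N + 1 - i)"] rhom_zero by (auto simp: h_def good_def Let_def)
  moreover have "F i = df Z (i - 1) * h i + h (i + 1) * df P i" for i
  proof (cases "i \<le> N")
    case True
    then have n: "nat (N + 1 - i) = Suc (nat (N - i))" "nat (N + 1 - (i + 1)) = nat (N - i)" by simp_all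
    have "df Z (i - 1) * H (Suc (nat (N - i))) = F i - H (nat (N - i)) * df P i"
      using H(2)[of "nat (N - i)"] True by (simp add: rel_def Let_def)
    then show ?thesis using True by (simp add: h_def n)
  next
    case False
    then have "F i = 0" "h i = 0" "df P i = 0"
      using rhom_from_zero[OF E0 chainD(1)[OF F]] rhom_from_zero[OF E0 hom] rhom_from_zero[OF E0 df_hom[OF P]] by auto
    then show ?thesis by simp
  qed
  ultimately show ?thesis by (rule that)
qed

text \<open>The composite of \<open>F\<close> with the inclusion of \<open>Y\<close> into the cone
  of \<open>S\<close> is null-homotopic, as the cone is acyclic. The component of the homotopy in
  \<open>X\<close> is the lift \<open>G\<close>, the one in \<open>Y\<close> a homotopy between
  \<open>F\<close> and \<open>S * G\<close>.\<close>

lemma lift_qis: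
  assumes P: "P \<in> cpxs" and prj: "\<And>i. prj (obj P i)" and X: "X \<in> cpxs" and Y: "Y \<in> cpxs"
    and S: "qis X Y S" and F: "qis P Y F"
  obtains G where "qis P X G"
proof -
  obtain f where f: "f \<in> chain_maps Q X Y" "\<And>i. fam (f i) = S i"
    using chain_unfam[OF X Y qisD(1)[OF S]] by metis
  then have fS: "(\<lambda>i. fam (f i)) = S" by auto
  let ?Z = "cone Q X Y f"
  note Z = cone_cpx[OF X Y f(1)]
  have dfZ: "df ?Z i = - df X (i + 1) + s_in (obj X (i + 2)) (obj Y (i + 1)) * S (i + 1) +
    s_in (obj X (i + 2)) (obj Y (i + 1)) * (df Y i * s_out (obj X (i + 1)) (obj Y i))" for i
    using df_cone[OF X Y f(1)] f(2) by simp
  have dfZ': "df ?Z (i - 1) = - df X i + s_in (obj X (i + 1)) (obj Y i) * S i +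
    s_in (obj X (i + 1)) (obj Y i) * (df Y (i - 1) * s_out (obj X i) (obj Y (i - 1)))" for i
    using dfZ[of "i - 1"] by (simp add: add.commute)
  have 2: "i + 1 + 1 = i + (2::int)" for i by simp
  note sh = cpx_shape[OF X] cpx_shape[OF Y]
  note m = rhom_sum_maps[OF sh]
  have ac: "acyclic_cpx ?Z" using cone_acyclic[OF X Y f(1)] S fS by simp
  have ch: "chain P ?Z (\<lambda>i. s_in (obj X (i + 1)) (obj Y i) * F i)"
    unfolding chain_def
  proof (intro allI conjI)
    fix i
    show "rhom (obj P i) (obj ?Z i) (s_in (obj X (i + 1)) (obj Y i) * F i)"
      using rhom_mult[OF m(3) chainD(1)[OF qisD(1)[OF F]]] by simp
    have z: "df X (i + 1) * s_in (obj X (i + 1)) (obj Y i) = 0" "S (i + 1) * s_in (obj X (i + 1)) (obj Y i) = 0"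
      by (rule hom_s(1)[OF df_hom[OF X]], rule hom_s(1)[OF chainD(1)[OF qisD(1)[OF S]]])
    show "s_in (obj X (i + 1 + 1)) (obj Y (i + 1)) * F (i + 1) * df P i =
      df ?Z i * (s_in (obj X (i + 1)) (obj Y i) * F i)"
      using chainD(2)[OF qisD(1)[OF F], of i] rhomD[OF df_hom[OF Y, of i]]
      by (simp add: dfZ distrib_right left_diff_distrib mult.assoc z[THEN mult_assoc_eq] s_simps' 2)
  qed
  obtain h where h: "\<And>i. rhom (obj P i) (obj ?Z (i - 1)) (h i)"
    "\<And>i. s_in (obj X (i + 1)) (obj Y i) * F i = df ?Z (i - 1) * h i + h (i + 1) * df P i"
    using null_homotopic[OF P prj Z ac ch] by blast
  have h': "rhom (obj P i) (rep_sum Q (obj X i) (obj Y (i - 1))) (h i)" for i using h(1)[of i] by simp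
  define G where "G i = Eo (obj X i) * h i" for i
  define K where "K i = s_out (obj X i) (obj Y (i - 1)) * h i" for i
  have GK: "rhom (obj P i) (obj X i) (G i)" "rhom (obj P i) (obj Y (i - 1)) (K i)" for i
    unfolding G_def K_def using rhom_mult[OF m(2) h'] rhom_mult[OF m(4) h'] .
  have XE: "df X i * h i = df X i * G i" "S i * h i = S i * G i" for i
    using rhomD(4)[OF df_hom[OF X]] rhomD(4)[OF chainD(1)[OF qisD(1)[OF S]]] by (simp_all add: G_def)
  \<comment> \<open>The homotopy equation with the cone differential expanded. Its first component
    says that \<open>G\<close> is a chain map, its second that \<open>K\<close> is the
    homotopy.\<close>
  have eq: "s_in (obj X (i + 1)) (obj Y i) * F i = - (df X i * G i) +
    s_in (obj X (i + 1)) (obj Y i) * (S i * G i + df Y (i - 1) * K i) + h (i + 1) * df P i" for i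
    unfolding h(2) dfZ' by (simp add: distrib_right distrib_left left_diff_distrib mult.assoc XE K_def)
  have "0 = - (df X i * G i) + G (i + 1) * df P i" for i
    using arg_cong[OF eq[of i], of "\<lambda>x. Eo (obj X (i + 1)) * x"]
    by (simp add: distrib_left right_diff_distrib s_simps' rhomD[OF df_hom[OF X]] G_def mult.assoc)
  then have "chain P X G" unfolding chain_def using GK(1) by (metis add.commute add.inverse_unique minus_minus)
  moreover have "F i = S i * G i + df Y (i - 1) * K i + K (i + 1) * df P i" for i
  proof -
    have "s_out (obj X (i + 1)) (obj Y i) * (df X i * G i) = 0"
      using mult_assoc_eq[OF hom_s(2)[OF df_hom[OF X]]] by simp
    then have "F i = Eo (obj Y i) * (S i * G i + df Y (i - 1) * K i) + K (i + 1) * df P i"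
      using arg_cong[OF eq[of i], of "\<lambda>x. s_out (obj X (i + 1)) (obj Y i) * x"]
      by (simp add: distrib_left right_diff_distrib s_simps' rhomD[OF chainD(1)[OF qisD(1)[OF F]]] K_def mult.assoc)
    then show ?thesis
      using rhomD[OF chainD(1)[OF qisD(1)[OF S]]] rhomD[OF df_hom'[OF Y]] by (simp add: distrib_left)
  qed
  ultimately have "qis P X G" using GK(2) by (intro qis_lift[OF S F])
  then show ?thesis by (rule that)
qed

text \<open>Induction along the zigzag: forward maps are composed with, backward maps are lifted
  along. Only the starting complex has to be projective.\<close>

lemma quasi_isomorphic_qis:
  assumes P: "P \<in> cpxs" and prj: "\<And>i. prj (obj P i)" and q: "quasi_isomorphic Q R P Y"
  obtains F where "qis P Y F"
proof -
  have "\<exists>F. qis P Y F"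
    using q unfolding quasi_isomorphic_def
  proof (induction rule: equivclp_induct)
    case base
    then show ?case using qis_id[OF P] by blast
  next
    case (step Y Z)
    obtain F where F: "qis P Y F" using step.IH by blast
    from step.hyps(2) show ?case
    proof
      assume "Y \<in> cpxs \<and> Z \<in> cpxs \<and> quasi_isos Q Y Z \<noteq> {}"
      then show ?thesis using quasi_isos_nonempty qis_comp[OF F] by blast
    next
      assume *: "Z \<in> cpxs \<and> Y \<in> cpxs \<and> quasi_isos Q Z Y \<noteq> {}"
      then obtain S where "qis Z Y S" using quasi_isos_nonempty by blast
      then show ?thesis using lift_qis[OF P prj _ _ _ F] * by metis
    qed
  qed
  then show ?thesis using that by blast
qed

lemma qis_quasi_isomorphic:
  assumes "X \<in> cpxs" "Y \<in> cpxs" "qis X Y F"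
  shows "quasi_isomorphic Q R X Y"
  unfolding quasi_isomorphic_def using assms quasi_isos_nonempty by (intro r_into_equivclp) blast

lemma quasi_isomorphic_sym: "quasi_isomorphic Q R X Y \<Longrightarrow> quasi_isomorphic Q R Y X"
  unfolding quasi_isomorphic_def by (rule equivclp_sym)

lemma quasi_isomorphic_trans:
  "quasi_isomorphic Q R X Y \<Longrightarrow> quasi_isomorphic Q R Y Z \<Longrightarrow> quasi_isomorphic Q R X Z"
  unfolding quasi_isomorphic_def by (rule equivclp_trans)

section \<open>Contractions\<close>

definition contr :: "('v, 'a) cpx \<Rightarrow> (int \<Rightarrow> 'v \<Rightarrow> fmat) \<Rightarrow> bool" where
  "contr X h \<longleftrightarrow> (\<forall>i. rhom (obj X i) (obj X (i - 1)) (h i) \<and>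
     df X (i - 1) * h i + h (i + 1) * df X i = Eo (obj X i))"

lemma contrD:
  assumes "contr X h"
  shows "rhom (obj X i) (obj X (i - 1)) (h i)" "rhom (obj X (i + 1)) (obj X i) (h (i + 1))"
    "df X (i - 1) * h i + h (i + 1) * df X i = Eo (obj X i)"
proof -
  show *: "rhom (obj X i) (obj X (i - 1)) (h i)" "df X (i - 1) * h i + h (i + 1) * df X i = Eo (obj X i)" for i
    using assms unfolding contr_def by blast+
  show "rhom (obj X (i + 1)) (obj X i) (h (i + 1))" using *(1)[of "i + 1"] by simp
qed

lemma contractible_iff:
  assumes X: "X \<in> cpxs"
  shows "contractible Q X \<longleftrightarrow> (\<exists>h. contr X h)"
proof
  have hX: "diff X i \<in> rep_hom Q (obj X i) (obj X (i + 1))" for i using X by (simp add: bounded_cpxs_def)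
  have hX': "diff X (i - 1) \<in> rep_hom Q (obj X (i - 1)) (obj X i)" for i using hX[of "i - 1"] by simp
  note off = cpx_shape[OF X, unfolded rep_shape_def]
  {
    assume "contractible Q X"
    then obtain h where h: "\<And>i. h i \<in> rep_hom Q (obj X i) (obj X (i - 1))"
      and eq: "\<And>i v. v \<in> verts Q \<Longrightarrow> diff X (i - 1) v * h i v + h (i + 1) v * diff X i v = 1\<^sub>m (cdim X i v)"
      unfolding contractible_def by blast
    have h': "h (i + 1) \<in> rep_hom Q (obj X (i + 1)) (obj X i)" for i using h[of "i + 1"] by simp
    have "df X (i - 1) * fam (h i) + fam (h (i + 1)) * df X i = Eo (obj X i)" for i
    proof
      fix v
      show "(df X (i - 1) * fam (h i) + fam (h (i + 1)) * df X i) v = Eo (obj X i) v"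
      proof (cases "v \<in> verts Q")
        case True
        note d = rep_hom_dims[OF hX True] rep_hom_dims[OF hX' True] rep_hom_dims[OF h True] rep_hom_dims[OF h' True]
        show ?thesis
          using arg_cong[OF eq[OF True, of i], of of_mat] True d
          by (simp add: of_mat_add of_mat_mult df_def fam_def Eo_def)
      qed (use off in \<open>simp add: df_def fam_def Eo_def\<close>)
    qed
    then show "\<exists>h. contr X h"
      unfolding contr_def using rhom_fam[OF h cpx_shape[OF X] cpx_shape[OF X]] by (intro exI[of _ "\<lambda>i. fam (h i)"]) blast
  next
    assume "\<exists>h. contr X h"
    then obtain h where h: "contr X h" ..
    define g where "g i = unfam (obj X i) (obj X (i - 1)) (h i)" for i
    have g: "g i \<in> rep_hom Q (obj X i) (obj X (i - 1))" for i
      unfolding g_def using contrD(1)[OF h] X by (intro unfam_rep_hom cpx_shape)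
    have g': "g (i + 1) \<in> rep_hom Q (obj X (i + 1)) (obj X i)" for i using g[of "i + 1"] by simp
    have gh: "fam (g i) = h i" for i
      unfolding g_def using contrD(1)[OF h] X by (intro fam_unfam cpx_shape)
    show "contractible Q X"
      unfolding contractible_def
    proof (intro exI[of _ g] conjI allI ballI g)
      fix i v assume v: "v \<in> verts Q"
      note d = rep_hom_dims[OF hX v] rep_hom_dims[OF hX' v] rep_hom_dims[OF g v] rep_hom_dims[OF g' v]
      show "diff X (i - 1) v * g i v + g (i + 1) v * diff X i v = 1\<^sub>m (cdim X i v)"
      proof (rule of_mat_eqD)
        show "of_mat (diff X (i - 1) v * g i v + g (i + 1) v * diff X i v) = of_mat (1\<^sub>m (cdim X i v))"
          using fun_cong[OF contrD(3)[OF h, of i], of v] v d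
          by (simp add: of_mat_add of_mat_mult df_def fam_def Eo_def flip: gh)
      qed (use d in simp_all)
    qed
  }
qed

text \<open>A contraction is a null-homotopy of the identity.\<close>

lemma acyclic_contr:
  assumes X: "X \<in> cpxs" and prj: "\<And>i. prj (obj X i)" and ac: "acyclic_cpx X"
  obtains h where "contr X h"
proof -
  obtain h where "\<And>i. rhom (obj X i) (obj X (i - 1)) (h i)"
    "\<And>i. Eo (obj X i) = df X (i - 1) * h i + h (i + 1) * df X i"
    using null_homotopic[OF X prj X ac chain_id[OF X]] by blast
  then have "contr X h" by (simp add: contr_def)
  then show ?thesis by (rule that)
qed

section \<open>Direct sums and isomorphisms of complexes\<close>

lemma obj_cpx_sum [simp]: "obj (cpx_sum Q X Y) i = rep_sum Q (obj X i) (obj Y i)"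
  by (simp add: cpx_sum_def)

lemma df_cpx_sum:
  assumes X: "X \<in> cpxs" and Y: "Y \<in> cpxs"
  shows "df (cpx_sum Q X Y) i = df X i + s_in (obj X (i + 1)) (obj Y (i + 1)) * (df Y i * s_out (obj X i) (obj Y i))"
proof
  fix v
  have hX: "diff X i \<in> rep_hom Q (obj X i) (obj X (i + 1))" for i using X by (simp add: bounded_cpxs_def)
  have hY: "diff Y i \<in> rep_hom Q (obj Y i) (obj Y (i + 1))" for i using Y by (simp add: bounded_cpxs_def)
  show "df (cpx_sum Q X Y) i v =
    (df X i + s_in (obj X (i + 1)) (obj Y (i + 1)) * (df Y i * s_out (obj X i) (obj Y i))) v"
  proof (cases "v \<in> verts Q")
    case True
    note d = rep_hom_dims[OF hX True] rep_hom_dims[OF hY True]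
    show ?thesis
      using True d by (simp add: df_def fam_def cpx_sum_def of_mat_block_diag s_in_def s_out_def mult.assoc)
  qed (simp add: df_def fam_def)
qed

lemma cpx_sum_facts:
  assumes X: "X \<in> cpxs" and Y: "Y \<in> cpxs"
  shows "Eo (obj X (i + 1)) * df (cpx_sum Q X Y) i = df X i * Eo (obj X i)"
    "df (cpx_sum Q X Y) i * Eo (obj X i) = Eo (obj X (i + 1)) * df X i"
    "s_out (obj X (i + 1)) (obj Y (i + 1)) * df (cpx_sum Q X Y) i = df Y i * s_out (obj X i) (obj Y i)"
    "df (cpx_sum Q X Y) i * s_in (obj X i) (obj Y i) = s_in (obj X (i + 1)) (obj Y (i + 1)) * df Y i"
  using hom_s[OF df_hom[OF X]] rhomD[OF df_hom[OF X, of i]] rhomD[OF df_hom[OF Y, of i]]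
  by (simp_all add: df_cpx_sum[OF assms] distrib_left distrib_right mult.assoc s_simps' hom_s(1)[OF df_hom[OF X]])

lemma cpx_sum_cpx:
  assumes X: "X \<in> cpxs" and Y: "Y \<in> cpxs"
  shows "cpx_sum Q X Y \<in> cpxs"
proof (rule cpxI)
  let ?Z = "cpx_sum Q X Y"
  note m = rhom_sum_maps[OF cpx_shape[OF X] cpx_shape[OF Y]]
  show "obj ?Z i \<in> reps Q R" for i using X Y by (simp add: rep_sum_reps cpx_reps)
  show "diff ?Z i \<in> (\<Pi>\<^sub>E v\<in>verts Q. carrier_mat (cdim ?Z (i + 1) v) (cdim ?Z i v))" for i
  proof -
    have hX: "diff X i \<in> rep_hom Q (obj X i) (obj X (i + 1))" for i using X by (simp add: bounded_cpxs_def)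
    have hY: "diff Y i \<in> rep_hom Q (obj Y i) (obj Y (i + 1))" for i using Y by (simp add: bounded_cpxs_def)
    show ?thesis
      using rep_hom_dims[OF hX] rep_hom_dims[OF hY] by (auto simp: cpx_sum_def intro!: carrier_matI)
  qed
  show "rhom (obj ?Z i) (obj ?Z (i + 1)) (df ?Z i)" for i
  proof -
    have "rhom (obj ?Z i) (obj ?Z (i + 1)) (Eo (obj X (i + 1)) * (df X i * Eo (obj X i)))"
      "rhom (obj ?Z i) (obj ?Z (i + 1)) (s_in (obj X (i + 1)) (obj Y (i + 1)) * (df Y i * s_out (obj X i) (obj Y i)))"
      unfolding obj_cpx_sum using m df_hom[OF X] df_hom[OF Y] by (intro rhom_mult; fast)+
    then show ?thesis
      using rhomD[OF df_hom[OF X]] by (simp add: df_cpx_sum[OF assms] rhom_add)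
  qed
  show "df ?Z (i + 1) * df ?Z i = 0" for i
    using df_df[OF X, of i] mult_assoc_eq[OF df_df[OF Y, of i]] hom_s(1)[OF df_hom[OF X, of "i + 1"]]
      mult_assoc_eq[OF hom_s(1)[OF df_hom[OF X, of "i + 1"]]] hom_s(2)[OF df_hom[OF X, of i]]
      rhomD[OF df_hom[OF Y, of i]]
    by (simp add: df_cpx_sum[OF assms] distrib_left distrib_right mult.assoc s_simps')
  have "{i. \<exists>v. cdim ?Z i v \<noteq> 0} \<subseteq> {i. \<exists>v. cdim X i v \<noteq> 0} \<union> {i. \<exists>v. cdim Y i v \<noteq> 0}" by auto
  then show "finite {i. \<exists>v. cdim ?Z i v \<noteq> 0}"
    using finite_cdim[OF X] finite_cdim[OF Y] finite_subset by blast
qed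

lemma cpx_sum_chains:
  assumes X: "X \<in> cpxs" and Y: "Y \<in> cpxs"
  shows "chain X (cpx_sum Q X Y) (\<lambda>i. Eo (obj X i))" "chain (cpx_sum Q X Y) X (\<lambda>i. Eo (obj X i))"
    "chain Y (cpx_sum Q X Y) (\<lambda>i. s_in (obj X i) (obj Y i))" "chain (cpx_sum Q X Y) Y (\<lambda>i. s_out (obj X i) (obj Y i))"
  using rhom_sum_maps[OF cpx_shape[OF X] cpx_shape[OF Y]] cpx_sum_facts[OF assms]
  by (simp_all add: chain_def)

lemma contr_acyclic: assumes X: "X \<in> cpxs" and h: "contr X h" shows "acyclic_cpx X"
  unfolding acyclic_cpx_def
proof (intro allI ballI impI)
  fix i v x assume x: "cyc X i v x"
  have "x = (df X (i - 1) * h i + h (i + 1) * df X i) v * x"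
    unfolding contrD(3)[OF h] using x by (simp add: cyc_def sized_def Eo_def)
  also have "\<dots> = df X (i - 1) v * (h i v * x)"
    using x by (simp add: cyc_def distrib_right mult.assoc)
  finally show "bd X i v x"
    unfolding bd_def using sized_mult[OF rhom_sized[OF contrD(1)[OF h]]] x unfolding cyc_def by blast
qed

text \<open>The inclusion of \<open>X\<close> is a quasi-isomorphism: the \<open>C\<close>-component
  of a cocycle is a cocycle of an acyclic complex, hence a coboundary.\<close>

lemma sum_contractible_quasi_isomorphic:
  assumes X: "X \<in> cpxs" and C: "C \<in> cpxs" and h: "contr C h"
  shows "quasi_isomorphic Q R X (cpx_sum Q X C)"
proof -
  note c = cpx_sum_chains[OF X C]
  have "qis X (cpx_sum Q X C) (\<lambda>i. Eo (obj X i))"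
    unfolding qis_def
  proof (intro conjI allI ballI impI c(1))
    fix i v assume v: "v \<in> verts Q"
    show "bd X i v x" if "cyc X i v x" "bd (cpx_sum Q X C) i v (Eo (obj X i) v * x)" for x
      using chain_bd[OF c(2) that(2)] that(1) by (simp add: cyc_def sized_def Eo_def)
    show "\<exists>x. cyc X i v x \<and> bd (cpx_sum Q X C) i v (y - Eo (obj X i) v * x)" if y: "cyc (cpx_sum Q X C) i v y" for y
    proof (intro exI conjI)
      show "cyc X i v (Eo (obj X i) v * y)" by (rule chain_cyc[OF c(2) y])
      have "bd C i v (s_out (obj X i) (obj C i) v * y)"
        using contr_acyclic[OF C h] chain_cyc[OF c(4) y] v unfolding acyclic_cpx_def by blast
      then have "bd (cpx_sum Q X C) i v (s_in (obj X i) (obj C i) v * (s_out (obj X i) (obj C i) v * y))"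
        by (rule chain_bd[OF c(3)])
      moreover have "Eo (rep_sum Q (obj X i) (obj C i)) v * y = y" using y by (simp add: cyc_def sized_def Eo_def)
      moreover have "Eo (rep_sum Q (obj X i) (obj C i)) v * y =
          Eo (obj X i) v * y + s_in (obj X i) (obj C i) v * (s_out (obj X i) (obj C i) v * y)"
        by (simp add: Eo_rep_sum distrib_right mult.assoc)
      moreover have "Eo (obj X i) v * (Eo (obj X i) v * y) = Eo (obj X i) v * y"
        by (simp add: Eo_def flip: mult.assoc)
      ultimately have "bd (cpx_sum Q X C) i v (y - Eo (obj X i) v * (Eo (obj X i) v * y))"
        by (metis add_diff_cancel_left')
      then show "bd (cpx_sum Q X C) i v (y - Eo (obj X i) v * (Eo (obj X i) v * y))" .
    qed
  qed
  then show ?thesis by (rule qis_quasi_isomorphic[OF X cpx_sum_cpx[OF X C]])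
qed

definition ciso :: "('v, 'a) cpx \<Rightarrow> ('v, 'a) cpx \<Rightarrow> bool" where
  "ciso X Y \<longleftrightarrow> (\<exists>F G. chain X Y F \<and> chain Y X G \<and> (\<forall>i. G i * F i = Eo (obj X i) \<and> F i * G i = Eo (obj Y i)))"

text \<open>A degreewise inverse of a chain map commutes with the differentials
  automatically.\<close>

lemma cisoI:
  assumes X: "X \<in> cpxs" and Y: "Y \<in> cpxs" and F: "chain X Y F" and G: "\<And>i. rhom (obj Y i) (obj X i) (G i)"
    and GF: "\<And>i. G i * F i = Eo (obj X i)" and FG: "\<And>i. F i * G i = Eo (obj Y i)"
  shows "ciso X Y"
proof -
  have "G (i + 1) * df Y i = df X i * G i" for i
  proof -
    have "G (i + 1) * df Y i = G (i + 1) * (df Y i * (F i * G i))"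
      using rhomD[OF df_hom[OF Y, of i]] FG by simp
    also have "\<dots> = (G (i + 1) * F (i + 1)) * (df X i * G i)"
      using mult_assoc_eq[OF chainD(2)[OF F, of i]] by (simp add: mult.assoc)
    also have "\<dots> = df X i * G i"
      using rhomD[OF df_hom[OF X, of i]] GF by simp
    finally show ?thesis .
  qed
  then have "chain Y X G" using G by (simp add: chain_def)
  then show ?thesis unfolding ciso_def using F GF FG by blast
qed

lemma ciso_refl: "X \<in> cpxs \<Longrightarrow> ciso X X"
  unfolding ciso_def using chain_id Eo_idem by blast

lemma ciso_sym: "ciso X Y \<Longrightarrow> ciso Y X"
  unfolding ciso_def by blast

lemma ciso_trans:
  assumes "ciso X Y" "ciso Y Z" shows "ciso X Z"
proof -
  obtain F G where 1: "chain X Y F" "chain Y X G" "\<And>i. G i * F i = Eo (obj X i)" "\<And>i. F i * G i = Eo (obj Y i)"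
    using assms(1) unfolding ciso_def by blast
  obtain F' G' where 2: "chain Y Z F'" "chain Z Y G'" "\<And>i. G' i * F' i = Eo (obj Y i)" "\<And>i. F' i * G' i = Eo (obj Z i)"
    using assms(2) unfolding ciso_def by blast
  note hs = rhomD[OF chainD(1)[OF 1(1)]] rhomD[OF chainD(1)[OF 1(2)]] rhomD[OF chainD(1)[OF 2(1)]] rhomD[OF chainD(1)[OF 2(2)]]
  have "(G i * G' i) * (F' i * F i) = Eo (obj X i)" "(F' i * F i) * (G i * G' i) = Eo (obj Z i)" for i
    by (simp_all add: mult.assoc mult_assoc_eq[OF 2(3)] mult_assoc_eq[OF 1(4)] hs 1(3) 2(4))
  then show ?thesis
    unfolding ciso_def using chain_comp[OF 1(1) 2(1)] chain_comp[OF 2(2) 1(2)] by blast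
qed

lemma ciso_quasi_isomorphic:
  assumes X: "X \<in> cpxs" and Y: "Y \<in> cpxs" and i: "ciso X Y"
  shows "quasi_isomorphic Q R X Y"
proof -
  obtain F G where F: "chain X Y F" "chain Y X G" "\<And>i. G i * F i = Eo (obj X i)" "\<And>i. F i * G i = Eo (obj Y i)"
    using i unfolding ciso_def by blast
  have GF: "G i v * (F i v * x) = idm (cdim X i v) * x" "F i v * (G i v * x) = idm (cdim Y i v) * x" for i v x
    using fun_cong[OF F(3), of i v] fun_cong[OF F(4), of i v] by (simp_all add: Eo_def flip: mult.assoc)
  have "qis X Y F"
    unfolding qis_def
  proof (intro conjI allI ballI impI F(1))
    fix i v
    show "bd X i v x" if "cyc X i v x" "bd Y i v (F i v * x)" for x
      using chain_bd[OF F(2) that(2)] that(1) by (simp add: GF cyc_def sized_def)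
    show "\<exists>x. cyc X i v x \<and> bd Y i v (y - F i v * x)" if "cyc Y i v y" for y
      using chain_cyc[OF F(2) that] that bd_zero
      by (intro exI[of _ "G i v * y"]) (simp add: GF cyc_def sized_def)
  qed
  then show ?thesis by (rule qis_quasi_isomorphic[OF X Y])
qed

lemma ciso_sum:
  assumes c: "X \<in> cpxs" "Y \<in> cpxs" "X' \<in> cpxs" "Y' \<in> cpxs" and X: "ciso X X'" and Y: "ciso Y Y'"
  shows "ciso (cpx_sum Q X Y) (cpx_sum Q X' Y')"
proof -
  obtain F G where 1: "chain X X' F" "chain X' X G" "\<And>i. G i * F i = Eo (obj X i)" "\<And>i. F i * G i = Eo (obj X' i)"
    using X unfolding ciso_def by blast
  obtain F' G' where 2: "chain Y Y' F'" "chain Y' Y G'" "\<And>i. G' i * F' i = Eo (obj Y i)" "\<And>i. F' i * G' i = Eo (obj Y' i)"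
    using Y unfolding ciso_def by blast
  note hs = rhomD[OF chainD(1)[OF 1(1)]] rhomD[OF chainD(1)[OF 1(2)]] rhomD[OF chainD(1)[OF 2(1)]] rhomD[OF chainD(1)[OF 2(2)]]
  have chain_add: "chain A B (\<lambda>i. F i + G i)" if "chain A B F" "chain A B G" for A B F G
    using that by (simp add: chain_def rhom_add distrib_left distrib_right)
  have ch: "chain (cpx_sum Q A B) (cpx_sum Q A' B') (\<lambda>i. F i + s_in (obj A' i) (obj B' i) * (G i * s_out (obj A i) (obj B i)))"
    if "A \<in> cpxs" "B \<in> cpxs" "A' \<in> cpxs" "B' \<in> cpxs" "chain A A' F" "chain B B' G" for A B A' B' F G
  proof -
    have "chain (cpx_sum Q A B) (cpx_sum Q A' B') (\<lambda>i. Eo (obj A' i) * (F i * Eo (obj A i)))"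
      by (rule chain_comp[OF chain_comp[OF cpx_sum_chains(2) that(5)] cpx_sum_chains(1)]) (use that in auto)
    moreover have "chain (cpx_sum Q A B) (cpx_sum Q A' B') (\<lambda>i. s_in (obj A' i) (obj B' i) * (G i * s_out (obj A i) (obj B i)))"
      by (rule chain_comp[OF chain_comp[OF cpx_sum_chains(4) that(6)] cpx_sum_chains(3)]) (use that in auto)
    ultimately show ?thesis
      using chain_add rhomD[OF chainD(1)[OF that(5)]] by fastforce
  qed
  have inv: "(G i + s_in A B * (G' i * s_out A' B')) * (F i + s_in A' B' * (F' i * s_out A B)) = Eo (rep_sum Q A B)"
    if "rhom A A' (F i)" "rhom B B' (F' i)" "rhom A' A (G i)" "rhom B' B (G' i)" "G i * F i = Eo A" "G' i * F' i = Eo B"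
    for i A B A' B' and F F' G G' :: "int \<Rightarrow> 'v \<Rightarrow> fmat"
    using hom_s(1)[OF that(3)] hom_s(2)[OF that(1)] rhomD[OF that(2)] rhomD[OF that(4)] that(5)
    by (simp add: distrib_left distrib_right mult.assoc s_simps' mult_assoc_eq[OF that(6)]
        mult_assoc_eq[OF hom_s(1)[OF that(3)]] Eo_rep_sum)
  show ?thesis
    unfolding ciso_def
    by (intro exI conjI allI, rule ch[OF c 1(1) 2(1)], rule ch[OF c(3,4,1,2) 1(2) 2(2)])
      (simp_all add: inv 1 2 chainD(1)[OF 1(1)] chainD(1)[OF 1(2)] chainD(1)[OF 2(1)] chainD(1)[OF 2(2)])
qed

section \<open>Contractible complexes of projectives\<close>

text \<open>\<open>h d h\<close> is again a contraction. Since \<open>d h\<close> and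
  \<open>h d\<close> are complementary, \<open>d h h d\<close> equals \<open>(1 - h d) h d\<close>,
  which is 0. The vanishing square is what makes the complement \<open>h\<close> of the cocycles
  orthogonal to the projection \<open>d h\<close>.\<close>

lemma contr_normalise:
  assumes X: "X \<in> cpxs" and h: "contr X h"
  obtains h' where "contr X h'" "\<And>i. h' i * h' (i + 1) = 0"
proof -
  have e: "df X (i - 1) * h i + h (i + 1) * df X i = Eo (obj X i)" for i by (rule contrD(3)[OF h])
  have dhd: "df X (i - 1) * (h i * df X (i - 1)) = df X (i - 1)" for i
  proof -
    have "df X (i - 2) * h (i - 1) + h i * df X (i - 1) = Eo (obj X (i - 1))" using e[of "i - 1"] by simp
    then have "df X (i - 1) * (df X (i - 2) * h (i - 1) + h i * df X (i - 1)) = df X (i - 1)"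
      using rhomD[OF df_hom'[OF X]] by simp
    moreover have "df X (i - 1) * df X (i - 2) = 0" using df_df[OF X, of "i - 2"] by simp
    ultimately show ?thesis
      by (simp add: distrib_left mult_assoc_eq[OF \<open>df X (i - 1) * df X (i - 2) = 0\<close>])
  qed
  have dhd': "df X i * (h (i + 1) * df X i) = df X i" for i using dhd[of "i + 1"] by simp
  \<comment> \<open>Both products with the differential are unchanged, by
    \<open>d h d = d\<close>.\<close>
  define h' where "h' i = h i * (df X (i - 1) * h i)" for i
  have hom: "rhom (obj X i) (obj X (i - 1)) (h' i)" for i
    unfolding h'_def by (rule rhom_mult[OF contrD(1)[OF h] rhom_mult[OF df_hom'[OF X] contrD(1)[OF h]]])
  have "df X (i - 1) * h' i + h' (i + 1) * df X i = Eo (obj X i)" for i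
  proof -
    have "df X (i - 1) * h' i = df X (i - 1) * (h i * df X (i - 1)) * h i" by (simp only: h'_def mult.assoc)
    then have 1: "df X (i - 1) * h' i = df X (i - 1) * h i" unfolding dhd .
    have "h' (i + 1) * df X i = h (i + 1) * (df X i * (h (i + 1) * df X i))" by (simp add: h'_def mult.assoc)
    then show ?thesis unfolding 1 dhd' by (simp add: e)
  qed
  moreover have "h' i * h' (i + 1) = 0" for i
  proof -
    have "df X (i - 1) * (h i * (h (i + 1) * df X i)) = (Eo (obj X i) - h (i + 1) * df X i) * (h (i + 1) * df X i)"
      using e[of i] by (simp flip: e[of i] add: mult.assoc)
    also have "\<dots> = 0"
      using rhomD[OF contrD(2)[OF h, of i]] dhd'[of i] by (simp add: left_diff_distrib mult.assoc)
    finally have "h i * (df X (i - 1) * (h i * (h (i + 1) * df X i)) * h (i + 1)) = 0" by simp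
    then show ?thesis by (simp add: h'_def mult.assoc)
  qed
  ultimately show ?thesis using that[of h'] hom by (simp add: contr_def)
qed

text \<open>A contractible complex is the sum of the complexes \<open>K i = K i\<close> in degrees \<open>i - 1\<close> and \<open>i\<close>,
  where \<open>K i\<close> is the representation of cocycles in degree \<open>i\<close>.\<close>

definition splitting ::
  "('v, 'a) cpx \<Rightarrow> (int \<Rightarrow> ('v, 'a) rep) \<Rightarrow> (int \<Rightarrow> 'v \<Rightarrow> fmat) \<Rightarrow> (int \<Rightarrow> 'v \<Rightarrow> fmat) \<Rightarrow>
     (int \<Rightarrow> 'v \<Rightarrow> fmat) \<Rightarrow> (int \<Rightarrow> 'v \<Rightarrow> fmat) \<Rightarrow> bool" where
  "splitting X K j1 q1 j2 q2 \<longleftrightarrow> (\<forall>i. K i \<in> reps Q R \<and>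
     rhom (K i) (obj X i) (j1 i) \<and> rhom (obj X i) (K i) (q1 i) \<and>
     rhom (K (i + 1)) (obj X i) (j2 i) \<and> rhom (obj X i) (K (i + 1)) (q2 i) \<and>
     j1 i * q1 i + j2 i * q2 i = Eo (obj X i) \<and> q1 i * j1 i = Eo (K i) \<and> q2 i * j2 i = Eo (K (i + 1)) \<and>
     q1 i * j2 i = 0 \<and> q2 i * j1 i = 0 \<and> df X i = j1 (i + 1) * q2 i)"

lemma splittingD:
  assumes "splitting X K j1 q1 j2 q2"
  shows "K i \<in> reps Q R" "rhom (K i) (obj X i) (j1 i)" "rhom (obj X i) (K i) (q1 i)"
    "rhom (K (i + 1)) (obj X i) (j2 i)" "rhom (obj X i) (K (i + 1)) (q2 i)"
    "j1 i * q1 i + j2 i * q2 i = Eo (obj X i)" "q1 i * j1 i = Eo (K i)" "q2 i * j2 i = Eo (K (i + 1))"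
    "q1 i * j2 i = 0" "q2 i * j1 i = 0" "df X i = j1 (i + 1) * q2 i"
  using assms unfolding splitting_def by blast+

text \<open>\<open>d h\<close> and \<open>h d\<close> are complementary idempotents. The first
  projects onto the cocycles, and \<open>h\<close> embeds the cocycles of the next degree as a
  complement, on which \<open>d\<close> is inverse to \<open>h\<close>.\<close>

lemma contr_splitting:
  assumes X: "X \<in> cpxs" and h: "contr X h"
  obtains K j1 q1 j2 q2 where "splitting X K j1 q1 j2 q2"
proof -
  obtain h where h: "contr X h" and hh: "\<And>i. h i * h (i + 1) = 0" using contr_normalise[OF assms] by blast
  have "\<exists>K B L. K \<in> reps Q R \<and> rhom K (obj X i) B \<and> L * B = Eo K \<and> df X i * B = 0 \<and>
     (\<forall>F. Eo (obj X i) * F = F \<longrightarrow> df X i * F = 0 \<longrightarrow> B * (L * F) = F) \<and>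
     (\<forall>M F. rhom M (obj X i) F \<longrightarrow> df X i * F = 0 \<longrightarrow> rhom M K (L * F))" for i
    by (rule kernel_rep[OF cpx_reps[OF X] df_hom[OF X, of i]]) blast
  then obtain K B L where K: "\<And>i. K i \<in> reps Q R" "\<And>i. rhom (K i) (obj X i) (B i)" "\<And>i. L i * B i = Eo (K i)"
    "\<And>i. df X i * B i = 0" "\<And>i F. Eo (obj X i) * F = F \<Longrightarrow> df X i * F = 0 \<Longrightarrow> B i * (L i * F) = F"
    "\<And>i M F. rhom M (obj X i) F \<Longrightarrow> df X i * F = 0 \<Longrightarrow> rhom M (K i) (L i * F)"
    by metis
  have e: "df X (i - 1) * h i + h (i + 1) * df X i = Eo (obj X i)" for i by (rule contrD(3)[OF h])
  have dhB: "df X (i - 1) * (h i * B i) = B i" for i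
  proof -
    have "B i = (df X (i - 1) * h i + h (i + 1) * df X i) * B i" unfolding e using rhomD[OF K(2)] by simp
    then show ?thesis by (simp add: distrib_right mult.assoc K(4))
  qed
  have dhB': "df X i * (h (i + 1) * B (i + 1)) = B (i + 1)" for i using dhB[of "i + 1"] by simp
  have dh: "rhom (obj X i) (obj X i) (df X (i - 1) * h i)" "df X i * (df X (i - 1) * h i) = 0" for i
    using rhom_mult[OF df_hom'[OF X] contrD(1)[OF h]] mult_assoc_eq[OF df_df'[OF X, of i]] by auto
  have BL: "B i * (L i * (df X (i - 1) * h i)) = df X (i - 1) * h i" "B (i + 1) * (L (i + 1) * df X i) = df X i" for i
    using K(5)[OF rhomD(1)[OF dh(1)] dh(2)] K(5)[OF rhomD(1)[OF df_hom[OF X]] df_df[OF X]] .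
  have "splitting X K B (\<lambda>i. L i * (df X (i - 1) * h i)) (\<lambda>i. h (i + 1) * B (i + 1)) (\<lambda>i. L (i + 1) * df X i)"
    unfolding splitting_def
  proof (intro allI conjI K(1,2))
    fix i
    show "rhom (obj X i) (K i) (L i * (df X (i - 1) * h i))" by (rule K(6)[OF dh])
    show "rhom (K (i + 1)) (obj X i) (h (i + 1) * B (i + 1))" by (rule rhom_mult[OF contrD(2)[OF h] K(2)])
    show "rhom (obj X i) (K (i + 1)) (L (i + 1) * df X i)" by (rule K(6)[OF df_hom[OF X] df_df[OF X]])
    show "B i * (L i * (df X (i - 1) * h i)) + h (i + 1) * B (i + 1) * (L (i + 1) * df X i) = Eo (obj X i)"
      using e[of i] by (simp add: mult.assoc BL)
    show "L i * (df X (i - 1) * h i) * B i = Eo (K i)" by (simp add: mult.assoc dhB K(3))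
    show "L (i + 1) * df X i * (h (i + 1) * B (i + 1)) = Eo (K (i + 1))" by (simp add: mult.assoc dhB' K(3))
    show "L i * (df X (i - 1) * h i) * (h (i + 1) * B (i + 1)) = 0"
      by (simp add: mult.assoc mult_assoc_eq[OF hh])
    show "L (i + 1) * df X i * B i = 0" by (simp add: mult.assoc K(4))
    show "df X i = B (i + 1) * (L (i + 1) * df X i)" by (simp add: BL)
  qed
  then show ?thesis by (rule that)
qed

text \<open>Tops determine projectives, and are additive. Starting from the lowest degree, the tops of
  the cocycles of a contractible complex are hence determined by those of its terms.\<close>

lemma contractible_unique:
  assumes X: "X \<in> cpxs" "contr X h" "\<And>i. prj (obj X i)"
    and Y: "Y \<in> cpxs" "contr Y h'" "\<And>i. prj (obj Y i)"
    and XY: "\<And>i. riso (obj X i) (obj Y i)"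
  shows "ciso X Y"
proof -
  obtain K j1 q1 j2 q2 where S: "splitting X K j1 q1 j2 q2" using contr_splitting[OF X(1,2)] .
  obtain K' j1' q1' j2' q2' where S': "splitting Y K' j1' q1' j2' q2'" using contr_splitting[OF Y(1,2)] .
  \<comment> \<open>One choice of tops for all representations at once, so that the dimensions of
    tops become a function of the representation.\<close>
  have "\<forall>M. \<exists>t. \<exists>q s. is_top M t q s" using ex_top by metis
  then obtain t where t: "\<And>M. \<exists>q s. is_top M (t M) q s" by metis
  then obtain q s where t: "\<And>M. is_top M (t M) (q M) (s M)" by metis
  have add: "t (obj X i) v = t (K i) v + t (K (i + 1)) v" for i v
    by (rule top_biproduct[OF t t t splittingD(2,4,3,5,6,7,8)[OF S]])
  have add': "t (obj Y i) v = t (K' i) v + t (K' (i + 1)) v" for i v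
    by (rule top_biproduct[OF t t t splittingD(2,4,3,5,6,7,8)[OF S']])
  have eq: "t (obj X i) = t (obj Y i)" for i by (rule top_iso_unique[OF t t XY])
  have "finite {i. \<exists>v. cdim X i v \<noteq> 0}" using X(1) by (rule finite_cdim)
  then obtain N where N: "\<And>i. i \<in> {i. \<exists>v. cdim X i v \<noteq> 0} \<Longrightarrow> N \<le> i"
    by (meson bdd_below.E bdd_below_finite)
  have E0: "cdim X i v = 0" if "i < N" for i v using N[of i] that by force
  \<comment> \<open>Below degree \<open>N\<close> the term of the complex is zero; its top is the
    sum of two tops, so both vanish.\<close>
  have t0: "t (K i) v = 0 \<and> t (K' i) v = 0" if i: "i < N" for i v
  proof -
    have "t (obj X i) v = 0" using top_le[OF t, of "obj X i" v] E0[OF i] by simp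
    then show ?thesis using add[of i v] add'[of i v] eq[of i] by simp
  qed
  \<comment> \<open>Additivity yields the top of \<open>K (i + 1)\<close> from those of
    \<open>K i\<close> and of the term in degree \<open>i\<close>. The induction starts at
    \<open>N - 1\<close>, where both sides are zero.\<close>
  have tK: "t (K i) v = t (K' i) v" for i v
  proof (cases "i < N")
    case False
    then have "N - 1 \<le> i" by simp
    then show ?thesis
    proof (induction i rule: int_ge_induct)
      case (step i)
      then show ?case using add[of i v] add'[of i v] eq[of i] by simp
    qed (simp add: t0)
  qed (simp add: t0)
  have "riso (K i) (K' i)" for i
  proof (rule prj_top_riso[OF splittingD(1)[OF S] _ t splittingD(1)[OF S']])
    show "prj (K i)" by (rule prj_retract[OF X(3) splittingD(2,3,7)[OF S]])
    show "prj (K' i)" by (rule prj_retract[OF Y(3) splittingD(2,3,7)[OF S']])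
    have "t (K i) = t (K' i)" using tK by blast
    then show "is_top (K' i) (t (K i)) (q (K' i)) (s (K' i))" using t by metis
  qed
  then obtain k k' where k: "\<And>i. rhom (K i) (K' i) (k i)" "\<And>i. rhom (K' i) (K i) (k' i)"
    "\<And>i. k' i * k i = Eo (K i)" "\<And>i. k i * k' i = Eo (K' i)"
    unfolding riso_def by metis
  note hs = rhomD[OF splittingD(2)[OF S]] rhomD[OF splittingD(3)[OF S]] rhomD[OF splittingD(4)[OF S]] rhomD[OF splittingD(5)[OF S]]
    rhomD[OF splittingD(2)[OF S']] rhomD[OF splittingD(3)[OF S']] rhomD[OF splittingD(4)[OF S']] rhomD[OF splittingD(5)[OF S']]
    rhomD[OF k(1)] rhomD[OF k(2)]
  note as = splittingD(7-10)[OF S] splittingD(7-10)[OF S'] k(3,4)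
  note as' = as as[THEN mult_assoc_eq]
  show ?thesis
  proof (rule cisoI[OF X(1) Y(1)])
    \<comment> \<open>Each summand is carried over by its own isomorphism. In degree
      \<open>i\<close> the summands \<open>K i\<close> and \<open>K (i + 1)\<close> meet, and the
      differential identifies the second with its copy in degree \<open>i + 1\<close>.\<close>
    show "chain X Y (\<lambda>i. j1' i * (k i * q1 i) + j2' i * (k (i + 1) * q2 i))"
      unfolding chain_def
    proof (intro allI conjI)
      fix i
      show "rhom (obj X i) (obj Y i) (j1' i * (k i * q1 i) + j2' i * (k (i + 1) * q2 i))"
        by (intro rhom_add rhom_mult) (rule splittingD[OF S] splittingD[OF S'] k(1))+
      show "(j1' (i + 1) * (k (i + 1) * q1 (i + 1)) + j2' (i + 1) * (k (i + 1 + 1) * q2 (i + 1))) * df X i =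
        df Y i * (j1' i * (k i * q1 i) + j2' i * (k (i + 1) * q2 i))"
        by (simp add: splittingD(11)[OF S, of i] splittingD(11)[OF S', of i] distrib_left distrib_right mult.assoc as' hs)
    qed
    show "rhom (obj Y i) (obj X i) (j1 i * (k' i * q1' i) + j2 i * (k' (i + 1) * q2' i))" for i
      by (intro rhom_add rhom_mult) (rule splittingD[OF S] splittingD[OF S'] k(2))+
    show "(j1 i * (k' i * q1' i) + j2 i * (k' (i + 1) * q2' i)) * (j1' i * (k i * q1 i) + j2' i * (k (i + 1) * q2 i)) = Eo (obj X i)"
      "(j1' i * (k i * q1 i) + j2' i * (k (i + 1) * q2 i)) * (j1 i * (k' i * q1' i) + j2 i * (k' (i + 1) * q2' i)) = Eo (obj Y i)" for i
      by (simp_all add: distrib_left distrib_right mult.assoc as' hs splittingD(6)[OF S] splittingD(6)[OF S'])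
  qed
qed

section \<open>Stabilising a homotopy equivalence to an isomorphism\<close>

text \<open>Both sides are isomorphic to the mapping cylinder of \<open>f\<close>. In coordinates, with \<open>h\<close> a contraction of
  the cone and \<open>w = x - pr\<^sub>1 (h (x', y))\<close>, the isomorphism takes \<open>(x, (x', y))\<close> to \<open>(y + f w, (- x', w))\<close>.\<close>

lemma cylinder_iso:
  assumes X: "X \<in> cpxs" and Y: "Y \<in> cpxs" and f: "f \<in> chain_maps Q X Y" and h: "contr (cone Q X Y f) h"
    and g: "g \<in> chain_maps Q X X" "\<And>i. fam (g i) = Eo (obj X i)"
  shows "ciso (cpx_sum Q X (cone Q X Y f)) (cpx_sum Q Y (cone Q X X g))"
proof -
  define Z where "Z = cone Q X Y f"
  define C where "C = cone Q X X g"
  have Zc: "Z \<in> cpxs" and Cc: "C \<in> cpxs" unfolding Z_def C_def by (rule cone_cpx[OF X Y f], rule cone_cpx[OF X X g(1)])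
  note ch = chain_fam[OF X Y f]
  have objZ: "obj Z i = rep_sum Q (obj X (i + 1)) (obj Y i)" and objC: "obj C i = rep_sum Q (obj X (i + 1)) (obj X i)" for i
    by (simp_all add: Z_def C_def)
  have 2: "i + 1 + 1 = i + (2::int)" "i - 1 + 1 = i" "i - 1 + 2 = i + 1" for i by simp_all
  define F where "F i = fam (f i)" for i
  define e where "e i = Eo (obj X i)" for i
  define eY where "eY i = Eo (obj Y i)" for i
  define pZ where "pZ i = s_out (obj X i) (obj Z i)" for i
  define iZ where "iZ i = s_in (obj X i) (obj Z i)" for i
  define pC where "pC i = s_out (obj Y i) (obj C i)" for i
  define iC where "iC i = s_in (obj Y i) (obj C i)" for i
  define sX where "sX i = s_in (obj X (i + 1)) (obj X i)" for i
  define oX where "oX i = s_out (obj X (i + 1)) (obj X i)" for i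
  define sY where "sY i = s_in (obj X (i + 1)) (obj Y i)" for i
  define oY where "oY i = s_out (obj X (i + 1)) (obj Y i)" for i
  define A where "A i = rep_sum Q (obj X i) (obj Z i)" for i
  define B where "B i = rep_sum Q (obj Y i) (obj C i)" for i
  note defs = e_def eY_def pZ_def iZ_def pC_def iC_def sX_def oX_def sY_def oY_def A_def B_def F_def
  note sh = cpx_shape[OF X] cpx_shape[OF Y] cpx_shape[OF Zc] cpx_shape[OF Cc]
  have homs: "rhom (obj X i) (A i) (e i)" "rhom (A i) (obj X i) (e i)" "rhom (obj Z i) (A i) (iZ i)" "rhom (A i) (obj Z i) (pZ i)"
    "rhom (obj Y i) (B i) (eY i)" "rhom (B i) (obj Y i) (eY i)" "rhom (obj C i) (B i) (iC i)" "rhom (B i) (obj C i) (pC i)"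
    "rhom (obj X (i + 1)) (obj Z i) (e (i + 1))" "rhom (obj Z i) (obj X (i + 1)) (e (i + 1))"
    "rhom (obj Y i) (obj Z i) (sY i)" "rhom (obj Z i) (obj Y i) (oY i)"
    "rhom (obj X (i + 1)) (obj C i) (e (i + 1))" "rhom (obj C i) (obj X (i + 1)) (e (i + 1))"
    "rhom (obj X i) (obj C i) (sX i)" "rhom (obj C i) (obj X i) (oX i)" for i
    unfolding defs objZ objC by (rule rhom_sum_maps sh rep_shape_sum)+
  have hF: "rhom (obj X i) (obj Y i) (F i)" for i unfolding F_def by (rule chainD(1)[OF ch])
  have hh: "rhom (obj Z i) (obj Z (i - 1)) (h i)" for i unfolding Z_def by (rule contrD(1)[OF h])
  have hd: "rhom (obj X i) (obj X (i + 1)) (df X i)" "rhom (obj Y i) (obj Y (i + 1)) (df Y i)" for i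
    by (rule df_hom[OF X], rule df_hom[OF Y])
  have hd2: "rhom (obj X (i + 1)) (obj X (i + 2)) (df X (i + 1))" for i using hd(1)[of "i + 1"] by (simp add: 2)
  have hh': "rhom (obj Z i) (obj X i) (e i * h i)" for i
    using rhom_mult[OF homs(10)[of "i - 1"], of "obj Z i" "h i"] hh by (simp add: 2)
  have E: "pZ i * e i = 0" "pZ i * iZ i = Eo (obj Z i)" "e i * iZ i = 0"
    "pC i * eY i = 0" "pC i * iC i = Eo (obj C i)" "eY i * iC i = 0"
    "oY i * e (i + 1) = 0" "oY i * sY i = eY i" "e (i + 1) * sY i = 0"
    "oX i * e (i + 1) = 0" "oX i * sX i = e i" "e (i + 1) * sX i = 0"
    "e i * e i = e i" "eY i * eY i = eY i" for i
    by (simp_all add: defs s_simps)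
  have sums: "Eo (A i) = e i + iZ i * pZ i" "Eo (B i) = eY i + iC i * pC i"
    "Eo (obj Z i) = e (i + 1) + sY i * oY i" "Eo (obj C i) = e (i + 1) + sX i * oX i" for i
    by (simp_all add: defs Eo_rep_sum objZ objC)
  have ab: "sX i * e i = sX i" "e i * oX i = oX i" "sY i * eY i = sY i" "eY i * oY i = oY i"
    "e (i + 1) * e (i + 1) = e (i + 1)" "F i * e i = F i" "eY i * F i = F i"
    "df X i * e i = df X i" "e (i + 1) * df X i = df X i" "df Y i * eY i = df Y i"
    "Eo (obj Z i) * pZ i = pZ i" "iZ i * Eo (obj Z i) = iZ i" "Eo (obj C i) * pC i = pC i" "iC i * Eo (obj C i) = iC i"
    "Eo (obj C i) * sX i = sX i" "Eo (obj Z i) * sY i = sY i" "Eo (obj C i) * e (i + 1) = e (i + 1)" "Eo (obj Z i) * e (i + 1) = e (i + 1)"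
    "e (i + 1) * Eo (obj Z i) = e (i + 1)" for i
    using rhomD[OF hF[of i]] rhomD[OF hd(1)[of i]] rhomD[OF hd(2)[of i]] rhomD[OF homs(9)[of i]] rhomD[OF homs(10)[of i]]
      rhomD[OF homs(13)[of i]] rhomD[OF homs(15)[of i]] rhomD[OF homs(11)[of i]] rhomD[OF homs(3)[of i]] rhomD[OF homs(4)[of i]]
      rhomD[OF homs(7)[of i]] rhomD[OF homs(8)[of i]] rhomD[OF homs(12)[of i]] rhomD[OF homs(16)[of i]]
    by (simp_all add: e_def eY_def)
  have dA: "df (cpx_sum Q X Z) i = df X i + iZ (i + 1) * (df Z i * pZ i)" for i
    using df_cpx_sum[OF X Zc] by (simp add: defs)
  have dB: "df (cpx_sum Q Y C) i = df Y i + iC (i + 1) * (df C i * pC i)" for i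
    using df_cpx_sum[OF Y Cc] by (simp add: defs)
  have dZ: "df Z i = - df X (i + 1) + sY (i + 1) * F (i + 1) + sY (i + 1) * (df Y i * oY i)" for i
    using df_cone[OF X Y f, of i] by (simp add: Z_def defs 2)
  have dC: "df C i = - df X (i + 1) + sX (i + 1) * e (i + 1) + sX (i + 1) * (df X i * oX i)" for i
    using df_cone[OF X X g(1), of i] by (simp add: C_def defs 2 g(2))
  have zeros: "pZ (i + 1) * df X i = 0" "oY (i + 1) * df X (i + 1) = 0" "df X (i + 1) * sX i = 0"
    "df Y i * iC i = 0" "pC i * F i = 0" "pC i * oY i = 0" "F (i + 1) * sY i = 0" "df X (i + 1) * sY i = 0" "sX (i + 1) * sX i = 0" "pZ i * oX i = 0" for i
    using hom_s(2)[OF homs(16)] hom_s(1)[OF homs(15)[of "i + 1"]] hom_s(2)[OF hd(1)] hom_s(2)[OF hd2] hom_s(1)[OF hd2] hom_s(1)[OF hd(2)] hom_s(2)[OF hF]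
      hom_s(2)[OF homs(12)] hom_s(1)[OF hF]
    by (simp_all add: defs 2)
  note ring = distrib_left distrib_right left_diff_distrib right_diff_distrib mult.assoc
  note rules = E ab zeros E[THEN mult_assoc_eq] ab[THEN mult_assoc_eq] zeros[THEN mult_assoc_eq]
  have e2: "e (i + 2) * df X (i + 1) = df X (i + 1)" "e (i + 2) * sY (i + 1) = 0" for i
    using ab(9)[of "i + 1"] E(9)[of "i + 1"] by (simp_all add: 2)
  \<comment> \<open>The first row of the equation saying that \<open>h\<close> contracts the cone;
    the sign comes from the first row of the cone differential.\<close>
  have ehd: "e (i + 1) * (h (i + 1) * df Z i) = e (i + 1) + df X i * h i" for i
  proof -
    have "df Z (i - 1) * h i + h (i + 1) * df Z i = Eo (obj Z i)" unfolding Z_def by (rule contrD(3)[OF h])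
    then have "h (i + 1) * df Z i = Eo (obj Z i) - df Z (i - 1) * h i" by (simp add: eq_diff_eq add.commute)
    moreover have "e (i + 1) * df Z (i - 1) = - df X i"
      unfolding dZ[of "i - 1"] 2 by (simp add: ring rules)
    ultimately show ?thesis by (simp add: ring rules mult_assoc_eq[of "e (i + 1)" "df Z (i - 1)"])
  qed
  \<comment> \<open>\<open>W\<close> is the coordinate \<open>w\<close>, while \<open>r\<close> and
    \<open>y\<close> extract x' and y. \<open>T\<close> is then the announced map.\<close>
  define W where "W i = e i - e i * (h i * pZ i)" for i
  define r where "r i = e (i + 1) * pZ i" for i
  define y where "y i = oY i * pZ i" for i
  define T where "T i = y i + F i * W i + iC i * (sX i * W i - r i)" for i
  \<comment> \<open>The inverse takes (y, (a, w)) to (w + pr1 (h z), z) with z = (- a, y - f w).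
    Here \<xi> reads off w, \<open>V\<close> is z, and \<open>U\<close> is the inverse.\<close>
  define \<xi> where "\<xi> i = oX i * pC i" for i
  define V where "V i = sY i * (eY i - F i * \<xi> i) - e (i + 1) * pC i" for i
  define U where "U i = \<xi> i + e i * (h i * V i) + iZ i * V i" for i
  have hW: "rhom (A i) (obj X i) (W i)" for i
    unfolding W_def using rhom_diff[OF homs(2) rhom_mult[OF hh' homs(4)]] by (simp add: mult.assoc)
  have hr: "rhom (A i) (obj X (i + 1)) (r i)" for i unfolding r_def by (rule rhom_mult[OF homs(10,4)])
  have hy: "rhom (A i) (obj Y i) (y i)" for i unfolding y_def by (rule rhom_mult[OF homs(12,4)])
  have hx: "rhom (B i) (obj X i) (\<xi> i)" for i unfolding \<xi>_def by (rule rhom_mult[OF homs(16,8)])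
  have hV: "rhom (B i) (obj Z i) (V i)" for i
    unfolding V_def
    by (rule rhom_diff[OF rhom_mult[OF homs(11) rhom_diff[OF homs(6) rhom_mult[OF hF hx]]] rhom_mult[OF homs(9) rhom_mult[OF homs(14,8)]], unfolded mult_assoc_eq[OF E(13)]])
  have hT: "rhom (A i) (B i) (T i)" for i
  proof -
    have "rhom (A i) (B i) (eY i * (y i + F i * W i) + iC i * (sX i * W i - e (i + 1) * r i))"
      by (rule rhom_add[OF rhom_mult[OF homs(5) rhom_add[OF hy rhom_mult[OF hF hW]]]
        rhom_mult[OF homs(7) rhom_diff[OF rhom_mult[OF homs(15) hW] rhom_mult[OF homs(13) hr]]]])
    then show ?thesis by (simp add: T_def r_def y_def ring rules)
  qed
  have hU: "rhom (B i) (A i) (U i)" for i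
  proof -
    have "rhom (B i) (A i) (e i * (\<xi> i + e i * h i * V i) + iZ i * V i)"
      by (rule rhom_add[OF rhom_mult[OF homs(1) rhom_add[OF hx rhom_mult[OF hh' hV]]] rhom_mult[OF homs(3) hV]])
    then show ?thesis by (simp add: U_def \<xi>_def ring rules)
  qed
  have "ciso (cpx_sum Q X Z) (cpx_sum Q Y C)"
  proof (rule cisoI[OF cpx_sum_cpx[OF X Zc] cpx_sum_cpx[OF Y Cc]])
    show "chain (cpx_sum Q X Z) (cpx_sum Q Y C) T"
      unfolding chain_def
    proof (intro allI conjI)
      fix i
      show "rhom (obj (cpx_sum Q X Z) i) (obj (cpx_sum Q Y C) i) (T i)" using hT[of i] by (simp add: A_def B_def)
      let ?d = "df (cpx_sum Q X Z) i"
      have pd: "pZ (i + 1) * ?d = df Z i * pZ i"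
        using rhomD(3)[OF df_hom[OF Zc]] by (simp add: dA ring rules)
      have WD: "W (i + 1) * ?d = df X i * W i - r i"
      proof -
        have "e (i + 1) * ?d = df X i" by (simp add: dA ring rules)
        moreover have "e (i + 1) * (h (i + 1) * (df Z i * pZ i)) = e (i + 1) * pZ i + df X i * (h i * pZ i)"
          using arg_cong[OF ehd[of i], of "\<lambda>x. x * pZ i"] by (simp add: distrib_right mult.assoc)
        ultimately show ?thesis
          by (simp add: W_def r_def ring pd rules)
      qed
      have rD: "r (i + 1) * ?d = - (df X (i + 1) * r i)"
        by (simp add: r_def ring pd 2) (simp add: dZ ring rules e2 e2[THEN mult_assoc_eq])
      have yD: "y (i + 1) * ?d = F (i + 1) * r i + df Y i * y i"
        using rhomD(3)[OF hF[of "i + 1"]] rhomD(3)[OF hd(2)[of i]]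
        by (simp add: y_def r_def ring pd) (simp add: dZ ring rules eY_def)
      have Fd: "F (i + 1) * df X i = df Y i * F i" unfolding F_def by (rule chainD(2)[OF ch])
      have "T (i + 1) * ?d = F (i + 1) * r i + df Y i * y i + F (i + 1) * (df X i * W i - r i)
        + iC (i + 1) * (sX (i + 1) * (df X i * W i - r i) + df X (i + 1) * r i)"
        by (simp add: T_def distrib_left distrib_right left_diff_distrib right_diff_distrib mult.assoc WD rD yD)
      also have "\<dots> = df Y i * (y i + F i * W i) + iC (i + 1) * (sX (i + 1) * (df X i * W i - r i) + df X (i + 1) * r i)"
        by (simp add: ring mult_assoc_eq[OF Fd])
      also have "\<dots> = df (cpx_sum Q Y C) i * T i"
      proof -
        have "pC i * T i = sX i * W i - r i"
          by (simp add: T_def y_def r_def ring rules)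
        moreover have "df C i * (sX i * W i - r i) = sX (i + 1) * (df X i * W i - r i) + df X (i + 1) * r i"
          by (simp add: dC r_def ring rules)
        moreover have "df Y i * T i = df Y i * (y i + F i * W i)" by (simp add: T_def ring rules)
        ultimately show ?thesis by (simp add: dB distrib_right mult.assoc)
      qed
      finally show "T (i + 1) * ?d = df (cpx_sum Q Y C) i * T i" .
    qed
    fix i
    show "rhom (obj (cpx_sum Q Y C) i) (obj (cpx_sum Q X Z) i) (U i)" using hU[of i] by (simp add: A_def B_def)
    have VT: "V i * T i = pZ i"
    proof -
      have "\<xi> i * T i = W i" "e (i + 1) * (pC i * T i) = - r i"
        using rhomD(1)[OF hW[of i]] by (simp_all add: \<xi>_def T_def y_def r_def ring rules flip: e_def)
      moreover have "eY i * T i = y i + F i * W i" by (simp add: T_def y_def ring rules)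
      ultimately have "V i * T i = sY i * y i + r i" by (simp add: V_def ring)
      also have "\<dots> = Eo (obj Z i) * pZ i" unfolding sums(3) by (simp add: y_def r_def ring add.commute)
      finally show ?thesis by (simp add: ab)
    qed
    have xT: "\<xi> i * T i = W i"
      using rhomD(1)[OF hW[of i]] by (simp add: \<xi>_def T_def y_def r_def ring rules flip: e_def)
    have "U i * T i = e i + iZ i * pZ i"
      by (simp add: U_def ring VT xT W_def)
    then show "U i * T i = Eo (obj (cpx_sum Q X Z) i)" using sums(1)[of i] by (simp add: A_def)
    have WU: "W i * U i = \<xi> i"
      using rhomD(1)[OF hx[of i]] rhomD(1)[OF hV[of i]] by (simp add: W_def U_def ring rules \<xi>_def)
    have pU: "pZ i * U i = V i"
      using rhomD(1)[OF hV[of i]] by (simp add: U_def \<xi>_def ring rules)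
    have rU: "r i * U i = - (e (i + 1) * pC i)" by (simp add: r_def ring pU) (simp add: V_def ring rules)
    have yU: "y i * U i = eY i - F i * \<xi> i" by (simp add: y_def ring pU) (simp add: V_def ring rules)
    have "T i * U i = eY i + iC i * ((sX i * oX i + e (i + 1)) * pC i)"
      by (simp add: T_def ring WU rU yU \<xi>_def)
    also have "\<dots> = eY i + iC i * (Eo (obj C i) * pC i)" unfolding sums(4) by (simp add: add.commute)
    also have "\<dots> = Eo (B i)" by (simp add: ab sums(2))
    finally show "T i * U i = Eo (obj (cpx_sum Q Y C) i)" by (simp add: B_def)
  qed
  then show ?thesis unfolding Z_def C_def .
qed

end

section \<open>The action of the general linear groups\<close>

lemma unit_mat:
  assumes "A \<in> Units (ring_mat TYPE(complex) n ())"
  shows "A \<in> carrier_mat n n" "inverse_mat A \<in> carrier_mat n n"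
    "A * inverse_mat A = 1\<^sub>m n" "inverse_mat A * A = 1\<^sub>m n"
proof -
  interpret ring "ring_mat TYPE(complex) n ()" by (rule ring_mat)
  show A: "A \<in> carrier_mat n n" using Units_closed[OF assms] by (simp add: ring_mat_simps)
  then have "inverse_mat A = inv\<^bsub>ring_mat TYPE(complex) n ()\<^esub> A" by (simp add: inverse_mat_def)
  then show "inverse_mat A \<in> carrier_mat n n" "A * inverse_mat A = 1\<^sub>m n" "inverse_mat A * A = 1\<^sub>m n"
    using Units_inv_closed[OF assms] Units_r_inv[OF assms] Units_l_inv[OF assms] by (simp_all add: ring_mat_simps)
qed

lemma unit_matI:
  "A \<in> carrier_mat n n \<Longrightarrow> B \<in> carrier_mat n n \<Longrightarrow> A * B = 1\<^sub>m n \<Longrightarrow> B * A = 1\<^sub>m n \<Longrightarrow>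
     A \<in> Units (ring_mat TYPE(complex) n ())"
  by (auto simp: Units_def ring_mat_simps)

context bound_quiver_algebra
begin

text \<open>Zero off the vertex set, in accordance with \<open>fam\<close>, because a dimension
  sequence may be non-zero there.\<close>

definition Ed :: "(int \<Rightarrow> 'v \<Rightarrow> nat) \<Rightarrow> int \<Rightarrow> 'v \<Rightarrow> fmat" where
  "Ed ds i v = (if v \<in> verts Q then idm (ds i v) else 0)"

definition gl :: "(int \<Rightarrow> 'v \<Rightarrow> complex mat) \<Rightarrow> int \<Rightarrow> 'v \<Rightarrow> fmat" where
  "gl g i = fam (g i)"

definition gli :: "(int \<Rightarrow> 'v \<Rightarrow> complex mat) \<Rightarrow> int \<Rightarrow> 'v \<Rightarrow> fmat" where
  "gli g i = fam (\<lambda>v. inverse_mat (g i v))"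

lemma Ed_cdim: "X \<in> cpxs \<Longrightarrow> Ed (cdim X) i = Eo (obj X i)"
  using cpx_shape[of X i] by (auto simp: Ed_def Eo_def fun_eq_iff rep_shape_def)

lemma GL_seqD:
  assumes "g \<in> GL_seq Q ds" "v \<in> verts Q"
  shows "g i v \<in> carrier_mat (ds i v) (ds i v)" "inverse_mat (g i v) \<in> carrier_mat (ds i v) (ds i v)"
    "g i v * inverse_mat (g i v) = 1\<^sub>m (ds i v)" "inverse_mat (g i v) * g i v = 1\<^sub>m (ds i v)"
proof -
  have "g i v \<in> Units (ring_mat TYPE(complex) (ds i v) ())" using assms by (auto simp: GL_seq_def)
  from unit_mat[OF this] show "g i v \<in> carrier_mat (ds i v) (ds i v)" "inverse_mat (g i v) \<in> carrier_mat (ds i v) (ds i v)"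
    "g i v * inverse_mat (g i v) = 1\<^sub>m (ds i v)" "inverse_mat (g i v) * g i v = 1\<^sub>m (ds i v)" .
qed

lemma gl_facts:
  assumes g: "g \<in> GL_seq Q ds"
  shows "gl g i * gli g i = Ed ds i" "gli g i * gl g i = Ed ds i" "Ed ds i * gl g i = gl g i" "gl g i * Ed ds i = gl g i"
    "Ed ds i * gli g i = gli g i" "gli g i * Ed ds i = gli g i"
proof -
  have m: "of_mat (g i v) * of_mat (inverse_mat (g i v)) = idm (ds i v)"
    "of_mat (inverse_mat (g i v)) * of_mat (g i v) = idm (ds i v)" if "v \<in> verts Q" for v
    using GL_seqD[OF g that, of i] by (auto simp flip: of_mat_mult)
  show "gl g i * gli g i = Ed ds i" "gli g i * gl g i = Ed ds i" "Ed ds i * gl g i = gl g i" "gl g i * Ed ds i = gl g i"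
    "Ed ds i * gli g i = gli g i" "gli g i * Ed ds i = gli g i"
    using m sized_of_mat[OF GL_seqD(1)[OF g]] sized_of_mat[OF GL_seqD(2)[OF g]]
    by (auto simp: gl_def gli_def Ed_def fam_def fun_eq_iff sized_def)
qed

text \<open>\<open>inverse_mat\<close> is an abstract inverse in a ring of square matrices. This
  identifies it with any explicit left inverse.\<close>

lemma gli_unique:
  assumes g: "g \<in> GL_seq Q ds" and B: "B * gl g i = Ed ds i" "B * Ed ds i = B"
  shows "gli g i = B"
proof -
  have "gli g i = B * gl g i * gli g i" using gl_facts(5)[OF g] B by simp
  also have "\<dots> = B" by (simp only: mult.assoc gl_facts(1)[OF g] B(2))
  finally show ?thesis .
qed

lemma GL_seqI:
  assumes "\<And>i. g i \<in> extensional (verts Q)"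
    and "\<And>i v. v \<in> verts Q \<Longrightarrow> g i v \<in> carrier_mat (ds i v) (ds i v)"
    and "\<And>i v. v \<in> verts Q \<Longrightarrow> h i v \<in> carrier_mat (ds i v) (ds i v)"
    and "\<And>i v. v \<in> verts Q \<Longrightarrow> of_mat (g i v) * of_mat (h i v) = idm (ds i v)"
    and "\<And>i v. v \<in> verts Q \<Longrightarrow> of_mat (h i v) * of_mat (g i v) = idm (ds i v)"
  shows "g \<in> GL_seq Q ds"
proof -
  have "g i v \<in> Units (ring_mat TYPE(complex) (ds i v) ())" if v: "v \<in> verts Q" for i v
  proof (rule unit_matI)
    show c: "g i v \<in> carrier_mat (ds i v) (ds i v)" "h i v \<in> carrier_mat (ds i v) (ds i v)" using assms v by auto
    show "g i v * h i v = 1\<^sub>m (ds i v)" "h i v * g i v = 1\<^sub>m (ds i v)"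
      using c assms(4,5)[OF v, of i] by (auto intro!: of_mat_eqD simp: of_mat_mult)
  qed
  then show ?thesis using assms(1) by (auto simp: GL_seq_def PiE_def)
qed

lemma rdim_conj [simp]: "rdim (obj (conj_act Q g X) i) = rdim (obj X i)"
  by (simp add: conj_act_def)

lemma act_conj:
  assumes X: "X \<in> cpxs" and g: "g \<in> GL_seq Q (cdim X)" and a: "a \<in> arcs Q"
  shows "act (obj (conj_act Q g X) i) a = gl g i (head Q a) * (act (obj X i) a * gli g i (tail Q a))"
proof -
  have "rmap (obj X i) a \<in> carrier_mat (cdim X i (head Q a)) (cdim X i (tail Q a))"
    using cpx_shape[OF X, of i] a by (auto simp: rep_shape_def)
  then show ?thesis
    using a GL_seqD[OF g, of "head Q a" i] GL_seqD[OF g, of "tail Q a" i]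
    by (simp add: act_def conj_act_def gl_def gli_def fam_def of_mat_mult mult.assoc)
qed

lemma df_conj:
  assumes X: "X \<in> cpxs" and g: "g \<in> GL_seq Q (cdim X)"
  shows "df (conj_act Q g X) i = gl g (i + 1) * (df X i * gli g i)"
proof
  fix v
  have hX: "diff X i \<in> rep_hom Q (obj X i) (obj X (i + 1))" for i using X by (simp add: bounded_cpxs_def)
  show "df (conj_act Q g X) i v = (gl g (i + 1) * (df X i * gli g i)) v"
    using GL_seqD[OF g, of v i] GL_seqD[OF g, of v "i + 1"] rep_hom_dims[OF hX, of v i]
    by (auto simp: df_def conj_act_def gl_def gli_def fam_def of_mat_mult mult.assoc)
qed

text \<open>Conjugation transports the structure along \<open>g\<close>, so that \<open>g\<close>
  itself is an isomorphism onto the conjugate, with inverse \<open>gli g\<close>.\<close>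

lemma conj_hom:
  assumes X: "X \<in> cpxs" and g: "g \<in> GL_seq Q (cdim X)"
  shows "rep_shape (obj (conj_act Q g X) i)" "Eo (obj (conj_act Q g X) i) = Eo (obj X i)"
    "rhom (obj X i) (obj (conj_act Q g X) i) (gl g i)" "rhom (obj (conj_act Q g X) i) (obj X i) (gli g i)"
proof -
  let ?Y = "conj_act Q g X"
  note f = gl_facts[OF g, of i, unfolded Ed_cdim[OF X]]
  show sh: "rep_shape (obj ?Y i)"
  proof -
    have "rmap (obj ?Y i) a \<in> carrier_mat (cdim ?Y i (head Q a)) (cdim ?Y i (tail Q a))" if a: "a \<in> arcs Q" for a
      using a GL_seqD(1)[OF g, of "head Q a" i] GL_seqD(2)[OF g, of "tail Q a" i]
      by (auto simp: conj_act_def)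
    then show ?thesis using cpx_shape[OF X, of i] unfolding rep_shape_def by (auto simp: conj_act_def)
  qed
  show E: "Eo (obj ?Y i) = Eo (obj X i)" by (simp add: Eo_def)
  have at: "gli g i v * gl g i v = idm (cdim X i v)" for v
    using fun_cong[OF f(2), of v] by (simp add: Eo_def)
  have act: "act (obj X i) a * idm (cdim X i (tail Q a)) = act (obj X i) a"
    "idm (cdim X i (head Q a)) * (act (obj X i) a * x) = act (obj X i) a * x" if "a \<in> arcs Q" for a x
    using act_sized[OF cpx_shape[OF X] that] by (simp_all flip: mult.assoc)
  show "rhom (obj X i) (obj ?Y i) (gl g i)" "rhom (obj ?Y i) (obj X i) (gli g i)"
    unfolding rhom_def E using f
    by (auto simp: act_conj[OF X g] mult.assoc at mult_assoc_eq[OF at] act)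
qed

lemma conj_cpx:
  assumes X: "X \<in> cpxs" and g: "g \<in> GL_seq Q (cdim X)"
  shows "conj_act Q g X \<in> cpxs" "ciso X (conj_act Q g X)"
proof -
  let ?Y = "conj_act Q g X"
  note f = gl_facts[OF g, unfolded Ed_cdim[OF X]]
  note h = conj_hom[OF X g]
  show Y: "?Y \<in> cpxs"
  proof (rule cpxI)
    show "obj ?Y i \<in> reps Q R" for i
      by (rule reps_subrep[OF cpx_reps[OF X] cpx_reps[OF X] h(1)[of i] h(4)[of i] h(4)[of i], of "gl g i" 0])
        (use fun_cong[OF f(1)] in \<open>simp add: Eo_def\<close>)
    show "diff ?Y i \<in> (\<Pi>\<^sub>E v\<in>verts Q. carrier_mat (cdim ?Y (i + 1) v) (cdim ?Y i v))" for i
      using carrier_matD[OF GL_seqD(1)[OF g, of _ "i + 1"]] carrier_matD[OF GL_seqD(2)[OF g, of _ i]]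
      by (auto simp: conj_act_def intro!: carrier_matI)
    show "rhom (obj ?Y i) (obj ?Y (i + 1)) (df ?Y i)" for i
      unfolding df_conj[OF X g] by (intro rhom_mult[OF h(3)] rhom_mult[OF df_hom[OF X]] h(4))
    show "df ?Y (i + 1) * df ?Y i = 0" for i
      using rhomD[OF df_hom[OF X, of i]]
      by (simp add: df_conj[OF X g] mult.assoc mult_assoc_eq[OF f(2)] mult_assoc_eq[OF df_df[OF X]])
    show "finite {i. \<exists>v. cdim ?Y i v \<noteq> 0}" using finite_cdim[OF X] by simp
  qed
  show "ciso X ?Y"
  proof (rule cisoI[OF X Y _ h(4)])
    show "chain X ?Y (gl g)"
      unfolding chain_def using h(3) rhomD[OF df_hom[OF X]] f(2) by (simp add: df_conj[OF X g] mult.assoc)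
  qed (simp_all add: f h(2))
qed

text \<open>The matrices are \<open>undefined\<close> off the quiver on both sides, so equality of
  the ring data yields equality of the records.\<close>

lemma cpx_eqI:
  assumes X: "X \<in> cpxs" and Y: "Y \<in> cpxs" and d: "cdim X = cdim Y"
    and a: "\<And>i a. a \<in> arcs Q \<Longrightarrow> act (obj X i) a = act (obj Y i) a" and df: "\<And>i. df X i = df Y i"
  shows "X = Y"
proof -
  have dd: "rdim (obj X i) = rdim (obj Y i)" for i using d by (rule fun_cong)
  have "diff X i = diff Y i" for i
  proof (rule fam_inject)
    show "diff X i \<in> (\<Pi>\<^sub>E v\<in>verts Q. carrier_mat (cdim X (i + 1) v) (cdim X i v))"
      using X by (simp add: bounded_cpxs_def rep_hom_def)
    show "diff Y i \<in> (\<Pi>\<^sub>E v\<in>verts Q. carrier_mat (cdim X (i + 1) v) (cdim X i v))"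
      unfolding dd using Y by (simp add: bounded_cpxs_def rep_hom_def)
    show "fam (diff X i) = fam (diff Y i)" using df by (simp add: df_def)
  qed
  moreover have "obj X i = obj Y i" for i
  proof -
    have "rmap (obj X i) = rmap (obj Y i)"
    proof (rule PiE_ext)
      show s: "rmap (obj X i) \<in> (\<Pi>\<^sub>E a\<in>arcs Q. carrier_mat (cdim X i (head Q a)) (cdim X i (tail Q a)))"
        using cpx_shape[OF X] by (simp add: rep_shape_def)
      show s': "rmap (obj Y i) \<in> (\<Pi>\<^sub>E a\<in>arcs Q. carrier_mat (cdim X i (head Q a)) (cdim X i (tail Q a)))"
        unfolding dd using cpx_shape[OF Y] by (simp add: rep_shape_def)
      fix b assume b: "b \<in> arcs Q"
      have "rmap (obj X i) b \<in> carrier_mat (cdim X i (head Q b)) (cdim X i (tail Q b))"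
        "rmap (obj Y i) b \<in> carrier_mat (cdim X i (head Q b)) (cdim X i (tail Q b))" using s s' b by auto
      then show "rmap (obj X i) b = rmap (obj Y i) b" using a[OF b, of i] of_mat_inject by (simp add: act_def)
    qed
    then show ?thesis using dd by simp
  qed
  ultimately have "diff X = diff Y" "obj X = obj Y" by auto
  then show ?thesis by simp
qed

lemma ciso_cdim: "ciso X Y \<Longrightarrow> cdim X = cdim Y"
proof
  fix i assume "ciso X Y"
  then have "riso (obj X i) (obj Y i)" unfolding ciso_def riso_def by (metis chainD(1))
  then show "cdim X i = cdim Y i" by (rule riso_rdim)
qed

text \<open>Isomorphic complexes have equal dimensions, so an isomorphism is a family of invertible
  square matrices, and compatibility with arrows and differentials says that it conjugates one
  complex into the other. Orbits are thus isomorphism classes.\<close>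

lemma ciso_conj:
  assumes X: "X \<in> cpxs" and Y: "Y \<in> cpxs" and i: "ciso X Y"
  obtains g where "g \<in> GL_seq Q (cdim X)" "Y = conj_act Q g X"
proof -
  obtain F G where F: "chain X Y F" "chain Y X G" "\<And>i. G i * F i = Eo (obj X i)" "\<And>i. F i * G i = Eo (obj Y i)"
    using i unfolding ciso_def by blast
  have d: "cdim Y = cdim X" using ciso_cdim[OF i] by simp
  have dd: "cdim Y i = cdim X i" for i using d by (rule fun_cong)
  have EE: "Eo (obj Y i) = Eo (obj X i)" for i by (simp add: Eo_def dd)
  define g where "g i = unfam (obj X i) (obj Y i) (F i)" for i
  define h where "h i = unfam (obj Y i) (obj X i) (G i)" for i
  have gF: "fam (g i) = F i" and hG: "fam (h i) = G i" for i
    unfolding g_def h_def using chainD(1)[OF F(1)] chainD(1)[OF F(2)] X Y by (auto intro!: fam_unfam cpx_shape)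
  have g: "g \<in> GL_seq Q (cdim X)"
  proof (rule GL_seqI[where h = h])
    show "g i \<in> extensional (verts Q)" for i by (simp add: g_def unfam_def)
    fix i v assume v: "v \<in> verts Q"
    show "g i v \<in> carrier_mat (cdim X i v) (cdim X i v)" "h i v \<in> carrier_mat (cdim X i v) (cdim X i v)"
      using v by (simp_all add: g_def h_def unfam_def dd)
    have "of_mat (g i v) = F i v" "of_mat (h i v) = G i v"
      using fun_cong[OF gF, of i v] fun_cong[OF hG, of i v] v by (simp_all add: fam_def)
    then show "of_mat (g i v) * of_mat (h i v) = idm (cdim X i v)" "of_mat (h i v) * of_mat (g i v) = idm (cdim X i v)"
      using fun_cong[OF F(3), of i v] fun_cong[OF F(4), of i v] by (simp_all add: Eo_def dd)
  qed
  have gl: "gl g i = F i" for i by (simp add: gl_def gF)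
  have gli: "gli g i = G i" for i
    by (rule gli_unique[OF g]) (use F(3) rhomD[OF chainD(1)[OF F(2)], of i] in \<open>simp_all add: gl Ed_cdim[OF X] EE\<close>)
  have "Y = conj_act Q g X"
  proof (rule cpx_eqI[OF Y conj_cpx(1)[OF X g]])
    show "cdim Y = cdim (conj_act Q g X)" using d by simp
    show "df Y i = df (conj_act Q g X) i" for i
      using mult_assoc_eq[OF chainD(2)[OF F(1), of i]] F(4)[of i] rhomD[OF df_hom[OF Y, of i]]
      by (simp add: df_conj[OF X g] gl gli mult.assoc)
    show "act (obj Y i) a = act (obj (conj_act Q g X) i) a" if a: "a \<in> arcs Q" for i a
      using mult_assoc_eq[OF rhom_arc[OF chainD(1)[OF F(1), of i] a]] fun_cong[OF F(4), of i "tail Q a"]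
        act_sized(2)[OF cpx_shape[OF Y, of i] a]
      by (simp add: act_conj[OF X g a] gl gli mult.assoc Eo_def)
  qed
  with g show ?thesis by (rule that)
qed

subsection \<open>Composition and direct sums of group elements\<close>

definition gl_mult :: "(int \<Rightarrow> 'v \<Rightarrow> complex mat) \<Rightarrow> (int \<Rightarrow> 'v \<Rightarrow> complex mat) \<Rightarrow> int \<Rightarrow> 'v \<Rightarrow> complex mat" where
  "gl_mult g h = (\<lambda>i. \<lambda>v\<in>verts Q. g i v * h i v)"

definition gl_sum :: "(int \<Rightarrow> 'v \<Rightarrow> complex mat) \<Rightarrow> (int \<Rightarrow> 'v \<Rightarrow> complex mat) \<Rightarrow> int \<Rightarrow> 'v \<Rightarrow> complex mat" where
  "gl_sum g h = (\<lambda>i. \<lambda>v\<in>verts Q. block_diag (g i v) (h i v))"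

definition gl_one :: "(int \<Rightarrow> 'v \<Rightarrow> nat) \<Rightarrow> int \<Rightarrow> 'v \<Rightarrow> complex mat" where
  "gl_one ds = (\<lambda>i. \<lambda>v\<in>verts Q. 1\<^sub>m (ds i v))"

lemma gl_mult_GL:
  assumes g: "g \<in> GL_seq Q ds" and h: "h \<in> GL_seq Q ds"
  shows "gl_mult g h \<in> GL_seq Q ds" "gl (gl_mult g h) i = gl g i * gl h i" "gli (gl_mult g h) i = gli h i * gli g i"
proof -
  have m: "of_mat (g i v) * of_mat (inverse_mat (g i v)) = idm (ds i v)"
    "of_mat (inverse_mat (h i v)) * of_mat (h i v) = idm (ds i v)"
    "of_mat (h i v) * of_mat (inverse_mat (h i v)) = idm (ds i v)"
    "of_mat (inverse_mat (g i v)) * of_mat (g i v) = idm (ds i v)" if "v \<in> verts Q" for i v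
    using GL_seqD[OF g that, of i] GL_seqD[OF h that, of i] by (auto simp flip: of_mat_mult)
  have s: "idm (ds i v) * of_mat (inverse_mat (g i v)) = of_mat (inverse_mat (g i v))"
    "idm (ds i v) * of_mat (h i v) = of_mat (h i v)" if "v \<in> verts Q" for i v
    using sized_of_mat[OF GL_seqD(2)[OF g that]] sized_of_mat[OF GL_seqD(1)[OF h that]] by (simp_all add: sized_def)
  show GL: "gl_mult g h \<in> GL_seq Q ds"
  proof (rule GL_seqI[where h = "\<lambda>i v. inverse_mat (h i v) * inverse_mat (g i v)"])
    fix i v assume v: "v \<in> verts Q"
    note d = GL_seqD(1,2)[OF g v, of i] GL_seqD(1,2)[OF h v, of i]
    show "gl_mult g h i v \<in> carrier_mat (ds i v) (ds i v)" "inverse_mat (h i v) * inverse_mat (g i v) \<in> carrier_mat (ds i v) (ds i v)"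
      using d v by (auto simp: gl_mult_def)
    show "of_mat (gl_mult g h i v) * of_mat (inverse_mat (h i v) * inverse_mat (g i v)) = idm (ds i v)"
      "of_mat (inverse_mat (h i v) * inverse_mat (g i v)) * of_mat (gl_mult g h i v) = idm (ds i v)"
      using d v m[OF v, of i] s[OF v, of i]
      by (simp_all add: gl_mult_def of_mat_mult mult.assoc m[OF v, of i, THEN mult_assoc_eq])
  qed (simp add: gl_mult_def)
  show e: "gl (gl_mult g h) i = gl g i * gl h i"
  proof -
    have "dim_col (g i v) = dim_row (h i v)" if "v \<in> verts Q" for v
      using GL_seqD(1)[OF g that, of i] GL_seqD(1)[OF h that, of i] by simp
    then show ?thesis unfolding gl_def by (intro fam_mult) (auto simp: gl_mult_def)
  qed
  show "gli (gl_mult g h) i = gli h i * gli g i"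
    by (rule gli_unique[OF GL]) (simp_all add: e gl_facts[OF g] gl_facts[OF h] mult.assoc mult_assoc_eq[OF gl_facts(2)[OF g]] mult_assoc_eq[OF gl_facts(3)[OF h]])
qed

lemma gl_one_GL: "gl_one ds \<in> GL_seq Q ds" "gl (gl_one ds) i = Ed ds i" "gli (gl_one ds) i = Ed ds i"
proof -
  show GL: "gl_one ds \<in> GL_seq Q ds"
    by (rule GL_seqI[where h = "\<lambda>i v. 1\<^sub>m (ds i v)"]) (simp_all add: gl_one_def)
  show e: "gl (gl_one ds) i = Ed ds i" by (simp add: gl_def Ed_def gl_one_def fam_def fun_eq_iff)
  show "gli (gl_one ds) i = Ed ds i"
    by (rule gli_unique[OF GL]) (simp_all add: e, simp_all add: Ed_def fun_eq_iff)
qed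

lemma gl_sum_GL:
  assumes X: "X \<in> cpxs" and Y: "Y \<in> cpxs" and g: "g \<in> GL_seq Q (cdim X)" and h: "h \<in> GL_seq Q (cdim Y)"
  shows "gl_sum g h \<in> GL_seq Q (cdim (cpx_sum Q X Y))"
    "gl (gl_sum g h) i = gl g i + s_in (obj X i) (obj Y i) * (gl h i * s_out (obj X i) (obj Y i))"
    "gli (gl_sum g h) i = gli g i + s_in (obj X i) (obj Y i) * (gli h i * s_out (obj X i) (obj Y i))"
proof -
  note fg = gl_facts[OF g, unfolded Ed_cdim[OF X]] and fh = gl_facts[OF h, unfolded Ed_cdim[OF Y]]
  define j where "j i = s_in (obj X i) (obj Y i)" for i
  define p where "p i = s_out (obj X i) (obj Y i)" for i
  have jp: "Eo (obj X i) * j i = 0" "p i * Eo (obj X i) = 0" "p i * j i = Eo (obj Y i)" "j i * Eo (obj Y i) = j i"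
    "Eo (obj Y i) * p i = p i" for i
    by (simp_all add: j_def p_def s_simps)
  have z: "gl g i * j i = 0" "gli g i * j i = 0" "p i * gl g i = 0" "p i * gli g i = 0" for i
    using hom_s(1)[OF conj_hom(3)[OF X g]] hom_s(2)[OF conj_hom(4)[OF X g]]
      mult.assoc[of "gli g i" "Eo (obj X i)" "j i"] mult.assoc[of "p i" "Eo (obj X i)" "gl g i"]
    by (simp_all add: j_def p_def fg s_simps)
  have block: "fam (\<lambda>v. block_diag (a v) (b v)) = fam a + j i * (fam b * p i)"
    if "\<And>v. v \<in> verts Q \<Longrightarrow> a v \<in> carrier_mat (cdim X i v) (cdim X i v)"
      "\<And>v. v \<in> verts Q \<Longrightarrow> b v \<in> carrier_mat (cdim Y i v) (cdim Y i v)" for a b i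
  proof
    fix v
    show "fam (\<lambda>v. block_diag (a v) (b v)) v = (fam a + j i * (fam b * p i)) v"
      using that[of v] by (cases "v \<in> verts Q") (auto simp: fam_def of_mat_block_diag j_def p_def s_in_def s_out_def mult.assoc)
  qed
  have 1: "gl (gl_sum g h) i = gl g i + j i * (gl h i * p i)" for i
  proof -
    have "gl (gl_sum g h) i = fam (\<lambda>v. block_diag (g i v) (h i v))" by (auto simp: gl_def gl_sum_def fam_def fun_eq_iff)
    then show ?thesis unfolding gl_def using block GL_seqD(1)[OF g] GL_seqD(1)[OF h] by simp
  qed
  have 2: "fam (\<lambda>v. block_diag (inverse_mat (g i v)) (inverse_mat (h i v))) = gli g i + j i * (gli h i * p i)" for i
    unfolding gli_def using block GL_seqD(2)[OF g] GL_seqD(2)[OF h] by simp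
  have E: "Eo (rep_sum Q (obj X i) (obj Y i)) = Eo (obj X i) + j i * p i" for i
    by (simp add: Eo_rep_sum j_def p_def)
  note ring = distrib_left distrib_right mult.assoc
  have inv: "(gl g i + j i * (gl h i * p i)) * (gli g i + j i * (gli h i * p i)) = Eo (rep_sum Q (obj X i) (obj Y i))"
    "(gli g i + j i * (gli h i * p i)) * (gl g i + j i * (gl h i * p i)) = Eo (rep_sum Q (obj X i) (obj Y i))" for i
    by (simp_all add: ring z z[THEN mult_assoc_eq] jp jp[THEN mult_assoc_eq] fg fh fg[THEN mult_assoc_eq] fh[THEN mult_assoc_eq] E)
  show GL: "gl_sum g h \<in> GL_seq Q (cdim (cpx_sum Q X Y))"
  proof (rule GL_seqI[where h = "\<lambda>i v. block_diag (inverse_mat (g i v)) (inverse_mat (h i v))"])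
    show "gl_sum g h i \<in> extensional (verts Q)" for i by (simp add: gl_sum_def)
    fix i v assume v: "v \<in> verts Q"
    note d = GL_seqD(1,2)[OF g v, of i] GL_seqD(1,2)[OF h v, of i]
    show "gl_sum g h i v \<in> carrier_mat (cdim (cpx_sum Q X Y) i v) (cdim (cpx_sum Q X Y) i v)"
      "block_diag (inverse_mat (g i v)) (inverse_mat (h i v)) \<in> carrier_mat (cdim (cpx_sum Q X Y) i v) (cdim (cpx_sum Q X Y) i v)"
      using d v by (auto simp: gl_sum_def intro!: carrier_matI)
    have "of_mat (gl_sum g h i v) = (gl g i + j i * (gl h i * p i)) v"
      "of_mat (block_diag (inverse_mat (g i v)) (inverse_mat (h i v))) = (gli g i + j i * (gli h i * p i)) v"
      using fun_cong[OF 1, of i v] fun_cong[OF 2, of i v] v by (simp_all add: gl_def fam_def)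
    then show "of_mat (gl_sum g h i v) * of_mat (block_diag (inverse_mat (g i v)) (inverse_mat (h i v))) = idm (cdim (cpx_sum Q X Y) i v)"
      "of_mat (block_diag (inverse_mat (g i v)) (inverse_mat (h i v))) * of_mat (gl_sum g h i v) = idm (cdim (cpx_sum Q X Y) i v)"
      using fun_cong[OF inv(1), of i v] fun_cong[OF inv(2), of i v] by (simp_all only: times_fun_apply Eo_def obj_cpx_sum)
  qed
  show "gl (gl_sum g h) i = gl g i + s_in (obj X i) (obj Y i) * (gl h i * s_out (obj X i) (obj Y i))"
    using 1 by (simp add: j_def p_def)
  have "gli (gl_sum g h) i = gli g i + j i * (gli h i * p i)"
  proof (rule gli_unique[OF GL])
    show "(gli g i + j i * (gli h i * p i)) * gl (gl_sum g h) i = Ed (cdim (cpx_sum Q X Y)) i"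
      unfolding 1 inv Ed_cdim[OF cpx_sum_cpx[OF X Y]] by simp
    show "(gli g i + j i * (gli h i * p i)) * Ed (cdim (cpx_sum Q X Y)) i = gli g i + j i * (gli h i * p i)"
      unfolding Ed_cdim[OF cpx_sum_cpx[OF X Y]] unfolding obj_cpx_sum E
      by (simp add: ring z z[THEN mult_assoc_eq] jp jp[THEN mult_assoc_eq] fg fh)
  qed
  then show "gli (gl_sum g h) i = gli g i + s_in (obj X i) (obj Y i) * (gli h i * s_out (obj X i) (obj Y i))"
    by (simp add: j_def p_def)
qed

lemma conj_conj:
  assumes X: "X \<in> cpxs" and g: "g \<in> GL_seq Q (cdim X)" and h: "h \<in> GL_seq Q (cdim X)"
  shows "conj_act Q g (conj_act Q h X) = conj_act Q (gl_mult g h) X"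
proof -
  note m = gl_mult_GL[OF g h]
  have g': "g \<in> GL_seq Q (cdim (conj_act Q h X))" using g by simp
  show ?thesis
    by (rule cpx_eqI[OF conj_cpx(1)[OF conj_cpx(1)[OF X h] g'] conj_cpx(1)[OF X m(1)]])
      (simp_all add: act_conj[OF conj_cpx(1)[OF X h] g'] act_conj[OF X h] act_conj[OF X m(1)]
        df_conj[OF conj_cpx(1)[OF X h] g'] df_conj[OF X h] df_conj[OF X m(1)] m(2,3) mult.assoc)
qed

lemma conj_one: "X \<in> cpxs \<Longrightarrow> conj_act Q (gl_one (cdim X)) X = X"
proof (rule cpx_eqI)
  assume X: "X \<in> cpxs"
  show "conj_act Q (gl_one (cdim X)) X \<in> cpxs" by (rule conj_cpx(1)[OF X gl_one_GL(1)])
  show "act (obj (conj_act Q (gl_one (cdim X)) X) i) a = act (obj X i) a" if "a \<in> arcs Q" for i a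
    using act_sized[OF cpx_shape[OF X, of i] that] that
    by (simp add: act_conj[OF X gl_one_GL(1)] gl_one_GL(2,3) Ed_def)
  show "df (conj_act Q (gl_one (cdim X)) X) i = df X i" for i
    using rhomD[OF df_hom[OF X, of i]] by (simp add: df_conj[OF X gl_one_GL(1)] gl_one_GL(2,3) Ed_cdim[OF X])
qed simp_all

lemma conj_sum:
  assumes X: "X \<in> cpxs" and Y: "Y \<in> cpxs" and g: "g \<in> GL_seq Q (cdim X)" and h: "h \<in> GL_seq Q (cdim Y)"
  shows "cpx_sum Q (conj_act Q g X) (conj_act Q h Y) = conj_act Q (gl_sum g h) (cpx_sum Q X Y)"
proof -
  note m = gl_sum_GL[OF X Y g h]
  note Xg = conj_cpx(1)[OF X g] and Yh = conj_cpx(1)[OF Y h]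
  note XY = cpx_sum_cpx[OF X Y]
  note fg = gl_facts[OF g, unfolded Ed_cdim[OF X]] and fh = gl_facts[OF h, unfolded Ed_cdim[OF Y]]
  have s: "s_in (obj (conj_act Q g X) i) (obj (conj_act Q h Y) i) = s_in (obj X i) (obj Y i)"
    "s_out (obj (conj_act Q g X) i) (obj (conj_act Q h Y) i) = s_out (obj X i) (obj Y i)" for i
    by (simp_all add: s_in_def s_out_def)
  have z: "gl g i * s_in (obj X i) N = 0" "s_out (obj X i) N * gli g i = 0" for i N
    using hom_s(1)[OF conj_hom(3)[OF X g]] hom_s(2)[OF conj_hom(4)[OF X g]] by auto
  note s' = s_simps
  note ring = distrib_left distrib_right mult.assoc
  show ?thesis
  proof (rule cpx_eqI[OF cpx_sum_cpx[OF Xg Yh] conj_cpx(1)[OF XY m(1)]])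
    show "cdim (cpx_sum Q (conj_act Q g X) (conj_act Q h Y)) = cdim (conj_act Q (gl_sum g h) (cpx_sum Q X Y))"
      by (simp add: fun_eq_iff)
    show "df (cpx_sum Q (conj_act Q g X) (conj_act Q h Y)) i = df (conj_act Q (gl_sum g h) (cpx_sum Q X Y)) i" for i
      using hom_s(1)[OF df_hom[OF X, of i]] hom_s(2)[OF df_hom[OF X, of i]] rhomD[OF df_hom[OF Y, of i]]
      by (simp add: df_cpx_sum[OF Xg Yh] df_conj[OF X g] df_conj[OF Y h] df_conj[OF XY m(1)] df_cpx_sum[OF X Y] m(2,3) s
          ring s' s'[THEN mult_assoc_eq] z z[THEN mult_assoc_eq] fh fh[THEN mult_assoc_eq]
          hom_s[OF df_hom[OF X, of i], THEN mult_assoc_eq])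
    show "act (obj (cpx_sum Q (conj_act Q g X) (conj_act Q h Y)) i) a = act (obj (conj_act Q (gl_sum g h) (cpx_sum Q X Y)) i) a"
      if a: "a \<in> arcs Q" for i a
    proof -
      let ?h = "head Q a" and ?t = "tail Q a"
      let ?j = "s_in (obj X i) (obj Y i)" and ?p = "s_out (obj X i) (obj Y i)"
      have sz: "act (obj X i) a * idm (cdim X i ?t) = act (obj X i) a" "idm (cdim X i ?h) * act (obj X i) a = act (obj X i) a"
        "idm (cdim Y i ?h) * act (obj Y i) a = act (obj Y i) a" "act (obj Y i) a * idm (cdim Y i ?t) = act (obj Y i) a"
        using act_sized[OF cpx_shape[OF X, of i] a] act_sized[OF cpx_shape[OF Y, of i] a] by simp_all
      have jp: "?p v * ?j v = idm (cdim Y i v)" "idm (cdim X i v) * ?j v = 0" "?p v * idm (cdim X i v) = 0" for v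
        by (simp_all add: s_in_def s_out_def)
      have az: "act (obj X i) a * ?j ?t = 0" "?p ?h * act (obj X i) a = 0"
        using sz(1,2) jp by (metis mult.assoc mult_zero_right, metis mult.assoc mult_zero_left)
      have gz: "gl g i v * ?j v = 0" "?p v * gli g i v = 0" for v
        using fun_cong[OF z(1)[of i "obj Y i"], of v] fun_cong[OF z(2)[of i "obj Y i"], of v] by simp_all
      show ?thesis
        using a act_rep_sum[OF cpx_shape[OF Xg] cpx_shape[OF Yh] a] act_rep_sum[OF cpx_shape[OF X] cpx_shape[OF Y] a]
        by (simp add: act_conj[OF X g] act_conj[OF Y h] act_conj[OF XY m(1)] m(2,3) s ring
            jp jp[THEN mult_assoc_eq] az az[THEN mult_assoc_eq] gz gz[THEN mult_assoc_eq] mult_assoc_eq[OF sz(3)] sz(4) mult_assoc_eq[OF sz(4)])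
    qed
  qed
qed

lemma cpx_sum_assoc: "cpx_sum Q (cpx_sum Q X Y) Z = cpx_sum Q X (cpx_sum Q Y Z)"
proof -
  have "diff (cpx_sum Q (cpx_sum Q X Y) Z) = diff (cpx_sum Q X (cpx_sum Q Y Z))"
    by (auto simp: cpx_sum_def block_diag_assoc fun_eq_iff)
  moreover have "obj (cpx_sum Q (cpx_sum Q X Y) Z) = obj (cpx_sum Q X (cpx_sum Q Y Z))"
    by (simp add: fun_eq_iff rep_sum_assoc)
  ultimately show ?thesis by simp
qed

text \<open>Both sides are conjugates of the triple sum of \<open>X\<close>, \<open>C12\<close> and
  \<open>C23\<close>, which exists without brackets thanks to strict associativity. The conjugating
  elements are the two sides of \<open>compat\<close>.\<close>

lemma conj_sum_functorial:
  assumes X: "X \<in> cpxs" and C: "C12 \<in> cpxs" "C23 \<in> cpxs"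
    and k12: "k12 \<in> GL_seq Q (cdim (cpx_sum Q X C12))"
    and k23: "k23 \<in> GL_seq Q (cdim (cpx_sum Q (cpx_sum Q X C12) C23))"
    and k13: "k13 \<in> GL_seq Q (cdim (cpx_sum Q (cpx_sum Q X C12) C23))"
    and t: "t \<in> GL_seq Q (cdim (cpx_sum Q C12 C23))" "conj_act Q t (cpx_sum Q C12 C23) = C13"
    and compat: "\<And>i v. v \<in> verts Q \<Longrightarrow> k13 i v * block_diag (1\<^sub>m (cdim X i v)) (t i v) =
      k23 i v * block_diag (k12 i v) (1\<^sub>m (cdim C23 i v))"
  shows "conj_act Q k23 (cpx_sum Q (conj_act Q k12 (cpx_sum Q X C12)) C23) = conj_act Q k13 (cpx_sum Q X C13)"
proof -
  note XC = cpx_sum_cpx[OF X C(1)] and CC = cpx_sum_cpx[OF C]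
  note XCC = cpx_sum_cpx[OF XC C(2)] and XCC' = cpx_sum_cpx[OF X CC]
  note u = gl_sum_GL(1)[OF XC C(2) k12 gl_one_GL(1)] and w = gl_sum_GL(1)[OF X CC gl_one_GL(1) t(1)]
  have "cpx_sum Q (conj_act Q k12 (cpx_sum Q X C12)) C23 =
      conj_act Q (gl_sum k12 (gl_one (cdim C23))) (cpx_sum Q (cpx_sum Q X C12) C23)"
    using conj_sum[OF XC C(2) k12 gl_one_GL(1)] conj_one[OF C(2)] by simp
  then have "conj_act Q k23 (cpx_sum Q (conj_act Q k12 (cpx_sum Q X C12)) C23) =
      conj_act Q (gl_mult k23 (gl_sum k12 (gl_one (cdim C23)))) (cpx_sum Q (cpx_sum Q X C12) C23)"
    using conj_conj[OF XCC k23 u] by simp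
  also have "gl_mult k23 (gl_sum k12 (gl_one (cdim C23))) = gl_mult k13 (gl_sum (gl_one (cdim X)) t)"
    using compat by (auto simp: gl_mult_def gl_sum_def gl_one_def fun_eq_iff)
  also have "conj_act Q \<dots> (cpx_sum Q (cpx_sum Q X C12) C23) = conj_act Q k13 (conj_act Q (gl_sum (gl_one (cdim X)) t) (cpx_sum Q X (cpx_sum Q C12 C23)))"
    using conj_conj[OF XCC' _ w, of k13] k13 by (simp add: cpx_sum_assoc)
  also have "conj_act Q (gl_sum (gl_one (cdim X)) t) (cpx_sum Q X (cpx_sum Q C12 C23)) = cpx_sum Q X C13"
    using conj_sum[OF X CC gl_one_GL(1) t(1)] conj_one[OF X] t(2) by simp
  finally show ?thesis .
qed

end

section \<open>Quotient maps and direct limits\<close>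

lemma quotient_map_sum_topology:
  assumes q: "\<And>i. i \<in> I \<Longrightarrow> quotient_map (X i) (Y i) (f i)"
  shows "quotient_map (sum_topology X I) (sum_topology Y I) (\<lambda>(i, x). (i, f i x))"
  unfolding quotient_map_def
proof (intro conjI allI impI)
  have s: "f i ` topspace (X i) = topspace (Y i)" if "i \<in> I" for i
    using q[OF that] by (simp add: quotient_map_def)
  show "(\<lambda>(i, x). (i, f i x)) ` topspace (sum_topology X I) = topspace (sum_topology Y I)"
  proof (intro equalityI subsetI)
    fix z assume "z \<in> (\<lambda>(i, x). (i, f i x)) ` topspace (sum_topology X I)"
    then show "z \<in> topspace (sum_topology Y I)" using s by fastforce
  next
    fix z assume "z \<in> topspace (sum_topology Y I)"
    then obtain i y where z: "z = (i, y)" "i \<in> I" "y \<in> topspace (Y i)" by auto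
    then obtain x where "x \<in> topspace (X i)" "y = f i x" using s by blast
    then show "z \<in> (\<lambda>(i, x). (i, f i x)) ` topspace (sum_topology X I)" using z by force
  qed
  fix U assume U: "U \<subseteq> topspace (sum_topology Y I)"
  let ?V = "{z \<in> topspace (sum_topology X I). (case z of (i, x) \<Rightarrow> (i, f i x)) \<in> U}"
  have "openin (X i) {x. (i, x) \<in> ?V} \<longleftrightarrow> openin (Y i) {y. (i, y) \<in> U}" if i: "i \<in> I" for i
  proof -
    have eq: "{x. (i, x) \<in> ?V} = {x \<in> topspace (X i). f i x \<in> {y. (i, y) \<in> U}}" using i by auto
    have "{y. (i, y) \<in> U} \<subseteq> topspace (Y i)" using U by auto
    then show ?thesis using q[OF i] unfolding quotient_map_def eq by blast
  qed
  moreover have "?V \<subseteq> Sigma I (topspace \<circ> X)" by auto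
  ultimately show "openin (sum_topology X I) ?V = openin (sum_topology Y I) U"
    using U unfolding openin_sum_topology by simp
qed

text \<open>Each quotient map factors through the other because the fibres agree, and a quotient map
  that is injective is a homeomorphism.\<close>

lemma quotient_maps_homeomorphic:
  assumes f: "quotient_map X Y f" and g: "quotient_map X Z g"
    and fg: "\<And>x y. x \<in> topspace X \<Longrightarrow> y \<in> topspace X \<Longrightarrow> f x = f y \<longleftrightarrow> g x = g y"
  obtains \<phi> where "homeomorphic_map Y Z \<phi>" "\<And>x. x \<in> topspace X \<Longrightarrow> \<phi> (f x) = g x"
proof -
  obtain \<phi> where \<phi>: "continuous_map Y Z \<phi>" "\<And>x. x \<in> topspace X \<Longrightarrow> \<phi> (f x) = g x"
    using quotient_map_lift_exists[OF f quotient_imp_continuous_map[OF g]] fg by metis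
  have "quotient_map X Z (\<phi> \<circ> f)" by (rule quotient_map_eq[OF g]) (simp add: \<phi>)
  then have "quotient_map Y Z \<phi>"
    by (rule quotient_map_from_composition[OF quotient_imp_continuous_map[OF f] \<phi>(1)])
  moreover have "inj_on \<phi> (topspace Y)"
  proof (rule inj_onI)
    fix a b assume ab: "a \<in> topspace Y" "b \<in> topspace Y" "\<phi> a = \<phi> b"
    obtain x y where "x \<in> topspace X" "a = f x" "y \<in> topspace X" "b = f y"
      using ab quotient_imp_surjective_map[OF f] by blast
    then show "a = b" using ab \<phi>(2) fg by simp
  qed
  ultimately show ?thesis using that \<phi>(2) by (simp add: homeomorphic_map_def)
qed

text \<open>Amalgamation above a common lower bound takes the place of directedness. In a chain of
  two related pairs, the middle index is such a bound of the two indices at which the pairs become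
  equal.\<close>

lemma dlim_rel_equiv:
  assumes refl: "\<And>i. i \<in> I \<Longrightarrow> leq i i"
    and trans: "\<And>i j k. i \<in> I \<Longrightarrow> j \<in> I \<Longrightarrow> k \<in> I \<Longrightarrow> leq i j \<Longrightarrow> leq j k \<Longrightarrow> leq i k"
    and amalgam: "\<And>i j k. i \<in> I \<Longrightarrow> j \<in> I \<Longrightarrow> k \<in> I \<Longrightarrow> leq i j \<Longrightarrow> leq i k \<Longrightarrow> \<exists>l\<in>I. leq j l \<and> leq k l"
    and funct: "\<And>i j k x. i \<in> I \<Longrightarrow> j \<in> I \<Longrightarrow> k \<in> I \<Longrightarrow> leq i j \<Longrightarrow> leq j k \<Longrightarrow> x \<in> D i \<Longrightarrow> t j k (t i j x) = t i k x"
  shows "equiv (Sigma I D) (dlim_rel I leq D t)"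
proof (rule equivI)
  show "dlim_rel I leq D t \<subseteq> Sigma I D \<times> Sigma I D" by (auto simp: dlim_rel_def)
  show "refl_on (Sigma I D) (dlim_rel I leq D t)" using refl by (auto simp: refl_on_def dlim_rel_def)
  show "sym (dlim_rel I leq D t)" by (auto simp: sym_def dlim_rel_def)
  show "trans (dlim_rel I leq D t)"
  proof (rule transI)
    fix a b c assume "(a, b) \<in> dlim_rel I leq D t" "(b, c) \<in> dlim_rel I leq D t"
    moreover obtain i x j y k z where abc: "a = (i, x)" "b = (j, y)" "c = (k, z)" by (cases a; cases b; cases c)
    ultimately have I: "i \<in> I" "j \<in> I" "k \<in> I" and D: "x \<in> D i" "y \<in> D j" "z \<in> D k"
      and ex: "\<exists>l\<in>I. leq i l \<and> leq j l \<and> t i l x = t j l y" "\<exists>l\<in>I. leq j l \<and> leq k l \<and> t j l y = t k l z"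
      by (simp_all add: dlim_rel_def)
    obtain l where l: "l \<in> I" "leq i l" "leq j l" "t i l x = t j l y" using ex(1) by blast
    obtain m where m: "m \<in> I" "leq j m" "leq k m" "t j m y = t k m z" using ex(2) by blast
    obtain n where n: "n \<in> I" "leq l n" "leq m n" using amalgam[OF I(2) l(1) m(1) l(3) m(2)] by blast
    have "t i n x = t l n (t i l x)" by (rule funct[OF I(1) l(1) n(1) l(2) n(2) D(1), symmetric])
    also have "\<dots> = t j n y" unfolding l(4) by (rule funct[OF I(2) l(1) n(1) l(3) n(2) D(2)])
    also have "\<dots> = t m n (t j m y)" by (rule funct[OF I(2) m(1) n(1) m(2) n(3) D(2), symmetric])
    also have "\<dots> = t k n z" unfolding m(4) by (rule funct[OF I(3) m(1) n(1) m(3) n(3) D(3)])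
    finally have "t i n x = t k n z" .
    moreover have "leq i n" "leq k n"
      using trans[OF I(1) l(1) n(1) l(2) n(2)] trans[OF I(3) m(1) n(1) m(3) n(3)] .
    ultimately show "(a, c) \<in> dlim_rel I leq D t" using abc I D n(1) by (auto simp: dlim_rel_def)
  qed
qed

section \<open>Levels\<close>

context bound_quiver_algebra
begin

lemma contr_sum:
  assumes X: "X \<in> cpxs" "contr X h" and Y: "Y \<in> cpxs" "contr Y k"
  shows "\<exists>h. contr (cpx_sum Q X Y) h"
proof -
  define j where "j i = s_in (obj X i) (obj Y i)" for i
  define p where "p i = s_out (obj X i) (obj Y i)" for i
  note m = rhom_sum_maps[OF cpx_shape[OF X(1)] cpx_shape[OF Y(1)]]
  have jp: "p i * j i = Eo (obj Y i)" "j i * Eo (obj Y i) = j i" "Eo (obj Y i) * p i = p i" for i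
    by (simp_all add: j_def p_def s_simps)
  have z: "df X i * j i = 0" "h i * j i = 0" "p i * df X (i - 1) = 0" "p i * h (i + 1) = 0" "p (i - 1) * h i = 0" for i
    using hom_s(1)[OF df_hom[OF X(1)]] hom_s(1)[OF contrD(1)[OF X(2)]] hom_s(2)[OF df_hom'[OF X(1)]]
      hom_s(2)[OF contrD(2)[OF X(2)]] hom_s(2)[OF contrD(1)[OF X(2)]] by (simp_all add: j_def p_def)
  have d: "df (cpx_sum Q X Y) i = df X i + j (i + 1) * (df Y i * p i)" for i
    by (simp add: df_cpx_sum[OF X(1) Y(1)] j_def p_def)
  have d': "df (cpx_sum Q X Y) (i - 1) = df X (i - 1) + j i * (df Y (i - 1) * p (i - 1))" for i
    using d[of "i - 1"] by simp
  have "contr (cpx_sum Q X Y) (\<lambda>i. h i + j (i - 1) * (k i * p i))"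
    unfolding contr_def
  proof (intro allI conjI)
    fix i
    have "rhom (obj (cpx_sum Q X Y) i) (obj (cpx_sum Q X Y) (i - 1))
      (Eo (obj X (i - 1)) * (h i * Eo (obj X i)) + j (i - 1) * (k i * p i))"
      unfolding obj_cpx_sum j_def p_def
      by (intro rhom_add rhom_mult[OF m(1)] rhom_mult[OF contrD(1)[OF X(2)]] m(2) rhom_mult[OF m(3)]
        rhom_mult[OF contrD(1)[OF Y(2)]] m(4))
    then show "rhom (obj (cpx_sum Q X Y) i) (obj (cpx_sum Q X Y) (i - 1)) (h i + j (i - 1) * (k i * p i))"
      by (simp add: rhomD[OF contrD(1)[OF X(2)]])
    have "j i * ((df Y (i - 1) * k i + k (i + 1) * df Y i) * p i) = j i * p i"
      unfolding contrD(3)[OF Y(2)] by (simp add: jp)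
    then have "j i * (df Y (i - 1) * (k i * p i)) + j i * (k (i + 1) * (df Y i * p i)) = j i * p i"
      by (simp add: distrib_left distrib_right mult.assoc)
    moreover have "df X (i - 1) * h i + h (i + 1) * df X i = Eo (obj X i)" by (rule contrD(3)[OF X(2)])
    ultimately have "df X (i - 1) * h i + (j i * (df Y (i - 1) * (k i * p i)) + (h (i + 1) * df X i + j i * (k (i + 1) * (df Y i * p i))))
      = Eo (obj (cpx_sum Q X Y) i)" by (simp add: Eo_rep_sum j_def p_def algebra_simps)
    moreover have "df X (i - 1) * j (i - 1) = 0" "h (i + 1) * j (i + 1) = 0" "p (i - 1) * h i = 0" "p (i + 1) * df X i = 0"
      using z(1)[of "i - 1"] z(2)[of "i + 1"] z(5)[of i] z(3)[of "i + 1"] by simp_all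
    ultimately show "df (cpx_sum Q X Y) (i - 1) * (h i + j (i - 1) * (k i * p i)) +
      (h (i + 1) + j (i + 1 - 1) * (k (i + 1) * p (i + 1))) * df (cpx_sum Q X Y) i = Eo (obj (cpx_sum Q X Y) i)"
      using rhomD(3)[OF contrD(1)[OF Y(2), of i]] rhomD(3)[OF df_hom[OF Y(1), of i]]
      by (simp add: d d' distrib_left distrib_right mult.assoc mult_assoc_eq[OF jp(1)]
        mult_assoc_eq[of "df X (i - 1)" "j (i - 1)" 0] mult_assoc_eq[of "h (i + 1)" "j (i + 1)" 0]
        mult_assoc_eq[of "p (i - 1)" "h i" 0] add.assoc)
  qed
  then show ?thesis by blast
qed

text \<open>The contractible complex witnessing that every level is below itself.\<close>

definition zero_cpx :: "('v, 'a) cpx" where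
  "zero_cpx = \<lparr>obj = (\<lambda>_. zero_rep Q), diff = (\<lambda>_. \<lambda>v\<in>verts Q. 0\<^sub>m 0 0)\<rparr>"

lemma zero_cpx: "zero_cpx \<in> cpxs" "contr zero_cpx (\<lambda>_. 0)"
proof -
  have o: "obj zero_cpx i = zero_rep Q" for i by (simp add: zero_cpx_def)
  have df: "df zero_cpx i = 0" for i by (simp add: df_def zero_cpx_def fam_def fun_eq_iff)
  show "zero_cpx \<in> cpxs"
    by (rule cpxI) (simp_all add: o df zero_rep_reps rhom_zero, simp_all add: zero_cpx_def zero_rep_def)
  show "contr zero_cpx (\<lambda>_. 0)" by (simp add: contr_def o df rhom_zero)
qed

text \<open>The difference of the two generators is itself one of the generating relations, so
  adding it moves one coset into the other.\<close>

lemma K0_class_eq: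
  assumes X: "X \<in> cpxs" and Y: "Y \<in> cpxs" and q: "quasi_isomorphic Q R X Y"
  shows "K0_class Q R X = K0_class Q R Y"
proof -
  have sub: "K0_class Q R X \<subseteq> K0_class Q R Y" if "X \<in> cpxs" "Y \<in> cpxs" "quasi_isomorphic Q R X Y" for X Y
  proof
    let ?G = "free_Abelian_group cpxs"
    fix z assume "z \<in> K0_class Q R X"
    then obtain h where h: "h \<in> K0_relations Q R" "z = h + frag_of X"
      by (auto simp: K0_class_def r_coset_def)
    have "frag_of X - frag_of Y \<in> K0_relations Q R"
      unfolding K0_relations_def using that by (intro generate.incl) blast
    then have "h \<otimes>\<^bsub>?G\<^esub> (frag_of X - frag_of Y) \<in> K0_relations Q R"
      using h(1) unfolding K0_relations_def by (rule generate.eng[rotated])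
    then show "z \<in> K0_class Q R Y"
      unfolding K0_class_def r_coset_def h(2)
      by (intro UN_I[of "h \<otimes>\<^bsub>?G\<^esub> (frag_of X - frag_of Y)"]) simp_all
  qed
  show ?thesis using sub[OF X Y q] sub[OF Y X quasi_isomorphic_sym[OF q]] by blast
qed

end

locale direct_system = bound_quiver_algebra Q R
  for Q :: "('v, 'a) pre_digraph" and R :: "(('v, 'a) path \<Rightarrow>\<^sub>0 complex) set" +
  fixes P :: "('v, 'a) rep list" and d :: "(('v, 'a) cpx \<Rightarrow>\<^sub>0 int) set"
    and C :: "pdseq \<Rightarrow> pdseq \<Rightarrow> ('v, 'a) cpx" and \<iota> :: "pdseq \<Rightarrow> pdseq \<Rightarrow> int \<Rightarrow> 'v \<Rightarrow> complex mat"
  assumes projectives: "indecomposable_projectives Q R P"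
    and compatible: "compatible_family Q R P d C \<iota>"
begin

abbreviation "L \<equiv> levels Q R P d"
abbreviation "lle \<equiv> level_le Q R P"
abbreviation "pc \<equiv> proj_cpxs Q R P"
abbreviation "tr \<equiv> transition Q C \<iota>"

section \<open>Projective complexes at a level, and the order on levels\<close>

lemma P_reps: "set P \<subseteq> reps Q R"
  using projectives by (auto simp: indecomposable_projectives_def projective_rep_def)

lemma proj_sum_reps: "proj_sum Q P m \<in> reps Q R"
  unfolding proj_sum_rsum using P_reps set_proj_list by (intro rsum_reps) blast

lemma proj_sum_prj: "prj (proj_sum Q P m)"
proof -
  have "prj M" if "M \<in> set P" for M
    using projectives that by (auto simp: indecomposable_projectives_def intro: projective_prj)
  then show ?thesis
    unfolding proj_sum_rsum using P_reps set_proj_list by (intro rsum_prj) blast+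
qed

lemma pcD:
  assumes "X \<in> pc e"
  shows "X \<in> cpxs" "cdim X = dim_seq Q P e" "riso (obj X i) (proj_sum Q P (e i))" "prj (obj X i)"
proof -
  show X: "X \<in> cpxs" "cdim X = dim_seq Q P e" using assms by (simp_all add: proj_cpxs_def)
  show r: "riso (obj X i) (proj_sum Q P (e i))"
    using assms rep_iso_iff[OF cpx_shape[OF X(1)] reps_shape[OF proj_sum_reps]] by (simp add: proj_cpxs_def)
  show "prj (obj X i)" by (rule riso_prj[OF riso_sym[OF r] proj_sum_prj])
qed

lemma pcI:
  assumes X: "X \<in> cpxs" and r: "\<And>i. riso (obj X i) (proj_sum Q P (e i))"
  shows "X \<in> pc e"
  using X r riso_rdim[OF r] rep_iso_iff[OF cpx_shape[OF X] reps_shape[OF proj_sum_reps]]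
  by (simp add: proj_cpxs_def dim_seq_def fun_eq_iff)

lemma pc_ciso: "X \<in> pc e \<Longrightarrow> Y \<in> cpxs \<Longrightarrow> ciso X Y \<Longrightarrow> Y \<in> pc e"
proof (rule pcI)
  fix i assume X: "X \<in> pc e" and "ciso X Y"
  then have "riso (obj Y i) (obj X i)" unfolding ciso_def riso_def by (metis chainD(1))
  then show "riso (obj Y i) (proj_sum Q P (e i))" using riso_trans pcD(3)[OF X] by blast
qed

lemma riso_sum_proj:
  assumes "M \<in> reps Q R" "riso M (proj_sum Q P m)" "N \<in> reps Q R" "riso N (proj_sum Q P n)"
  shows "riso (rep_sum Q M N) (proj_sum Q P (\<lambda>j. m j + n j))"
proof -
  have "riso (rep_sum Q M N) (rep_sum Q (proj_sum Q P m) (proj_sum Q P n))"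
    using assms proj_sum_reps by (intro riso_sum_cong reps_shape)
  then show ?thesis using riso_trans riso_sym[OF proj_sum_add[OF P_reps]] by blast
qed

lemma pc_sum: "X \<in> pc e \<Longrightarrow> Y \<in> pc e' \<Longrightarrow> cpx_sum Q X Y \<in> pc (\<lambda>i j. e i j + e' i j)"
  by (rule pcI) (auto intro!: cpx_sum_cpx riso_sum_proj cpx_reps dest: pcD)

lemma pc_cone:
  assumes X: "X \<in> pc e" and Y: "Y \<in> pc e'" and f: "f \<in> chain_maps Q X Y"
  shows "cone Q X Y f \<in> pc (\<lambda>i j. e (i + 1) j + e' i j)"
  by (rule pcI) (auto intro!: cone_cpx riso_sum_proj cpx_reps f pcD[OF X] pcD[OF Y])

text \<open>The sequence of multiplicities fixes the terms up to isomorphism, and these fix a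
  contractible complex. Any contractible complex of the right level may therefore stand in for the
  chosen ones.\<close>

lemma pc_contractible_unique:
  assumes "A \<in> pc e" "contractible Q A" "B \<in> pc e" "contractible Q B"
  shows "ciso A B"
proof -
  obtain h k where "contr A h" "contr B k"
    using assms contractible_iff[OF pcD(1)] by blast
  moreover have "riso (obj A i) (obj B i)" for i
    using riso_trans[OF pcD(3)[OF assms(1)] riso_sym[OF pcD(3)[OF assms(3)]]] .
  ultimately show ?thesis
    using contractible_unique[OF pcD(1)[OF assms(1)] _ pcD(4)[OF assms(1)] pcD(1)[OF assms(3)] _ pcD(4)[OF assms(3)]]
    by blast
qed

text \<open>A contractible summand changes the dimensions but not the class in \<open>K0\<close>,
  because the inclusion into the sum is a quasi-isomorphism.\<close>

lemma level_add:
  assumes e: "e \<in> L" and e': "proj_dim_seq P e'" and A: "A \<in> pc e'" "contractible Q A"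
  shows "(\<lambda>i j. e i j + e' i j) \<in> L" "lle e (\<lambda>i j. e i j + e' i j)"
proof -
  let ?e = "\<lambda>i j. e i j + e' i j"
  have pe: "proj_dim_seq P e" "dim_seq Q P e \<in> dim_fibre Q R d" using e by (simp_all add: levels_def)
  have "{i. \<exists>j. ?e i j \<noteq> 0} \<subseteq> {i. \<exists>j. e i j \<noteq> 0} \<union> {i. \<exists>j. e' i j \<noteq> 0}" by auto
  then have "proj_dim_seq P ?e"
    using pe(1) e' finite_subset unfolding proj_dim_seq_def by fastforce
  moreover have "dim_seq Q P ?e \<in> dim_fibre Q R d"
  proof -
    \<comment> \<open>Any complex with these dimensions serves as a witness for the fibre; its terms
      need not be projective.\<close>
    obtain X where X: "X \<in> cpxs" "cdim X = dim_seq Q P e" "K0_class Q R X = d"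
      using pe(2) by (auto simp: dim_fibre_def)
    obtain h where h: "contr A h" using A contractible_iff[OF pcD(1)] by blast
    note XA = cpx_sum_cpx[OF X(1) pcD(1)[OF A(1)]]
    have "rdim (obj (cpx_sum Q X A) i) = dim_seq Q P ?e i" for i
    proof -
      have "rdim (proj_sum Q P (\<lambda>j. e i j + e' i j)) = rdim (rep_sum Q (proj_sum Q P (e i)) (proj_sum Q P (e' i)))"
        by (rule riso_rdim[OF proj_sum_add[OF P_reps]])
      then show ?thesis
        using fun_cong[OF X(2), of i] fun_cong[OF pcD(2)[OF A(1)], of i] by (auto simp: dim_seq_def fun_eq_iff)
    qed
    moreover have "K0_class Q R (cpx_sum Q X A) = d"
      using K0_class_eq[OF X(1) XA sum_contractible_quasi_isomorphic[OF X(1) pcD(1)[OF A(1)] h]] X(3) by simp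
    ultimately show ?thesis using XA by (auto simp: dim_fibre_def fun_eq_iff intro!: bexI[of _ "cpx_sum Q X A"])
  qed
  ultimately show "?e \<in> L" by (simp add: levels_def)
  have "seq_diff ?e e = e'" by (simp add: seq_diff_def)
  then show "lle e ?e" using A by (auto simp: level_le_def)
qed

lemma levelD: "e \<in> L \<Longrightarrow> proj_dim_seq P e"
  by (simp add: levels_def)

lemma le_refl: "lle e e"
proof -
  have "riso (obj zero_cpx i) (proj_sum Q P (\<lambda>_. 0))" for i
  proof -
    have "proj_list P (\<lambda>_. 0) = []" by (simp add: proj_list_def)
    then show ?thesis
      by (simp add: proj_sum_rsum zero_cpx_def riso_refl reps_shape zero_rep_reps)
  qed
  then have "zero_cpx \<in> pc (seq_diff e e)" by (intro pcI zero_cpx(1)) (simp add: seq_diff_def)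
  then show ?thesis using zero_cpx contractible_iff by (auto simp: level_le_def)
qed

lemma le_trans:
  assumes "lle e1 e2" "lle e2 e3" shows "lle e1 e3"
proof -
  obtain A B where A: "A \<in> pc (seq_diff e2 e1)" "contractible Q A" and B: "B \<in> pc (seq_diff e3 e2)" "contractible Q B"
    using assms by (auto simp: level_le_def)
  have l: "e1 i j \<le> e2 i j" "e2 i j \<le> e3 i j" for i j using assms by (auto simp: level_le_def)
  have "(\<lambda>i j. seq_diff e2 e1 i j + seq_diff e3 e2 i j) = seq_diff e3 e1"
    using l by (auto simp: seq_diff_def fun_eq_iff)
  then have "cpx_sum Q A B \<in> pc (seq_diff e3 e1)" using pc_sum[OF A(1) B(1)] by simp
  moreover have "contractible Q (cpx_sum Q A B)"
    using contr_sum[OF pcD(1)[OF A(1)] _ pcD(1)[OF B(1)]] A B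
      contractible_iff[OF pcD(1)[OF A(1)]] contractible_iff[OF pcD(1)[OF B(1)]]
      contractible_iff[OF cpx_sum_cpx[OF pcD(1)[OF A(1)] pcD(1)[OF B(1)]]] by blast
  ultimately show ?thesis using l order_trans unfolding level_le_def by blast
qed

lemma proj_dim_seq_diff: "proj_dim_seq P e \<Longrightarrow> proj_dim_seq P (seq_diff e e')"
proof -
  assume e: "proj_dim_seq P e"
  have "e i j \<noteq> 0" if "seq_diff e e' i j \<noteq> 0" for i j using that by (simp add: seq_diff_def)
  then have "{i. \<exists>j. seq_diff e e' i j \<noteq> 0} \<subseteq> {i. \<exists>j. e i j \<noteq> 0}" by blast
  then show ?thesis using e finite_subset unfolding proj_dim_seq_def by (auto simp: seq_diff_def)
qed

text \<open>The sum of \<open>k\<close> and \<open>k' - e\<close> equals that of \<open>k'\<close>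
  and \<open>k - e\<close>, so each index reaches it by adding the contractible complex that leads
  from \<open>e\<close> to the other.\<close>

lemma le_amalgam:
  assumes e: "e \<in> L" "k \<in> L" "k' \<in> L" "lle e k" "lle e k'"
  shows "\<exists>l\<in>L. lle k l \<and> lle k' l"
proof -
  obtain A B where A: "A \<in> pc (seq_diff k e)" "contractible Q A" and B: "B \<in> pc (seq_diff k' e)" "contractible Q B"
    using e by (auto simp: level_le_def)
  have l: "e i j \<le> k i j" "e i j \<le> k' i j" for i j using e by (auto simp: level_le_def)
  have "(\<lambda>i j. k i j + seq_diff k' e i j) = (\<lambda>i j. k' i j + seq_diff k e i j)"
    using l by (simp add: seq_diff_def fun_eq_iff add.commute)
  then show ?thesis
    using level_add[OF e(2) proj_dim_seq_diff[OF levelD[OF e(3)]] B] level_add[OF e(3) proj_dim_seq_diff[OF levelD[OF e(2)]] A]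
    by metis
qed

lemma C_facts:
  assumes "e1 \<in> L" "e2 \<in> L" "lle e1 e2"
  shows "C e1 e2 \<in> pc (seq_diff e2 e1)" "contractible Q (C e1 e2)" "\<iota> e1 e2 \<in> GL_seq Q (dim_seq Q P e2)"
  using compatible assms unfolding compatible_family_def by blast+

lemma sum_C_pc:
  assumes e: "e1 \<in> L" "e2 \<in> L" "lle e1 e2" and X: "X \<in> pc e1"
  shows "cpx_sum Q X (C e1 e2) \<in> pc e2"
proof -
  have "(\<lambda>i j. e1 i j + seq_diff e2 e1 i j) = e2"
    using e(3) by (auto simp: level_le_def seq_diff_def fun_eq_iff)
  then show ?thesis using pc_sum[OF X C_facts(1)[OF e]] by simp
qed

lemma tr_pc:
  assumes e: "e1 \<in> L" "e2 \<in> L" "lle e1 e2" and X: "X \<in> pc e1"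
  shows "tr e1 e2 X \<in> pc e2" "ciso (cpx_sum Q X (C e1 e2)) (tr e1 e2 X)" "quasi_isomorphic Q R X (tr e1 e2 X)"
proof -
  note S = sum_C_pc[OF assms]
  have g: "\<iota> e1 e2 \<in> GL_seq Q (cdim (cpx_sum Q X (C e1 e2)))" using C_facts(3)[OF e] pcD(2)[OF S] by simp
  note c = conj_cpx[OF pcD(1)[OF S] g]
  show i: "ciso (cpx_sum Q X (C e1 e2)) (tr e1 e2 X)" unfolding transition_def by (rule c(2))
  have T: "tr e1 e2 X \<in> cpxs" unfolding transition_def by (rule c(1))
  show "tr e1 e2 X \<in> pc e2" by (rule pc_ciso[OF S T i])
  obtain h where h: "contr (C e1 e2) h"
    using C_facts[OF e] contractible_iff[OF pcD(1)] by blast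
  show "quasi_isomorphic Q R X (tr e1 e2 X)"
    using quasi_isomorphic_trans[OF sum_contractible_quasi_isomorphic[OF pcD(1)[OF X] pcD(1)[OF C_facts(1)[OF e]] h]
      ciso_quasi_isomorphic[OF pcD(1)[OF S] T i]] .
qed

lemma tr_ciso:
  assumes e: "e1 \<in> L" "e2 \<in> L" "lle e1 e2" and X: "X \<in> pc e1" and Y: "Y \<in> pc e1" and i: "ciso X Y"
  shows "ciso (tr e1 e2 X) (tr e1 e2 Y)"
proof -
  note c = pcD(1)[OF C_facts(1)[OF e]]
  have "ciso (cpx_sum Q X (C e1 e2)) (cpx_sum Q Y (C e1 e2))"
    by (rule ciso_sum[OF pcD(1)[OF X] c pcD(1)[OF Y] c i ciso_refl[OF c]])
  then show ?thesis using tr_pc(2)[OF e X] tr_pc(2)[OF e Y] ciso_trans ciso_sym by blast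
qed

text \<open>The identification \<tau> of the compatible family compares the two ways of adding
  contractible summands, and the equation it satisfies with the matrices \<iota> is the hypothesis
  of \<open>conj_sum_functorial\<close>.\<close>

lemma tr_tr:
  assumes e: "e1 \<in> L" "e2 \<in> L" "e3 \<in> L" "lle e1 e2" "lle e2 e3" and X: "X \<in> pc e1"
  shows "tr e2 e3 (tr e1 e2 X) = tr e1 e3 X"
proof -
  note e13 = le_trans[OF e(4,5)]
  note c12 = C_facts[OF e(1,2,4)] and c23 = C_facts[OF e(2,3,5)] and c13 = C_facts[OF e(1,3) e13]
  obtain \<tau> where \<tau>: "\<tau> \<in> GL_seq Q (dim_seq Q P (seq_diff e3 e1))"
    "conj_act Q \<tau> (cpx_sum Q (C e1 e2) (C e2 e3)) = C e1 e3"
    "\<And>i v. v \<in> verts Q \<Longrightarrow> \<iota> e1 e3 i v * block_diag (1\<^sub>m (dim_seq Q P e1 i v)) (\<tau> i v) =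
       \<iota> e2 e3 i v * block_diag (\<iota> e1 e2 i v) (1\<^sub>m (dim_seq Q P (seq_diff e3 e2) i v))"
    using compatible e unfolding compatible_family_def by blast
  have l: "e1 i j \<le> e2 i j" "e2 i j \<le> e3 i j" for i j using e by (auto simp: level_le_def)
  have s1: "(\<lambda>i j. seq_diff e2 e1 i j + seq_diff e3 e2 i j) = seq_diff e3 e1"
    and s2: "(\<lambda>i j. e2 i j + seq_diff e3 e2 i j) = e3"
    using l by (auto simp: seq_diff_def fun_eq_iff)
  note S = sum_C_pc[OF e(1,2,4) X]
  have SS: "cpx_sum Q (cpx_sum Q X (C e1 e2)) (C e2 e3) \<in> pc e3" using pc_sum[OF S c23(1)] s2 by simp
  have CC: "cpx_sum Q (C e1 e2) (C e2 e3) \<in> pc (seq_diff e3 e1)" using pc_sum[OF c12(1) c23(1)] s1 by simp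
  show ?thesis
    unfolding transition_def
  proof (rule conj_sum_functorial[OF pcD(1)[OF X] pcD(1)[OF c12(1)] pcD(1)[OF c23(1)], where t = \<tau>])
    show "\<iota> e1 e2 \<in> GL_seq Q (cdim (cpx_sum Q X (C e1 e2)))" using c12(3) pcD(2)[OF S] by simp
    show "\<iota> e2 e3 \<in> GL_seq Q (cdim (cpx_sum Q (cpx_sum Q X (C e1 e2)) (C e2 e3)))"
      "\<iota> e1 e3 \<in> GL_seq Q (cdim (cpx_sum Q (cpx_sum Q X (C e1 e2)) (C e2 e3)))"
      using c23(3) c13(3) pcD(2)[OF SS] by simp_all
    show "\<tau> \<in> GL_seq Q (cdim (cpx_sum Q (C e1 e2) (C e2 e3)))" using \<tau>(1) pcD(2)[OF CC] by simp
    show "conj_act Q \<tau> (cpx_sum Q (C e1 e2) (C e2 e3)) = C e1 e3" by (rule \<tau>(2))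
    show "\<iota> e1 e3 i v * block_diag (1\<^sub>m (cdim X i v)) (\<tau> i v) =
      \<iota> e2 e3 i v * block_diag (\<iota> e1 e2 i v) (1\<^sub>m (cdim (C e2 e3) i v))" if "v \<in> verts Q" for i v
      using \<tau>(3)[OF that, of i] fun_cong[OF fun_cong[OF pcD(2)[OF X], of i], of v]
        fun_cong[OF fun_cong[OF pcD(2)[OF c23(1)], of i], of v] by simp
  qed
qed

text \<open>A quasi-isomorphism \<open>f\<close> from \<open>X\<close> to \<open>Y\<close> is a homotopy equivalence, and \<open>X \<oplus> cone f\<close> is isomorphic to
  \<open>Y \<oplus> cone 1\<close>. The contractible summands may be replaced by those used in the transition maps.\<close>

lemma quasi_isomorphic_iff:
  assumes e: "e \<in> L" "e' \<in> L" and X: "X \<in> pc e" and Y: "Y \<in> pc e'"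
  shows "quasi_isomorphic Q R X Y \<longleftrightarrow> (\<exists>k\<in>L. lle e k \<and> lle e' k \<and> ciso (tr e k X) (tr e' k Y))"
proof
  assume "\<exists>k\<in>L. lle e k \<and> lle e' k \<and> ciso (tr e k X) (tr e' k Y)"
  then obtain k where k: "k \<in> L" "lle e k" "lle e' k" "ciso (tr e k X) (tr e' k Y)" by blast
  note tX = tr_pc[OF e(1) k(1,2) X] and tY = tr_pc[OF e(2) k(1,3) Y]
  show "quasi_isomorphic Q R X Y"
    using quasi_isomorphic_trans[OF tX(3) quasi_isomorphic_trans[OF
      ciso_quasi_isomorphic[OF pcD(1)[OF tX(1)] pcD(1)[OF tY(1)] k(4)] quasi_isomorphic_sym[OF tY(3)]]] .
next
  assume q: "quasi_isomorphic Q R X Y"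
  note Xc = pcD(1)[OF X] and Yc = pcD(1)[OF Y]
  obtain F where F: "qis X Y F" using quasi_isomorphic_qis[OF Xc pcD(4)[OF X] q] .
  obtain f where f: "f \<in> chain_maps Q X Y" "\<And>i. fam (f i) = F i" using chain_unfam[OF Xc Yc qisD(1)[OF F]] by metis
  then have fF: "(\<lambda>i. fam (f i)) = F" by auto
  obtain g where g: "g \<in> chain_maps Q X X" "\<And>i. fam (g i) = Eo (obj X i)" using chain_unfam[OF Xc Xc chain_id[OF Xc]] by metis
  then have gE: "(\<lambda>i. fam (g i)) = (\<lambda>i. Eo (obj X i))" by auto
  let ?A = "cone Q X Y f" and ?B = "cone Q X X g"
  have A: "?A \<in> pc (\<lambda>i j. e (i + 1) j + e' i j)" and B: "?B \<in> pc (\<lambda>i j. e (i + 1) j + e i j)"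
    using pc_cone[OF X Y f(1)] pc_cone[OF X X g(1)] .
  have ac: "acyclic_cpx ?A" "acyclic_cpx ?B"
    using cone_acyclic[OF Xc Yc f(1)] F fF cone_acyclic[OF Xc Xc g(1)] qis_id[OF Xc] gE by simp_all
  obtain h where h: "contr ?A h" using acyclic_contr[OF pcD(1)[OF A] pcD(4)[OF A] ac(1)] .
  obtain h' where h': "contr ?B h'" using acyclic_contr[OF pcD(1)[OF B] pcD(4)[OF B] ac(2)] .
  have cA: "contractible Q ?A" and cB: "contractible Q ?B"
    using h h' contractible_iff[OF pcD(1)[OF A]] contractible_iff[OF pcD(1)[OF B]] by blast+
  have pe: "proj_dim_seq P e" "proj_dim_seq P e'" using e levelD by blast+
  have shift: "proj_dim_seq P (\<lambda>i j. e (i + 1) j + a i j)" if a: "proj_dim_seq P a" for a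
  proof -
    have "i \<in> (\<lambda>i. i - 1) ` {i. \<exists>j. e i j \<noteq> 0}" if "e (i + 1) j \<noteq> 0" for i j
      using that by (intro image_eqI[of _ _ "i + 1"]) auto
    then have "{i. \<exists>j. e (i + 1) j + a i j \<noteq> 0} \<subseteq> (\<lambda>i. i - 1) ` {i. \<exists>j. e i j \<noteq> 0} \<union> {i. \<exists>j. a i j \<noteq> 0}"
      by auto
    moreover have "finite ((\<lambda>i. i - 1) ` {i. \<exists>j. e i j \<noteq> 0} \<union> {i. \<exists>j. a i j \<noteq> 0})"
      using pe(1) a unfolding proj_dim_seq_def by (intro finite_UnI finite_imageI) blast+
    ultimately have "finite {i. \<exists>j. e (i + 1) j + a i j \<noteq> 0}" by (rule finite_subset)
    then show ?thesis using pe(1) a unfolding proj_dim_seq_def by auto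
  qed
  \<comment> \<open>The terms of \<open>X\<close> and of the cone of \<open>f\<close> together. By
    symmetry these are also the terms of \<open>Y\<close> and of the cone of the identity of
    \<open>X\<close>, so this level lies above both.\<close>
  define k where "k = (\<lambda>i j. e i j + (e (i + 1) j + e' i j))"
  have k': "k = (\<lambda>i j. e' i j + (e (i + 1) j + e i j))" by (simp add: k_def fun_eq_iff)
  have kL: "k \<in> L" "lle e k" unfolding k_def by (rule level_add[OF e(1) shift[OF pe(2)] A cA])+
  have k'L: "lle e' k" unfolding k' by (rule level_add(2)[OF e(2) shift[OF pe(1)] B cB])
  have dA: "seq_diff k e = (\<lambda>i j. e (i + 1) j + e' i j)" by (simp add: k_def seq_diff_def)
  have dB: "seq_diff k e' = (\<lambda>i j. e (i + 1) j + e i j)" by (simp add: k' seq_diff_def)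
  note CX = C_facts[OF e(1) kL] and CY = C_facts[OF e(2) kL(1) k'L]
  have iA: "ciso (C e k) ?A" using pc_contractible_unique[OF CX(1,2)] A cA dA by simp
  have iB: "ciso ?B (C e' k)" using pc_contractible_unique[OF _ cB CY(1,2)] B dB by simp
  have "ciso (cpx_sum Q X (C e k)) (cpx_sum Q X ?A)"
    by (rule ciso_sum[OF Xc pcD(1)[OF CX(1)] Xc pcD(1)[OF A] ciso_refl[OF Xc] iA])
  moreover have "ciso (cpx_sum Q X ?A) (cpx_sum Q Y ?B)" by (rule cylinder_iso[OF Xc Yc f(1) h g])
  moreover have "ciso (cpx_sum Q Y ?B) (cpx_sum Q Y (C e' k))"
    by (rule ciso_sum[OF Yc pcD(1)[OF B] Yc pcD(1)[OF CY(1)] ciso_refl[OF Yc] iB])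
  ultimately have "ciso (cpx_sum Q X (C e k)) (cpx_sum Q Y (C e' k))" using ciso_trans by blast
  then have "ciso (tr e k X) (tr e' k Y)"
    using tr_pc(2)[OF e(1) kL X] tr_pc(2)[OF e(2) kL(1) k'L Y] ciso_trans ciso_sym by blast
  then show "\<exists>k\<in>L. lle e k \<and> lle e' k \<and> ciso (tr e k X) (tr e' k Y)" using kL k'L by blast
qed

section \<open>The limits\<close>

lemma topspace_proj_variety [simp]: "topspace (proj_variety Q R P e) = pc e"
proof -
  \<comment> \<open>The constant polynomial 1 shows that the whole affine space is open.\<close>
  have "{X \<in> cpx_space Q (dim_seq Q P e). (1::complex) \<noteq> 0} \<in> {{X \<in> cpx_space Q (dim_seq Q P e). p X \<noteq> 0} | p. p \<in> polynomials Q (dim_seq Q P e)}"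
    using polynomials.intros(1)[of 1 Q "dim_seq Q P e"] by (intro CollectI exI[of _ "\<lambda>_. 1"]) auto
  then have "cpx_space Q (dim_seq Q P e) \<subseteq> topspace (zariski Q (dim_seq Q P e))"
    unfolding zariski_def topology_generated_by_topspace by (auto simp: Union_iff)
  moreover have "pc e \<subseteq> cpx_space Q (dim_seq Q P e)"
  proof
    fix X assume X: "X \<in> pc e"
    have dd: "dim_seq Q P e i = cdim X i" for i using fun_cong[OF pcD(2)[OF X], of i] by simp
    have "diff X i \<in> rep_hom Q (obj X i) (obj X (i + 1))" for i using pcD(1)[OF X] by (simp add: bounded_cpxs_def)
    then show "X \<in> cpx_space Q (dim_seq Q P e)"
      using cpx_shape[OF pcD(1)[OF X]] pcD(2)[OF X] by (simp add: cpx_space_def dd rep_shape_def rep_hom_def)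
  qed
  ultimately show ?thesis unfolding proj_variety_def by auto
qed

abbreviation "dl \<equiv> dlim_rel L lle pc tr"

lemma dl_equiv: "equiv (Sigma L pc) dl"
  by (rule dlim_rel_equiv) (auto intro: le_refl le_trans le_amalgam tr_tr)

lemma dl_quasi_isomorphic: "((e, X), (e', Y)) \<in> dl \<Longrightarrow> quasi_isomorphic Q R X Y"
proof -
  assume "((e, X), (e', Y)) \<in> dl"
  then obtain k where k: "e \<in> L" "X \<in> pc e" "e' \<in> L" "Y \<in> pc e'" "k \<in> L" "lle e k" "lle e' k" "tr e k X = tr e' k Y"
    by (auto simp: dlim_rel_def)
  have "quasi_isomorphic Q R X (tr e k X)" "quasi_isomorphic Q R Y (tr e k X)"
    using tr_pc(3) k by (blast, metis)
  then show ?thesis using quasi_isomorphic_trans quasi_isomorphic_sym by blast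
qed

section \<open>Points of the limit variety and relations between them\<close>

abbreviation "cls e X \<equiv> cpx_class Q R P d C \<iota> e X"

lemma cpx_class_eq: "cls e X = dl `` {(e, X)}"
  by (simp add: cpx_class_def)

lemma topspace_Pb_limit: "topspace (Pb_limit Q R P d C \<iota>) = Sigma L pc // dl"
  by (simp add: Pb_limit_def dlim_topology_def comp_def)

lemma Pb_limit_cases:
  assumes "x \<in> topspace (Pb_limit Q R P d C \<iota>)"
  obtains e X where "e \<in> L" "X \<in> pc e" "x = cls e X"
  using assms unfolding topspace_Pb_limit cpx_class_eq by (auto elim!: quotientE)

lemma cls_topspace: "e \<in> L \<Longrightarrow> X \<in> pc e \<Longrightarrow> cls e X \<in> topspace (Pb_limit Q R P d C \<iota>)"
  unfolding topspace_Pb_limit cpx_class_eq by (intro quotientI) auto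

lemma cls_self: "e \<in> L \<Longrightarrow> X \<in> pc e \<Longrightarrow> (e, X) \<in> cls e X"
  unfolding cpx_class_eq by (intro equiv_class_self[OF dl_equiv]) auto

lemma cls_mem: "(e', Y) \<in> cls e X \<Longrightarrow> quasi_isomorphic Q R X Y"
  unfolding cpx_class_eq by (auto intro: dl_quasi_isomorphic)

lemma cls_tr:
  assumes "e \<in> L" "X \<in> pc e" "k \<in> L" "lle e k"
  shows "cls k (tr e k X) = cls e X"
proof -
  have "((e, X), (k, tr e k X)) \<in> dl"
    using assms tr_pc(1)[OF assms(1,3,4,2)] le_refl tr_tr[OF assms(1,3,3,4) le_refl assms(2)]
    by (auto simp: dlim_rel_def intro!: bexI[of _ k])
  then show ?thesis unfolding cpx_class_eq using equiv_class_eq[OF dl_equiv] by metis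
qed

lemma quasi_isomorphic_refl: "quasi_isomorphic Q R X X"
  by (simp add: quasi_isomorphic_def)

text \<open>A group element is an isomorphism onto the conjugate, and conversely every isomorphism
  between complexes of equal dimensions is a group element.\<close>

lemma orbit_rel_iff:
  assumes X: "X \<in> pc e"
  shows "(X, Y) \<in> orbit_rel Q R P e \<longleftrightarrow> Y \<in> pc e \<and> ciso X Y"
proof
  assume "(X, Y) \<in> orbit_rel Q R P e"
  then obtain g where g: "g \<in> GL_seq Q (dim_seq Q P e)" "Y = conj_act Q g X" by (auto simp: orbit_rel_def)
  have "g \<in> GL_seq Q (cdim X)" using g(1) pcD(2)[OF X] by simp
  from conj_cpx[OF pcD(1)[OF X] this] show "Y \<in> pc e \<and> ciso X Y" using g(2) pc_ciso[OF X] by blast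
next
  assume Y: "Y \<in> pc e \<and> ciso X Y"
  obtain g where "g \<in> GL_seq Q (cdim X)" "Y = conj_act Q g X"
    using ciso_conj[OF pcD(1)[OF X] pcD(1)[of Y e]] Y by blast
  then show "(X, Y) \<in> orbit_rel Q R P e" using X pcD(2)[OF X] by (auto simp: orbit_rel_def)
qed

text \<open>Quasi-isomorphism between representatives at explicit levels. The orbit relation and the
  relation defining \<open>QP\<close> are both shown to be this set.\<close>

definition \<rho> where
  "\<rho> = {(cls e X, cls e' Y) | e X e' Y. e \<in> L \<and> X \<in> pc e \<and> e' \<in> L \<and> Y \<in> pc e' \<and> quasi_isomorphic Q R X Y}"

text \<open>All representatives of a point of the limit are quasi-isomorphic, since transition maps
  only add contractible summands; hence the choice of representatives is immaterial.\<close>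

lemma \<rho>_iff:
  assumes "e \<in> L" "X \<in> pc e" "e' \<in> L" "Y \<in> pc e'"
  shows "(cls e X, cls e' Y) \<in> \<rho> \<longleftrightarrow> quasi_isomorphic Q R X Y"
proof
  assume "(cls e X, cls e' Y) \<in> \<rho>"
  then obtain a Z b W where z: "cls e X = cls a Z" "cls e' Y = cls b W" "a \<in> L" "Z \<in> pc a" "b \<in> L" "W \<in> pc b"
    "quasi_isomorphic Q R Z W" unfolding \<rho>_def by blast
  have "quasi_isomorphic Q R X Z" "quasi_isomorphic Q R Y W"
    using cls_mem cls_self z by metis+
  then show "quasi_isomorphic Q R X Y" using z(7) quasi_isomorphic_trans quasi_isomorphic_sym by blast
qed (use assms in \<open>auto simp: \<rho>_def\<close>)

lemma \<rho>_class_eq_iff: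
  assumes "e \<in> L" "X \<in> pc e" "e' \<in> L" "Y \<in> pc e'"
  shows "\<rho> `` {cls e X} = \<rho> `` {cls e' Y} \<longleftrightarrow> quasi_isomorphic Q R X Y"
proof
  assume "\<rho> `` {cls e X} = \<rho> `` {cls e' Y}"
  moreover have "cls e' Y \<in> \<rho> `` {cls e' Y}" using \<rho>_iff[OF assms(3,4,3,4)] quasi_isomorphic_refl by simp
  ultimately show "quasi_isomorphic Q R X Y" using \<rho>_iff[OF assms] by blast
next
  assume q: "quasi_isomorphic Q R X Y"
  have "z \<in> \<rho> `` {cls e X} \<longleftrightarrow> z \<in> \<rho> `` {cls e' Y}" for z
  proof (cases "\<exists>a Z. a \<in> L \<and> Z \<in> pc a \<and> z = cls a Z")
    case True
    then obtain a Z where z: "a \<in> L" "Z \<in> pc a" "z = cls a Z" by blast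
    have "quasi_isomorphic Q R X Z \<longleftrightarrow> quasi_isomorphic Q R Y Z"
      using q quasi_isomorphic_trans quasi_isomorphic_sym by metis
    then show ?thesis
      using \<rho>_iff[OF assms(1,2) z(1,2)] \<rho>_iff[OF assms(3,4) z(1,2)] z(3) by simp
  qed (auto simp: \<rho>_def)
  then show "\<rho> `` {cls e X} = \<rho> `` {cls e' Y}" by blast
qed

text \<open>Conjugate complexes are isomorphic, hence quasi-isomorphic. Conversely, quasi-isomorphic
  complexes become isomorphic at some common level, and the isomorphism is a group element at that
  level.\<close>

lemma limit_orbit_rel_eq: "limit_orbit_rel Q R P d C \<iota> = \<rho>"
proof (intro equalityI subsetI)
  fix z assume "z \<in> limit_orbit_rel Q R P d C \<iota>"
  then obtain e g X where z: "e \<in> L" "g \<in> GL_seq Q (dim_seq Q P e)" "X \<in> pc e" "z = (cls e X, cls e (conj_act Q g X))"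
    by (auto simp: limit_orbit_rel_def limit_acts_def)
  then have "(X, conj_act Q g X) \<in> orbit_rel Q R P e" by (auto simp: orbit_rel_def)
  then have Y: "conj_act Q g X \<in> pc e" "ciso X (conj_act Q g X)" using orbit_rel_iff[OF z(3)] by auto
  then have "quasi_isomorphic Q R X (conj_act Q g X)" using ciso_quasi_isomorphic pcD(1) z(3) by blast
  then show "z \<in> \<rho>" using z Y unfolding \<rho>_def by blast
next
  fix z assume "z \<in> \<rho>"
  then obtain e X e' Y where z: "z = (cls e X, cls e' Y)" "e \<in> L" "X \<in> pc e" "e' \<in> L" "Y \<in> pc e'" "quasi_isomorphic Q R X Y"
    unfolding \<rho>_def by blast
  obtain k where k: "k \<in> L" "lle e k" "lle e' k" "ciso (tr e k X) (tr e' k Y)"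
    using quasi_isomorphic_iff[OF z(2,4,3,5)] z(6) by blast
  have tX: "tr e k X \<in> pc k" and tY: "tr e' k Y \<in> pc k"
    using tr_pc(1)[OF z(2) k(1,2) z(3)] tr_pc(1)[OF z(4) k(1,3) z(5)] .
  then have "(tr e k X, tr e' k Y) \<in> orbit_rel Q R P k" using k(4) orbit_rel_iff[OF tX] by blast
  then obtain g where g: "g \<in> GL_seq Q (dim_seq Q P k)" "tr e' k Y = conj_act Q g (tr e k X)"
    by (auto simp: orbit_rel_def)
  have "limit_acts Q R P d C \<iota> (GL_class Q R P d \<iota> k g) (cls k (tr e k X)) (cls k (tr e' k Y))"
    unfolding limit_acts_def using k(1) g tX by auto
  moreover have "GL_class Q R P d \<iota> k g \<in> GL_limit Q R P d \<iota>"
    unfolding GL_class_def GL_limit_def using k(1) g(1) by (intro quotientI) auto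
  ultimately have "(cls k (tr e k X), cls k (tr e' k Y)) \<in> limit_orbit_rel Q R P d C \<iota>"
    by (auto simp: limit_orbit_rel_def)
  \<comment> \<open>The points are the same as before: transition to level \<open>k\<close> does not
    change a class in the limit.\<close>
  then show "z \<in> limit_orbit_rel Q R P d C \<iota>"
    using cls_tr[OF z(2,3) k(1,2)] cls_tr[OF z(4,5) k(1,3)] z(1) by simp
qed

lemma quasi_iso_rel_eq: "quasi_iso_rel Q R P d C \<iota> = \<rho>"
proof (intro equalityI subsetI)
  fix z assume "z \<in> quasi_iso_rel Q R P d C \<iota>"
  then obtain x y a Z b W where z: "z = (x, y)" "x \<in> topspace (Pb_limit Q R P d C \<iota>)" "y \<in> topspace (Pb_limit Q R P d C \<iota>)"
    "(a, Z) \<in> x" "(b, W) \<in> y" "quasi_isomorphic Q R Z W"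
    by (auto simp: quasi_iso_rel_def)
  obtain e X where X: "e \<in> L" "X \<in> pc e" "x = cls e X" using Pb_limit_cases[OF z(2)] .
  obtain e' Y where Y: "e' \<in> L" "Y \<in> pc e'" "y = cls e' Y" using Pb_limit_cases[OF z(3)] .
  have "quasi_isomorphic Q R X Z" "quasi_isomorphic Q R Y W" using cls_mem z(4,5) X(3) Y(3) by blast+
  then have "quasi_isomorphic Q R X Y" using z(6) quasi_isomorphic_trans quasi_isomorphic_sym by blast
  then show "z \<in> \<rho>" using X Y z(1) unfolding \<rho>_def by blast
next
  fix z assume "z \<in> \<rho>"
  then obtain e X e' Y where z: "z = (cls e X, cls e' Y)" "e \<in> L" "X \<in> pc e" "e' \<in> L" "Y \<in> pc e'" "quasi_isomorphic Q R X Y"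
    unfolding \<rho>_def by blast
  then show "z \<in> quasi_iso_rel Q R P d C \<iota>"
    using cls_topspace cls_self unfolding quasi_iso_rel_def by blast
qed

section \<open>The limit of the orbit spaces\<close>

abbreviation "orb e X \<equiv> orbit_rel Q R P e `` {X}"

lemma orb_eq: "X \<in> pc e \<Longrightarrow> orb e X = {Y \<in> pc e. ciso X Y}"
  using orbit_rel_iff by blast

lemma orb_eq_iff: "X \<in> pc e \<Longrightarrow> Y \<in> pc e \<Longrightarrow> orb e X = orb e Y \<longleftrightarrow> ciso X Y"
proof -
  assume X: "X \<in> pc e" and Y: "Y \<in> pc e"
  have "ciso Y Y" using ciso_refl pcD(1)[OF Y] by blast
  then show ?thesis unfolding orb_eq[OF X] orb_eq[OF Y] using Y ciso_trans ciso_sym by blast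
qed

lemma orbit_transition_orb:
  assumes e: "e \<in> L" "k \<in> L" "lle e k" and X: "X \<in> pc e"
  shows "orbit_transition Q R P C \<iota> e k (orb e X) = orb k (tr e k X)"
proof -
  have "X \<in> orb e X" using orb_eq[OF X] X ciso_refl pcD(1) by blast
  moreover have "orb k (tr e k Y) = orb k (tr e k X)" if "Y \<in> orb e X" for Y
    using that orb_eq_iff tr_pc(1)[OF e] tr_ciso[OF e] X ciso_sym unfolding orb_eq[OF X] by blast
  ultimately show ?thesis unfolding orbit_transition_def by blast
qed

abbreviation "odl \<equiv> dlim_rel L lle (\<lambda>e. topspace (QP_level Q R P e)) (orbit_transition Q R P C \<iota>)"

lemma topspace_QP_level: "topspace (QP_level Q R P e) = {orb e X | X. X \<in> pc e}"
  by (auto simp: QP_level_def quotient_def)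

text \<open>Orbits with equal images at level \<open>k\<close> are orbits of complexes that are
  isomorphic after transition to \<open>k\<close>; some such \<open>k\<close> exists exactly for
  quasi-isomorphic complexes.\<close>

lemma odl_iff:
  assumes "e \<in> L" "X \<in> pc e" "e' \<in> L" "Y \<in> pc e'"
  shows "((e, orb e X), (e', orb e' Y)) \<in> odl \<longleftrightarrow> quasi_isomorphic Q R X Y"
proof -
  have "orbit_transition Q R P C \<iota> e k (orb e X) = orbit_transition Q R P C \<iota> e' k (orb e' Y) \<longleftrightarrow> ciso (tr e k X) (tr e' k Y)"
    if "k \<in> L" "lle e k" "lle e' k" for k
    using orbit_transition_orb orb_eq_iff tr_pc(1) assms that by metis
  then show ?thesis
    unfolding quasi_isomorphic_iff[OF assms(1,3,2,4)] dlim_rel_def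
    using assms by (auto simp: topspace_QP_level)
qed

lemma odl_class_eq_iff:
  assumes "e \<in> L" "X \<in> pc e" "e' \<in> L" "Y \<in> pc e'"
  shows "odl `` {(e, orb e X)} = odl `` {(e', orb e' Y)} \<longleftrightarrow> quasi_isomorphic Q R X Y"
proof
  assume "odl `` {(e, orb e X)} = odl `` {(e', orb e' Y)}"
  moreover have "(e', orb e' Y) \<in> odl `` {(e', orb e' Y)}" using odl_iff[OF assms(3,4,3,4)] quasi_isomorphic_refl by simp
  ultimately show "quasi_isomorphic Q R X Y" using odl_iff[OF assms] by blast
next
  assume q: "quasi_isomorphic Q R X Y"
  have "z \<in> odl `` {(e, orb e X)} \<longleftrightarrow> z \<in> odl `` {(e', orb e' Y)}" for z
  proof (cases "\<exists>a Z. a \<in> L \<and> Z \<in> pc a \<and> z = (a, orb a Z)")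
    case True
    then obtain a Z where z: "a \<in> L" "Z \<in> pc a" "z = (a, orb a Z)" by blast
    have "quasi_isomorphic Q R X Z \<longleftrightarrow> quasi_isomorphic Q R Y Z"
      using q quasi_isomorphic_trans quasi_isomorphic_sym by metis
    then show ?thesis
      using odl_iff[OF assms(1,2) z(1,2)] odl_iff[OF assms(3,4) z(1,2)] z(3) by simp
  next
    case False
    then show ?thesis by (auto simp: dlim_rel_def topspace_QP_level)
  qed
  then show "odl `` {(e, orb e X)} = odl `` {(e', orb e' Y)}" by blast
qed

lemma QP_eq_Q1P: "QP Q R P d C \<iota> = Q1P Q R P d C \<iota>"
  by (simp add: QP_def Q1P_def quasi_iso_rel_eq limit_orbit_rel_eq)

text \<open>Orbits can be taken before or after the limit: either way the result is a composite of
  two quotient maps from the disjoint union of the varieties. Both composites identify exactly the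
  quasi-isomorphic pairs.\<close>

lemma levels_limit_homeomorphic:
  "\<exists>\<phi>. homeomorphic_map (QP_levels_limit Q R P d C \<iota>) (Q1P Q R P d C \<iota>) \<phi> \<and>
     (\<forall>e\<in>L. \<forall>X\<in>pc e. \<phi> (orbit_class Q R P d C \<iota> e (orb e X)) = limit_orbit_rel Q R P d C \<iota> `` {cls e X})"
proof -
  let ?S = "sum_topology (proj_variety Q R P) L"
  let ?q1 = "\<lambda>z. odl `` {case z of (e, X) \<Rightarrow> (e, orb e X)}"
  let ?q2 = "\<lambda>z. \<rho> `` {dl `` {z}}"
  have "quotient_map ?S (sum_topology (QP_level Q R P) L) (\<lambda>(e, X). (e, orb e X))"
    unfolding QP_level_def by (rule quotient_map_sum_topology) (rule quotient_map_quotient_topology)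
  from quotient_map_compose[OF this quotient_map_quotient_topology[of _ odl]]
  have q1: "quotient_map ?S (QP_levels_limit Q R P d C \<iota>) ?q1"
    by (simp add: QP_levels_limit_def dlim_topology_def comp_def)
  have "quotient_map ?S (Pb_limit Q R P d C \<iota>) (\<lambda>z. dl `` {z})"
    unfolding Pb_limit_def dlim_topology_def topspace_proj_variety by (rule quotient_map_quotient_topology)
  from quotient_map_compose[OF this quotient_map_quotient_topology[of _ \<rho>]]
  have q2: "quotient_map ?S (Q1P Q R P d C \<iota>) ?q2"
    by (simp add: Q1P_def limit_orbit_rel_eq comp_def)
  have "?q1 z = ?q1 w \<longleftrightarrow> ?q2 z = ?q2 w" if zw: "z \<in> topspace ?S" "w \<in> topspace ?S" for z w
  proof -
    obtain e X e' Y where "z = (e, X)" "w = (e', Y)" "e \<in> L" "X \<in> pc e" "e' \<in> L" "Y \<in> pc e'" using zw by auto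
    then show ?thesis using odl_class_eq_iff \<rho>_class_eq_iff by (simp add: cpx_class_eq)
  qed
  then obtain \<phi> where \<phi>: "homeomorphic_map (QP_levels_limit Q R P d C \<iota>) (Q1P Q R P d C \<iota>) \<phi>"
    "\<And>z. z \<in> topspace ?S \<Longrightarrow> \<phi> (?q1 z) = ?q2 z"
    using quotient_maps_homeomorphic[OF q1 q2] by blast
  show ?thesis
  proof (rule exI[of _ \<phi>], intro conjI ballI \<phi>(1))
    fix e X assume "e \<in> L" "X \<in> pc e"
    then show "\<phi> (orbit_class Q R P d C \<iota> e (orbit_rel Q R P e `` {X})) =
        limit_orbit_rel Q R P d C \<iota> `` {cpx_class Q R P d C \<iota> e X}"
      using \<phi>(2)[of "(e, X)"] by (simp add: orbit_class_def limit_orbit_rel_eq cpx_class_eq)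
  qed
qed

end

text \<open>Two of the spaces are quotients of one space by relations that agree as sets, so they
  are equal as topologies. The third consists of classes of pairs of a level and an orbit and can
  only be compared by a map; prescribing its value on the class of every orbit makes this the
  canonical one.\<close>

theorem proposition2p1:
  fixes Q :: "('v, 'a) pre_digraph"
    and R :: "(('v, 'a) path \<Rightarrow>\<^sub>0 complex) set"
    and P :: "('v, 'a) rep list"
    and d :: "(('v, 'a) cpx \<Rightarrow>\<^sub>0 int) set"
    and C :: "pdseq \<Rightarrow> pdseq \<Rightarrow> ('v, 'a) cpx"
    and \<iota> :: "pdseq \<Rightarrow> pdseq \<Rightarrow> int \<Rightarrow> 'v \<Rightarrow> complex mat"
  assumes "bound_quiver Q R"
    and "indecomposable_projectives Q R P"
    and "finite_global_dimension Q R"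
    and "d \<in> carrier (K0 Q R)"
    and "compatible_family Q R P d C \<iota>"
  shows "QP Q R P d C \<iota> = Q1P Q R P d C \<iota> \<and>
    (\<exists>\<phi>. homeomorphic_map (QP_levels_limit Q R P d C \<iota>) (Q1P Q R P d C \<iota>) \<phi> \<and>
      (\<forall>e\<in>levels Q R P d. \<forall>X\<in>proj_cpxs Q R P e.
        \<phi> (orbit_class Q R P d C \<iota> e (orbit_rel Q R P e `` {X})) =
        limit_orbit_rel Q R P d C \<iota> `` {cpx_class Q R P d C \<iota> e X}))"
proof -
  interpret direct_system Q R P d C \<iota>
    using assms by unfold_locales
  show ?thesis using QP_eq_Q1P levels_limit_homeomorphic by blast
qed

end
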